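(* Let $k$ be a fixed positive integer. There is an algorithm that solves the following problem in $O(|E|\log(2+|V|^2/|E|))$ time: given a skew-symmetric graph $G=(V,E)$ with symmetry $\sigma$, a set $S=\{s_1,\ldots,s_k\}\subseteq V$ disjoint from $S'=\sigma(S)$, and an integer symmetric flow $f$ from $S$ to $S'$, find a decomposition $$f=\sum_{1\le i\le j\le k}(f_{ij}+f'_{ij}),$$ where each $f_{ij}$ is an integer flow from $s_i$ to $s'_j=\sigma(s_j)$ and $f'_{ij}$ is the function symmetric to $f_{ij}$.
   Context: A skew-symmetric graph is a finite digraph $G=(V,E)$ (parallel arcs allowed, no loops) with a map $\sigma$ that is a fixed-point-free involution on $V$ and a fixed-point-free involution on $E$, such that for each arc $e$ from $u$ to $v$, $\sigma(e)$ is an arc from $\sigma(v)$ to $\sigma(u)$. Write $x'=\sigma(x)$. It is assumed that $|V|=O(|E|)$. For a function $h$ on $E$, its symmetric function $h'$ is defined by $h'(\sigma(e))=h(e)$ for $e\in E$, and $h$ is symmetric if $h=h'$. For $f:E\to\mathbb{R}$, $\mathrm{div}_f(v)$ is the sum of $f(e)$ over arcs $e$ leaving $v$ minus the sum of $f(e)$ over arcs $e$ entering $v$. An integer symmetric flow from $S$ to $S'$ is a symmetric function $f:E\to\mathbb{Z}_+$ with $\mathrm{div}_f(v)\ge0$ for $v\in S$ and $\mathrm{div}_f(v)=0$ for $v\in V-(S\cup S')$ (so by symmetry $\mathrm{div}_f(v)\le 0$ for $v\in S'$). An integer flow from $s$ to $t$ is a function $h:E\to\mathbb{Z}_+$ with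 $\mathrm{div}_h(s)\ge0$, $\mathrm{div}_h(t)\le0$, and $\mathrm{div}_h(v)=0$ for all other $v$. Running time counts arithmetic operations and comparisons on numbers as unit cost, and the constant in $O(\cdot)$ may depend on $k$. *)

theory Defs
  imports Complex_Main "Graph_Theory.Digraph"
begin

section \<open>Skew-symmetric graphs and flows\<close>

text \<open>
  The symmetry \<open>\<sigma>\<close> acts on vertices and on arcs; the two actions are
  \<open>\<sigma>\<^sub>V = sv\<close> and \<open>\<sigma>\<^sub>E = se\<close>. Only their values on the vertices and arcs of
  \<open>G\<close> matter, and likewise for functions on arcs.
\<close>

locale skew_symmetric_graph = fin_digraph G + loopfree_digraph G
  for G :: "('a, 'b) pre_digraph" +
  fixes sv :: "'a \<Rightarrow> 'a" and se :: "'b \<Rightarrow> 'b"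
  assumes sv_in_verts: "v \<in> verts G \<Longrightarrow> sv v \<in> verts G"
    and sv_involution: "v \<in> verts G \<Longrightarrow> sv (sv v) = v"
    and sv_no_fixpoint: "v \<in> verts G \<Longrightarrow> sv v \<noteq> v"
    and se_in_arcs: "e \<in> arcs G \<Longrightarrow> se e \<in> arcs G"
    and se_involution: "e \<in> arcs G \<Longrightarrow> se (se e) = e"
    and se_no_fixpoint: "e \<in> arcs G \<Longrightarrow> se e \<noteq> e"
    and tail_se: "e \<in> arcs G \<Longrightarrow> tail G (se e) = sv (head G e)"
    and head_se: "e \<in> arcs G \<Longrightarrow> head G (se e) = sv (tail G e)"

text \<open>
  \<open>h'\<close> is determined by \<open>h' (\<sigma> e) = h e\<close>; since \<open>\<sigma>\<close> is an involution this
  means \<open>h' e = h (\<sigma> e)\<close>.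
\<close>

definition symmetric_fun :: "('b \<Rightarrow> 'b) \<Rightarrow> ('b \<Rightarrow> 'c) \<Rightarrow> 'b \<Rightarrow> 'c" where
  "symmetric_fun se h = (\<lambda>e. h (se e))"

lemma (in skew_symmetric_graph) symmetric_fun_unique:
  "(\<forall>e\<in>arcs G. g (se e) = h e) \<longleftrightarrow> (\<forall>e\<in>arcs G. g e = symmetric_fun se h e)"
proof
  assume *: "\<forall>e\<in>arcs G. g (se e) = h e"
  show "\<forall>e\<in>arcs G. g e = symmetric_fun se h e"
  proof
    fix e assume e: "e \<in> arcs G"
    then have "g (se (se e)) = h (se e)" using * se_in_arcs by blast
    then show "g e = symmetric_fun se h e" using se_involution[OF e] by (simp add: symmetric_fun_def)
  qed
qed (simp add: symmetric_fun_def se_in_arcs se_involution)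

definition divergence :: "('a, 'b) pre_digraph \<Rightarrow> ('b \<Rightarrow> 'c::ab_group_add) \<Rightarrow> 'a \<Rightarrow> 'c" where
  "divergence G h v = (\<Sum>e\<in>out_arcs G v. h e) - (\<Sum>e\<in>in_arcs G v. h e)"

definition integer_symmetric_flow ::
  "('a, 'b) pre_digraph \<Rightarrow> ('a \<Rightarrow> 'a) \<Rightarrow> ('b \<Rightarrow> 'b) \<Rightarrow> 'a set \<Rightarrow> ('b \<Rightarrow> int) \<Rightarrow> bool" where
  "integer_symmetric_flow G sv se S f \<longleftrightarrow>
     (\<forall>e\<in>arcs G. f e \<ge> 0) \<and>
     (\<forall>e\<in>arcs G. f e = symmetric_fun se f e) \<and>
     (\<forall>v\<in>S. divergence G f v \<ge> 0) \<and>
     (\<forall>v\<in>verts G - (S \<union> sv ` S). divergence G f v = 0)"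

definition integer_flow ::
  "('a, 'b) pre_digraph \<Rightarrow> 'a \<Rightarrow> 'a \<Rightarrow> ('b \<Rightarrow> int) \<Rightarrow> bool" where
  "integer_flow G s t h \<longleftrightarrow>
     (\<forall>e\<in>arcs G. h e \<ge> 0) \<and>
     divergence G h s \<ge> 0 \<and> divergence G h t \<le> 0 \<and>
     (\<forall>v\<in>verts G - {s, t}. divergence G h v = 0)"

definition flow_instance ::
  "nat \<Rightarrow> ('a, 'b) pre_digraph \<Rightarrow> ('a \<Rightarrow> 'a) \<Rightarrow> ('b \<Rightarrow> 'b) \<Rightarrow> (nat \<Rightarrow> 'a) \<Rightarrow> ('b \<Rightarrow> int) \<Rightarrow> bool" where
  "flow_instance k G sv se s f \<longleftrightarrow>
     skew_symmetric_graph G sv se \<and>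
     inj_on s {1..k} \<and> s ` {1..k} \<subseteq> verts G \<and>
     s ` {1..k} \<inter> sv ` s ` {1..k} = {} \<and>
     integer_symmetric_flow G sv se (s ` {1..k}) f"

definition flow_decomposition ::
  "nat \<Rightarrow> ('a, 'b) pre_digraph \<Rightarrow> ('a \<Rightarrow> 'a) \<Rightarrow> ('b \<Rightarrow> 'b) \<Rightarrow> (nat \<Rightarrow> 'a) \<Rightarrow> ('b \<Rightarrow> int)
     \<Rightarrow> (nat \<Rightarrow> nat \<Rightarrow> 'b \<Rightarrow> int) \<Rightarrow> bool" where
  "flow_decomposition k G sv se s f F \<longleftrightarrow>
     (\<forall>i\<in>{1..k}. \<forall>j\<in>{i..k}. integer_flow G (s i) (sv (s j)) (F i j)) \<and>
     (\<forall>e\<in>arcs G. f e = (\<Sum>i\<in>{1..k}. \<Sum>j\<in>{i..k}. F i j e + symmetric_fun se (F i j) e))"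


section \<open>The machine model: structured programs for a unit-cost RAM\<close>

text \<open>
  A program is a finite text over finitely many integer variables and arrays,
  fixed independently of the input. Array indices are computed values, which
  gives indirect addressing. Integers may be arbitrarily large and every
  elementary operation costs one step. The arithmetic operations are addition,
  subtraction and (floor) halving. Multiplication and division of arbitrary
  operands are left out: with unbounded integers at unit cost they would allow
  whole arrays to be packed into, and processed as, one number.

  Identifiers carry a list of subscripts so that a program may use a family of
  arrays; the subscripts are part of the program text, not computed.
\<close>

type_synonym ident = "string \<times> nat list"

datatype aexp =
    Const int
  | Var ident
  | Elem ident aexp
  | Plus aexp aexp
  | Minus aexp aexp
  | Half aexp

datatype bexp =
    Less aexp aexp
  | Equal aexp aexp
  | Not bexp
  | And bexp bexp

datatype com =
    Skip
  | Assign ident aexp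
  | Update ident aexp aexp
  | Seq com com
  | If bexp com com
  | While bexp com

record store =
  var :: "ident \<Rightarrow> int"
  arr :: "ident \<Rightarrow> int \<Rightarrow> int"

fun aval :: "aexp \<Rightarrow> store \<Rightarrow> int" where
  "aval (Const c) st = c"
| "aval (Var x) st = var st x"
| "aval (Elem A a) st = arr st A (aval a st)"
| "aval (Plus a b) st = aval a st + aval b st"
| "aval (Minus a b) st = aval a st - aval b st"
| "aval (Half a) st = aval a st div 2"

fun bval :: "bexp \<Rightarrow> store \<Rightarrow> bool" where
  "bval (Less a b) st \<longleftrightarrow> aval a st < aval b st"
| "bval (Equal a b) st \<longleftrightarrow> aval a st = aval b st"
| "bval (Not p) st \<longleftrightarrow> \<not> bval p st"
| "bval (And p q) st \<longleftrightarrow> bval p st \<and> bval q st"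

fun acost :: "aexp \<Rightarrow> nat" where
  "acost (Const c) = 1"
| "acost (Var x) = 1"
| "acost (Elem A a) = 1 + acost a"
| "acost (Plus a b) = 1 + acost a + acost b"
| "acost (Minus a b) = 1 + acost a + acost b"
| "acost (Half a) = 1 + acost a"

fun bcost :: "bexp \<Rightarrow> nat" where
  "bcost (Less a b) = 1 + acost a + acost b"
| "bcost (Equal a b) = 1 + acost a + acost b"
| "bcost (Not p) = 1 + bcost p"
| "bcost (And p q) = 1 + bcost p + bcost q"

text \<open>
  \<open>exec c st t st'\<close>: started in store \<open>st\<close>, the program \<open>c\<close> terminates in
  store \<open>st'\<close> after exactly \<open>t\<close> elementary steps.
\<close>

inductive exec :: "com \<Rightarrow> store \<Rightarrow> nat \<Rightarrow> store \<Rightarrow> bool" where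
  Skip: "exec Skip st 1 st"
| Assign: "exec (Assign x a) st (1 + acost a) (st\<lparr>var := (var st)(x := aval a st)\<rparr>)"
| Update: "exec (Update A a b) st (1 + acost a + acost b)
     (st\<lparr>arr := (arr st)(A := (arr st A)(aval a st := aval b st))\<rparr>)"
| Seq: "exec c st t st' \<Longrightarrow> exec d st' u st'' \<Longrightarrow> exec (Seq c d) st (t + u) st''"
| IfTrue: "bval p st \<Longrightarrow> exec c st t st' \<Longrightarrow> exec (If p c d) st (1 + bcost p + t) st'"
| IfFalse: "\<not> bval p st \<Longrightarrow> exec d st t st' \<Longrightarrow> exec (If p c d) st (1 + bcost p + t) st'"
| WhileFalse: "\<not> bval p st \<Longrightarrow> exec (While p c) st (1 + bcost p) st"
| WhileTrue: "bval p st \<Longrightarrow> exec c st t st' \<Longrightarrow> exec (While p c) st' u st'' \<Longrightarrow>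
     exec (While p c) st (1 + bcost p + t + u) st''"

inductive_cases exec_SkipE: "exec Skip st t st'"
inductive_cases exec_AssignE: "exec (Assign x a) st t st'"
inductive_cases exec_UpdateE: "exec (Update A a b) st t st'"
inductive_cases exec_SeqE: "exec (Seq c d) st t st'"
inductive_cases exec_IfE: "exec (If p c d) st t st'"
inductive_cases exec_WhileE: "exec (While p c) st t st'"

lemma exec_deterministic:
  "exec c st t st' \<Longrightarrow> exec c st u st'' \<Longrightarrow> u = t \<and> st'' = st'"
proof (induction arbitrary: u st'' rule: exec.induct)
  case (Seq c st t st' d t2 st2)
  from Seq.prems obtain t3 st3 t4 where
    "exec c st t3 st3" "exec d st3 t4 st''" "u = t3 + t4" by (rule exec_SeqE)
  with Seq.IH show ?case by metis
next
  case (IfTrue p st c t st' d)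
  from IfTrue.prems IfTrue.hyps obtain t3 where
    "exec c st t3 st''" "u = 1 + bcost p + t3" by (auto elim!: exec_IfE)
  with IfTrue.IH show ?case by metis
next
  case (IfFalse p st d t st' c)
  from IfFalse.prems IfFalse.hyps obtain t3 where
    "exec d st t3 st''" "u = 1 + bcost p + t3" by (auto elim!: exec_IfE)
  with IfFalse.IH show ?case by metis
next
  case (WhileFalse p st c)
  from WhileFalse.prems show ?case by cases (use WhileFalse.hyps in simp_all)
next
  case (WhileTrue p st c t st' t2 st2)
  from WhileTrue.prems obtain t3 st3 t4 where
    "exec c st t3 st3" "exec (While p c) st3 t4 st''" "u = 1 + bcost p + t3 + t4"
    by cases (use WhileTrue.hyps(1) in simp_all)
  with WhileTrue.IH show ?case by metis
qed (auto elim: exec_SkipE exec_AssignE exec_UpdateE)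


section \<open>Input and output conventions\<close>

text \<open>
  Vertices and arcs are numbered: \<open>verts G = {..<n}\<close>, \<open>arcs G = {..<m}\<close>.
  Initially the variables \<open>n\<close>, \<open>m\<close> and the arrays
  \<open>tail, head, sigmaV, sigmaE, s, f\<close> hold the instance, and all other memory
  is zero. The value \<open>f\<^sub>i\<^sub>j(e)\<close> is returned in cell \<open>e\<close> of the array \<open>flow\<close>
  with subscripts \<open>[i, j]\<close>.
\<close>

definition array_on :: "nat set \<Rightarrow> (nat \<Rightarrow> int) \<Rightarrow> int \<Rightarrow> int" where
  "array_on I g = (\<lambda>x. if 0 \<le> x \<and> nat x \<in> I then g (nat x) else 0)"

definition input_store ::
  "nat \<Rightarrow> (nat, nat) pre_digraph \<Rightarrow> (nat \<Rightarrow> nat) \<Rightarrow> (nat \<Rightarrow> nat) \<Rightarrow> (nat \<Rightarrow> nat) \<Rightarrow> (nat \<Rightarrow> int)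
     \<Rightarrow> store" where
  "input_store k G sv se s f =
     \<lparr>var = (\<lambda>_. 0)
        ((''n'', []) := int (card (verts G)),
         (''m'', []) := int (card (arcs G))),
      arr = (\<lambda>_ _. 0)
        ((''tail'', []) := array_on (arcs G) (\<lambda>e. int (tail G e)),
         (''head'', []) := array_on (arcs G) (\<lambda>e. int (head G e)),
         (''sigmaV'', []) := array_on (verts G) (\<lambda>v. int (sv v)),
         (''sigmaE'', []) := array_on (arcs G) (\<lambda>e. int (se e)),
         (''s'', []) := array_on {1..k} (\<lambda>i. int (s i)),
         (''f'', []) := array_on (arcs G) f)\<rparr>"

definition output_flow :: "store \<Rightarrow> nat \<Rightarrow> nat \<Rightarrow> nat \<Rightarrow> int" where
  "output_flow st i j e = arr st (''flow'', [i, j]) (int e)"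

definition numbered :: "(nat, nat) pre_digraph \<Rightarrow> bool" where
  "numbered G \<longleftrightarrow> verts G = {..<card (verts G)} \<and> arcs G = {..<card (arcs G)}"

end

theory Submission
  imports Defs
begin

text \<open>
  The program first rounds half of \<open>f\<close> to an integer flow \<open>g\<close> with \<open>f = g + g'\<close>: for each pair
  of mates of odd value it chooses which arc gets the extra unit by orienting the quotient
  multigraph in a balanced way, splicing edges at vertices into paths. As \<open>f\<close> is balanced at the ordinary
  vertices, so is \<open>g\<close>. After adding a super source arc to each \<open>s\<^sub>i\<close> and a super sink arc from each
  \<open>s'\<^sub>j\<close>, the flow \<open>g\<close> is decomposed by eliminating the vertices in order of increasing degree:
  units on \<open>u \<rightarrow> v \<rightarrow> w\<close> are moved to an arc \<open>u \<rightarrow> w\<close>, and arcs between the same two vertices are merged.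
  With \<open>t\<close> vertices left the minimum degree is at most \<open>min (2 m / t) (2 t)\<close> up to constants for the
  terminals, and the sum of these bounds is \<open>O(m log (2 + n\<^sup>2 / m))\<close>. Finally each remaining arc leads from one
  super source to one super sink, and undoing the moves in reverse order pulls this assignment
  back to parts \<open>h\<^sub>i\<^sub>j\<close> of \<open>g\<close>; then \<open>f\<^sub>i\<^sub>i = h\<^sub>i\<^sub>i\<close> and \<open>f\<^sub>i\<^sub>j = h\<^sub>i\<^sub>j + h'\<^sub>j\<^sub>i\<close> for \<open>i < j\<close>.
\<close>

section \<open>Weakest preconditions with running time\<close>

text \<open>Rounding comes first because the mirror image of a flow from s_j to s'_i runs from s_i
  to s'_j: once \<open>f = g + g'\<close>, an ordinary decomposition of \<open>g\<close> over all
  ordered pairs suffices. Splicing leaves at most one open path end at a quotient vertex, so twice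
  the divergence of \<open>g\<close> is within 1 of that of \<open>f\<close>, and integrality yields
  the right sign everywhere. Peeling off paths one at a time would cost their total length. A move
  instead empties an arc at the vertex being eliminated and brings at most one other arc to life, so
  the number of live arcs never grows and a vertex needs at most as many moves as its degree. Exact
  degree order would need a priority queue; doubling thresholds suffice, since the degrees of
  postponed vertices are charged to live arcs by a quantity (\<open>exposed\<close>) that later
  moves cannot decrease. The undo phase spends a constant (for fixed \<open>k\<close>) per log
  entry. That cost is prepaid by the weight \<open>K\<close> in the potentials at the time the entry
  is written, because the final length of the log is bounded only through the elimination
  costs.\<close>

definition wp :: "com \<Rightarrow> (nat \<Rightarrow> store \<Rightarrow> bool) \<Rightarrow> store \<Rightarrow> bool" where
  "wp c Q st \<longleftrightarrow> (\<exists>t st'. exec c st t st' \<and> Q t st')"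

lemma wp_conseq: "wp c P st \<Longrightarrow> (\<And>t st'. P t st' \<Longrightarrow> Q t st') \<Longrightarrow> wp c Q st"
  by (auto simp: wp_def)

lemma wp_Skip [simp]: "wp Skip Q st \<longleftrightarrow> Q 1 st"
  unfolding wp_def by (subst exec.simps) auto

lemma wp_Assign [simp]:
  "wp (Assign x a) Q st \<longleftrightarrow> Q (1 + acost a) (st\<lparr>var := (var st)(x := aval a st)\<rparr>)"
  unfolding wp_def by (subst exec.simps) auto

lemma wp_Update [simp]:
  "wp (Update A a b) Q st \<longleftrightarrow>
     Q (1 + acost a + acost b) (st\<lparr>arr := (arr st)(A := (arr st A)(aval a st := aval b st))\<rparr>)"
  unfolding wp_def by (subst exec.simps) auto

lemma wp_Seq [simp]: "wp (Seq c d) Q st \<longleftrightarrow> wp c (\<lambda>t st'. wp d (\<lambda>u. Q (t + u)) st') st"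
  unfolding wp_def by (subst exec.simps) (simp, blast)

lemma wp_If [simp]:
  "wp (If p c d) Q st \<longleftrightarrow>
     (if bval p st then wp c (\<lambda>t. Q (1 + bcost p + t)) st else wp d (\<lambda>t. Q (1 + bcost p + t)) st)"
  unfolding wp_def by (subst exec.simps) auto

section \<open>Frame conditions read off the program text\<close>

fun written_vars :: "com \<Rightarrow> ident set" where
  "written_vars Skip = {}"
| "written_vars (Assign x a) = {x}"
| "written_vars (Update A a b) = {}"
| "written_vars (Seq c d) = written_vars c \<union> written_vars d"
| "written_vars (If p c d) = written_vars c \<union> written_vars d"
| "written_vars (While p c) = written_vars c"

fun written_arrs :: "com \<Rightarrow> ident set" where
  "written_arrs Skip = {}"
| "written_arrs (Assign x a) = {}"
| "written_arrs (Update A a b) = {A}"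
| "written_arrs (Seq c d) = written_arrs c \<union> written_arrs d"
| "written_arrs (If p c d) = written_arrs c \<union> written_arrs d"
| "written_arrs (While p c) = written_arrs c"

text \<open>Invariants below mention only what a loop changes; the rest is recovered by evaluating
  the two finite sets of written names. The granularity is a whole array, so nothing is inferred
  about the other cells of an array that is written.\<close>

definition agree :: "com \<Rightarrow> store \<Rightarrow> store \<Rightarrow> bool" where
  "agree c st st' \<longleftrightarrow> (\<forall>x. x \<notin> written_vars c \<longrightarrow> var st' x = var st x) \<and>
     (\<forall>A. A \<notin> written_arrs c \<longrightarrow> arr st' A = arr st A)"

lemma agree_var: "agree c st st' \<Longrightarrow> x \<notin> written_vars c \<Longrightarrow> var st' x = var st x"
  and agree_arr: "agree c st st' \<Longrightarrow> A \<notin> written_arrs c \<Longrightarrow> arr st' A = arr st A"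
  by (metis agree_def, metis agree_def)

lemma agree_trans: "agree c st st' \<Longrightarrow> agree c st' st'' \<Longrightarrow> agree c st st''"
  by (simp add: agree_def)

lemma exec_agree: "exec c st t st' \<Longrightarrow> agree c st st'"
  by (induction rule: exec.induct) (auto simp: agree_def)

lemma wp_conseq_agree:
  "wp c P st \<Longrightarrow> (\<And>t st'. P t st' \<Longrightarrow> agree c st st' \<Longrightarrow> Q t st') \<Longrightarrow> wp c Q st"
  unfolding wp_def using exec_agree by blast

lemma wp_SeqI:
  assumes "wp c P st"
    and "\<And>t st'. P t st' \<Longrightarrow> agree c st st' \<Longrightarrow> wp d (\<lambda>u. Q (t + u)) st'"
  shows "wp (Seq c d) Q st"
  using wp_conseq_agree[OF assms] by simp

text \<open>
  \<open>\<mu>\<close> proves termination. The potential \<open>\<phi>\<close> pays for the running time; it may be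
  negative, so that it can also pay for the growth of a counter that bounds later work.
\<close>

lemma wp_While:
  fixes \<phi> :: "store \<Rightarrow> real" and \<mu> :: "store \<Rightarrow> nat"
  assumes "I st0"
    and body: "\<And>st. I st \<Longrightarrow> agree c st0 st \<Longrightarrow> bval b st \<Longrightarrow>
      wp c (\<lambda>t st'. I st' \<and> \<mu> st' < \<mu> st \<and> real t + real (1 + bcost b) + \<phi> st' \<le> \<phi> st) st"
  shows "wp (While b c) (\<lambda>t st'. I st' \<and> \<not> bval b st' \<and>
      real t + \<phi> st' \<le> \<phi> st0 + real (1 + bcost b)) st0"
proof -
  have "I st \<Longrightarrow> agree c st0 st \<Longrightarrow> \<exists>t st'. exec (While b c) st t st' \<and> I st' \<and> \<not> bval b st' \<and>
      real t + \<phi> st' \<le> \<phi> st + real (1 + bcost b)" for st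
  proof (induction "\<mu> st" arbitrary: st rule: less_induct)
    case less
    show ?case
    proof (cases "bval b st")
      case False
      then show ?thesis using less.prems exec.WhileFalse[OF False, of c] by force
    next
      case True
      obtain t st1 where 1: "exec c st t st1" "I st1" "\<mu> st1 < \<mu> st"
        "real t + real (1 + bcost b) + \<phi> st1 \<le> \<phi> st"
        using body[OF less.prems True] by (auto simp: wp_def)
      have "agree c st0 st1" using less.prems(2) exec_agree[OF 1(1)] by (rule agree_trans)
      then obtain u st2 where 2: "exec (While b c) st1 u st2" "I st2" "\<not> bval b st2"
        "real u + \<phi> st2 \<le> \<phi> st1 + real (1 + bcost b)"
        using less.hyps[OF 1(3,2)] by blast
      show ?thesis
        using exec.WhileTrue[OF True 1(1) 2(1)] 1(4) 2 by force
    qed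
  qed
  from this[of st0] assms(1) show ?thesis by (auto simp: wp_def agree_def)
qed

text \<open>Integer potentials keep cost goals inside linear integer arithmetic; only the
  logarithmic bound over the stages needs the real version.\<close>

lemma wp_While_int:
  fixes \<phi> :: "store \<Rightarrow> int" and \<mu> :: "store \<Rightarrow> nat"
  assumes "I st0"
    and body: "\<And>st. I st \<Longrightarrow> agree c st0 st \<Longrightarrow> bval b st \<Longrightarrow>
      wp c (\<lambda>t st'. I st' \<and> \<mu> st' < \<mu> st \<and> int t + int (1 + bcost b) + \<phi> st' \<le> \<phi> st) st"
  shows "wp (While b c) (\<lambda>t st'. I st' \<and> \<not> bval b st' \<and>
      int t + \<phi> st' \<le> \<phi> st0 + int (1 + bcost b)) st0"
proof -
  have eq: "(real t + real u + real_of_int x \<le> real_of_int y) \<longleftrightarrow> int t + int u + x \<le> y"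
    "(real t + real_of_int x \<le> real_of_int y + real u) \<longleftrightarrow> int t + x \<le> y + int u" for t u x y
    by linarith+
  show ?thesis
    using wp_While[of I st0 c b \<mu> "\<lambda>st. real_of_int (\<phi> st)"] assms unfolding eq by blast
qed

fun seqs :: "com list \<Rightarrow> com" where
  "seqs [] = Skip"
| "seqs (c # cs) = Seq c (seqs cs)"

text \<open>Subscripts belong to the program text, so a loop over terminal pairs has to be unrolled.
  The invariant is indexed by the number of elements already executed; the final \<open>+ 1\<close>
  is the cost of the closing \<open>Skip\<close>.\<close>

lemma wp_seqs:
  fixes K :: int
  assumes "I 0 st0"
    and step: "\<And>i st. i < length xs \<Longrightarrow> I i st \<Longrightarrow> agree (seqs (map f xs)) st0 st \<Longrightarrow>
      wp (f (xs ! i)) (\<lambda>t st'. I (Suc i) st' \<and> int t \<le> K) st"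
  shows "wp (seqs (map f xs)) (\<lambda>t st'. I (length xs) st' \<and> int t \<le> K * int (length xs) + 1) st0"
proof -
  have sub: "written_vars (f (xs ! i)) \<subseteq> written_vars (seqs (map f xs)) \<and>
    written_arrs (f (xs ! i)) \<subseteq> written_arrs (seqs (map f xs))" if "i < length xs" for i
    using that
  proof (induction xs arbitrary: i)
    case (Cons a xs)
    then show ?case by (cases i) auto
  qed simp
  \<comment> \<open>\<open>n\<close> counts the elements still to run, so the induction peels the
    front of the remaining list while agreement with the initial store is carried along.\<close>
  have "n \<le> length xs \<Longrightarrow> I (length xs - n) st \<Longrightarrow> agree (seqs (map f xs)) st0 st \<Longrightarrow>
    \<exists>t st'. exec (seqs (map f (drop (length xs - n) xs))) st t st' \<and> I (length xs) st' \<and>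
      int t \<le> K * int n + 1" for n st
  proof (induction n arbitrary: st)
    case 0
    then show ?case using exec.Skip by (intro exI[of _ 1] exI[of _ st]) auto
  next
    case (Suc n)
    let ?i = "length xs - Suc n"
    have i: "?i < length xs" "Suc ?i = length xs - n" using Suc.prems by auto
    have d: "drop ?i xs = xs ! ?i # drop (length xs - n) xs"
      using i by (metis Cons_nth_drop_Suc)
    obtain t st1 where 1: "exec (f (xs ! ?i)) st t st1" "I (Suc ?i) st1" "int t \<le> K"
      using step[OF i(1) Suc.prems(2,3)] by (auto simp: wp_def)
    have "agree (seqs (map f xs)) st st1"
      using exec_agree[OF 1(1)] sub[OF i(1)] by (meson agree_def subsetD)
    then have "agree (seqs (map f xs)) st0 st1" using Suc.prems(3) agree_trans by blast
    moreover have "I (length xs - n) st1" using 1(2) i(2) by simp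
    ultimately obtain u st2 where 2: "exec (seqs (map f (drop (length xs - n) xs))) st1 u st2"
      "I (length xs) st2" "int u \<le> K * int n + 1"
      using Suc.IH[of st1] Suc.prems(1) by auto
    have "exec (seqs (map f (drop ?i xs))) st (t + u) st2"
      unfolding d using exec.Seq[OF 1(1) 2(1)] by simp
    moreover have "int (t + u) \<le> K * int (Suc n) + 1" using 1(3) 2(3) by (simp add: algebra_simps)
    ultimately show ?case using 2(2) by blast
  qed
  from this[of "length xs" st0] assms(1) show ?thesis by (auto simp: wp_def agree_def)
qed

abbreviation Vr :: "string \<Rightarrow> aexp" where "Vr x \<equiv> Var (x, [])"
abbreviation Ar :: "string \<Rightarrow> aexp \<Rightarrow> aexp" where "Ar x a \<equiv> Elem (x, []) a"
abbreviation vr :: "store \<Rightarrow> string \<Rightarrow> int" where "vr st x \<equiv> var st (x, [])"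
abbreviation ar :: "store \<Rightarrow> string \<Rightarrow> int \<Rightarrow> int" where "ar st x \<equiv> arr st (x, [])"
abbreviation assign :: "string \<Rightarrow> aexp \<Rightarrow> com" (infix "::=" 60)
  where "x ::= a \<equiv> Assign (x, []) a"
abbreviation upd :: "string \<Rightarrow> aexp \<Rightarrow> aexp \<Rightarrow> com" ("(_\<lbrakk>_\<rbrakk> ::=/ _)" [61, 0, 61] 60)
  where "x\<lbrakk>a\<rbrakk> ::= b \<equiv> Update (x, []) a b"
abbreviation seqc :: "com \<Rightarrow> com \<Rightarrow> com" (infixr ";;" 55)
  where "c ;; d \<equiv> Seq c d"

definition for_loop :: "string \<Rightarrow> string \<Rightarrow> com \<Rightarrow> com" where
  "for_loop i n c = While (Less (Vr i) (Vr n)) (c;; i ::= Plus (Vr i) (Const 1))"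

lemma written_for_loop [simp]:
  "written_vars (for_loop i n c) = insert (i, []) (written_vars c)"
  "written_arrs (for_loop i n c) = written_arrs c"
  by (auto simp: for_loop_def)

text \<open>The increment runs after the body, so the body must establish the invariant for the
  store in which the counter is already advanced. Guard and increment cost 8 steps together, rounded
  up to 10.\<close>

lemma wp_for_loop_pot:
  fixes K :: int and \<phi> :: "store \<Rightarrow> int"
  assumes "I (vr st0 i) st0" and le: "vr st0 i \<le> vr st0 n"
    and w: "(i, []) \<notin> written_vars c" "(n, []) \<notin> written_vars c" "i \<noteq> n"
    and body: "\<And>e st. I e st \<Longrightarrow> agree (for_loop i n c) st0 st \<Longrightarrow> vr st i = e \<Longrightarrow> vr st0 i \<le> e \<Longrightarrow>
      e < vr st0 n \<Longrightarrow>
      wp c (\<lambda>t st'. I (e + 1) (st'\<lparr>var := (var st')((i, []) := e + 1)\<rparr>) \<and>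
        int t + \<phi> (st'\<lparr>var := (var st')((i, []) := e + 1)\<rparr>) \<le> \<phi> st + K) st"
  shows "wp (for_loop i n c) (\<lambda>t st'. I (vr st0 n) st' \<and> vr st' i = vr st0 n \<and>
      int t + \<phi> st' \<le> \<phi> st0 + (K + 10) * (vr st0 n - vr st0 i) + 10) st0"
proof -
  let ?c = "c;; i ::= Plus (Vr i) (Const 1)" and ?b = "Less (Vr i) (Vr n)"
  let ?I = "\<lambda>st. I (vr st i) st \<and> vr st0 i \<le> vr st i \<and> vr st i \<le> vr st0 n"
  let ?\<phi> = "\<lambda>st. \<phi> st + (K + 10) * (vr st0 n - vr st i)"
  have ag: "agree (for_loop i n c) st0 st \<and> vr st n = vr st0 n" if "agree ?c st0 st" for st
    using that w unfolding agree_def by auto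
  have "wp (While ?b ?c) (\<lambda>t st'. ?I st' \<and> \<not> bval ?b st' \<and>
      int t + ?\<phi> st' \<le> ?\<phi> st0 + int (1 + bcost ?b)) st0"
  proof (rule wp_While_int[where \<mu> = "\<lambda>st. nat (vr st0 n - vr st i)"])
    show "?I st0" using assms(1) le by simp
  next
    fix st
    assume I: "?I st" and "agree ?c st0 st" and b: "bval ?b st"
    with ag have a: "agree (for_loop i n c) st0 st" "vr st i < vr st0 n" by auto
    have "wp c (\<lambda>t st'. I (vr st i + 1) (st'\<lparr>var := (var st')((i, []) := vr st i + 1)\<rparr>) \<and>
        int t + \<phi> (st'\<lparr>var := (var st')((i, []) := vr st i + 1)\<rparr>) \<le> \<phi> st + K) st"
      using I a by (intro body) auto
    then show "wp ?c (\<lambda>t st'. ?I st' \<and> nat (vr st0 n - vr st' i) < nat (vr st0 n - vr st i) \<and>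
      int t + int (1 + bcost ?b) + ?\<phi> st' \<le> ?\<phi> st) st"
    proof (rule wp_SeqI)
      fix t st'
      assume *: "I (vr st i + 1) (st'\<lparr>var := (var st')((i, []) := vr st i + 1)\<rparr>) \<and>
        int t + \<phi> (st'\<lparr>var := (var st')((i, []) := vr st i + 1)\<rparr>) \<le> \<phi> st + K" "agree c st st'"
      then have "vr st' i = vr st i" using w by (auto dest: agree_var)
      then show "wp (i ::= Plus (Vr i) (Const 1)) (\<lambda>u st'. ?I st' \<and>
          nat (vr st0 n - vr st' i) < nat (vr st0 n - vr st i) \<and>
          int (t + u) + int (1 + bcost ?b) + ?\<phi> st' \<le> ?\<phi> st) st'"
        using * I a by (auto simp: algebra_simps)
    qed
  qed
  then show ?thesis
    unfolding for_loop_def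
  proof (rule wp_conseq_agree)
    fix t st'
    assume *: "?I st' \<and> \<not> bval ?b st' \<and> int t + ?\<phi> st' \<le> ?\<phi> st0 + int (1 + bcost ?b)"
      and "agree (While ?b ?c) st0 st'"
    then have "vr st' n = vr st0 n" using w by (auto dest!: agree_var[of _ _ _ "(n, [])"])
    then have "vr st' i = vr st0 n" using * by auto
    then show "I (vr st0 n) st' \<and> vr st' i = vr st0 n \<and>
        int t + \<phi> st' \<le> \<phi> st0 + (K + 10) * (vr st0 n - vr st0 i) + 10"
      using * by auto
  qed
qed

lemma wp_for_loop:
  fixes K :: int
  assumes "I (vr st0 i) st0" and "vr st0 i \<le> vr st0 n"
    and "(i, []) \<notin> written_vars c" "(n, []) \<notin> written_vars c" "i \<noteq> n"
    and "\<And>e st. I e st \<Longrightarrow> agree (for_loop i n c) st0 st \<Longrightarrow> vr st i = e \<Longrightarrow> vr st0 i \<le> e \<Longrightarrow>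
      e < vr st0 n \<Longrightarrow>
      wp c (\<lambda>t st'. I (e + 1) (st'\<lparr>var := (var st')((i, []) := e + 1)\<rparr>) \<and> int t \<le> K) st"
  shows "wp (for_loop i n c) (\<lambda>t st'. I (vr st0 n) st' \<and> vr st' i = vr st0 n \<and>
      int t \<le> (K + 10) * (vr st0 n - vr st0 i) + 10) st0"
  using wp_for_loop_pot[of I st0 i n c "\<lambda>_. 0" K] assms by simp

section \<open>Balanced orientations by splicing paths\<close>

text \<open>Entry of the signed incidence matrix: \<open>h p * bd src dst p v\<close> summed over
  the arcs \<open>p\<close> is the divergence of \<open>h\<close> at \<open>v\<close>. A loop has
  only zero entries, which later makes the collecting node \<open>M\<close> harmless.\<close>

definition bd :: "(int \<Rightarrow> int) \<Rightarrow> (int \<Rightarrow> int) \<Rightarrow> int \<Rightarrow> int \<Rightarrow> int" where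
  "bd src dst p v = of_bool (src p = v) - of_bool (dst p = v)"

text \<open>
  Edges that were spliced together form a path, which is represented by its newest
  edge \<open>r\<close> and has the ends \<open>ta r\<close> and \<open>tb r\<close>. An older edge \<open>i\<close> is traversed in the
  same (\<open>sg i = 1\<close>) or opposite (\<open>sg i = -1\<close>) direction as \<open>par i\<close>. At most one path
  ends in a vertex \<open>v\<close>, and \<open>wait v\<close> is its number plus one (0 if there is none).
\<close>

definition open_end :: "(int \<Rightarrow> int) \<Rightarrow> (int \<Rightarrow> int) \<Rightarrow> (int \<Rightarrow> int) \<Rightarrow> int \<Rightarrow> int" where
  "open_end wait ta x v =
     (if wait v = 0 then 0 else if ta (wait v - 1) = v then x (wait v - 1) else - x (wait v - 1))"

text \<open>The signs of the representatives (\<open>sg\<close> equal to 0) are free and determine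
  all others. Quantifying over all such \<open>x\<close> lets the invariants hold before any
  orientation has been chosen.\<close>

definition follows :: "int set \<Rightarrow> (int \<Rightarrow> int) \<Rightarrow> (int \<Rightarrow> int) \<Rightarrow> (int \<Rightarrow> int) \<Rightarrow> bool" where
  "follows B par sg x \<longleftrightarrow> (\<forall>i\<in>B. sg i \<noteq> 0 \<longrightarrow> x i = sg i * x (par i))"

text \<open>\<open>i < par i\<close> makes links point to newer edges, so a single pass in
  decreasing order resolves all signs. A waiting path is registered at both of its ends, which are
  distinct since closed paths are dropped.\<close>

definition links_ok ::
  "int set \<Rightarrow> (int \<Rightarrow> int) \<Rightarrow> (int \<Rightarrow> int) \<Rightarrow> (int \<Rightarrow> int) \<Rightarrow> (int \<Rightarrow> int) \<Rightarrow> (int \<Rightarrow> int) \<Rightarrow> bool" where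
  "links_ok B wait ta tb par sg \<longleftrightarrow>
     (\<forall>i\<in>B. sg i \<in> {-1, 0, 1} \<and> (sg i \<noteq> 0 \<longrightarrow> i < par i \<and> par i \<in> B)) \<and>
     (\<forall>v. wait v \<noteq> 0 \<longrightarrow> wait v - 1 \<in> B \<and> sg (wait v - 1) = 0 \<and>
        ta (wait v - 1) \<noteq> tb (wait v - 1) \<and> (v = ta (wait v - 1) \<or> v = tb (wait v - 1)) \<and>
        wait (ta (wait v - 1)) = wait v \<and> wait (tb (wait v - 1)) = wait v)"

definition spliced where
  "spliced rt rh B wait ta tb par sg \<longleftrightarrow> links_ok B wait ta tb par sg \<and>
     (\<forall>x. follows B par sg x \<longrightarrow> (\<forall>v. (\<Sum>i\<in>B. x i * bd rt rh i v) = open_end wait ta x v))"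

text \<open>The newest edge \<open>e\<close> represents a path from \<open>a\<close> to \<open>b\<close> that is not yet registered in \<open>wait\<close>.\<close>

definition pending where
  "pending rt rh B e a b wait ta tb par sg \<longleftrightarrow> links_ok B wait ta tb par sg \<and>
     0 \<le> e \<and> e \<in> B \<and> (\<forall>i\<in>B. i \<le> e) \<and> sg e = 0 \<and> (\<forall>v. wait v \<noteq> e + 1) \<and>
     (\<forall>x. follows B par sg x \<longrightarrow> (\<forall>v. (\<Sum>i\<in>B. x i * bd rt rh i v) =
        open_end wait ta x v + x e * (of_bool (a = v) - of_bool (b = v))))"

lemma spliced_empty: "spliced rt rh {} (\<lambda>_. 0) ta tb par sg"
  by (simp add: spliced_def links_ok_def open_end_def)

text \<open>A number above all earlier ones occurs in no \<open>wait\<close> entry, so the new edge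
  starts as a path of its own.\<close>

lemma pending_insert:
  assumes "spliced rt rh B wait ta tb par sg" "finite B" "\<forall>i\<in>B. i < e" "sg e = 0" "0 \<le> e"
  shows "pending rt rh (insert e B) e (rt e) (rh e) wait ta tb par sg"
proof -
  have e: "e \<notin> B" using assms(3) by auto
  have l: "links_ok B wait ta tb par sg" using assms(1) by (simp add: spliced_def)
  have w: "wait v \<noteq> e + 1" for v
  proof
    assume v: "wait v = e + 1"
    then have "wait v \<noteq> 0" using assms(5) by simp
    then have "wait v - 1 \<in> B" using l unfolding links_ok_def by blast
    then show False using v e by simp
  qed
  show ?thesis
    using assms l e w unfolding pending_def spliced_def
    by (auto simp: links_ok_def follows_def bd_def less_imp_le algebra_simps)
qed

text \<open>Read in the direction given by \<open>s\<close>, the waiting path \<open>P\<close> runs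
  from \<open>c\<close> to \<open>a\<close>, and the pending path continues from \<open>a\<close> to
  \<open>b\<close>. With \<open>x P = s * x e\<close> the two terms at \<open>a\<close> cancel, and
  \<open>e\<close> represents the joined path from \<open>c\<close> to \<open>b\<close>.\<close>

lemma pending_attach:
  assumes pend: "pending rt rh B e a b wait ta tb par sg" and "wait a \<noteq> 0"
    and P: "P = wait a - 1"
    and c: "c = (if tb P = a then ta P else tb P)" and s: "s = (if tb P = a then 1 else -1)"
  shows "pending rt rh B e c b (wait(a := 0, c := 0)) ta tb (par(P := e)) (sg(P := s))"
proof -
  note l = pend[unfolded pending_def, THEN conjunct1]
  have 1: "P \<in> B" "sg P = 0" "ta P \<noteq> tb P" "a = ta P \<or> a = tb P" "wait (ta P) = P + 1"
    "wait (tb P) = P + 1" "wait a = P + 1"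
    using l assms(2) P unfolding links_ok_def by auto
  have wc: "wait c = P + 1" "c \<noteq> a" using 1 c by (auto split: if_splits)
  have e: "0 \<le> e" "e \<in> B" "sg e = 0" "\<forall>i\<in>B. i \<le> e" "\<forall>v. wait v \<noteq> e + 1"
    using pend by (auto simp: pending_def)
  then have Pe: "P < e" "P \<noteq> e" using 1 by (metis order_le_less)+
  \<comment> \<open>Clearing \<open>wait\<close> at \<open>a\<close> and \<open>c\<close> therefore
    unregisters \<open>P\<close> completely and disturbs no other path.\<close>
  have only: "v = a \<or> v = c" if "wait v = P + 1" for v
  proof -
    have "v = ta P \<or> v = tb P"
      using l that assms(2) 1(7) unfolding links_ok_def by (metis add_diff_cancel_right')
    then show ?thesis using 1(4) c by auto
  qed
  have l': "links_ok B (wait(a := 0, c := 0)) ta tb (par(P := e)) (sg(P := s))"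
    unfolding links_ok_def
  proof (intro conjI ballI allI impI)
    fix i assume "i \<in> B"
    then show "(sg(P := s)) i \<in> {-1, 0, 1}" using l s by (auto simp: links_ok_def)
    show "(sg(P := s)) i \<noteq> 0 \<Longrightarrow> i < (par(P := e)) i" using l Pe \<open>i \<in> B\<close> by (auto simp: links_ok_def)
    show "(sg(P := s)) i \<noteq> 0 \<Longrightarrow> (par(P := e)) i \<in> B" using l e \<open>i \<in> B\<close> by (auto simp: links_ok_def)
  next
    fix v let ?w = "wait(a := 0, c := 0)"
    assume v: "?w v \<noteq> 0"
    then have v': "v \<noteq> a" "v \<noteq> c" "?w v = wait v" "wait v \<noteq> 0" by (auto split: if_splits)
    obtain r where r: "wait v = r + 1" by (metis diff_add_cancel)
    have rP: "r \<noteq> P" using only[of v] v' r by auto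
    have v2: "r \<in> B" "sg r = 0" "ta r \<noteq> tb r" "v = ta r \<or> v = tb r"
      "wait (ta r) = r + 1" "wait (tb r) = r + 1"
      using l v'(4) r unfolding links_ok_def by (metis add_diff_cancel_right')+
    have ends: "ta r \<noteq> a" "ta r \<noteq> c" "tb r \<noteq> a" "tb r \<noteq> c"
      using v2(5,6) rP 1(7) wc(1) by auto
    have w: "?w v = r + 1" "?w (ta r) = r + 1" "?w (tb r) = r + 1"
      using v'(3) r ends v2(5,6) by simp_all
    have sr: "(sg(P := s)) r = 0" using v2(2) rP by simp
    show "?w v - 1 \<in> B" "(sg(P := s)) (?w v - 1) = 0" "ta (?w v - 1) \<noteq> tb (?w v - 1)"
      "v = ta (?w v - 1) \<or> v = tb (?w v - 1)"
      "?w (ta (?w v - 1)) = ?w v" "?w (tb (?w v - 1)) = ?w v"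
      unfolding w add_diff_cancel_right' by (rule v2(1) sr v2(3) v2(4) refl)+
  qed
  have "(\<Sum>i\<in>B. x i * bd rt rh i v) =
        open_end (wait(a := 0, c := 0)) ta x v + x e * (of_bool (c = v) - of_bool (b = v))"
    if x: "follows B (par(P := e)) (sg(P := s)) x" for x v
  proof -
    have xP: "x P = s * x e" using x 1(1) s by (auto simp: follows_def split: if_splits)
    have "follows B par sg x"
      using x 1(2) unfolding follows_def by (metis fun_upd_other)
    then have "(\<Sum>i\<in>B. x i * bd rt rh i v) =
        open_end wait ta x v + x e * (of_bool (a = v) - of_bool (b = v))"
      using pend by (simp add: pending_def)
    also have "\<dots> = open_end (wait(a := 0, c := 0)) ta x v + x e * (of_bool (c = v) - of_bool (b = v))"
    proof -
      consider "v = a" | "v = c" | "v \<noteq> a" "v \<noteq> c" by blast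
      then show ?thesis
      proof cases
        case 1
        then show ?thesis using xP s \<open>ta P \<noteq> tb P\<close> \<open>a = ta P \<or> a = tb P\<close> \<open>wait a = P + 1\<close> \<open>c \<noteq> a\<close> assms(2)
          by (auto simp: open_end_def)
      next
        case 2
        then show ?thesis using xP s c \<open>ta P \<noteq> tb P\<close> \<open>a = ta P \<or> a = tb P\<close> wc \<open>wait a = P + 1\<close> assms(2)
          by (auto simp: open_end_def)
      next
        case 3
        then show ?thesis by (auto simp: open_end_def)
      qed
    qed
    finally show ?thesis .
  qed
  then show ?thesis using l' e Pe 1 wc by (auto simp: pending_def)
qed

text \<open>Reversing all directions negates \<open>bd\<close>, \<open>open_end\<close> and the term
  of the pending path alike. Attachment at the head thus follows from attachment at the
  tail.\<close>

lemma pending_reverse: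
  assumes "pending rt rh B e a b wait ta tb par sg"
  shows "pending rh rt B e b a wait tb ta par sg"
proof -
  have l: "links_ok B wait ta tb par sg" using assms by (simp add: pending_def)
  have bd: "bd rh rt i v = - bd rt rh i v" for i v by (simp add: bd_def)
  have oe: "open_end wait tb x v = - open_end wait ta x v" for x v
    using l unfolding links_ok_def open_end_def by (smt (verit))
  have l': "links_ok B wait tb ta par sg" using l unfolding links_ok_def by metis
  show ?thesis using assms l' unfolding pending_def oe bd
    by (auto simp: sum_negf algebra_simps)
qed

lemma pending_attach':
  assumes "pending rt rh B e a b wait ta tb par sg" and "wait b \<noteq> 0"
    and "P = wait b - 1"
    and "c = (if ta P = b then tb P else ta P)" and "s = (if ta P = b then 1 else -1)"
  shows "pending rt rh B e a c (wait(b := 0, c := 0)) ta tb (par(P := e)) (sg(P := s))"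
  using pending_attach[OF pending_reverse[OF assms(1)] assms(2-5)] by (rule pending_reverse)

text \<open>A closed path contributes nothing at any vertex, so it can be forgotten whatever its
  sign.\<close>

lemma pending_closed:
  "pending rt rh B e a a wait ta tb par sg \<Longrightarrow> spliced rt rh B wait ta tb par sg"
  by (simp add: pending_def spliced_def)

lemma pending_register:
  assumes pend: "pending rt rh B e a b wait ta tb par sg" and ab: "a \<noteq> b" "wait a = 0" "wait b = 0"
  shows "spliced rt rh B (wait(a := e + 1, b := e + 1)) (ta(e := a)) (tb(e := b)) par sg"
proof -
  let ?w = "wait(a := e + 1, b := e + 1)" and ?ta = "ta(e := a)" and ?tb = "tb(e := b)"
  note l = pend[unfolded pending_def, THEN conjunct1]
  have e: "0 \<le> e" "e \<in> B" "sg e = 0" "\<forall>v. wait v \<noteq> e + 1" using pend by (auto simp: pending_def)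
  have ne: "wait v - 1 \<noteq> e" for v using e(4) by (metis diff_add_cancel)
  have "links_ok B ?w ?ta ?tb par sg"
    unfolding links_ok_def
  proof (intro conjI allI impI)
    show "\<forall>i\<in>B. sg i \<in> {-1, 0, 1} \<and> (sg i \<noteq> 0 \<longrightarrow> i < par i \<and> par i \<in> B)"
      using l by (auto simp: links_ok_def)
  next
    fix v assume v: "?w v \<noteq> 0"
    let ?r = "?w v - 1"
    have "?r \<in> B \<and> sg ?r = 0 \<and> ?ta ?r \<noteq> ?tb ?r \<and> (v = ?ta ?r \<or> v = ?tb ?r) \<and>
      ?w (?ta ?r) = ?w v \<and> ?w (?tb ?r) = ?w v"
    proof (cases "v = a \<or> v = b")
      case True
      then show ?thesis using e ab by auto
    next
      case False
      then have v': "?w v = wait v" "wait v \<noteq> 0" using v by auto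
      let ?s = "wait v - 1"
      have s: "?s \<in> B \<and> sg ?s = 0 \<and> ta ?s \<noteq> tb ?s \<and> (v = ta ?s \<or> v = tb ?s) \<and>
        wait (ta ?s) = wait v \<and> wait (tb ?s) = wait v"
        using l v'(2) unfolding links_ok_def by blast
      with s have "wait (ta ?s) \<noteq> 0" "wait (tb ?s) \<noteq> 0" using v'(2) by simp_all
      then have "ta ?s \<noteq> a" "ta ?s \<noteq> b" "tb ?s \<noteq> a" "tb ?s \<noteq> b" using ab by auto
      then show ?thesis unfolding v'(1) using s ne[of v] by simp
    qed
    then show "?r \<in> B" "sg ?r = 0" "?ta ?r \<noteq> ?tb ?r" "v = ?ta ?r \<or> v = ?tb ?r"
      "?w (?ta ?r) = ?w v" "?w (?tb ?r) = ?w v" by blast+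
  qed
  moreover have "open_end ?w ?ta x v = open_end wait ta x v + x e * (of_bool (a = v) - of_bool (b = v))"
    for x v
    using ab ne[of v] e(1) by (auto simp: open_end_def)
  ultimately show ?thesis using pend by (simp add: pending_def spliced_def)
qed

text \<open>Only the one path that may be open at \<open>v\<close> is not cancelled there, and it
  contributes a single signed unit.\<close>

lemma spliced_balance:
  assumes "spliced rt rh B wait ta tb par sg" "follows B par sg x" "\<forall>i\<in>B. x i \<in> {-1, 1}"
  shows "\<bar>\<Sum>i\<in>B. x i * bd rt rh i v\<bar> \<le> 1"
proof -
  have "(\<Sum>i\<in>B. x i * bd rt rh i v) = open_end wait ta x v" "links_ok B wait ta tb par sg"
    using assms by (auto simp: spliced_def)
  moreover have "x (wait v - 1) \<in> {-1, 1}" if "wait v \<noteq> 0"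
    using calculation(2) that assms(3) unfolding links_ok_def by blast
  ultimately show ?thesis by (auto simp: open_end_def)
qed

section \<open>Rounding half of a symmetric flow\<close>

text \<open>A pair of mates is represented by the arc with the smaller number. Parity is tested by
  doubling the floor half, as the machine has no remainder operation.\<close>

abbreviation odd_rep :: bexp where
  "odd_rep \<equiv> And (Less (Vr ''e'') (Ar ''sigmaE'' (Vr ''e'')))
     (Less (Plus (Half (Ar ''f'' (Vr ''e''))) (Half (Ar ''f'' (Vr ''e'')))) (Ar ''f'' (Vr ''e'')))"

definition attach_a :: com where
  "attach_a =
     If (Equal (Ar ''wait'' (Vr ''a'')) (Const 0)) Skip
      (''p'' ::= Minus (Ar ''wait'' (Vr ''a'')) (Const 1);;
       If (Equal (Ar ''tb'' (Vr ''p'')) (Vr ''a''))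
         (''c'' ::= Ar ''ta'' (Vr ''p'');; ''sg''\<lbrakk>Vr ''p''\<rbrakk> ::= Const 1)
         (''c'' ::= Ar ''tb'' (Vr ''p'');; ''sg''\<lbrakk>Vr ''p''\<rbrakk> ::= Const (-1));;
       ''par''\<lbrakk>Vr ''p''\<rbrakk> ::= Vr ''e'';;
       ''wait''\<lbrakk>Vr ''a''\<rbrakk> ::= Const 0;; ''wait''\<lbrakk>Vr ''c''\<rbrakk> ::= Const 0;;
       ''a'' ::= Vr ''c'')"

definition attach_b :: com where
  "attach_b =
     If (Equal (Ar ''wait'' (Vr ''b'')) (Const 0)) Skip
      (''p'' ::= Minus (Ar ''wait'' (Vr ''b'')) (Const 1);;
       If (Equal (Ar ''ta'' (Vr ''p'')) (Vr ''b''))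
         (''c'' ::= Ar ''tb'' (Vr ''p'');; ''sg''\<lbrakk>Vr ''p''\<rbrakk> ::= Const 1)
         (''c'' ::= Ar ''ta'' (Vr ''p'');; ''sg''\<lbrakk>Vr ''p''\<rbrakk> ::= Const (-1));;
       ''par''\<lbrakk>Vr ''p''\<rbrakk> ::= Vr ''e'';;
       ''wait''\<lbrakk>Vr ''b''\<rbrakk> ::= Const 0;; ''wait''\<lbrakk>Vr ''c''\<rbrakk> ::= Const 0;;
       ''b'' ::= Vr ''c'')"

definition load_ends :: com where
  "load_ends =
     (''a'' ::= Ar ''tail'' (Vr ''e'');;
      If (Less (Ar ''sigmaV'' (Vr ''a'')) (Vr ''a'')) (''a'' ::= Ar ''sigmaV'' (Vr ''a'')) Skip;;
      ''b'' ::= Ar ''head'' (Vr ''e'');;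
      If (Less (Ar ''sigmaV'' (Vr ''b'')) (Vr ''b'')) (''b'' ::= Ar ''sigmaV'' (Vr ''b'')) Skip)"

definition register :: com where
  "register =
     If (Equal (Vr ''a'') (Vr ''b'')) Skip
       (''wait''\<lbrakk>Vr ''a''\<rbrakk> ::= Plus (Vr ''e'') (Const 1);; ''wait''\<lbrakk>Vr ''b''\<rbrakk> ::= Plus (Vr ''e'') (Const 1);;
        ''ta''\<lbrakk>Vr ''e''\<rbrakk> ::= Vr ''a'';; ''tb''\<lbrakk>Vr ''e''\<rbrakk> ::= Vr ''b'')"

definition splice_edge :: com where
  "splice_edge = (load_ends;; attach_a;; attach_b;; register)"

definition splice_all :: com where
  "splice_all = (''e'' ::= Const 0;; for_loop ''e'' ''m'' (If odd_rep splice_edge Skip))"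

text \<open>On even values \<open>x\<close> still holds its initial 0, on odd ones it is 1 or -1. So
  \<open>f + x\<close> is even in both cases and \<open>Half\<close> is exact; the mate receives the
  rest of \<open>f\<close>.\<close>

definition round_edge :: com where
  "round_edge =
     (If odd_rep
       (If (Equal (Ar ''sg'' (Vr ''e'')) (Const 0)) (''x''\<lbrakk>Vr ''e''\<rbrakk> ::= Const 1)
       (If (Equal (Ar ''sg'' (Vr ''e'')) (Const 1))
         (''x''\<lbrakk>Vr ''e''\<rbrakk> ::= Ar ''x'' (Ar ''par'' (Vr ''e'')))
         (''x''\<lbrakk>Vr ''e''\<rbrakk> ::= Minus (Const 0) (Ar ''x'' (Ar ''par'' (Vr ''e'')))))) Skip;;
      ''h''\<lbrakk>Vr ''e''\<rbrakk> ::= Half (Plus (Ar ''f'' (Vr ''e'')) (Ar ''x'' (Vr ''e'')));;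
      ''h''\<lbrakk>Ar ''sigmaE'' (Vr ''e'')\<rbrakk> ::= Minus (Ar ''f'' (Vr ''e'')) (Ar ''h'' (Vr ''e'')))"

definition round_all :: com where
  "round_all = (''e'' ::= Vr ''m'';;
     While (Less (Const 0) (Vr ''e''))
       (''e'' ::= Minus (Vr ''e'') (Const 1);;
        If (Less (Vr ''e'') (Ar ''sigmaE'' (Vr ''e''))) round_edge Skip))"

definition odd_reps :: "(int \<Rightarrow> int) \<Rightarrow> (int \<Rightarrow> int) \<Rightarrow> int \<Rightarrow> int set" where
  "odd_reps se f e = {i. 0 \<le> i \<and> i < e \<and> i < se i \<and> odd (f i)}"

lemma finite_odd_reps [simp]: "finite (odd_reps se f e)"
  by (rule finite_subset[of _ "{0..<e}"]) (auto simp: odd_reps_def)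

lemma half_less_iff_odd: "x div 2 + x div 2 < x \<longleftrightarrow> odd (x :: int)"
  "2 * (x div 2) < x \<longleftrightarrow> odd (x :: int)"
  by presburger+

text \<open>Vertices of the quotient graph are the orbits of the symmetry, each represented by its
  smaller member.\<close>

definition rep :: "(int \<Rightarrow> int) \<Rightarrow> int \<Rightarrow> int" where
  "rep sv v = (if sv v < v then sv v else v)"

text \<open>\<open>sg\<close> must stay 0 at edges not yet processed, because
  \<open>pending_insert\<close> starts every new edge as a representative.\<close>

abbreviation "pending_st rt rh B st \<equiv>
  pending rt rh B (vr st ''e'') (vr st ''a'') (vr st ''b'') (ar st ''wait'') (ar st ''ta'') (ar st ''tb'')
    (ar st ''par'') (ar st ''sg'') \<and> (\<forall>i. i \<notin> B \<longrightarrow> ar st ''sg'' i = 0)"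

lemma pending_wait_mem: "pending rt rh B e a b wait ta tb par sg \<Longrightarrow> wait v \<noteq> 0 \<Longrightarrow> wait v - 1 \<in> B"
  by (auto simp: pending_def links_ok_def)

lemma wp_attach_a:
  assumes "pending_st rt rh B st"
  shows "wp attach_a (\<lambda>t st'. pending_st rt rh B st' \<and> ar st' ''wait'' (vr st' ''a'') = 0 \<and> t \<le> 40) st"
proof (cases "ar st ''wait'' (vr st ''a'') = 0")
  case True
  then show ?thesis using assms by (simp add: attach_a_def)
next
  case False
  note P = pending_attach[OF assms[THEN conjunct1] False refl refl refl]
  have "ar st ''wait'' (vr st ''a'') - 1 \<in> B"
    using assms False pending_wait_mem by blast
  then show ?thesis
    using P False assms by (cases "ar st ''tb'' (ar st ''wait'' (vr st ''a'') - 1) = vr st ''a''")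
      (auto simp: attach_a_def)
qed

lemma wp_attach_b:
  assumes "pending_st rt rh B st" "ar st ''wait'' (vr st ''a'') = 0"
  shows "wp attach_b (\<lambda>t st'. pending_st rt rh B st' \<and> ar st' ''wait'' (vr st' ''a'') = 0 \<and>
    ar st' ''wait'' (vr st' ''b'') = 0 \<and> t \<le> 40) st"
proof (cases "ar st ''wait'' (vr st ''b'') = 0")
  case True
  then show ?thesis using assms by (simp add: attach_b_def)
next
  case False
  note P = pending_attach'[OF assms(1)[THEN conjunct1] False refl refl refl]
  have "ar st ''wait'' (vr st ''b'') - 1 \<in> B"
    using assms False pending_wait_mem by blast
  then show ?thesis
    using P False assms by (cases "ar st ''ta'' (ar st ''wait'' (vr st ''b'') - 1) = vr st ''b''")
      (auto simp: attach_b_def)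
qed

abbreviation "spliced_st rt rh B st \<equiv>
  spliced rt rh B (ar st ''wait'') (ar st ''ta'') (ar st ''tb'') (ar st ''par'') (ar st ''sg'') \<and>
  (\<forall>i. i \<notin> B \<longrightarrow> ar st ''sg'' i = 0)"

lemma wp_splice_edge:
  assumes "spliced_st (\<lambda>i. rep (ar st ''sigmaV'') (ar st ''tail'' i))
      (\<lambda>i. rep (ar st ''sigmaV'') (ar st ''head'' i)) B st" (is "spliced_st ?rt ?rh B st")
    and "finite B" "\<forall>i\<in>B. i < vr st ''e''" "0 \<le> vr st ''e''"
  shows "wp splice_edge (\<lambda>t st'. spliced_st (\<lambda>i. rep (ar st ''sigmaV'') (ar st ''tail'' i))
      (\<lambda>i. rep (ar st ''sigmaV'') (ar st ''head'' i)) (insert (vr st ''e'') B) st' \<and> t \<le> 140) st"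
proof -
  let ?e = "vr st ''e''"
  have "?e \<notin> B" using assms(3) by auto
  then have p: "pending ?rt ?rh (insert ?e B) ?e (?rt ?e) (?rh ?e) (ar st ''wait'') (ar st ''ta'') (ar st ''tb'')
    (ar st ''par'') (ar st ''sg'')"
    using assms by (intro pending_insert) auto
  have sg: "\<forall>i. i \<notin> insert ?e B \<longrightarrow> ar st ''sg'' i = 0" using assms by auto
  show ?thesis
    unfolding splice_edge_def
  proof (rule wp_SeqI)
    show "wp load_ends (\<lambda>t st'. pending_st ?rt ?rh (insert ?e B) st' \<and> vr st' ''e'' = ?e \<and> t \<le> 40) st"
      using p sg by (auto simp: load_ends_def rep_def)
  next
    fix t1 :: nat and st1
    assume 1: "pending_st ?rt ?rh (insert ?e B) st1 \<and> vr st1 ''e'' = ?e \<and> t1 \<le> 40"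
    show "wp (attach_a;; attach_b;; register) (\<lambda>u st'. spliced_st ?rt ?rh (insert ?e B) st' \<and> t1 + u \<le> 140) st1"
    proof (rule wp_SeqI[OF wp_attach_a], use 1 in blast, rule wp_SeqI[OF wp_attach_b], blast, blast)
      fix t2 t3 :: nat and st2 st3
      assume 2: "pending_st ?rt ?rh (insert ?e B) st2 \<and> ar st2 ''wait'' (vr st2 ''a'') = 0 \<and> t2 \<le> 40"
        and 3: "pending_st ?rt ?rh (insert ?e B) st3 \<and> ar st3 ''wait'' (vr st3 ''a'') = 0 \<and>
          ar st3 ''wait'' (vr st3 ''b'') = 0 \<and> t3 \<le> 40"
      show "wp register (\<lambda>u st'. spliced_st ?rt ?rh (insert ?e B) st' \<and> t1 + (t2 + (t3 + u)) \<le> 140) st3"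
      proof (cases "vr st3 ''a'' = vr st3 ''b''")
        case True
        then show ?thesis using 1 2 3 by (auto simp: register_def intro: pending_closed)
      next
        case False
        then show ?thesis using 1 2 3 pending_register[OF conjunct1[OF 3[THEN conjunct1]] False]
          by (auto simp: register_def)
      qed
    qed
  qed
qed

lemma odd_reps_Suc:
  assumes "0 \<le> e"
  shows "odd_reps se f (e + 1) = (if e < se e \<and> odd (f e) then insert e (odd_reps se f e) else odd_reps se f e)"
  using assms by (auto simp: odd_reps_def less_le)

lemma wp_splice_all:
  fixes st0 :: store
  defines "rt \<equiv> (\<lambda>i. rep (ar st0 ''sigmaV'') (ar st0 ''tail'' i))"
    and "rh \<equiv> (\<lambda>i. rep (ar st0 ''sigmaV'') (ar st0 ''head'' i))"
    and "B \<equiv> odd_reps (ar st0 ''sigmaE'') (ar st0 ''f'')"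
  assumes z: "ar st0 ''wait'' = (\<lambda>_. 0)" "ar st0 ''sg'' = (\<lambda>_. 0)" and m: "0 \<le> vr st0 ''m''"
  shows "wp splice_all (\<lambda>t st'. spliced_st rt rh (B (vr st0 ''m'')) st' \<and> int t \<le> 200 * vr st0 ''m'' + 20) st0"
proof -
  let ?c = "If odd_rep splice_edge Skip"
  let ?st = "st0\<lparr>var := (var st0)((''e'', []) := 0)\<rparr>"
  let ?I = "\<lambda>e st. spliced_st rt rh (B e) st"
  note defs = splice_edge_def load_ends_def attach_a_def attach_b_def register_def
  have "wp (for_loop ''e'' ''m'' ?c) (\<lambda>t st'. ?I (vr ?st ''m'') st' \<and> vr st' ''e'' = vr ?st ''m'' \<and>
      int t \<le> (160 + 10) * (vr ?st ''m'' - vr ?st ''e'') + 10) ?st"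
  proof (rule wp_for_loop)
    have "odd_reps se f 0 = {}" for se f by (auto simp: odd_reps_def)
    then show "?I (vr ?st ''e'') ?st" by (simp add: B_def z spliced_empty)
  next
    fix e st
    assume I: "?I e st" and ag: "agree (for_loop ''e'' ''m'' ?c) ?st st" and e: "vr st ''e'' = e"
      "vr ?st ''e'' \<le> e" "e < vr ?st ''m''"
    have fr: "ar st ''sigmaV'' = ar st0 ''sigmaV''" "ar st ''sigmaE'' = ar st0 ''sigmaE''"
      "ar st ''tail'' = ar st0 ''tail''" "ar st ''head'' = ar st0 ''head''" "ar st ''f'' = ar st0 ''f''"
      using ag[THEN agree_arr] by (auto simp: defs)
    show "wp ?c (\<lambda>t st'. ?I (e + 1) (st'\<lparr>var := (var st')((''e'', []) := e + 1)\<rparr>) \<and> int t \<le> 160) st"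
    proof (cases "bval odd_rep st")
      case True
      have "B (e + 1) = insert e (B e)"
        using True e by (simp add: B_def odd_reps_Suc fr half_less_iff_odd)
      moreover have "wp splice_edge (\<lambda>t st'. spliced_st rt rh (insert e (B e)) st' \<and> t \<le> 140) st"
      proof -
        have "spliced_st (\<lambda>i. rep (ar st ''sigmaV'') (ar st ''tail'' i)) (\<lambda>i. rep (ar st ''sigmaV'') (ar st ''head'' i)) (B e) st"
          using I unfolding rt_def rh_def by (simp add: fr)
        moreover have "finite (B e)" unfolding B_def by simp
        moreover have "\<forall>i\<in>B e. i < vr st ''e''" "0 \<le> vr st ''e''"
          using e by (auto simp: B_def odd_reps_def)
        ultimately show ?thesis
          using wp_splice_edge[of st "B e"] unfolding rt_def rh_def fr e(1) by blast
      qed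
      ultimately show ?thesis using True by (auto elim!: wp_conseq)
    next
      case False
      then have "B (e + 1) = B e"
        using e by (auto simp: B_def odd_reps_Suc fr half_less_iff_odd)
      then show ?thesis using False I by auto
    qed
  qed (use m in \<open>auto simp: defs\<close>)
  then show ?thesis unfolding splice_all_def by (auto elim!: wp_conseq)
qed

lemma wp_round_edge:
  fixes st0 :: store
  shows "wp round_edge (\<lambda>t st'. t \<le> 60 \<and>
     (\<exists>y. ar st' ''x'' = (if bval odd_rep st then (ar st ''x'')(vr st ''e'' := y) else ar st ''x'') \<and>
        (ar st ''sg'' (vr st ''e'') = 0 \<longrightarrow> y = 1) \<and>
        (ar st ''sg'' (vr st ''e'') = 1 \<longrightarrow> y = ar st ''x'' (ar st ''par'' (vr st ''e''))) \<and>
        (ar st ''sg'' (vr st ''e'') = -1 \<longrightarrow> y = - ar st ''x'' (ar st ''par'' (vr st ''e'')))) \<and>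
     ar st' ''h'' = (ar st ''h'')
       (vr st ''e'' := (ar st ''f'' (vr st ''e'') + ar st' ''x'' (vr st ''e'')) div 2,
        ar st ''sigmaE'' (vr st ''e'') := ar st ''f'' (vr st ''e'') -
          (ar st ''f'' (vr st ''e'') + ar st' ''x'' (vr st ''e'')) div 2)) st"
  by (auto simp: round_edge_def)

lemma wp_round_all:
  fixes st0 :: store
  defines "f \<equiv> ar st0 ''f''" and "se \<equiv> ar st0 ''sigmaE''" and "sg \<equiv> ar st0 ''sg''" and "par \<equiv> ar st0 ''par''"
  defines "B \<equiv> odd_reps se f (vr st0 ''m'')"
  assumes z: "ar st0 ''x'' = (\<lambda>_. 0)"
    and l: "links_ok B wait ta tb par sg"
    and se: "\<And>i. 0 \<le> i \<Longrightarrow> i < vr st0 ''m'' \<Longrightarrow> se (se i) = i"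
    and m: "0 \<le> vr st0 ''m''"
  shows "wp round_all (\<lambda>t st'. (\<exists>x. follows B par sg x \<and> (\<forall>i\<in>B. x i \<in> {-1, 1}) \<and> (\<forall>i. i \<notin> B \<longrightarrow> x i = 0) \<and>
      (\<forall>j. 0 \<le> j \<and> j < vr st0 ''m'' \<and> j < se j \<longrightarrow>
         ar st' ''h'' j = (f j + x j) div 2 \<and> ar st' ''h'' (se j) = f j - (f j + x j) div 2)) \<and>
      int t \<le> 100 * vr st0 ''m'' + 10) st0"
proof -
  let ?m = "vr st0 ''m''"
  let ?c = "''e'' ::= Minus (Vr ''e'') (Const 1);; If (Less (Vr ''e'') (Ar ''sigmaE'' (Vr ''e''))) round_edge Skip"
  let ?b = "Less (Const 0) (Vr ''e'')"
  let ?st = "st0\<lparr>var := (var st0)((''e'', []) := ?m)\<rparr>"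
  \<comment> \<open>The pass runs downward, so the parent \<open>par i > i\<close> of an edge
    already has its sign. Cells not yet reached hold 0, as do those of even pairs.\<close>
  let ?X = "\<lambda>e x. (\<forall>i\<in>B. e \<le> i \<longrightarrow> x i \<in> {-1, 1} \<and> (sg i \<noteq> 0 \<longrightarrow> x i = sg i * x (par i))) \<and>
     (\<forall>i. i < e \<or> i \<notin> B \<longrightarrow> x i = 0)"
  let ?G = "\<lambda>e x g. \<forall>j. e \<le> j \<and> j < ?m \<and> j < se j \<longrightarrow> g j = (f j + x j) div 2 \<and> g (se j) = f j - (f j + x j) div 2"
  let ?I = "\<lambda>st. 0 \<le> vr st ''e'' \<and> vr st ''e'' \<le> ?m \<and> ?X (vr st ''e'') (ar st ''x'') \<and>
     ?G (vr st ''e'') (ar st ''x'') (ar st ''h'')"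
  have "wp (While ?b ?c) (\<lambda>t st'. ?I st' \<and> \<not> bval ?b st' \<and>
      int t + 100 * vr st' ''e'' \<le> 100 * vr ?st ''e'' + int (1 + bcost ?b)) ?st"
  proof (rule wp_While_int[where \<mu> = "\<lambda>st. nat (vr st ''e'')"])
    show "?I ?st" using m z by (auto simp: B_def odd_reps_def)
  next
    fix st
    assume I: "?I st" and ag: "agree ?c ?st st" and b: "bval ?b st"
    let ?e = "vr st ''e'' - 1"
    let ?st1 = "st\<lparr>var := (var st)((''e'', []) := ?e)\<rparr>"
    have fr: "ar st ''f'' = f" "ar st ''sigmaE'' = se" "ar st ''sg'' = sg" "ar st ''par'' = par"
      using ag[THEN agree_arr] by (auto simp: round_edge_def f_def se_def sg_def par_def)
    have e: "0 \<le> ?e" "?e < ?m" using I b by auto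
    have Bi: "i < ?m" "i < se i" "0 \<le> i" if "i \<in> B" for i using that by (auto simp: B_def odd_reps_def)
    let ?Q = "\<lambda>K t st'. t \<le> K \<and> ?X ?e (ar st' ''x'') \<and> ?G ?e (ar st' ''x'') (ar st' ''h'') \<and> vr st' ''e'' = ?e"
    have "wp (If (Less (Vr ''e'') (Ar ''sigmaE'' (Vr ''e''))) round_edge Skip) (?Q 70) ?st1"
    proof (cases "?e < se ?e")
      case False
      \<comment> \<open>The arc with the larger number of a pair is not in \<open>B\<close> and is
        filled in together with its mate, so this iteration changes nothing.\<close>
      have "?X ?e (ar st ''x'')"
      proof (intro conjI ballI allI impI)
        fix i assume i: "i \<in> B" "?e \<le> i"
        then have "vr st ''e'' \<le> i" using False Bi(2)[of i] by (cases "i = ?e") auto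
        then show "ar st ''x'' i \<in> {-1, 1}" "sg i \<noteq> 0 \<Longrightarrow> ar st ''x'' i = sg i * ar st ''x'' (par i)"
          using I i by blast+
      qed (use I in auto)
      moreover have "?G ?e (ar st ''x'') (ar st ''h'')"
      proof (intro allI impI)
        fix j assume j: "?e \<le> j \<and> j < ?m \<and> j < se j"
        then have "vr st ''e'' \<le> j" using False by (cases "j = ?e") auto
        then show "ar st ''h'' j = (f j + ar st ''x'' j) div 2 \<and> ar st ''h'' (se j) = f j - (f j + ar st ''x'' j) div 2"
          using I j by blast
      qed
      ultimately show ?thesis using False fr by simp
    next
      case True
      have odd: "bval odd_rep ?st1 \<longleftrightarrow> ?e \<in> B"
        using True e by (simp add: fr half_less_iff_odd B_def odd_reps_def)
      have "wp round_edge (?Q 60) ?st1"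
      proof (rule wp_conseq_agree[OF wp_round_edge], unfold odd, elim conjE exE)
        fix t :: nat and st' y
        assume ag': "agree round_edge ?st1 st'" and "t \<le> 60"
          and x: "ar st' ''x'' = (if ?e \<in> B then (ar ?st1 ''x'')(vr ?st1 ''e'' := y) else ar ?st1 ''x'')"
          and y: "ar ?st1 ''sg'' (vr ?st1 ''e'') = 0 \<longrightarrow> y = 1"
            "ar ?st1 ''sg'' (vr ?st1 ''e'') = 1 \<longrightarrow> y = ar ?st1 ''x'' (ar ?st1 ''par'' (vr ?st1 ''e''))"
            "ar ?st1 ''sg'' (vr ?st1 ''e'') = -1 \<longrightarrow> y = - ar ?st1 ''x'' (ar ?st1 ''par'' (vr ?st1 ''e''))"
          and g: "ar st' ''h'' = (ar ?st1 ''h'')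
             (vr ?st1 ''e'' := (ar ?st1 ''f'' (vr ?st1 ''e'') + ar st' ''x'' (vr ?st1 ''e'')) div 2,
              ar ?st1 ''sigmaE'' (vr ?st1 ''e'') := ar ?st1 ''f'' (vr ?st1 ''e'') -
               (ar ?st1 ''f'' (vr ?st1 ''e'') + ar st' ''x'' (vr ?st1 ''e'')) div 2)"
        let ?x = "ar st ''x''" and ?x' = "ar st' ''x''"
        have x': "?x' = (if ?e \<in> B then ?x(?e := y) else ?x)" using x by simp
        have y': "sg ?e = 0 \<longrightarrow> y = 1" "sg ?e = 1 \<longrightarrow> y = ?x (par ?e)" "sg ?e = -1 \<longrightarrow> y = - ?x (par ?e)"
          using y by (simp_all add: fr)
        have lk: "sg i \<in> {-1, 0, 1}" "sg i \<noteq> 0 \<Longrightarrow> i < par i \<and> par i \<in> B" if "i \<in> B" for i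
          using l that unfolding links_ok_def by blast+
        have xI: "?x i \<in> {-1, 1}" "sg i \<noteq> 0 \<Longrightarrow> ?x i = sg i * ?x (par i)" if "i \<in> B" "?e < i" for i
          using I that by force+
        have "?X ?e ?x'"
        proof (intro conjI ballI allI impI)
          fix i assume i: "i \<in> B" "?e \<le> i"
          have "?x' i \<in> {-1, 1} \<and> (sg i \<noteq> 0 \<longrightarrow> ?x' i = sg i * ?x' (par i))"
          proof (cases "i = ?e")
            case True
            then show ?thesis using i x' y' lk[of ?e] xI(1)[of "par ?e"] by auto
          next
            case False
            then show ?thesis using i x' lk[of i] xI[of i] by auto
          qed
          then show "?x' i \<in> {-1, 1}" "sg i \<noteq> 0 \<Longrightarrow> ?x' i = sg i * ?x' (par i)" by blast+
        next
          fix i assume "i < ?e \<or> i \<notin> B"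
          then show "?x' i = 0" using I x' by auto
        qed
        moreover have "?G ?e ?x' (ar st' ''h'')"
        proof (intro allI impI)
          fix j assume j: "?e \<le> j \<and> j < ?m \<and> j < se j"
          have g': "ar st' ''h'' = (ar st ''h'')(?e := (f ?e + ?x' ?e) div 2, se ?e := f ?e - (f ?e + ?x' ?e) div 2)"
            using g by (simp add: fr)
          show "ar st' ''h'' j = (f j + ?x' j) div 2 \<and> ar st' ''h'' (se j) = f j - (f j + ?x' j) div 2"
          proof (cases "j = ?e")
            case True
            then show ?thesis using j by (simp add: g')
          next
            case False
            \<comment> \<open>Injectivity of the involution keeps the two cells written for this
              pair apart from those of every other pair.\<close>
            have "se (se ?e) = ?e" "se (se j) = j" using se e j by auto
            then have "se j \<noteq> ?e" "j \<noteq> se ?e" "se j \<noteq> se ?e" using j True False by auto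
            moreover have "?x' j = ?x j" using x' False by simp
            moreover have "ar st ''h'' j = (f j + ?x j) div 2 \<and> ar st ''h'' (se j) = f j - (f j + ?x j) div 2"
              using I j False by force
            ultimately show ?thesis using False unfolding g' by simp
          qed
        qed
        moreover have "vr st' ''e'' = ?e" using agree_var[OF ag', of "(''e'', [])"] by (simp add: round_edge_def)
        ultimately show "?Q 60 t st'" using \<open>t \<le> 60\<close> by simp
      qed
      then show ?thesis using True fr by (auto elim!: wp_conseq)
    qed
    then show "wp ?c (\<lambda>t st'. ?I st' \<and> nat (vr st' ''e'') < nat (vr st ''e'') \<and>
      int t + int (1 + bcost ?b) + 100 * vr st' ''e'' \<le> 100 * vr st ''e'') st"
      unfolding wp_Seq wp_Assign aval.simps
    proof (rule wp_conseq, goal_cases)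
      case (1 t st')
      then have v: "vr st' ''e'' = ?e" by blast
      have X: "?X ?e (ar st' ''x'')" "?G ?e (ar st' ''x'') (ar st' ''h'')" using 1 by blast+
      have "?I st'" unfolding v by (rule conjI[OF _ conjI[OF _ conjI[OF X]]]) (use e in auto)
      moreover have "t \<le> 70" using 1 by blast
      ultimately show ?case using v e by simp
    qed
  qed
  then show ?thesis
    unfolding round_all_def wp_Seq wp_Assign aval.simps
  proof (rule wp_conseq, goal_cases)
    case (1 t st')
    then have "?X 0 (ar st' ''x'')" "?G 0 (ar st' ''x'') (ar st' ''h'')" by auto
    then show ?case using 1 by (auto simp: follows_def B_def odd_reps_def intro!: exI[of _ "ar st' ''x''"])
  qed
qed

text \<open>The deviation \<open>2 * g - f\<close> is \<open>x\<close> on an odd representative and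
  \<open>- x\<close> on its mate. The incidences of two mates at \<open>v\<close> combine to that of
  one quotient edge at the orbit of \<open>v\<close>, so the balance of the signs there bounds the
  deviation at \<open>v\<close>.\<close>

lemma round_balance:
  fixes n m :: int and tl hd sv se f g x :: "int \<Rightarrow> int"
  defines "B \<equiv> odd_reps se f m"
  assumes sv: "\<And>v. 0 \<le> v \<Longrightarrow> v < n \<Longrightarrow> 0 \<le> sv v \<and> sv v < n \<and> sv (sv v) = v \<and> sv v \<noteq> v"
    and se: "\<And>e. 0 \<le> e \<Longrightarrow> e < m \<Longrightarrow> 0 \<le> se e \<and> se e < m \<and> se (se e) = e \<and> se e \<noteq> e \<and>
       0 \<le> tl e \<and> tl e < n \<and> 0 \<le> hd e \<and> hd e < n \<and> tl (se e) = sv (hd e) \<and> hd (se e) = sv (tl e)"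
    and f: "\<And>e. 0 \<le> e \<Longrightarrow> e < m \<Longrightarrow> 0 \<le> f e \<and> f (se e) = f e"
    and x: "\<forall>i\<in>B. x i \<in> {-1, 1}" "\<forall>i. i \<notin> B \<longrightarrow> x i = 0"
    and bal: "\<And>v. \<bar>\<Sum>i\<in>B. x i * bd (\<lambda>i. rep sv (tl i)) (\<lambda>i. rep sv (hd i)) i v\<bar> \<le> 1"
    and g: "\<forall>j. 0 \<le> j \<and> j < m \<and> j < se j \<longrightarrow> g j = (f j + x j) div 2 \<and> g (se j) = f j - (f j + x j) div 2"
  shows "\<And>e. 0 \<le> e \<Longrightarrow> e < m \<Longrightarrow> 0 \<le> g e \<and> g e + g (se e) = f e"
    and "\<And>v. 0 \<le> v \<Longrightarrow> v < n \<Longrightarrow>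
      \<bar>2 * (\<Sum>e\<in>{0..<m}. g e * bd tl hd e v) - (\<Sum>e\<in>{0..<m}. f e * bd tl hd e v)\<bar> \<le> 1"
proof -
  have B: "i \<in> B \<longleftrightarrow> 0 \<le> i \<and> i < m \<and> i < se i \<and> odd (f i)" for i by (auto simp: B_def odd_reps_def)
  have rep_j: "0 \<le> g j \<and> 0 \<le> g (se j) \<and> g j + g (se j) = f j \<and> 2 * g j - f j = x j" if "0 \<le> j" "j < m" "j < se j" for j
  proof (cases "odd (f j)")
    case True
    \<comment> \<open>An odd nonnegative value is at least 1, so rounding down stays
      nonnegative.\<close>
    then have "x j = -1 \<or> x j = 1" "0 < f j" using x B[of j] that f[of j] by auto (metis even_zero order_le_less)
    then show ?thesis using g that True by auto presburger+
  next
    case False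
    then have "x j = 0" using x(2) B[of j] by auto
    then show ?thesis using g that False f[of j] by auto
  qed
  show "0 \<le> g e \<and> g e + g (se e) = f e" if "0 \<le> e" "e < m" for e
  proof (cases "e < se e")
    case True
    then show ?thesis using rep_j that by blast
  next
    case False
    then show ?thesis using rep_j[of "se e"] se[OF that] f[OF that] by auto
  qed
  fix v :: int assume v: "0 \<le> v" "v < n"
  define d where "d e = 2 * g e - f e" for e
  have d: "d e = (if e < se e then x e else - x (se e))" if "0 \<le> e" "e < m" for e
  proof (cases "e < se e")
    case True
    then show ?thesis using rep_j that by (simp add: d_def)
  next
    case False
    then show ?thesis using rep_j[of "se e"] se[OF that] f[OF that] by (auto simp: d_def)
  qed
  have fin: "finite B" by (simp add: B_def)
  have inj: "inj_on se B" by (intro inj_onI) (metis B se)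
  have "2 * (\<Sum>e\<in>{0..<m}. g e * bd tl hd e v) - (\<Sum>e\<in>{0..<m}. f e * bd tl hd e v) =
    (\<Sum>e\<in>{0..<m}. d e * bd tl hd e v)"
    by (simp add: d_def sum_distrib_left flip: sum_subtractf) (simp add: algebra_simps)
  also have "\<dots> = (\<Sum>e\<in>B \<union> se ` B. d e * bd tl hd e v)"
  proof (rule sum.mono_neutral_right)
    show "B \<union> se ` B \<subseteq> {0..<m}" using se by (auto simp: B)
    show "\<forall>e\<in>{0..<m} - (B \<union> se ` B). d e * bd tl hd e v = 0"
    proof
      fix e assume e: "e \<in> {0..<m} - (B \<union> se ` B)"
      then have "se e \<notin> B" using se[of e] by (metis DiffE UnI2 atLeastLessThan_iff image_eqI)
      then show "d e * bd tl hd e v = 0" using e d[of e] x(2) by auto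
    qed
  qed simp
  also have "\<dots> = (\<Sum>e\<in>B. d e * bd tl hd e v) + (\<Sum>e\<in>se ` B. d e * bd tl hd e v)"
  proof (rule sum.union_disjoint)
    have "se i \<notin> B" if "i \<in> B" for i using that se[of i] B[of i] B[of "se i"] by auto
    then show "B \<inter> se ` B = {}" by blast
  qed (simp_all add: fin)
  also have "(\<Sum>e\<in>se ` B. d e * bd tl hd e v) = (\<Sum>e\<in>B. d (se e) * bd tl hd (se e) v)"
    by (rule sum.reindex_cong[OF inj]) auto
  also have "(\<Sum>e\<in>B. d e * bd tl hd e v) + (\<Sum>e\<in>B. d (se e) * bd tl hd (se e) v) =
    (\<Sum>e\<in>B. x e * bd (\<lambda>i. rep sv (tl i)) (\<lambda>i. rep sv (hd i)) e (rep sv v))"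
    unfolding sum.distrib[symmetric]
  proof (rule sum.cong[OF refl])
    fix e assume "e \<in> B"
    then have e: "0 \<le> e" "e < m" "e < se e" by (auto simp: B)
    have "d e = x e" "d (se e) = - x e" using d[of e] d[of "se e"] se[of e] e by auto
    moreover have "bd tl hd e v - bd tl hd (se e) v =
      bd (\<lambda>i. rep sv (tl i)) (\<lambda>i. rep sv (hd i)) e (rep sv v)"
    proof -
      \<comment> \<open>\<open>t = v\<close> and \<open>sv t = v\<close> exclude each other since no
        vertex is fixed, so the indicator of the orbit is the sum of two indicators.\<close>
      have r: "of_bool (rep sv t = rep sv v) = (of_bool (t = v) + of_bool (sv t = v) :: int)" if "0 \<le> t" "t < n" for t
      proof -
        have "rep sv t = rep sv v \<longleftrightarrow> t = v \<or> sv t = v"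
          using sv[OF v] sv[OF that] unfolding rep_def by (smt (verit))
        moreover have "\<not> (t = v \<and> sv t = v)" using sv[OF that] by auto
        ultimately show ?thesis by auto
      qed
      show ?thesis using se[OF e(1,2)] r[of "tl e"] r[of "hd e"] by (simp add: bd_def)
    qed
    ultimately show "d e * bd tl hd e v + d (se e) * bd tl hd (se e) v =
      x e * bd (\<lambda>i. rep sv (tl i)) (\<lambda>i. rep sv (hd i)) e (rep sv v)"
      by (metis (no_types, lifting) right_diff_distrib mult_minus_left diff_conv_add_uminus)
  qed
  finally show "\<bar>2 * (\<Sum>e\<in>{0..<m}. g e * bd tl hd e v) - (\<Sum>e\<in>{0..<m}. f e * bd tl hd e v)\<bar> \<le> 1"
    using bal by simp
qed

section \<open>A network with shortcuts\<close>

text \<open>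
  Nodes \<open>0, \<dots>, M - 1\<close> of the data structure are the given arcs, node \<open>M\<close> collects
  flow around closed walks, and the nodes \<open>p\<close> with \<open>M < p \<le> cnt\<close> are the arcs of a
  network without parallel arcs.
\<close>

definition ndeg :: "int \<Rightarrow> int \<Rightarrow> (int \<Rightarrow> int) \<Rightarrow> (int \<Rightarrow> int) \<Rightarrow> (int \<Rightarrow> int) \<Rightarrow> int \<Rightarrow> int" where
  "ndeg M cnt src dst cap v =
     (\<Sum>p\<in>{M<..cnt}. of_bool (0 < cap p) * (of_bool (src p = v) + of_bool (dst p = v)))"

definition nlive :: "int \<Rightarrow> int \<Rightarrow> (int \<Rightarrow> int) \<Rightarrow> int" where
  "nlive M cnt cap = (\<Sum>p\<in>{M<..cnt}. of_bool (0 < cap p))"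

text \<open>Linked lists of the nodes with the same \<open>src\<close>, newest first; a value \<open>\<le> M\<close> ends a list.\<close>

definition chain :: "int \<Rightarrow> int \<Rightarrow> (int \<Rightarrow> int) \<Rightarrow> (int \<Rightarrow> int) \<Rightarrow> (int \<Rightarrow> int) \<Rightarrow> bool" where
  "chain M cnt src hp nx \<longleftrightarrow>
     (\<forall>u. 0 \<le> hp u \<and> hp u \<le> cnt \<and> (M < hp u \<longrightarrow> src (hp u) = u) \<and>
        (\<forall>p. M < p \<and> p \<le> cnt \<and> hp u < p \<longrightarrow> src p \<noteq> u)) \<and>
     (\<forall>p. M < p \<and> p \<le> cnt \<longrightarrow> 0 \<le> nx p \<and> nx p < p \<and> (M < nx p \<longrightarrow> src (nx p) = src p) \<and>
        (\<forall>p'. M < p' \<and> nx p < p' \<and> p' < p \<longrightarrow> src p' \<noteq> src p))"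

text \<open>Adjacency matrix in a zero-initialised array. The value 0 can mean absence because
  network arcs have numbers above \<open>M\<close>, which \<open>shape_ok\<close> makes
  nonnegative.\<close>

definition mat_ok :: "int \<Rightarrow> int \<Rightarrow> int \<Rightarrow> (int \<Rightarrow> int) \<Rightarrow> (int \<Rightarrow> int) \<Rightarrow> (int \<Rightarrow> int) \<Rightarrow> bool" where
  "mat_ok M N cnt src dst mat \<longleftrightarrow>
     (\<forall>u w. 0 \<le> u \<and> u < N \<and> 0 \<le> w \<and> w < N \<and> mat (u * N + w) \<noteq> 0 \<longrightarrow>
        M < mat (u * N + w) \<and> mat (u * N + w) \<le> cnt \<and> src (mat (u * N + w)) = u \<and> dst (mat (u * N + w)) = w) \<and>
     (\<forall>p. M < p \<and> p \<le> cnt \<longrightarrow> 0 \<le> src p \<and> src p < N \<and> 0 \<le> dst p \<and> dst p < N \<and> mat (src p * N + dst p) = p)"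

text \<open>Vertices below \<open>n\<close> are ordinary, the next \<open>k\<close> are super
  sources and the last \<open>k\<close> super sinks; no arc enters a source or leaves a sink.
  \<open>row\<close> tabulates the multiples of the row length, as the machine cannot
  multiply.\<close>

definition shape_ok where
  "shape_ok n k M cnt src dst ohd onx ihd inx mat row \<longleftrightarrow>
     0 \<le> n \<and> 0 \<le> k \<and> 0 \<le> M \<and> M \<le> cnt \<and> chain M cnt src ohd onx \<and> chain M cnt dst ihd inx \<and>
     mat_ok M (n + 2 * k) cnt src dst mat \<and> (\<forall>u. 0 \<le> u \<and> u < n + 2 * k \<longrightarrow> row u = u * (n + 2 * k)) \<and>
     (\<forall>p. M < p \<and> p \<le> cnt \<longrightarrow> src p < n + k \<and> (dst p < n \<or> n + k \<le> dst p) \<and> src p \<noteq> dst p)"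

text \<open>Zero capacities above \<open>cnt\<close> mean that a newly allocated arc is empty
  without being initialised.\<close>

definition caps_ok :: "int \<Rightarrow> int \<Rightarrow> (int \<Rightarrow> int) \<Rightarrow> (int \<Rightarrow> int) \<Rightarrow> (int \<Rightarrow> int) \<Rightarrow> (int \<Rightarrow> int) \<Rightarrow> bool" where
  "caps_ok M cnt src dst deg cap \<longleftrightarrow>
     (\<forall>p. 0 \<le> cap p) \<and> (\<forall>p. cnt < p \<longrightarrow> cap p = 0) \<and> deg = ndeg M cnt src dst cap"

abbreviation "shape_st n k M st \<equiv>
  shape_ok n k M (vr st ''cnt'') (ar st ''tail'') (ar st ''head'') (ar st ''ohd'') (ar st ''onx'')
    (ar st ''ihd'') (ar st ''inx'') (ar st ''mat'') (ar st ''row'')"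

abbreviation "caps_st M st \<equiv>
  caps_ok M (vr st ''cnt'') (ar st ''tail'') (ar st ''head'') (ar st ''deg'') (ar st ''g'')"

section \<open>Updates of lists, matrix, degrees and capacities\<close>

lemma chain_insert:
  assumes "chain M cnt src hp nx" "M \<le> cnt" "0 \<le> M"
  shows "chain M (cnt + 1) (src(cnt + 1 := u)) (hp(u := cnt + 1)) (nx(cnt + 1 := hp u))"
proof -
  have h: "0 \<le> hp z" "hp z \<le> cnt" "M < hp z \<Longrightarrow> src (hp z) = z"
    "\<And>p. M < p \<Longrightarrow> p \<le> cnt \<Longrightarrow> hp z < p \<Longrightarrow> src p \<noteq> z" for z
    using assms(1) unfolding chain_def by blast+
  have x: "0 \<le> nx p" "nx p < p" "M < nx p \<Longrightarrow> src (nx p) = src p"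
    "\<And>p'. M < p' \<Longrightarrow> nx p < p' \<Longrightarrow> p' < p \<Longrightarrow> src p' \<noteq> src p" if "M < p" "p \<le> cnt" for p
    using assms(1) that unfolding chain_def by blast+
  have "0 \<le> (hp(u := cnt + 1)) z" "(hp(u := cnt + 1)) z \<le> cnt + 1"
    "M < (hp(u := cnt + 1)) z \<Longrightarrow> (src(cnt + 1 := u)) ((hp(u := cnt + 1)) z) = z"
    "\<And>p. M < p \<Longrightarrow> p \<le> cnt + 1 \<Longrightarrow> (hp(u := cnt + 1)) z < p \<Longrightarrow> (src(cnt + 1 := u)) p \<noteq> z" for z
    using h(1-3)[of z] h(4)[of _ z] assms(2,3) by (auto split: if_splits)
  moreover have "0 \<le> (nx(cnt + 1 := hp u)) p" "(nx(cnt + 1 := hp u)) p < p"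
    "M < (nx(cnt + 1 := hp u)) p \<Longrightarrow> (src(cnt + 1 := u)) ((nx(cnt + 1 := hp u)) p) = (src(cnt + 1 := u)) p"
    "\<And>p'. M < p' \<Longrightarrow> (nx(cnt + 1 := hp u)) p < p' \<Longrightarrow> p' < p \<Longrightarrow> (src(cnt + 1 := u)) p' \<noteq> (src(cnt + 1 := u)) p"
    if "M < p" "p \<le> cnt + 1" for p
    using h(1-3)[of u] h(4)[of _ u] x[of p] that by (cases "p = cnt + 1"; force)+
  ultimately show ?thesis unfolding chain_def by blast
qed

text \<open>Row and column are quotient and remainder of the cell number.\<close>

lemma cell_inject:
  fixes u w u' w' N :: int
  assumes "u * N + w = u' * N + w'" "0 \<le> w" "w < N" "0 \<le> w'" "w' < N"
  shows "u = u' \<and> w = w'"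
proof -
  have "(u * N + w) div N = u" "(u' * N + w') div N = u'"
    using assms int_div_pos_eq[of "u * N + w" N u w] int_div_pos_eq[of "u' * N + w'" N u' w']
    by (auto simp: mult.commute)
  then show ?thesis using assms(1) by auto
qed

lemma mat_insert:
  assumes ok: "mat_ok M N cnt src dst mat" and "M \<le> cnt" "0 \<le> M"
    and uw: "0 \<le> u" "u < N" "0 \<le> w" "w < N" and new: "mat (u * N + w) = 0"
  shows "mat_ok M N (cnt + 1) (src(cnt + 1 := u)) (dst(cnt + 1 := w)) (mat(u * N + w := cnt + 1))"
proof -
  have 1: "M < mat (a * N + b) \<and> mat (a * N + b) \<le> cnt \<and> src (mat (a * N + b)) = a \<and> dst (mat (a * N + b)) = b"
    if "0 \<le> a" "a < N" "0 \<le> b" "b < N" "mat (a * N + b) \<noteq> 0" for a b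
    using ok that unfolding mat_ok_def by blast
  have 2: "0 \<le> src p \<and> src p < N \<and> 0 \<le> dst p \<and> dst p < N \<and> mat (src p * N + dst p) = p"
    if "M < p" "p \<le> cnt" for p
    using ok that unfolding mat_ok_def by blast
  have 3: "src p * N + dst p \<noteq> u * N + w" if "M < p" "p \<le> cnt" for p
    using 2[OF that] new that assms(3) by auto
  show ?thesis
    unfolding mat_ok_def
  proof (rule conjI; intro allI impI; elim conjE)
    fix a b assume ab: "0 \<le> a" "a < N" "0 \<le> b" "b < N" "(mat(u * N + w := cnt + 1)) (a * N + b) \<noteq> 0"
    show "M < (mat(u * N + w := cnt + 1)) (a * N + b) \<and> (mat(u * N + w := cnt + 1)) (a * N + b) \<le> cnt + 1 \<and>
      (src(cnt + 1 := u)) ((mat(u * N + w := cnt + 1)) (a * N + b)) = a \<and>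
      (dst(cnt + 1 := w)) ((mat(u * N + w := cnt + 1)) (a * N + b)) = b"
    proof (cases "a * N + b = u * N + w")
      case True
      then show ?thesis using cell_inject[OF True] ab uw assms by auto
    next
      case False
      then show ?thesis using 1[OF ab(1-4)] ab(5) by auto
    qed
  next
    fix p assume "M < p" "p \<le> cnt + 1"
    then show "0 \<le> (src(cnt + 1 := u)) p \<and> (src(cnt + 1 := u)) p < N \<and> 0 \<le> (dst(cnt + 1 := w)) p \<and>
      (dst(cnt + 1 := w)) p < N \<and>
      (mat(u * N + w := cnt + 1)) ((src(cnt + 1 := u)) p * N + (dst(cnt + 1 := w)) p) = p"
      using 2[of p] 3[of p] uw by (cases "p = cnt + 1") auto
  qed
qed

lemma shape_insert:
  assumes "shape_ok n k M cnt src dst ohd onx ihd inx mat row"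
    and "0 \<le> u" "u < n + k" "0 \<le> w" "w < n + 2 * k" "w < n \<or> n + k \<le> w" "u \<noteq> w"
    and "mat (u * (n + 2 * k) + w) = 0"
  shows "shape_ok n k M (cnt + 1) (src(cnt + 1 := u)) (dst(cnt + 1 := w)) (ohd(u := cnt + 1)) (onx(cnt + 1 := ohd u))
    (ihd(w := cnt + 1)) (inx(cnt + 1 := ihd w)) (mat(u * (n + 2 * k) + w := cnt + 1)) row"
  using assms unfolding shape_ok_def by (auto intro!: chain_insert mat_insert)

lemma sum_upto_Suc:
  fixes F :: "int \<Rightarrow> int"
  assumes "M \<le> cnt"
  shows "(\<Sum>p\<in>{M<..cnt + 1}. F p) = (\<Sum>p\<in>{M<..cnt}. F p) + F (cnt + 1)"
proof -
  have "{M<..cnt + 1} = insert (cnt + 1) {M<..cnt}" using assms by auto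
  then show ?thesis by simp
qed

lemma ndeg_extend:
  assumes "M \<le> cnt" "cap (cnt + 1) = 0"
  shows "ndeg M (cnt + 1) (src(cnt + 1 := u)) (dst(cnt + 1 := w)) cap = ndeg M cnt src dst cap"
proof
  fix v
  have "(\<Sum>p\<in>{M<..cnt}. of_bool (0 < cap p) * (of_bool ((src(cnt + 1 := u)) p = v) + of_bool ((dst(cnt + 1 := w)) p = v)))
    = (\<Sum>p\<in>{M<..cnt}. of_bool (0 < cap p) * (of_bool (src p = v) + of_bool (dst p = v)) :: int)"
    by (rule sum.cong) auto
  then show "ndeg M (cnt + 1) (src(cnt + 1 := u)) (dst(cnt + 1 := w)) cap v = ndeg M cnt src dst cap v"
    unfolding ndeg_def sum_upto_Suc[OF assms(1)] using assms(2) by simp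
qed

lemma nlive_extend: "M \<le> cnt \<Longrightarrow> cap (cnt + 1) = 0 \<Longrightarrow> nlive M (cnt + 1) cap = nlive M cnt cap"
  unfolding nlive_def sum_upto_Suc by simp

lemma caps_insert:
  assumes "caps_ok M cnt src dst deg cap" "M \<le> cnt"
  shows "caps_ok M (cnt + 1) (src(cnt + 1 := u)) (dst(cnt + 1 := w)) deg cap"
  using assms ndeg_extend[OF assms(2), of cap] by (simp add: caps_ok_def)

lemma sum_change_one:
  fixes F G :: "int \<Rightarrow> int"
  assumes "finite A" "r \<in> A" "\<And>p. p \<in> A \<Longrightarrow> p \<noteq> r \<Longrightarrow> F p = G p"
  shows "sum F A = sum G A + F r - G r"
  using assms by (simp add: sum.remove)

lemma caps_set:
  assumes "caps_ok M cnt src dst deg cap" and r: "M < r" "r \<le> cnt" and "0 \<le> y"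
    and deg': "\<And>z. deg' z = deg z + (of_bool (0 < y) - of_bool (0 < cap r)) * (of_bool (src r = z) + of_bool (dst r = z))"
  shows "caps_ok M cnt src dst deg' (cap(r := y))"
proof -
  have "ndeg M cnt src dst (cap(r := y)) z = ndeg M cnt src dst cap z +
      (of_bool (0 < y) - of_bool (0 < cap r)) * (of_bool (src r = z) + of_bool (dst r = z))" for z
    unfolding ndeg_def
    by (subst sum_change_one[where r = r and G = "\<lambda>p. of_bool (0 < cap p) * (of_bool (src p = z) + of_bool (dst p = z))"])
      (use r in \<open>auto simp: algebra_simps\<close>)
  then show ?thesis using assms by (auto simp: caps_ok_def)
qed

lemma nlive_set:
  assumes "M < r" "r \<le> cnt"
  shows "nlive M cnt (cap(r := y)) = nlive M cnt cap + (of_bool (0 < y) - of_bool (0 < cap r))"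
  unfolding nlive_def
  by (subst sum_change_one[where r = r and G = "\<lambda>p. of_bool (0 < cap p)"]) (use assms in auto)

lemma caps_set_raw:
  assumes "caps_ok M cnt src dst deg cap" "r \<le> M" "M \<le> cnt" "0 \<le> y"
  shows "caps_ok M cnt src dst deg (cap(r := y))"
proof -
  have "ndeg M cnt src dst (cap(r := y)) = ndeg M cnt src dst cap"
    unfolding ndeg_def using assms(2) by (intro ext sum.cong) auto
  then show ?thesis using assms by (auto simp: caps_ok_def)
qed

lemma nlive_set_raw: "r \<le> M \<Longrightarrow> nlive M cnt (cap(r := y)) = nlive M cnt cap"
  unfolding nlive_def by (intro sum.cong) auto

text \<open>Arcs are never deleted from the matrix or the lists: an emptied arc keeps its cell with
  capacity 0 and can be refilled. A call therefore creates at most one cell, on which the accounting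
  of list scans relies.\<close>

definition find_arc :: com where
  "find_arc =
     (''r'' ::= Ar ''mat'' (Plus (Ar ''row'' (Vr ''u'')) (Vr ''w''));;
      If (Equal (Vr ''r'') (Const 0))
       (''cnt'' ::= Plus (Vr ''cnt'') (Const 1);; ''r'' ::= Vr ''cnt'';;
        ''mat''\<lbrakk>Plus (Ar ''row'' (Vr ''u'')) (Vr ''w'')\<rbrakk> ::= Vr ''r'';;
        ''tail''\<lbrakk>Vr ''r''\<rbrakk> ::= Vr ''u'';; ''head''\<lbrakk>Vr ''r''\<rbrakk> ::= Vr ''w'';;
        ''onx''\<lbrakk>Vr ''r''\<rbrakk> ::= Ar ''ohd'' (Vr ''u'');; ''ohd''\<lbrakk>Vr ''u''\<rbrakk> ::= Vr ''r'';;
        ''inx''\<lbrakk>Vr ''r''\<rbrakk> ::= Ar ''ihd'' (Vr ''w'');; ''ihd''\<lbrakk>Vr ''w''\<rbrakk> ::= Vr ''r'') Skip)"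

definition add_cap :: com where
  "add_cap =
     (If (And (Less (Const 0) (Vr ''x'')) (Equal (Ar ''g'' (Vr ''r'')) (Const 0)))
       (''deg''\<lbrakk>Vr ''u''\<rbrakk> ::= Plus (Ar ''deg'' (Vr ''u'')) (Const 1);;
        ''deg''\<lbrakk>Vr ''w''\<rbrakk> ::= Plus (Ar ''deg'' (Vr ''w'')) (Const 1)) Skip;;
      ''g''\<lbrakk>Vr ''r''\<rbrakk> ::= Plus (Ar ''g'' (Vr ''r'')) (Vr ''x''))"

definition lower :: "string \<Rightarrow> com" where
  "lower p =
     (''g''\<lbrakk>Vr p\<rbrakk> ::= Minus (Ar ''g'' (Vr p)) (Vr ''x'');;
      If (Equal (Ar ''g'' (Vr p)) (Const 0))
       (''deg''\<lbrakk>Ar ''tail'' (Vr p)\<rbrakk> ::= Minus (Ar ''deg'' (Ar ''tail'' (Vr p))) (Const 1);;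
        ''deg''\<lbrakk>Ar ''head'' (Vr p)\<rbrakk> ::= Minus (Ar ''deg'' (Ar ''head'' (Vr p))) (Const 1)) Skip)"

definition log_op :: com where
  "log_op =
     (''L'' ::= Plus (Vr ''L'') (Const 1);; ''lp''\<lbrakk>Vr ''L''\<rbrakk> ::= Vr ''p'';; ''lq''\<lbrakk>Vr ''L''\<rbrakk> ::= Vr ''q'';;
      ''lr''\<lbrakk>Vr ''L''\<rbrakk> ::= Vr ''r'';; ''lx''\<lbrakk>Vr ''L''\<rbrakk> ::= Vr ''x'')"

lemma wp_find_arc:
  assumes sh: "shape_st n k M st" and cp: "caps_st M st"
    and uw: "0 \<le> vr st ''u''" "vr st ''u'' < n + k" "0 \<le> vr st ''w''" "vr st ''w'' < n + 2 * k"
      "vr st ''w'' < n \<or> n + k \<le> vr st ''w''" "vr st ''u'' \<noteq> vr st ''w''"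
  shows "wp find_arc (\<lambda>t st'. shape_st n k M st' \<and> caps_st M st' \<and> t \<le> 60 \<and>
     M < vr st' ''r'' \<and> vr st' ''r'' \<le> vr st' ''cnt'' \<and>
     ar st' ''tail'' (vr st' ''r'') = vr st ''u'' \<and> ar st' ''head'' (vr st' ''r'') = vr st ''w'' \<and>
     vr st ''cnt'' \<le> vr st' ''cnt'' \<and> vr st' ''cnt'' \<le> vr st ''cnt'' + 1 \<and>
     (vr st ''cnt'' < vr st' ''cnt'' \<longrightarrow> vr st' ''r'' = vr st' ''cnt'') \<and>
     (\<forall>p. p \<le> vr st ''cnt'' \<longrightarrow> ar st' ''tail'' p = ar st ''tail'' p \<and> ar st' ''head'' p = ar st ''head'' p) \<and>
     nlive M (vr st' ''cnt'') (ar st' ''g'') = nlive M (vr st ''cnt'') (ar st ''g'')) st"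
proof -
  let ?u = "vr st ''u''" and ?w = "vr st ''w''" and ?N = "n + 2 * k" and ?cnt = "vr st ''cnt''"
  have row: "ar st ''row'' ?u = ?u * ?N" using sh uw by (auto simp: shape_ok_def)
  have M: "M \<le> ?cnt" "0 \<le> M" using sh by (auto simp: shape_ok_def)
  show ?thesis
  proof (cases "ar st ''mat'' (?u * ?N + ?w) = 0")
    case True
    have "ar st ''g'' (?cnt + 1) = 0" using cp by (simp add: caps_ok_def)
    then show ?thesis
      using shape_insert[OF sh uw True] caps_insert[OF cp M(1), of ?u ?w] M True row
        nlive_extend[OF M(1), of "ar st ''g''"]
      by (simp add: find_arc_def)
  next
    case False
    have "mat_ok M ?N ?cnt (ar st ''tail'') (ar st ''head'') (ar st ''mat'')"
      using sh by (simp add: shape_ok_def)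
    moreover have "?u < ?N" using uw(2) sh by (simp add: shape_ok_def)
    ultimately have "M < ar st ''mat'' (?u * ?N + ?w) \<and> ar st ''mat'' (?u * ?N + ?w) \<le> ?cnt \<and>
      ar st ''tail'' (ar st ''mat'' (?u * ?N + ?w)) = ?u \<and> ar st ''head'' (ar st ''mat'' (?u * ?N + ?w)) = ?w"
      using False uw(1,3,4) unfolding mat_ok_def by blast
    then show ?thesis using False row sh cp by (simp add: find_arc_def)
  qed
qed

lemma wp_add_cap:
  fixes st :: store
  defines "\<delta> \<equiv> of_bool (0 < ar st ''g'' (vr st ''r'') + vr st ''x'') - of_bool (0 < ar st ''g'' (vr st ''r'')) :: int"
  assumes cp: "caps_st M st" and r: "M < vr st ''r''" "vr st ''r'' \<le> vr st ''cnt''"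
    and uw: "ar st ''tail'' (vr st ''r'') = vr st ''u''" "ar st ''head'' (vr st ''r'') = vr st ''w''"
      "vr st ''u'' \<noteq> vr st ''w''"
    and x: "0 \<le> vr st ''x''"
  shows "wp add_cap (\<lambda>t st'. caps_st M st' \<and> t \<le> 40 \<and>
     ar st' ''g'' = (ar st ''g'')(vr st ''r'' := ar st ''g'' (vr st ''r'') + vr st ''x'') \<and>
     (\<forall>z. ar st' ''deg'' z = ar st ''deg'' z + \<delta> * (of_bool (vr st ''u'' = z) + of_bool (vr st ''w'' = z))) \<and>
     nlive M (vr st' ''cnt'') (ar st' ''g'') = nlive M (vr st ''cnt'') (ar st ''g'') + \<delta>) st"
proof -
  have nn: "0 \<le> ar st ''g'' (vr st ''r'')" using cp by (simp add: caps_ok_def)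
  note ok = caps_set[OF cp r, of "ar st ''g'' (vr st ''r'') + vr st ''x''", unfolded uw]
  show ?thesis
  proof (cases "0 < vr st ''x'' \<and> ar st ''g'' (vr st ''r'') = 0")
    case True
    then have "\<delta> = 1" by (simp add: \<delta>_def)
    then show ?thesis using ok True uw x nlive_set[OF r] by (auto simp: add_cap_def \<delta>_def)
  next
    case False
    then have "\<delta> = 0" using nn x by (auto simp: \<delta>_def)
    then show ?thesis using ok False uw x nn nlive_set[OF r] by (auto simp: add_cap_def \<delta>_def)
  qed
qed

lemma wp_lower:
  fixes st :: store and p :: string
  defines "\<delta> \<equiv> of_bool (ar st ''g'' (vr st p) = vr st ''x'') :: int"
  assumes cp: "caps_st M st" and r: "M < vr st p" "vr st p \<le> vr st ''cnt''"
    and x: "0 < vr st ''x''" "vr st ''x'' \<le> ar st ''g'' (vr st p)"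
    and ne: "ar st ''tail'' (vr st p) \<noteq> ar st ''head'' (vr st p)"
  shows "wp (lower p) (\<lambda>t st'. caps_st M st' \<and> t \<le> 40 \<and>
     ar st' ''g'' = (ar st ''g'')(vr st p := ar st ''g'' (vr st p) - vr st ''x'') \<and>
     (\<forall>z. ar st' ''deg'' z = ar st ''deg'' z -
        \<delta> * (of_bool (ar st ''tail'' (vr st p) = z) + of_bool (ar st ''head'' (vr st p) = z))) \<and>
     nlive M (vr st' ''cnt'') (ar st' ''g'') = nlive M (vr st ''cnt'') (ar st ''g'') - \<delta>) st"
proof -
  note ok = caps_set[OF cp r, of "ar st ''g'' (vr st p) - vr st ''x''"]
  show ?thesis
  proof (cases "ar st ''g'' (vr st p) = vr st ''x''")
    case True
    then show ?thesis using ok ne x nlive_set[OF r] by (auto simp: lower_def \<delta>_def)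
  next
    case False
    then show ?thesis using ok ne x nlive_set[OF r] by (auto simp: lower_def \<delta>_def)
  qed
qed

text \<open>
  Log entry \<open>l\<close> records that \<open>lx l\<close> units of flow were moved from the consecutive nodes
  \<open>lp l\<close> and \<open>lq l\<close> to \<open>lr l\<close>; \<open>capat j\<close> are the capacities after \<open>j\<close> moves.
\<close>

definition capat :: "(int \<Rightarrow> int) \<Rightarrow> (int \<Rightarrow> int) \<Rightarrow> (int \<Rightarrow> int) \<Rightarrow> (int \<Rightarrow> int) \<Rightarrow> (int \<Rightarrow> int) \<Rightarrow> int \<Rightarrow> int \<Rightarrow> int" where
  "capat c0 lp lq lr lx j p =
     c0 p + (\<Sum>l\<in>{0<..j}. lx l * (of_bool (lr l = p) - of_bool (lp l = p) - of_bool (lq l = p)))"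

definition log_ok where
  "log_ok c0 cnt src dst cap L lp lq lr lx \<longleftrightarrow>
     0 \<le> L \<and> cap = capat c0 lp lq lr lx L \<and> (\<forall>j p. 0 \<le> j \<and> j \<le> L \<longrightarrow> 0 \<le> capat c0 lp lq lr lx j p) \<and>
     (\<forall>l. 0 < l \<and> l \<le> L \<longrightarrow> lp l \<in> {0..cnt} \<and> lq l \<in> {0..cnt} \<and> lr l \<in> {0..cnt} \<and>
        lp l \<noteq> lr l \<and> lq l \<noteq> lr l \<and> lp l \<noteq> lq l \<and> 0 \<le> lx l \<and>
        (\<forall>v. bd src dst (lp l) v + bd src dst (lq l) v = bd src dst (lr l) v))"

abbreviation "log_st c0 st \<equiv>
  log_ok c0 (vr st ''cnt'') (ar st ''tail'') (ar st ''head'') (ar st ''g'') (vr st ''L'')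
    (ar st ''lp'') (ar st ''lq'') (ar st ''lr'') (ar st ''lx'')"

text \<open>Entry \<open>L + 1\<close> does not occur in the sums for \<open>j <= L\<close>, and
  older entries name only nodes up to \<open>cnt\<close>, whose ends are unchanged. So the log stays
  valid while the network grows.\<close>

lemma log_append:
  assumes ok: "log_ok c0 cnt src dst cap L lp lq lr lx"
    and cnt: "cnt \<le> cnt'" and agr: "\<And>p. p \<le> cnt \<Longrightarrow> src' p = src p \<and> dst' p = dst p"
    and pqr: "p \<in> {0..cnt}" "q \<in> {0..cnt}" "r \<in> {0..cnt'}" "p \<noteq> r" "q \<noteq> r" "p \<noteq> q" "0 \<le> x"
      "\<And>v. bd src' dst' p v + bd src' dst' q v = bd src' dst' r v"
    and cap': "\<And>z. cap' z = cap z + x * (of_bool (r = z) - of_bool (p = z) - of_bool (q = z))"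
    and nn: "\<And>z. 0 \<le> cap' z"
  shows "log_ok c0 cnt' src' dst' cap' (L + 1) (lp(L + 1 := p)) (lq(L + 1 := q)) (lr(L + 1 := r)) (lx(L + 1 := x))"
proof -
  let ?lp = "lp(L + 1 := p)" and ?lq = "lq(L + 1 := q)" and ?lr = "lr(L + 1 := r)" and ?lx = "lx(L + 1 := x)"
  have L: "0 \<le> L" using ok by (simp add: log_ok_def)
  have old: "capat c0 ?lp ?lq ?lr ?lx j z = capat c0 lp lq lr lx j z" if "j \<le> L" for j z
    unfolding capat_def using that by (intro arg_cong2[of _ _ _ _ "(+)"] sum.cong) auto
  have "capat c0 ?lp ?lq ?lr ?lx (L + 1) z = cap' z" for z
  proof -
    have "capat c0 ?lp ?lq ?lr ?lx (L + 1) z = capat c0 ?lp ?lq ?lr ?lx L z +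
      x * (of_bool (r = z) - of_bool (p = z) - of_bool (q = z))"
      unfolding capat_def sum_upto_Suc[OF L] by simp
    then show ?thesis using old[of L] ok cap' by (simp add: log_ok_def)
  qed
  then have new: "cap' = capat c0 ?lp ?lq ?lr ?lx (L + 1)" by auto
  have "0 \<le> capat c0 ?lp ?lq ?lr ?lx j z" if "0 \<le> j" "j \<le> L + 1" for j z
  proof (cases "j = L + 1")
    case True
    then show ?thesis using nn new by metis
  next
    case False
    then show ?thesis using that old[of j] ok by (simp add: log_ok_def)
  qed
  moreover have "?lp l \<in> {0..cnt'} \<and> ?lq l \<in> {0..cnt'} \<and> ?lr l \<in> {0..cnt'} \<and>
      ?lp l \<noteq> ?lr l \<and> ?lq l \<noteq> ?lr l \<and> ?lp l \<noteq> ?lq l \<and> 0 \<le> ?lx l \<and>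
      (\<forall>v. bd src' dst' (?lp l) v + bd src' dst' (?lq l) v = bd src' dst' (?lr l) v)"
    if l: "0 < l" "l \<le> L + 1" for l
  proof (cases "l = L + 1")
    case True
    then show ?thesis using pqr cnt by auto
  next
    case False
    then have "0 < l \<and> l \<le> L" using l by auto
    then have o: "lp l \<in> {0..cnt} \<and> lq l \<in> {0..cnt} \<and> lr l \<in> {0..cnt} \<and>
        lp l \<noteq> lr l \<and> lq l \<noteq> lr l \<and> lp l \<noteq> lq l \<and> 0 \<le> lx l \<and>
        (\<forall>v. bd src dst (lp l) v + bd src dst (lq l) v = bd src dst (lr l) v)"
      using ok unfolding log_ok_def by blast
    then have "bd src' dst' z v = bd src dst z v" if "z \<in> {lp l, lq l, lr l}" for z v
      using that agr[of z] by (auto simp: bd_def)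
    then show ?thesis using o False cnt by auto
  qed
  ultimately show ?thesis using L new unfolding log_ok_def by auto
qed

definition pick :: com where
  "pick =
     (''x'' ::= Ar ''g'' (Vr ''p'');; If (Less (Ar ''g'' (Vr ''q'')) (Vr ''x'')) (''x'' ::= Ar ''g'' (Vr ''q'')) Skip;;
      ''u'' ::= Ar ''tail'' (Vr ''p'');; ''w'' ::= Ar ''head'' (Vr ''q''))"

text \<open>If \<open>u = w\<close>, the two arcs form a closed walk. Network arcs must not be
  loops, so this flow is parked on \<open>M\<close>, whose incidence is zero.\<close>

definition link :: com where
  "link = If (Equal (Vr ''u'') (Vr ''w''))
      (''r'' ::= Vr ''M'';; ''g''\<lbrakk>Vr ''M''\<rbrakk> ::= Plus (Ar ''g'' (Vr ''M'')) (Vr ''x''))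
      (find_arc;; add_cap)"

definition shortcut :: com where
  "shortcut = (pick;; lower ''p'';; lower ''q'';; link;; log_op)"

text \<open>The effect of routing \<open>x\<close> units over the arc from \<open>u\<close> to \<open>w\<close>; \<open>c = 1\<close> if that arc becomes live.\<close>

definition link_post :: "int \<Rightarrow> int \<Rightarrow> int \<Rightarrow> store \<Rightarrow> int \<Rightarrow> store \<Rightarrow> bool" where
  "link_post n k M st c st' \<longleftrightarrow> c \<in> {0, 1} \<and> (vr st ''u'' = vr st ''w'' \<longrightarrow> c = 0) \<and>
     shape_st n k M st' \<and> caps_st M st' \<and>
     M \<le> vr st' ''r'' \<and> vr st' ''r'' \<le> vr st' ''cnt'' \<and>
     (vr st ''u'' = vr st ''w'' \<longrightarrow> vr st' ''r'' = M) \<and>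
     (vr st ''u'' \<noteq> vr st ''w'' \<longrightarrow> M < vr st' ''r'' \<and>
       ar st' ''tail'' (vr st' ''r'') = vr st ''u'' \<and> ar st' ''head'' (vr st' ''r'') = vr st ''w'') \<and>
     vr st ''cnt'' \<le> vr st' ''cnt'' \<and> vr st' ''cnt'' \<le> vr st ''cnt'' + 1 \<and>
     (vr st ''cnt'' < vr st' ''cnt'' \<longrightarrow> vr st' ''r'' = vr st' ''cnt'') \<and>
     (\<forall>p. p \<le> vr st ''cnt'' \<longrightarrow> ar st' ''tail'' p = ar st ''tail'' p \<and> ar st' ''head'' p = ar st ''head'' p) \<and>
     ar st' ''g'' = (ar st ''g'')(vr st' ''r'' := ar st ''g'' (vr st' ''r'') + vr st ''x'') \<and>
     (\<forall>z. ar st' ''deg'' z = ar st ''deg'' z + c * (of_bool (vr st ''u'' = z) + of_bool (vr st ''w'' = z))) \<and>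
     nlive M (vr st' ''cnt'') (ar st' ''g'') = nlive M (vr st ''cnt'') (ar st ''g'') + c"

lemma wp_new_link:
  assumes sh: "shape_st n k M st" and cp: "caps_st M st"
    and uw: "0 \<le> vr st ''u''" "vr st ''u'' < n + k" "0 \<le> vr st ''w''" "vr st ''w'' < n + 2 * k"
      "vr st ''w'' < n \<or> n + k \<le> vr st ''w''" and ne: "vr st ''u'' \<noteq> vr st ''w''"
    and x: "0 \<le> vr st ''x''"
  shows "wp (find_arc;; add_cap) (\<lambda>t st'. (\<exists>c. link_post n k M st c st') \<and> t \<le> 110) st"
proof (rule wp_SeqI[OF wp_find_arc[OF sh cp uw ne]], elim conjE)
  fix t :: nat and st1
  assume ag: "agree find_arc st st1" and sh1: "shape_st n k M st1" and cp1: "caps_st M st1" and t: "t \<le> 60"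
    and r: "M < vr st1 ''r''" "vr st1 ''r'' \<le> vr st1 ''cnt''"
      "ar st1 ''tail'' (vr st1 ''r'') = vr st ''u''" "ar st1 ''head'' (vr st1 ''r'') = vr st ''w''"
    and cnt: "vr st ''cnt'' \<le> vr st1 ''cnt''" "vr st1 ''cnt'' \<le> vr st ''cnt'' + 1"
      "vr st ''cnt'' < vr st1 ''cnt'' \<longrightarrow> vr st1 ''r'' = vr st1 ''cnt''"
    and th: "\<forall>p. p \<le> vr st ''cnt'' \<longrightarrow> ar st1 ''tail'' p = ar st ''tail'' p \<and> ar st1 ''head'' p = ar st ''head'' p"
    and live: "nlive M (vr st1 ''cnt'') (ar st1 ''g'') = nlive M (vr st ''cnt'') (ar st ''g'')"
  have fr: "vr st1 ''u'' = vr st ''u''" "vr st1 ''w'' = vr st ''w''" "vr st1 ''x'' = vr st ''x''"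
    "ar st1 ''g'' = ar st ''g''" "ar st1 ''deg'' = ar st ''deg''"
    using ag[THEN agree_var] ag[THEN agree_arr] by (simp_all add: find_arc_def)
  define c :: int where
    "c = of_bool (0 < ar st1 ''g'' (vr st1 ''r'') + vr st1 ''x'') - of_bool (0 < ar st1 ''g'' (vr st1 ''r''))"
  have c: "c \<in> {0, 1}" using x fr by (auto simp: c_def)
  have "wp add_cap (\<lambda>t st'. caps_st M st' \<and> t \<le> 40 \<and>
         ar st' ''g'' = (ar st1 ''g'')(vr st1 ''r'' := ar st1 ''g'' (vr st1 ''r'') + vr st1 ''x'') \<and>
         (\<forall>z. ar st' ''deg'' z = ar st1 ''deg'' z + c * (of_bool (vr st1 ''u'' = z) + of_bool (vr st1 ''w'' = z))) \<and>
         nlive M (vr st' ''cnt'') (ar st' ''g'') = nlive M (vr st1 ''cnt'') (ar st1 ''g'') + c) st1"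
    unfolding c_def using r fr ne x by (intro wp_add_cap[OF cp1 r(1,2)]) auto
  then show "wp add_cap (\<lambda>u st'. (\<exists>c. link_post n k M st c st') \<and> t + u \<le> 110) st1"
  proof (rule wp_conseq_agree, elim conjE)
    fix u :: nat and st'
    assume ag2: "agree add_cap st1 st'" and *: "caps_st M st'" "u \<le> 40"
       "ar st' ''g'' = (ar st1 ''g'')(vr st1 ''r'' := ar st1 ''g'' (vr st1 ''r'') + vr st1 ''x'')"
       "\<forall>z. ar st' ''deg'' z = ar st1 ''deg'' z + c * (of_bool (vr st1 ''u'' = z) + of_bool (vr st1 ''w'' = z))"
       "nlive M (vr st' ''cnt'') (ar st' ''g'') = nlive M (vr st1 ''cnt'') (ar st1 ''g'') + c"
    have fr2: "var st' = var st1" using ag2[THEN agree_var] by (auto simp: add_cap_def)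
    have fr3: "ar st' ''tail'' = ar st1 ''tail''" "ar st' ''head'' = ar st1 ''head''" "ar st' ''ohd'' = ar st1 ''ohd''"
      "ar st' ''onx'' = ar st1 ''onx''" "ar st' ''ihd'' = ar st1 ''ihd''" "ar st' ''inx'' = ar st1 ''inx''"
      "ar st' ''mat'' = ar st1 ''mat''" "ar st' ''row'' = ar st1 ''row''"
      using ag2[THEN agree_arr] by (auto simp: add_cap_def)
    have "shape_st n k M st'" using sh1 unfolding fr2 fr3 .
    then have "link_post n k M st c st'"
      unfolding link_post_def using *(1,4,5) c ne r cnt th live
      by (simp add: fr fr2 fr3 *(3) del: fun_upd_apply)
    then show "(\<exists>c. link_post n k M st c st') \<and> t + u \<le> 110" using t *(2) by auto
  qed
qed

lemma wp_link:
  assumes sh: "shape_st n k M st" and cp: "caps_st M st" and M: "vr st ''M'' = M"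
    and uw: "0 \<le> vr st ''u''" "vr st ''u'' < n + k" "0 \<le> vr st ''w''" "vr st ''w'' < n + 2 * k"
      "vr st ''w'' < n \<or> n + k \<le> vr st ''w''"
    and x: "0 \<le> vr st ''x''"
  shows "wp link (\<lambda>t st'. (\<exists>c. link_post n k M st c st') \<and> t \<le> 120) st"
proof (cases "vr st ''u'' = vr st ''w''")
  case True
  have "M \<le> vr st ''cnt''" using sh by (simp add: shape_ok_def)
  moreover have "0 \<le> ar st ''g'' M" using cp by (simp add: caps_ok_def)
  ultimately show ?thesis
    using True sh x M caps_set_raw[OF cp order_refl, of "ar st ''g'' M + vr st ''x''"]
      nlive_set_raw[of M M "vr st ''cnt''" "ar st ''g''"]
    by (auto simp: link_def link_post_def intro!: exI[of _ 0])
next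
  case False
  then show ?thesis
    using wp_new_link[OF sh cp uw False x] unfolding link_def by (auto elim!: wp_conseq)
qed

lemma ndeg_pos:
  assumes "M < p" "p \<le> cnt" "0 < cap p" "src p = v \<or> dst p = v"
  shows "0 < ndeg M cnt src dst cap v"
proof -
  have "0 < of_bool (0 < cap p) * (of_bool (src p = v) + of_bool (dst p = v) :: int)" using assms by auto
  also have "\<dots> \<le> ndeg M cnt src dst cap v"
    unfolding ndeg_def using assms by (intro member_le_sum) auto
  finally show ?thesis .
qed

text \<open>A move at \<open>v\<close> along \<open>u \<rightarrow> v \<rightarrow> w\<close>; \<open>zp\<close> and \<open>zq\<close> tell whether the two arcs were saturated.\<close>

definition cut_post where
  "cut_post n k M c0 v st st' \<longleftrightarrow> shape_st n k M st' \<and> caps_st M st' \<and> log_st c0 st' \<and>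
     vr st ''cnt'' \<le> vr st' ''cnt'' \<and> vr st' ''cnt'' \<le> vr st ''cnt'' + 1 \<and> vr st' ''L'' = vr st ''L'' + 1 \<and>
     (\<forall>p. p \<le> vr st ''cnt'' \<longrightarrow> ar st' ''tail'' p = ar st ''tail'' p \<and> ar st' ''head'' p = ar st ''head'' p) \<and>
     (vr st ''cnt'' < vr st' ''cnt'' \<longrightarrow> ar st' ''tail'' (vr st' ''cnt'') \<noteq> v \<and> ar st' ''head'' (vr st' ''cnt'') \<noteq> v) \<and>
     (\<forall>z<M. ar st' ''g'' z = ar st ''g'' z) \<and>
     (\<forall>z. M < z \<and> z \<le> vr st ''cnt'' \<and> (ar st ''tail'' z = v \<or> ar st ''head'' z = v) \<and>
        z \<noteq> vr st ''p'' \<and> z \<noteq> vr st ''q'' \<longrightarrow> ar st' ''g'' z = ar st ''g'' z) \<and>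
     (\<exists>u w zp zq c. zp \<in> {0, 1} \<and> zq \<in> {0, 1} \<and> c \<in> {0, 1} \<and> 1 \<le> zp + zq \<and> u \<noteq> v \<and> w \<noteq> v \<and>
        (u = w \<longrightarrow> c = 0) \<and> 0 < ar st ''deg'' u \<and> 0 < ar st ''deg'' w \<and>
        (\<forall>z. ar st' ''deg'' z = ar st ''deg'' z - zp * (of_bool (u = z) + of_bool (v = z)) -
           zq * (of_bool (v = z) + of_bool (w = z)) + c * (of_bool (u = z) + of_bool (w = z))) \<and>
        nlive M (vr st' ''cnt'') (ar st' ''g'') = nlive M (vr st ''cnt'') (ar st ''g'') - zp - zq + c)"

text \<open>Moving the smaller of the two capacities empties \<open>p\<close> or \<open>q\<close>,
  both incident with \<open>v\<close>, while a network arc that is filled avoids \<open>v\<close>.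
  The degree of \<open>v\<close> therefore strictly falls.\<close>

lemma wp_shortcut:
  assumes sh: "shape_st n k M st" and cp: "caps_st M st" and lg: "log_st c0 st" and M: "vr st ''M'' = M"
    and p: "M < vr st ''p''" "vr st ''p'' \<le> vr st ''cnt''" "ar st ''head'' (vr st ''p'') = v" "0 < ar st ''g'' (vr st ''p'')"
    and q: "M < vr st ''q''" "vr st ''q'' \<le> vr st ''cnt''" "ar st ''tail'' (vr st ''q'') = v" "0 < ar st ''g'' (vr st ''q'')"
    and trash: "ar st ''tail'' M = ar st ''head'' M"
  shows "wp shortcut (\<lambda>t st'. cut_post n k M c0 v st st' \<and> t \<le> 300) st"
proof -
  let ?p = "vr st ''p''" and ?q = "vr st ''q''" and ?g = "ar st ''g''" and ?cnt = "vr st ''cnt''"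
  define u where "u = ar st ''tail'' ?p"
  define w where "w = ar st ''head'' ?q"
  define x where "x = min (?g ?p) (?g ?q)"
  have M0: "0 \<le> M" "M \<le> ?cnt" using sh by (auto simp: shape_ok_def)
  have x: "0 < x" "x \<le> ?g ?p" "x \<le> ?g ?q" using p q by (auto simp: x_def)
  have node: "0 \<le> ar st ''tail'' z" "ar st ''tail'' z < n + k" "0 \<le> ar st ''head'' z" "ar st ''head'' z < n + 2 * k"
    "ar st ''head'' z < n \<or> n + k \<le> ar st ''head'' z" "ar st ''tail'' z \<noteq> ar st ''head'' z"
    if "M < z" "z \<le> ?cnt" for z
    using sh that unfolding shape_ok_def mat_ok_def by blast+
  have uvw: "u \<noteq> v" "w \<noteq> v" using node(6)[OF p(1,2)] node(6)[OF q(1,2)] p q by (auto simp: u_def w_def)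
  have pq: "?p \<noteq> ?q" using uvw p q by (auto simp: u_def)
  define zp :: int where "zp = of_bool (?g ?p = x)"
  define zq :: int where "zq = of_bool (?g ?q = x)"
  have z: "zp \<in> {0, 1}" "zq \<in> {0, 1}" "1 \<le> zp + zq" by (auto simp: zp_def zq_def x_def min_def)
  have d: "ar st ''deg'' = ndeg M ?cnt (ar st ''tail'') (ar st ''head'') ?g" using cp by (simp add: caps_ok_def)
  have degu: "0 < ar st ''deg'' u" "0 < ar st ''deg'' w"
    unfolding d using p q by (auto simp: u_def w_def intro: ndeg_pos)
  show ?thesis
    unfolding shortcut_def
  proof (rule wp_SeqI)
    show "wp pick (\<lambda>t st1. t \<le> 40 \<and> vr st1 ''x'' = x \<and> vr st1 ''u'' = u \<and> vr st1 ''w'' = w) st"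
      by (auto simp: pick_def x_def u_def w_def)
  next
    fix t1 :: nat and st1
    assume 1: "t1 \<le> 40 \<and> vr st1 ''x'' = x \<and> vr st1 ''u'' = u \<and> vr st1 ''w'' = w" and ag1: "agree pick st st1"
    have a1: "arr st1 = arr st" using ag1[THEN agree_arr] by (auto simp: pick_def)
    have v1: "vr st1 ''cnt'' = ?cnt" "vr st1 ''p'' = ?p" "vr st1 ''q'' = ?q" "vr st1 ''M'' = M" "vr st1 ''L'' = vr st ''L''"
      using ag1[THEN agree_var] M by (simp_all add: pick_def)
    have cp1: "caps_st M st1" using cp by (simp add: a1 v1)
    have "wp (lower ''p'') (\<lambda>t st'. caps_st M st' \<and> t \<le> 40 \<and>
     ar st' ''g'' = ?g(?p := ?g ?p - x) \<and>
     (\<forall>z. ar st' ''deg'' z = ar st ''deg'' z - zp * (of_bool (u = z) + of_bool (v = z))) \<and>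
     nlive M (vr st' ''cnt'') (ar st' ''g'') = nlive M ?cnt ?g - zp) st1"
      using wp_lower[OF cp1, of "''p''"] 1 p x node(6)[OF p(1,2)] by (simp add: a1 v1 zp_def u_def)
    then show "wp (lower ''p'';; lower ''q'';; link;; log_op) (\<lambda>t st'. cut_post n k M c0 v st st' \<and> t1 + t \<le> 300) st1"
    proof (rule wp_SeqI, elim conjE)
      fix t2 :: nat and st2
      assume ag2: "agree (lower ''p'') st1 st2" and cp2: "caps_st M st2" and t2: "t2 \<le> 40"
        and g2: "ar st2 ''g'' = ?g(?p := ?g ?p - x)"
        and deg2: "\<forall>z. ar st2 ''deg'' z = ar st ''deg'' z - zp * (of_bool (u = z) + of_bool (v = z))"
        and live2: "nlive M (vr st2 ''cnt'') (ar st2 ''g'') = nlive M ?cnt ?g - zp"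
      have v2: "var st2 = var st1" using ag2[THEN agree_var] by (auto simp: lower_def)
      have a2: "ar st2 A = ar st A" if "A \<notin> {''g'', ''deg''}" for A
        using ag2[THEN agree_arr] that by (auto simp: lower_def a1)
      have e: "vr st2 ''q'' = ?q" "vr st2 ''x'' = x" "vr st2 ''cnt'' = ?cnt" "ar st2 ''tail'' = ar st ''tail''"
        "ar st2 ''head'' = ar st ''head''" "ar st2 ''g'' ?q = ?g ?q"
        using 1 pq by (simp_all add: v2 v1 a2 g2)
      have "wp (lower ''q'') (\<lambda>t st'. caps_st M st' \<and> t \<le> 40 \<and>
       ar st' ''g'' = (ar st2 ''g'')(?q := ?g ?q - x) \<and>
       (\<forall>z. ar st' ''deg'' z = ar st2 ''deg'' z - zq * (of_bool (v = z) + of_bool (w = z))) \<and>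
       nlive M (vr st' ''cnt'') (ar st' ''g'') = nlive M ?cnt (ar st2 ''g'') - zq) st2"
        using wp_lower[OF cp2, of "''q''", unfolded e] q x node(6)[OF q(1,2)] unfolding q(3) zq_def w_def by blast
      then show "wp (lower ''q'';; link;; log_op) (\<lambda>t st'. cut_post n k M c0 v st st' \<and> t1 + (t2 + t) \<le> 300) st2"
      proof (rule wp_SeqI, elim conjE)
        fix t3 :: nat and st3
        assume ag3: "agree (lower ''q'') st2 st3" and cp3: "caps_st M st3" and t3: "t3 \<le> 40"
          and g3': "ar st3 ''g'' = (ar st2 ''g'')(?q := ?g ?q - x)"
          and deg3': "\<forall>z. ar st3 ''deg'' z = ar st2 ''deg'' z - zq * (of_bool (v = z) + of_bool (w = z))"
          and live3': "nlive M (vr st3 ''cnt'') (ar st3 ''g'') = nlive M ?cnt (ar st2 ''g'') - zq"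
        have g3: "ar st3 ''g'' = ?g(?p := ?g ?p - x, ?q := ?g ?q - x)" using g3' g2 by simp
        have deg3: "ar st3 ''deg'' z = ar st ''deg'' z - zp * (of_bool (u = z) + of_bool (v = z)) - zq * (of_bool (v = z) + of_bool (w = z))" for z
          using deg2 deg3' by simp
        have live3: "nlive M (vr st3 ''cnt'') (ar st3 ''g'') = nlive M ?cnt ?g - zp - zq"
          using live2 live3' e(3) by simp
        have v3: "var st3 = var st1" using ag3[THEN agree_var] by (auto simp: lower_def v2)
        have a3: "ar st3 A = ar st A" if "A \<notin> {''g'', ''deg''}" for A
          using ag3[THEN agree_arr] that a2 by (auto simp: lower_def)
        have sh3: "shape_st n k M st3" using sh by (simp add: a3 v3 v1)
        have "wp link (\<lambda>t st'. (\<exists>c. link_post n k M st3 c st') \<and> t \<le> 120) st3"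
          using node[OF p(1,2)] node[OF q(1,2)] 1 x
          by (intro wp_link[OF sh3 cp3]) (auto simp: v3 v1 u_def w_def)
        then show "wp (link;; log_op) (\<lambda>t st'. cut_post n k M c0 v st st' \<and> t1 + (t2 + (t3 + t)) \<le> 300) st3"
        proof (rule wp_SeqI, elim conjE exE)
          fix t4 :: nat and st4 c
          assume ag4: "agree link st3 st4" and t4: "t4 \<le> 120" and lp: "link_post n k M st3 c st4"
          have v4: "vr st4 ''p'' = vr st1 ''p''" "vr st4 ''q'' = vr st1 ''q''" "vr st4 ''x'' = vr st1 ''x''" "vr st4 ''L'' = vr st1 ''L''"
            using ag4[THEN agree_var] by (simp_all add: link_def find_arc_def add_cap_def v3)
          have a4: "ar st4 ''lp'' = ar st ''lp''" "ar st4 ''lq'' = ar st ''lq''" "ar st4 ''lr'' = ar st ''lr''" "ar st4 ''lx'' = ar st ''lx''"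
            using ag4[THEN agree_arr] a3 by (simp_all add: link_def find_arc_def add_cap_def)
          let ?r = "vr st4 ''r''"
          note l = lp[unfolded link_post_def v3 v1 1[THEN conjunct2, THEN conjunct1] 1[THEN conjunct2, THEN conjunct2, THEN conjunct1]
            1[THEN conjunct2, THEN conjunct2, THEN conjunct2] a3[of "''tail''", simplified] a3[of "''head''", simplified]]
          have agr: "ar st4 ''tail'' z = ar st ''tail'' z \<and> ar st4 ''head'' z = ar st ''head'' z" if "z \<le> ?cnt" for z
            using l that by blast
          have r: "?r = M \<and> u = w \<or> M < ?r \<and> ar st4 ''tail'' ?r = u \<and> ar st4 ''head'' ?r = w" "?r \<le> vr st4 ''cnt''" "M \<le> ?r"
            using l by blast+
          \<comment> \<open>The node that is filled is \<open>M\<close> or joins \<open>u\<close>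
            and \<open>w\<close>, both different from \<open>v\<close>; it cannot be one of the two
            arcs being reduced.\<close>
          have rpq: "?r \<noteq> ?p" "?r \<noteq> ?q"
            using r agr[OF p(2)] agr[OF q(2)] p q uvw by (auto simp: u_def w_def)
          have g4: "ar st4 ''g'' = (ar st3 ''g'')(?r := ar st3 ''g'' ?r + x)" using l by blast
          have g4': "ar st4 ''g'' z = ?g z + x * (of_bool (?r = z) - of_bool (?p = z) - of_bool (?q = z))" for z
            unfolding g4 g3 using pq rpq by auto
          have cp4: "caps_st M st4" and sh4: "shape_st n k M st4" and cnt4: "?cnt \<le> vr st4 ''cnt''" using l by blast+
          have bd4: "bd (ar st4 ''tail'') (ar st4 ''head'') ?p z + bd (ar st4 ''tail'') (ar st4 ''head'') ?q z =
            bd (ar st4 ''tail'') (ar st4 ''head'') ?r z" for z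
          proof -
            have "ar st4 ''tail'' ?p = u" "ar st4 ''head'' ?p = v" "ar st4 ''tail'' ?q = v" "ar st4 ''head'' ?q = w"
              using agr[OF p(2)] agr[OF q(2)] p(3) q(3) unfolding u_def w_def by simp_all
            moreover have "bd (ar st4 ''tail'') (ar st4 ''head'') ?r z = of_bool (u = z) - of_bool (w = z)"
              using r(1) agr[OF M0(2)] trash unfolding bd_def by (elim disjE conjE) simp_all
            ultimately show ?thesis by (simp add: bd_def)
          qed
          have "log_ok c0 (vr st4 ''cnt'') (ar st4 ''tail'') (ar st4 ''head'') (ar st4 ''g'') (vr st ''L'' + 1)
             ((ar st ''lp'')(vr st ''L'' + 1 := ?p)) ((ar st ''lq'')(vr st ''L'' + 1 := ?q))
             ((ar st ''lr'')(vr st ''L'' + 1 := ?r)) ((ar st ''lx'')(vr st ''L'' + 1 := x))"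
            using p q M0 rpq pq x r cp4 by (intro log_append[OF lg cnt4 agr _ _ _ _ _ _ _ bd4 g4']) (auto simp: caps_ok_def)
          then have lg5: "wp log_op (\<lambda>t st5. log_st c0 st5 \<and> t \<le> 30 \<and> vr st5 ''L'' = vr st ''L'' + 1) st4"
            using 1 by (simp add: log_op_def v4 a4 v1)
          have new: "ar st4 ''tail'' (vr st4 ''cnt'') \<noteq> v \<and> ar st4 ''head'' (vr st4 ''cnt'') \<noteq> v" if "?cnt < vr st4 ''cnt''"
          proof -
            have "?r = vr st4 ''cnt''" using l that by blast
            then show ?thesis using r(1) that M0 uvw by auto
          qed
          have gM: "ar st4 ''g'' z = ?g z" if "z < M" for z
            using g4'[of z] that r(3) p q by auto
          have gv: "ar st4 ''g'' z = ?g z"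
            if "M < z" "z \<le> ?cnt" "ar st ''tail'' z = v \<or> ar st ''head'' z = v" "z \<noteq> ?p" "z \<noteq> ?q" for z
            using g4'[of z] that r(1) agr[of z] uvw by auto
          have c: "c \<in> {0, 1}" "u = w \<longrightarrow> c = 0"
            "\<forall>z. ar st4 ''deg'' z = ar st3 ''deg'' z + c * (of_bool (u = z) + of_bool (w = z))"
            "nlive M (vr st4 ''cnt'') (ar st4 ''g'') = nlive M ?cnt (ar st3 ''g'') + c"
            using l by blast+
          have cnt4': "vr st4 ''cnt'' \<le> ?cnt + 1" using l by blast
          show "wp log_op (\<lambda>t st'. cut_post n k M c0 v st st' \<and> t1 + (t2 + (t3 + (t4 + t))) \<le> 300) st4"
          proof (rule wp_conseq_agree[OF lg5], elim conjE)
            fix t5 :: nat and st5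
            assume ag5: "agree log_op st4 st5" and lg5': "log_st c0 st5" and t5: "t5 \<le> 30" and L5: "vr st5 ''L'' = vr st ''L'' + 1"
            have v5: "vr st5 ''cnt'' = vr st4 ''cnt''" using ag5[THEN agree_var] by (simp add: log_op_def)
            have a5: "ar st5 ''tail'' = ar st4 ''tail''" "ar st5 ''head'' = ar st4 ''head''"
              "ar st5 ''ohd'' = ar st4 ''ohd''" "ar st5 ''onx'' = ar st4 ''onx''" "ar st5 ''ihd'' = ar st4 ''ihd''"
              "ar st5 ''inx'' = ar st4 ''inx''" "ar st5 ''mat'' = ar st4 ''mat''" "ar st5 ''row'' = ar st4 ''row''"
              "ar st5 ''g'' = ar st4 ''g''" "ar st5 ''deg'' = ar st4 ''deg''"
              using ag5[THEN agree_arr] by (simp_all add: log_op_def)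
            have ex: "\<exists>u w zp zq c. zp \<in> {0, 1} \<and> zq \<in> {0, 1} \<and> c \<in> {0, 1} \<and> 1 \<le> zp + zq \<and> u \<noteq> v \<and> w \<noteq> v \<and>
              (u = w \<longrightarrow> c = 0) \<and> 0 < ar st ''deg'' u \<and> 0 < ar st ''deg'' w \<and>
              (\<forall>z. ar st4 ''deg'' z = ar st ''deg'' z - zp * (of_bool (u = z) + of_bool (v = z)) -
                 zq * (of_bool (v = z) + of_bool (w = z)) + c * (of_bool (u = z) + of_bool (w = z))) \<and>
              nlive M (vr st4 ''cnt'') (ar st4 ''g'') = nlive M ?cnt ?g - zp - zq + c"
            proof (rule exI[of _ u], rule exI[of _ w], rule exI[of _ zp], rule exI[of _ zq], rule exI[of _ c], intro conjI)
              show "\<forall>z. ar st4 ''deg'' z = ar st ''deg'' z - zp * (of_bool (u = z) + of_bool (v = z)) -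
                 zq * (of_bool (v = z) + of_bool (w = z)) + c * (of_bool (u = z) + of_bool (w = z))"
                using c(3) deg3 by presburger
              show "nlive M (vr st4 ''cnt'') (ar st4 ''g'') = nlive M ?cnt ?g - zp - zq + c"
                using c(4) live3 unfolding v3 v1 by presburger
            qed (use z uvw degu c in blast)+
            have "\<forall>p. p \<le> ?cnt \<longrightarrow> ar st4 ''tail'' p = ar st ''tail'' p \<and> ar st4 ''head'' p = ar st ''head'' p"
              "?cnt < vr st4 ''cnt'' \<longrightarrow> ar st4 ''tail'' (vr st4 ''cnt'') \<noteq> v \<and> ar st4 ''head'' (vr st4 ''cnt'') \<noteq> v"
              "\<forall>z<M. ar st4 ''g'' z = ?g z"
              "\<forall>z. M < z \<and> z \<le> ?cnt \<and> (ar st ''tail'' z = v \<or> ar st ''head'' z = v) \<and> z \<noteq> ?p \<and> z \<noteq> ?q \<longrightarrow>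
                ar st4 ''g'' z = ?g z"
              using agr new gM gv by blast+
            then have "cut_post n k M c0 v st st5"
              unfolding cut_post_def v5 a5 by (intro conjI sh4 cp4 lg5'[unfolded v5 a5] L5 cnt4 cnt4' ex)
            then show "cut_post n k M c0 v st st5 \<and> t1 + (t2 + (t3 + (t4 + t5))) \<le> 300"
              using 1 t2 t3 t4 t5 by simp
          qed
        qed
      qed
    qed
  qed
qed

section \<open>Vertex elimination\<close>

lemma sum_of_bool_bd:
  assumes "finite A" "a \<in> A"
  shows "(\<Sum>p\<in>A. of_bool (a = p) * F p) = (F a :: int)"
proof -
  have "(\<Sum>p\<in>A. of_bool (a = p) * F p) = (\<Sum>p\<in>{a}. of_bool (a = p) * F p)"
    using assms by (intro sum.mono_neutral_right) auto
  then show ?thesis by simp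
qed

text \<open>A move replaces the incidences of \<open>p\<close> and \<open>q\<close> by that of
  \<open>r\<close>, which is their sum. After exchanging the sums over log and nodes every entry
  contributes 0 on its own.\<close>

lemma capat_conserved:
  assumes ok: "log_ok c0 cnt src dst cap L lp lq lr lx" and j: "0 \<le> j" "j \<le> L"
  shows "(\<Sum>p\<in>{0..cnt}. capat c0 lp lq lr lx j p * bd src dst p v) = (\<Sum>p\<in>{0..cnt}. c0 p * bd src dst p v)"
proof -
  have "(\<Sum>p\<in>{0..cnt}. (\<Sum>l\<in>{0<..j}. lx l * (of_bool (lr l = p) - of_bool (lp l = p) - of_bool (lq l = p))) * bd src dst p v)
    = (\<Sum>l\<in>{0<..j}. \<Sum>p\<in>{0..cnt}. lx l * (of_bool (lr l = p) * bd src dst p v - of_bool (lp l = p) * bd src dst p v - of_bool (lq l = p) * bd src dst p v))"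
    unfolding sum_distrib_right by (subst sum.swap) (simp add: algebra_simps)
  also have "\<dots> = (\<Sum>l\<in>{0<..j}. lx l * (bd src dst (lr l) v - bd src dst (lp l) v - bd src dst (lq l) v))"
  proof (rule sum.cong[OF refl])
    fix l assume "l \<in> {0<..j}"
    then have l: "0 < l \<and> l \<le> L" using j by auto
    have "lp l \<in> {0..cnt}" "lq l \<in> {0..cnt}" "lr l \<in> {0..cnt}" using ok l unfolding log_ok_def by blast+
    then show "(\<Sum>p\<in>{0..cnt}. lx l * (of_bool (lr l = p) * bd src dst p v - of_bool (lp l = p) * bd src dst p v - of_bool (lq l = p) * bd src dst p v))
      = lx l * (bd src dst (lr l) v - bd src dst (lp l) v - bd src dst (lq l) v)"
      by (simp only: sum_distrib_left[symmetric] sum_subtractf sum_of_bool_bd finite_atLeastAtMost_int)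
  qed
  also have "\<dots> = 0"
  proof (rule sum.neutral, rule ballI)
    fix l assume "l \<in> {0<..j}"
    then have l: "0 < l \<and> l \<le> L" using j by auto
    have "bd src dst (lp l) v + bd src dst (lq l) v = bd src dst (lr l) v" using ok l unfolding log_ok_def by blast
    then show "lx l * (bd src dst (lr l) v - bd src dst (lp l) v - bd src dst (lq l) v) = 0" by simp
  qed
  finally show ?thesis unfolding capat_def by (simp add: distrib_right sum.distrib)
qed

text \<open>With the super arcs included, conservation holds at the original vertices, terminals
  too. Hence all \<open>n\<close> of them can be eliminated alike.\<close>

definition flow_ok :: "int \<Rightarrow> int \<Rightarrow> (int \<Rightarrow> int) \<Rightarrow> (int \<Rightarrow> int) \<Rightarrow> (int \<Rightarrow> int) \<Rightarrow> bool" where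
  "flow_ok n M c0 tl0 hd0 \<longleftrightarrow> tl0 M = hd0 M \<and> (\<forall>p>M. c0 p = 0) \<and>
     (\<forall>v. 0 \<le> v \<and> v < n \<longrightarrow> (\<Sum>p\<in>{0..M}. c0 p * bd tl0 hd0 p v) = 0)"

definition net_ok where
  "net_ok n k M c0 tl0 hd0 st \<longleftrightarrow> shape_st n k M st \<and> caps_st M st \<and> log_st c0 st \<and> vr st ''M'' = M \<and>
     (\<forall>p\<le>M. ar st ''tail'' p = tl0 p \<and> ar st ''head'' p = hd0 p) \<and> (\<forall>z<M. ar st ''g'' z = 0)"

text \<open>The raw arcs are empty after insertion and \<open>M\<close> is a loop, so the conserved
  divergence sits entirely on the network arcs.\<close>

lemma net_balance:
  assumes net: "net_ok n k M c0 tl0 hd0 st" and fl: "flow_ok n M c0 tl0 hd0" and v: "0 \<le> v" "v < n"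
  shows "(\<Sum>p\<in>{M<..vr st ''cnt''}. ar st ''g'' p * bd (ar st ''tail'') (ar st ''head'') p v) = 0"
proof -
  let ?tl = "ar st ''tail''" and ?hd = "ar st ''head''" and ?g = "ar st ''g''" and ?cnt = "vr st ''cnt''"
  have lg: "log_st c0 st" and M: "0 \<le> M" "M \<le> ?cnt" using net by (auto simp: net_ok_def shape_ok_def)
  have eq: "?tl p = tl0 p" "?hd p = hd0 p" if "p \<le> M" for p using net that by (auto simp: net_ok_def)
  have split: "{0..?cnt} = {0..M} \<union> {M<..?cnt}" using M by auto
  have "(\<Sum>p\<in>{0..?cnt}. ?g p * bd ?tl ?hd p v) = (\<Sum>p\<in>{0..?cnt}. c0 p * bd ?tl ?hd p v)"
    using capat_conserved[OF lg, of "vr st ''L''"] lg by (simp add: log_ok_def)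
  also have "\<dots> = (\<Sum>p\<in>{0..M}. c0 p * bd ?tl ?hd p v) + (\<Sum>p\<in>{M<..?cnt}. c0 p * bd ?tl ?hd p v)"
    unfolding split by (rule sum.union_disjoint) auto
  also have "(\<Sum>p\<in>{0..M}. c0 p * bd ?tl ?hd p v) = (\<Sum>p\<in>{0..M}. c0 p * bd tl0 hd0 p v)"
    by (rule sum.cong) (auto simp: bd_def eq)
  also have "(\<Sum>p\<in>{M<..?cnt}. c0 p * bd ?tl ?hd p v) = 0" using fl by (simp add: flow_ok_def)
  also have "(\<Sum>p\<in>{0..M}. c0 p * bd tl0 hd0 p v) = 0" using fl v by (simp add: flow_ok_def)
  finally have "(\<Sum>p\<in>{0..?cnt}. ?g p * bd ?tl ?hd p v) = 0" by simp
  also have "(\<Sum>p\<in>{0..?cnt}. ?g p * bd ?tl ?hd p v) =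
      (\<Sum>p\<in>{0..M}. ?g p * bd ?tl ?hd p v) + (\<Sum>p\<in>{M<..?cnt}. ?g p * bd ?tl ?hd p v)"
    unfolding split by (rule sum.union_disjoint) auto
  also have "(\<Sum>p\<in>{0..M}. ?g p * bd ?tl ?hd p v) = 0"
  proof (rule sum.neutral, rule ballI)
    fix p assume "p \<in> {0..M}"
    then show "?g p * bd ?tl ?hd p v = 0"
      using net eq[of M] fl by (cases "p = M") (auto simp: net_ok_def flow_ok_def bd_def)
  qed
  finally show ?thesis by simp
qed

lemma sum_zero_imp:
  fixes F :: "int \<Rightarrow> int"
  assumes "finite A" "sum F A = 0" "a \<in> A" "0 < F a"
  shows "\<exists>b\<in>A. F b < 0"
proof (rule ccontr)
  assume "\<not> ?thesis"
  then have "0 \<le> F b" if "b \<in> A" for b using that by force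
  then have "F a \<le> sum F A" using assms by (intro member_le_sum) auto
  then show False using assms by simp
qed

text \<open>Conservation forces live arcs on both sides of \<open>v\<close> as soon as there is one.
  Both list scans of an elimination thus meet a live arc before running off the end.\<close>

lemma net_through:
  assumes net: "net_ok n k M c0 tl0 hd0 st" and fl: "flow_ok n M c0 tl0 hd0" and v: "0 \<le> v" "v < n"
    and deg: "0 < ar st ''deg'' v"
  shows "\<exists>p. M < p \<and> p \<le> vr st ''cnt'' \<and> ar st ''head'' p = v \<and> 0 < ar st ''g'' p"
    and "\<exists>q. M < q \<and> q \<le> vr st ''cnt'' \<and> ar st ''tail'' q = v \<and> 0 < ar st ''g'' q"
proof -
  let ?tl = "ar st ''tail''" and ?hd = "ar st ''head''" and ?g = "ar st ''g''" and ?cnt = "vr st ''cnt''"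
  let ?F = "\<lambda>p. ?g p * bd ?tl ?hd p v"
  have nn: "0 \<le> ?g p" for p using net by (auto simp: net_ok_def caps_ok_def)
  have "0 < ndeg M ?cnt ?tl ?hd ?g v" using net deg by (auto simp: net_ok_def caps_ok_def)
  then have "(\<Sum>p\<in>{M<..?cnt}. of_bool (0 < ?g p) * (of_bool (?tl p = v) + of_bool (?hd p = v)) :: int) \<noteq> 0"
    unfolding ndeg_def by simp
  then obtain p where p: "p \<in> {M<..?cnt}" "of_bool (0 < ?g p) * (of_bool (?tl p = v) + of_bool (?hd p = v)) \<noteq> (0 :: int)"
    by (rule sum.not_neutral_contains_not_neutral)
  have ne: "?tl z \<noteq> ?hd z" if "z \<in> {M<..?cnt}" for z using net that by (auto simp: net_ok_def shape_ok_def)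
  have p': "0 < ?g p" "?tl p = v \<or> ?hd p = v" using p(2) by (auto split: if_splits)
  have bal: "(\<Sum>p\<in>{M<..?cnt}. ?F p) = 0" by (rule net_balance[OF net fl v])
  then have bal': "(\<Sum>p\<in>{M<..?cnt}. - ?F p) = 0" by (simp add: sum_negf)
  have pos: "?tl z = v \<and> 0 < ?g z" if "0 < ?F z" for z
    using that nn[of z] by (auto simp: bd_def of_bool_def zero_less_mult_iff split: if_splits)
  have neg: "?hd z = v \<and> 0 < ?g z" if "?F z < 0" for z
    using that nn[of z] by (auto simp: bd_def of_bool_def mult_less_0_iff split: if_splits)
  show "\<exists>p. M < p \<and> p \<le> ?cnt \<and> ?hd p = v \<and> 0 < ?g p"
  proof (cases "?hd p = v")
    case False
    then have "0 < ?F p" using p' by (auto simp: bd_def)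
    then show ?thesis using sum_zero_imp[OF _ bal p(1)] neg by force
  qed (use p p' in auto)
  show "\<exists>q. M < q \<and> q \<le> ?cnt \<and> ?tl q = v \<and> 0 < ?g q"
  proof (cases "?tl p = v")
    case False
    then have "0 < - ?F p" using p' by (auto simp: bd_def)
    then show ?thesis using sum_zero_imp[OF _ bal' p(1)] pos by force
  qed (use p p' in auto)
qed

text \<open>An iteration skips an empty arc on one of the lists or makes one move. The flat loop
  lets a single potential pay for scanning and moving.\<close>

definition advance :: com where
  "advance = If (Equal (Ar ''g'' (Vr ''p'')) (Const 0)) (''p'' ::= Ar ''inx'' (Vr ''p''))
    (If (Equal (Ar ''g'' (Vr ''q'')) (Const 0)) (''q'' ::= Ar ''onx'' (Vr ''q'')) shortcut)"

definition eliminate :: com where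
  "eliminate =
     (''el''\<lbrakk>Vr ''v''\<rbrakk> ::= Const 1;; ''p'' ::= Ar ''ihd'' (Vr ''v'');; ''q'' ::= Ar ''ohd'' (Vr ''v'');;
      While (Less (Const 0) (Ar ''deg'' (Vr ''v''))) advance)"

text \<open>List cells that no elimination has scanned yet.\<close>

definition unscanned :: "int \<Rightarrow> store \<Rightarrow> int" where
  "unscanned M st = (\<Sum>z\<in>{M<..vr st ''cnt''}.
     of_bool (ar st ''el'' (ar st ''tail'' z) = 0) + of_bool (ar st ''el'' (ar st ''head'' z) = 0))"

text \<open>Lists run through decreasing numbers, so for a cell \<open>p\<close> of the list of
  \<open>v\<close> this is the length of the list from \<open>p\<close> on.\<close>

definition listed :: "int \<Rightarrow> (int \<Rightarrow> int) \<Rightarrow> int \<Rightarrow> int \<Rightarrow> int" where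
  "listed M src v p = (\<Sum>z\<in>{M<..p}. of_bool (src z = v))"

lemma listed_step:
  assumes "M < p" "src p = v" "p' < p"
  shows "listed M src v p' + 1 \<le> listed M src v p"
proof -
  have "(\<Sum>z\<in>{M<..p'}. of_bool (src z = v)) + (\<Sum>z\<in>{p}. of_bool (src z = v)) =
     (\<Sum>z\<in>{M<..p'} \<union> {p}. of_bool (src z = v) :: int)"
    using assms by (intro sum.union_disjoint[symmetric]) auto
  also have "\<dots> \<le> (\<Sum>z\<in>{M<..p}. of_bool (src z = v))"
    using assms by (intro sum_mono2) auto
  finally show ?thesis using assms by (simp only: listed_def) simp
qed

lemma listed_cong: "(\<And>z. z \<le> p \<Longrightarrow> src' z = src z) \<Longrightarrow> listed M src' v p = listed M src v p"
  unfolding listed_def by (intro sum.cong) auto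

lemma listed_nonneg: "0 \<le> listed M src v p"
  unfolding listed_def by (intro sum_nonneg) auto

text \<open>A live arc counts 1, 0 or -1 according to whether two, one or none of its ends lie in
  \<open>R\<close>. Unlike the degree sum over the postponed vertices, this quantity survives later
  eliminations.\<close>

definition exposed :: "int \<Rightarrow> int \<Rightarrow> int set \<Rightarrow> store \<Rightarrow> int" where
  "exposed M cnt R st = (\<Sum>z\<in>R. ar st ''deg'' z) - nlive M cnt (ar st ''g'')"

text \<open>
  \<open>exposed\<close> does not decrease: when a move reduces the degree sum of the surviving vertices,
  at least as many arcs disappear.
\<close>

definition elim_progress :: "int \<Rightarrow> int \<Rightarrow> store \<Rightarrow> store \<Rightarrow> bool" where
  "elim_progress M v st0 st \<longleftrightarrow>
     nlive M (vr st ''cnt'') (ar st ''g'') \<le> nlive M (vr st0 ''cnt'') (ar st0 ''g'') \<and>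
     (\<forall>z. z \<noteq> v \<and> ar st0 ''deg'' z = 0 \<longrightarrow> ar st ''deg'' z = 0) \<and>
     (\<forall>R. finite R \<and> v \<notin> R \<longrightarrow> exposed M (vr st0 ''cnt'') R st0 \<le> exposed M (vr st ''cnt'') R st)"

lemma sum_of_bool_mem: "finite R \<Longrightarrow> (\<Sum>z\<in>R. of_bool (u = z)) = (of_bool (u \<in> R) :: int)"
  using sum_of_bool_bd[of R u "\<lambda>_. 1"] by (cases "u \<in> R") (auto intro!: sum.neutral)

text \<open>Removing \<open>u -> v\<close> adds 1 minus the indicator of \<open>u\<close> in
  \<open>R\<close>; the new arc adds the indicators of \<open>u\<close> and \<open>w\<close> minus
  1. Together the indicator of \<open>w\<close> remains, which is nonnegative. Removing
  \<open>v -> w\<close> is symmetric, and any further removal can only add.\<close>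

lemma cut_progress:
  assumes "cut_post n k M c0 v st st'"
  shows "elim_progress M v st st'" "ar st' ''deg'' v < ar st ''deg'' v"
proof -
  obtain u w zp zq c where z: "zp \<in> {0, 1}" "zq \<in> {0, 1}" "c \<in> {0, 1}" "1 \<le> zp + zq" "u \<noteq> v" "w \<noteq> v"
    "0 < ar st ''deg'' u" "0 < ar st ''deg'' w"
    and deg: "\<And>z. ar st' ''deg'' z = ar st ''deg'' z - zp * (of_bool (u = z) + of_bool (v = z)) -
           zq * (of_bool (v = z) + of_bool (w = z)) + c * (of_bool (u = z) + of_bool (w = z))"
    and live: "nlive M (vr st' ''cnt'') (ar st' ''g'') = nlive M (vr st ''cnt'') (ar st ''g'') - zp - zq + c"
    using assms unfolding cut_post_def by blast
  show "ar st' ''deg'' v < ar st ''deg'' v" using deg[of v] z by auto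
  have "exposed M (vr st ''cnt'') R st \<le> exposed M (vr st' ''cnt'') R st'" if R: "finite R" "v \<notin> R" for R
  proof -
    let ?u = "of_bool (u \<in> R) :: int" and ?w = "of_bool (w \<in> R) :: int" and ?v = "of_bool (v \<in> R) :: int"
    have "(\<Sum>z\<in>R. ar st' ''deg'' z) = (\<Sum>z\<in>R. ar st ''deg'' z) - zp * (?u + ?v) - zq * (?v + ?w) + c * (?u + ?w)"
      by (simp only: deg sum.distrib sum_subtractf sum_distrib_left[symmetric] sum_of_bool_mem[OF R(1)])
    moreover have "- zp * (?u + ?v) - zq * (?v + ?w) + c * (?u + ?w) + zp + zq - c \<ge> 0"
    proof -
      have "zp = 0 \<or> zp = 1" "zq = 0 \<or> zq = 1" "c = 0 \<or> c = 1" using z(1-3) by auto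
      then show ?thesis using z(4) R(2) by (cases "u \<in> R"; cases "w \<in> R") (elim disjE; simp)+
    qed
    ultimately show ?thesis using live by (simp add: exposed_def)
  qed
  moreover have "ar st' ''deg'' z = 0" if "z \<noteq> v" "ar st ''deg'' z = 0" for z
  proof -
    have "u \<noteq> z" "w \<noteq> z" using z(7,8) that by auto
    then show ?thesis using deg[of z] that by simp
  qed
  ultimately have P: "\<forall>R. finite R \<and> v \<notin> R \<longrightarrow> exposed M (vr st ''cnt'') R st \<le> exposed M (vr st' ''cnt'') R st'"
    "\<forall>z. z \<noteq> v \<and> ar st ''deg'' z = 0 \<longrightarrow> ar st' ''deg'' z = 0" by blast+
  show "elim_progress M v st st'"
  proof -
    have "c \<le> 1" using z(3) by auto
    then show ?thesis using live z(4) P unfolding elim_progress_def by auto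
  qed
qed

lemma elim_progress_trans: "elim_progress M v a b \<Longrightarrow> elim_progress M v b c \<Longrightarrow> elim_progress M v a c"
  unfolding elim_progress_def by (meson order_trans)

lemma elim_progress_refl: "elim_progress M v st st"
  by (simp add: elim_progress_def)

text \<open>Cells already passed are empty and stay empty, since moves at \<open>v\<close> fill no
  network arc incident with \<open>v\<close>. One pass over each list is enough for the whole
  elimination.\<close>

definition pointer_ok :: "int \<Rightarrow> int \<Rightarrow> (int \<Rightarrow> int) \<Rightarrow> (int \<Rightarrow> int) \<Rightarrow> int \<Rightarrow> int \<Rightarrow> bool" where
  "pointer_ok M cnt src cap v p \<longleftrightarrow> 0 \<le> p \<and> p \<le> cnt \<and> (M < p \<longrightarrow> src p = v) \<and>
     (\<forall>z. M < z \<and> z \<le> cnt \<and> p < z \<and> src z = v \<longrightarrow> cap z = 0)"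

lemma pointer_init: "chain M cnt src hp nx \<Longrightarrow> pointer_ok M cnt src cap v (hp v)"
  unfolding chain_def pointer_ok_def by blast

lemma pointer_next:
  assumes "chain M cnt src hp nx" "pointer_ok M cnt src cap v p" "M < p" "cap p = 0"
  shows "pointer_ok M cnt src cap v (nx p)" "nx p < p"
proof -
  have p: "p \<le> cnt" "src p = v" "\<And>z. M < z \<Longrightarrow> z \<le> cnt \<Longrightarrow> p < z \<Longrightarrow> src z = v \<Longrightarrow> cap z = 0"
    using assms unfolding pointer_ok_def by blast+
  have n: "0 \<le> nx p" "nx p < p" "M < nx p \<longrightarrow> src (nx p) = src p"
    "\<And>z. M < z \<Longrightarrow> nx p < z \<Longrightarrow> z < p \<Longrightarrow> src z \<noteq> src p"
    using assms(1,3) p(1) unfolding chain_def by blast+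
  show "nx p < p" by (rule n)
  have "cap z = 0" if "M < z" "z \<le> cnt" "nx p < z" "src z = v" for z
    using p(3)[of z] n(4)[of z] that p(2) assms(4) by (cases z p rule: linorder_cases) auto
  then show "pointer_ok M cnt src cap v (nx p)" unfolding pointer_ok_def using n p by auto
qed

definition elim_inv where
  "elim_inv n k M c0 tl0 hd0 v st \<longleftrightarrow> net_ok n k M c0 tl0 hd0 st \<and> vr st ''v'' = v \<and>
     pointer_ok M (vr st ''cnt'') (ar st ''head'') (ar st ''g'') v (vr st ''p'') \<and>
     pointer_ok M (vr st ''cnt'') (ar st ''tail'') (ar st ''g'') v (vr st ''q'')"

text \<open>A move adds one log entry and at most one cell, hence \<open>2 * K\<close>; its at most
  300 steps, the loop overhead and the credit of 120 for the two list positions of a new cell fit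
  into 700. A list position is worth 60, enough to pay for skipping it.\<close>

definition elim_pot :: "int \<Rightarrow> int \<Rightarrow> int \<Rightarrow> store \<Rightarrow> int" where
  "elim_pot K M v st = K * (vr st ''L'' + vr st ''cnt'') + (2 * K + 700) * ar st ''deg'' v +
     60 * (listed M (ar st ''head'') v (vr st ''p'') + listed M (ar st ''tail'') v (vr st ''q'')) + 60 * unscanned M st"

lemma unscanned_cut:
  assumes "cut_post n k M c0 v st st'" "ar st' ''el'' = ar st ''el''" "M \<le> vr st ''cnt''"
  shows "unscanned M st' \<le> unscanned M st + 2"
proof -
  let ?F = "\<lambda>st z. of_bool (ar st ''el'' (ar st ''tail'' z) = 0) + of_bool (ar st ''el'' (ar st ''head'' z) = 0) :: int"
  have agr: "ar st' ''tail'' z = ar st ''tail'' z" "ar st' ''head'' z = ar st ''head'' z" if "z \<le> vr st ''cnt''" for z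
    using assms(1) that unfolding cut_post_def by blast+
  have eq: "(\<Sum>z\<in>{M<..vr st ''cnt''}. ?F st' z) = unscanned M st"
    unfolding unscanned_def by (rule sum.cong) (auto simp: agr assms(2))
  have "vr st' ''cnt'' = vr st ''cnt'' \<or> vr st' ''cnt'' = vr st ''cnt'' + 1"
    using assms(1) unfolding cut_post_def by linarith
  then show ?thesis
  proof
    assume c: "vr st' ''cnt'' = vr st ''cnt''"
    show ?thesis using eq unfolding unscanned_def[of M st'] c by linarith
  next
    assume c: "vr st' ''cnt'' = vr st ''cnt'' + 1"
    have "?F st' (vr st ''cnt'' + 1) \<le> 2" by auto
    then show ?thesis using eq unfolding unscanned_def[of M st'] c sum_upto_Suc[OF assms(3)] by linarith
  qed
qed

lemma wp_advance:
  assumes inv: "elim_inv n k M c0 tl0 hd0 v st" and fl: "flow_ok n M c0 tl0 hd0" and v: "0 \<le> v" "v < n"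
    and deg: "0 < ar st ''deg'' v" and K: "0 \<le> K"
  shows "wp advance (\<lambda>t st'. elim_inv n k M c0 tl0 hd0 v st' \<and> elim_progress M v st st' \<and>
     nat (ar st' ''deg'' v + vr st' ''p'' + vr st' ''q'') < nat (ar st ''deg'' v + vr st ''p'' + vr st ''q'') \<and>
     int t + 20 + elim_pot K M v st' \<le> elim_pot K M v st) st"
proof -
  let ?p = "vr st ''p''" and ?q = "vr st ''q''" and ?g = "ar st ''g''" and ?cnt = "vr st ''cnt''"
  have net: "net_ok n k M c0 tl0 hd0 st" and vv: "vr st ''v'' = v"
    and P: "pointer_ok M ?cnt (ar st ''head'') ?g v ?p" and Q: "pointer_ok M ?cnt (ar st ''tail'') ?g v ?q"
    using inv by (auto simp: elim_inv_def)
  have ch: "chain M ?cnt (ar st ''tail'') (ar st ''ohd'') (ar st ''onx'')"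
    "chain M ?cnt (ar st ''head'') (ar st ''ihd'') (ar st ''inx'')" "0 \<le> M" "M \<le> ?cnt"
    using net by (auto simp: net_ok_def shape_ok_def)
  \<comment> \<open>\<open>net_through\<close> supplies a live arc, and everything beyond the
    pointer is empty, so the pointer has not passed that arc.\<close>
  have Mp: "M < ?p" using net_through(1)[OF net fl v deg] P unfolding pointer_ok_def by force
  have Mq: "M < ?q" using net_through(2)[OF net fl v deg] Q unfolding pointer_ok_def by force
  have nn: "0 \<le> ?g z" for z using net by (auto simp: net_ok_def caps_ok_def)
  show ?thesis
  proof (cases "?g ?p = 0")
    case True
    note nx = pointer_next[OF ch(2) P Mp True]
    have "0 \<le> ?q" "0 \<le> ar st ''inx'' ?p" using Q nx(1) unfolding pointer_ok_def by blast+
    moreover have "listed M (ar st ''head'') v (ar st ''inx'' ?p) + 1 \<le> listed M (ar st ''head'') v ?p"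
      using Mp P nx(2) by (intro listed_step) (auto simp: pointer_ok_def)
    ultimately show ?thesis
      using True net vv nx Q deg
      by (simp add: advance_def elim_inv_def net_ok_def elim_progress_def elim_pot_def exposed_def unscanned_def)
  next
    case gp: False
    show ?thesis
    proof (cases "?g ?q = 0")
      case True
      note nx = pointer_next[OF ch(1) Q Mq True]
      have "0 \<le> ?p" "0 \<le> ar st ''onx'' ?q" using P nx(1) unfolding pointer_ok_def by blast+
      moreover have "listed M (ar st ''tail'') v (ar st ''onx'' ?q) + 1 \<le> listed M (ar st ''tail'') v ?q"
        using Mq Q nx(2) by (intro listed_step) (auto simp: pointer_ok_def)
      ultimately show ?thesis
        using True gp net vv nx P deg
        by (simp add: advance_def elim_inv_def net_ok_def elim_progress_def elim_pot_def exposed_def unscanned_def)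
    next
      case gq: False
      have pre: "shape_st n k M st" "caps_st M st" "log_st c0 st" "vr st ''M'' = M" "ar st ''tail'' M = ar st ''head'' M"
        using net fl by (auto simp: net_ok_def flow_ok_def)
      have pq: "?p \<le> ?cnt" "ar st ''head'' ?p = v" "?q \<le> ?cnt" "ar st ''tail'' ?q = v"
        using P Q Mp Mq by (auto simp: pointer_ok_def)
      have gpos: "0 < ?g ?p" "0 < ?g ?q" using gp gq nn[of ?p] nn[of ?q] by auto
      have "wp shortcut (\<lambda>t st'. elim_inv n k M c0 tl0 hd0 v st' \<and> elim_progress M v st st' \<and>
         nat (ar st' ''deg'' v + vr st' ''p'' + vr st' ''q'') < nat (ar st ''deg'' v + ?p + ?q) \<and>
         int t + 100 + elim_pot K M v st' \<le> elim_pot K M v st) st"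
      proof (rule wp_conseq_agree[OF wp_shortcut[OF pre(1-4) Mp pq(1,2) gpos(1) Mq pq(3,4) gpos(2) pre(5)]], elim conjE)
        fix t :: nat and st'
        assume ag: "agree shortcut st st'" and cut: "cut_post n k M c0 v st st'" and t: "t \<le> 300"
        note defs = shortcut_def pick_def lower_def link_def find_arc_def add_cap_def log_op_def
        have fr: "vr st' ''v'' = v" "vr st' ''p'' = ?p" "vr st' ''q'' = ?q" "vr st' ''M'' = M" "ar st' ''el'' = ar st ''el''"
          using ag[THEN agree_var] ag[THEN agree_arr] vv pre(4) by (simp_all add: defs)
        have c: "shape_st n k M st'" "caps_st M st'" "log_st c0 st'" "?cnt \<le> vr st' ''cnt''" "vr st' ''cnt'' \<le> ?cnt + 1"
          "vr st' ''L'' = vr st ''L'' + 1"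
          "\<forall>p. p \<le> ?cnt \<longrightarrow> ar st' ''tail'' p = ar st ''tail'' p \<and> ar st' ''head'' p = ar st ''head'' p"
          "?cnt < vr st' ''cnt'' \<longrightarrow> ar st' ''tail'' (vr st' ''cnt'') \<noteq> v \<and> ar st' ''head'' (vr st' ''cnt'') \<noteq> v"
          "\<forall>z<M. ar st' ''g'' z = ?g z"
          "\<And>z. M < z \<Longrightarrow> z \<le> ?cnt \<Longrightarrow> ar st ''tail'' z = v \<or> ar st ''head'' z = v \<Longrightarrow> z \<noteq> ?p \<Longrightarrow> z \<noteq> ?q \<Longrightarrow> ar st' ''g'' z = ?g z"
          using cut unfolding cut_post_def by blast+
        note prog = cut_progress[OF cut]
        have net': "net_ok n k M c0 tl0 hd0 st'"
          using net c(1-3,7,9) fr ch(4) unfolding net_ok_def by auto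
        have ne: "ar st ''tail'' z \<noteq> ar st ''head'' z" if "M < z" "z \<le> ?cnt" for z
          using pre(1) that unfolding shape_ok_def by blast
        have "pointer_ok M (vr st' ''cnt'') (ar st' ''head'') (ar st' ''g'') v ?p"
          unfolding pointer_ok_def
        proof (intro conjI allI impI; (elim conjE)?)
          show "0 \<le> ?p" "?p \<le> vr st' ''cnt''" using Mp ch(3) pq c(4) by auto
          show "ar st' ''head'' ?p = v" using c(7) pq by auto
          fix z assume z: "M < z" "z \<le> vr st' ''cnt''" "?p < z" "ar st' ''head'' z = v"
          \<comment> \<open>A cell allocated by this move does not touch \<open>v\<close>, so every
            cell of the list is an old one.\<close>
          have zc: "z \<le> ?cnt"
          proof (rule ccontr)
            assume "\<not> z \<le> ?cnt"
            then have "z = vr st' ''cnt''" "?cnt < vr st' ''cnt''" using z(2) c(5) by auto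
            then show False using c(8) z(4) by blast
          qed
          then have "ar st ''head'' z = v" using c(7) z(4) by auto
          moreover from this have "?g z = 0" "z \<noteq> ?q" using P z zc ne[of z] pq unfolding pointer_ok_def by auto
          ultimately show "ar st' ''g'' z = 0" using c(10)[of z] z zc by auto
        qed
        moreover have "pointer_ok M (vr st' ''cnt'') (ar st' ''tail'') (ar st' ''g'') v ?q"
          unfolding pointer_ok_def
        proof (intro conjI allI impI; (elim conjE)?)
          show "0 \<le> ?q" "?q \<le> vr st' ''cnt''" using Mq ch(3) pq c(4) by auto
          show "ar st' ''tail'' ?q = v" using c(7) pq by auto
          fix z assume z: "M < z" "z \<le> vr st' ''cnt''" "?q < z" "ar st' ''tail'' z = v"
          have zc: "z \<le> ?cnt"
          proof (rule ccontr)
            assume "\<not> z \<le> ?cnt"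
            then have "z = vr st' ''cnt''" "?cnt < vr st' ''cnt''" using z(2) c(5) by auto
            then show False using c(8) z(4) by blast
          qed
          then have "ar st ''tail'' z = v" using c(7) z(4) by auto
          moreover from this have "?g z = 0" "z \<noteq> ?p" using Q z zc ne[of z] pq unfolding pointer_ok_def by auto
          ultimately show "ar st' ''g'' z = 0" using c(10)[of z] z zc by auto
        qed
        ultimately have inv': "elim_inv n k M c0 tl0 hd0 v st'" using net' fr by (simp add: elim_inv_def)
        have "listed M (ar st' ''head'') v ?p = listed M (ar st ''head'') v ?p"
          "listed M (ar st' ''tail'') v ?q = listed M (ar st ''tail'') v ?q"
          using c(7) pq by (auto intro!: listed_cong)
        moreover have "unscanned M st' \<le> unscanned M st + 2" by (rule unscanned_cut[OF cut fr(5) ch(4)])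
        moreover have "(2 * K + 700) * ar st' ''deg'' v \<le> (2 * K + 700) * (ar st ''deg'' v - 1)"
          using prog(2) K by (intro mult_left_mono) auto
        moreover have "K * (vr st' ''L'' + vr st' ''cnt'') \<le> K * (vr st ''L'' + ?cnt + 2)"
          using c(5,6) K by (intro mult_left_mono) auto
        ultimately have "int t + 100 + elim_pot K M v st' \<le> elim_pot K M v st"
          using t unfolding elim_pot_def fr by (simp add: algebra_simps)
        moreover have "nat (ar st' ''deg'' v + vr st' ''p'' + vr st' ''q'') < nat (ar st ''deg'' v + ?p + ?q)"
          using prog(2) deg Mp Mq ch(3) fr by auto
        ultimately show "elim_inv n k M c0 tl0 hd0 v st' \<and> elim_progress M v st st' \<and>
         nat (ar st' ''deg'' v + vr st' ''p'' + vr st' ''q'') < nat (ar st ''deg'' v + ?p + ?q) \<and>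
         int t + 100 + elim_pot K M v st' \<le> elim_pot K M v st" using inv' prog(1) by blast
      qed
      then show ?thesis using gp gq unfolding advance_def by (auto elim!: wp_conseq)
    qed
  qed
qed

text \<open>Marking \<open>v\<close> before scanning releases the credit of all its list cells,
  which pays for traversing both lists. A cell gives credit once for each of its two ends.\<close>

lemma unscanned_mark:
  assumes "v' = v" "ar st ''el'' v = 0" "chain M (vr st ''cnt'') (ar st ''tail'') ohd onx" "chain M (vr st ''cnt'') (ar st ''head'') ihd inx"
    and "ar st' ''el'' = (ar st ''el'')(v := 1)" "ar st' ''tail'' = ar st ''tail''" "ar st' ''head'' = ar st ''head''"
    "vr st' ''cnt'' = vr st ''cnt''"
  shows "unscanned M st' + listed M (ar st ''head'') v (ihd v) + listed M (ar st ''tail'') v (ohd v) \<le> unscanned M st"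
proof -
  let ?cnt = "vr st ''cnt''"
  have le: "listed M src v (hp v) \<le> listed M src v ?cnt" if "chain M ?cnt src hp nx" for src hp nx
  proof -
    have "hp v \<le> ?cnt" using that unfolding chain_def by blast
    then show ?thesis unfolding listed_def by (intro sum_mono2) auto
  qed
  have "unscanned M st' + listed M (ar st ''head'') v ?cnt + listed M (ar st ''tail'') v ?cnt \<le> unscanned M st"
    unfolding unscanned_def listed_def assms(5-8) sum.distrib[symmetric]
    by (rule sum_mono) (use assms(2) in auto)
  then show ?thesis using le[OF assms(3)] le[OF assms(4)] by linarith
qed

lemma wp_eliminate:
  assumes net: "net_ok n k M c0 tl0 hd0 st0" and fl: "flow_ok n M c0 tl0 hd0" and v: "vr st0 ''v'' = v" "0 \<le> v" "v < n"
    and el: "ar st0 ''el'' v = 0" and K: "0 \<le> K"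
  shows "wp eliminate (\<lambda>t st'. net_ok n k M c0 tl0 hd0 st' \<and> elim_progress M v st0 st' \<and> ar st' ''deg'' v = 0 \<and>
     ar st' ''el'' = (ar st0 ''el'')(v := 1) \<and>
     int t + K * (vr st' ''L'' + vr st' ''cnt'') + 60 * unscanned M st' \<le>
       K * (vr st0 ''L'' + vr st0 ''cnt'') + 60 * unscanned M st0 + (2 * K + 700) * ar st0 ''deg'' v + 50) st0"
proof -
  let ?st = "st0\<lparr>arr := (arr st0)((''el'', []) := (ar st0 ''el'')(v := 1)),
    var := (var st0)((''p'', []) := ar st0 ''ihd'' v, (''q'', []) := ar st0 ''ohd'' v)\<rparr>"
  let ?b = "Less (Const 0) (Ar ''deg'' (Vr ''v''))"
  let ?I = "\<lambda>st. elim_inv n k M c0 tl0 hd0 v st \<and> elim_progress M v ?st st"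
  have ch: "chain M (vr st0 ''cnt'') (ar st0 ''tail'') (ar st0 ''ohd'') (ar st0 ''onx'')"
    "chain M (vr st0 ''cnt'') (ar st0 ''head'') (ar st0 ''ihd'') (ar st0 ''inx'')"
    using net by (auto simp: net_ok_def shape_ok_def)
  have I0: "?I ?st"
    using net v pointer_init[OF ch(1)] pointer_init[OF ch(2)]
    by (simp add: elim_inv_def net_ok_def elim_progress_refl)
  have un: "unscanned M ?st + listed M (ar st0 ''head'') v (ar st0 ''ihd'' v) +
     listed M (ar st0 ''tail'') v (ar st0 ''ohd'' v) \<le> unscanned M st0"
    by (rule unscanned_mark[OF refl el ch]) simp_all
  have "wp (While ?b advance) (\<lambda>t st'. ?I st' \<and> \<not> bval ?b st' \<and>
      int t + elim_pot K M v st' \<le> elim_pot K M v ?st + int (1 + bcost ?b)) ?st"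
  \<comment> \<open>Each iteration lowers one of the three summands and leaves the other two
    unchanged.\<close>
  proof (rule wp_While_int[where \<mu> = "\<lambda>st. nat (ar st ''deg'' v + vr st ''p'' + vr st ''q'')"])
    show "?I ?st" by (rule I0)
  next
    fix st
    assume I: "?I st" and "bval ?b st"
    then have d: "0 < ar st ''deg'' v" by (simp add: elim_inv_def)
    show "wp advance (\<lambda>t st'. ?I st' \<and>
      nat (ar st' ''deg'' v + vr st' ''p'' + vr st' ''q'') < nat (ar st ''deg'' v + vr st ''p'' + vr st ''q'') \<and>
      int t + int (1 + bcost ?b) + elim_pot K M v st' \<le> elim_pot K M v st) st"
      by (rule wp_conseq[OF wp_advance[OF I[THEN conjunct1] fl v(2,3) d K]])
        (use I in \<open>auto intro: elim_progress_trans\<close>)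
  qed
  then have "wp (While ?b advance) (\<lambda>t st'. net_ok n k M c0 tl0 hd0 st' \<and> elim_progress M v st0 st' \<and>
     ar st' ''deg'' v = 0 \<and> ar st' ''el'' = (ar st0 ''el'')(v := 1) \<and>
     int t + K * (vr st' ''L'' + vr st' ''cnt'') + 60 * unscanned M st' \<le>
       K * (vr st0 ''L'' + vr st0 ''cnt'') + 60 * unscanned M st0 + (2 * K + 700) * ar st0 ''deg'' v + 10) ?st"
  proof (rule wp_conseq_agree, elim conjE)
    fix t :: nat and st'
    assume ag: "agree (While ?b advance) ?st st'" and inv: "elim_inv n k M c0 tl0 hd0 v st'"
      and pr: "elim_progress M v ?st st'" and nb: "\<not> bval ?b st'"
      and t: "int t + elim_pot K M v st' \<le> elim_pot K M v ?st + int (1 + bcost ?b)"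
    have el': "ar st' ''el'' = (ar st0 ''el'')(v := 1)"
      using ag[THEN agree_arr, of "(''el'', [])"]
      by (simp add: advance_def shortcut_def pick_def lower_def link_def find_arc_def add_cap_def log_op_def)
    have net': "net_ok n k M c0 tl0 hd0 st'" using inv by (simp add: elim_inv_def)
    have "0 \<le> ar st' ''deg'' v" using net' by (auto simp: net_ok_def caps_ok_def ndeg_def intro!: sum_nonneg)
    then have d: "ar st' ''deg'' v = 0" using nb inv by (simp add: elim_inv_def)
    have pr': "elim_progress M v st0 st'" using pr by (simp add: elim_progress_def exposed_def)
    have "int t + K * (vr st' ''L'' + vr st' ''cnt'') + 60 * unscanned M st' \<le>
       K * (vr st0 ''L'' + vr st0 ''cnt'') + 60 * unscanned M st0 + (2 * K + 700) * ar st0 ''deg'' v + 10"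
      using t un d listed_nonneg[of M "ar st' ''head''" v "vr st' ''p''"] listed_nonneg[of M "ar st' ''tail''" v "vr st' ''q''"]
      unfolding elim_pot_def by simp
    then show "net_ok n k M c0 tl0 hd0 st' \<and> elim_progress M v st0 st' \<and>
     ar st' ''deg'' v = 0 \<and> ar st' ''el'' = (ar st0 ''el'')(v := 1) \<and>
     int t + K * (vr st' ''L'' + vr st' ''cnt'') + 60 * unscanned M st' \<le>
       K * (vr st0 ''L'' + vr st0 ''cnt'') + 60 * unscanned M st0 + (2 * K + 700) * ar st0 ''deg'' v + 10"
      using net' pr' d el' by blast
  qed
  then show ?thesis
    unfolding eliminate_def using v by (auto elim!: wp_conseq)
qed

section \<open>Elimination in order of increasing degree\<close>

lemma sum_ndeg_le:
  assumes "finite R"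
  shows "(\<Sum>z\<in>R. ndeg M cnt src dst cap z) \<le> 2 * nlive M cnt cap"
proof -
  have "(\<Sum>z\<in>R. ndeg M cnt src dst cap z) =
      (\<Sum>p\<in>{M<..cnt}. of_bool (0 < cap p) * ((\<Sum>z\<in>R. of_bool (src p = z)) + (\<Sum>z\<in>R. of_bool (dst p = z))))"
    unfolding ndeg_def by (subst sum.swap) (simp only: sum_distrib_left[symmetric] sum.distrib)
  also have "\<dots> \<le> (\<Sum>p\<in>{M<..cnt}. 2 * of_bool (0 < cap p))"
    unfolding sum_of_bool_mem[OF assms] by (rule sum_mono) auto
  finally show ?thesis unfolding nlive_def sum_distrib_left .
qed

definition remaining :: "int \<Rightarrow> store \<Rightarrow> int set" where
  "remaining n st = {v. 0 \<le> v \<and> v < n \<and> ar st ''el'' v = 0}"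

lemma finite_remaining [simp]: "finite (remaining n st)"
  by (rule finite_subset[of _ "{0..<n}"]) (auto simp: remaining_def)

text \<open>The matrix allows at most one arc per ordered pair, and eliminated vertices have no live
  arcs. So every live neighbour of \<open>v\<close> is a remaining vertex or one of the
  \<open>2 * k\<close> added ones, with at most one arc in each direction.\<close>

lemma deg_le:
  assumes net: "net_ok n k M c0 tl0 hd0 st"
    and gone: "\<And>z. 0 \<le> z \<Longrightarrow> z < n \<Longrightarrow> ar st ''el'' z \<noteq> 0 \<Longrightarrow> ar st ''deg'' z = 0"
  shows "ar st ''deg'' v \<le> 2 * (int (card (remaining n st)) + 2 * k)"
proof -
  let ?tl = "ar st ''tail''" and ?hd = "ar st ''head''" and ?g = "ar st ''g''" and ?cnt = "vr st ''cnt''"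
  let ?N = "n + 2 * k" and ?A = "remaining n st \<union> {n..<n + 2 * k}"
  have k: "0 \<le> k" "0 \<le> n" using net by (auto simp: net_ok_def shape_ok_def)
  have d: "ar st ''deg'' z = ndeg M ?cnt ?tl ?hd ?g z" for z using net by (auto simp: net_ok_def caps_ok_def)
  have mo: "mat_ok M ?N ?cnt ?tl ?hd (ar st ''mat'')" using net by (auto simp: net_ok_def shape_ok_def)
  have node: "0 \<le> ?tl p" "?tl p < ?N" "0 \<le> ?hd p" "?hd p < ?N" "ar st ''mat'' (?tl p * ?N + ?hd p) = p"
    if "M < p" "p \<le> ?cnt" for p
    using mo that unfolding mat_ok_def by blast+
  have A: "z \<in> ?A" if "M < p" "p \<le> ?cnt" "0 < ?g p" "z = ?tl p \<or> z = ?hd p" for p z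
  proof (cases "z < n")
    case True
    have "0 < ar st ''deg'' z" unfolding d using that by (auto intro: ndeg_pos)
    then have "ar st ''el'' z = 0" using gone[of z] True that node[of p] by force
    then show ?thesis using True that node[of p] by (auto simp: remaining_def)
  next
    case False
    then show ?thesis using that node[of p] by auto
  qed
  have card_A: "int (card ?A) \<le> int (card (remaining n st)) + 2 * k"
  proof -
    have "card ?A \<le> card (remaining n st) + card {n..<n + 2 * k}" by (rule card_Un_le)
    then show ?thesis using k by simp
  qed
  have count: "(\<Sum>p\<in>{M<..?cnt}. of_bool (0 < ?g p) * of_bool (src p = v)) \<le> int (card ?A)"
    if sd: "\<And>p. M < p \<Longrightarrow> p \<le> ?cnt \<Longrightarrow> src p = ?tl p \<and> dst p = ?hd p \<or> src p = ?hd p \<and> dst p = ?tl p"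
      and uniq: "\<And>p p'. M < p \<Longrightarrow> p \<le> ?cnt \<Longrightarrow> M < p' \<Longrightarrow> p' \<le> ?cnt \<Longrightarrow> src p = src p' \<Longrightarrow> dst p = dst p' \<Longrightarrow> p = p'"
    for src dst :: "int \<Rightarrow> int"
  proof -
    let ?P = "{p \<in> {M<..?cnt}. 0 < ?g p \<and> src p = v}"
    have "(\<Sum>p\<in>{M<..?cnt}. of_bool (0 < ?g p) * of_bool (src p = v)) = (\<Sum>p\<in>{M<..?cnt}. of_bool (0 < ?g p \<and> src p = v) :: int)"
      by (rule sum.cong) auto
    also have "\<dots> = int (card ?P)"
    proof -
      have "?P = {M<..?cnt} \<inter> {p. 0 < ?g p \<and> src p = v}" by blast
      then show ?thesis by (simp only: sum_of_bool_eq finite_greaterThanAtMost_int)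
    qed
    finally have eq: "(\<Sum>p\<in>{M<..?cnt}. of_bool (0 < ?g p) * of_bool (src p = v)) = int (card ?P)" .
    have "card ?P = card (dst ` ?P)"
      using uniq by (intro card_image[symmetric] inj_onI) auto
    moreover have "card (dst ` ?P) \<le> card ?A"
    proof (rule card_mono)
      show "dst ` ?P \<subseteq> ?A"
      proof
        fix z assume "z \<in> dst ` ?P"
        then obtain p where p: "M < p" "p \<le> ?cnt" "0 < ?g p" "z = dst p" by auto
        then show "z \<in> ?A" using A[OF p(1-3), of z] sd[OF p(1,2)] by blast
      qed
    qed simp
    ultimately show ?thesis unfolding eq by linarith
  qed
  have uniq: "p = p'" if "M < p" "p \<le> ?cnt" "M < p'" "p' \<le> ?cnt" "?tl p = ?tl p'" "?hd p = ?hd p'" for p p'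
  proof -
    have "p = ar st ''mat'' (?tl p * ?N + ?hd p)" by (rule node(5)[OF that(1,2), symmetric])
    also have "\<dots> = p'" unfolding that(5,6) by (rule node(5)[OF that(3,4)])
    finally show ?thesis .
  qed
  have "ndeg M ?cnt ?tl ?hd ?g v = (\<Sum>p\<in>{M<..?cnt}. of_bool (0 < ?g p) * of_bool (?tl p = v)) +
      (\<Sum>p\<in>{M<..?cnt}. of_bool (0 < ?g p) * of_bool (?hd p = v))"
    unfolding ndeg_def distrib_left sum.distrib ..
  also have "\<dots> \<le> int (card ?A) + int (card ?A)"
  proof (rule add_mono)
    show "(\<Sum>p\<in>{M<..?cnt}. of_bool (0 < ?g p) * of_bool (?tl p = v)) \<le> int (card ?A)"
      by (rule count[of ?tl ?hd]) (use uniq in auto)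
    show "(\<Sum>p\<in>{M<..?cnt}. of_bool (0 < ?g p) * of_bool (?hd p = v)) \<le> int (card ?A)"
      by (rule count[of ?hd ?tl]) (use uniq in auto)
  qed
  finally show ?thesis using card_A d by simp
qed

text \<open>Postponed vertices are written back to the front of the list being read, never beyond
  the reading position.\<close>

definition visit :: com where
  "visit =
     (''v'' ::= Ar ''rem'' (Vr ''i'');;
      If (Less (Vr ''D'') (Ar ''deg'' (Vr ''v'')))
        (''rem''\<lbrakk>Vr ''t2''\<rbrakk> ::= Vr ''v'';; ''t2'' ::= Plus (Vr ''t2'') (Const 1)) eliminate)"

text \<open>Doubling the threshold replaces a priority queue. The degree of a postponed vertex may
  still change within the stage; both the decision and the accounting use its value at the
  visit.\<close>

definition stage :: com where
  "stage =
     (''i'' ::= Const 0;; ''t2'' ::= Const 0;; for_loop ''i'' ''t'' visit;;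
      ''t'' ::= Vr ''t2'';; ''D'' ::= Plus (Vr ''D'') (Vr ''D''))"

definition elim_all :: com where
  "elim_all = (''D'' ::= Const 1;; While (Less (Const 0) (Vr ''t'')) stage)"

text \<open>The last inequality records that each postponed vertex had degree above \<open>D\<close>
  when it was visited. It is expressed through \<open>exposed\<close> because the degrees may drop
  again afterwards. Positions from \<open>t2\<close> up to \<open>i\<close> hold stale entries and
  are left out of the enumeration.\<close>

definition visit_inv where
  "visit_inv n k M c0 tl0 hd0 D T i st \<longleftrightarrow> net_ok n k M c0 tl0 hd0 st \<and>
     (\<forall>z. 0 \<le> z \<and> z < n \<and> ar st ''el'' z \<noteq> 0 \<longrightarrow> ar st ''deg'' z = 0) \<and>
     0 \<le> vr st ''t2'' \<and> vr st ''t2'' \<le> i \<and>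
     inj_on (ar st ''rem'') ({0..<vr st ''t2''} \<union> {i..<T}) \<and>
     ar st ''rem'' ` ({0..<vr st ''t2''} \<union> {i..<T}) = remaining n st \<and>
     nlive M (vr st ''cnt'') (ar st ''g'') \<le> M \<and>
     D * vr st ''t2'' \<le> exposed M (vr st ''cnt'') (ar st ''rem'' ` {0..<vr st ''t2''}) st + M"

definition stage_pot :: "int \<Rightarrow> int \<Rightarrow> store \<Rightarrow> int" where
  "stage_pot K M st = K * (vr st ''L'' + vr st ''cnt'') + 60 * unscanned M st"

lemma wp_visit:
  assumes inv: "visit_inv n k M c0 tl0 hd0 D T i st" and fl: "flow_ok n M c0 tl0 hd0" and K: "0 \<le> K"
    and i: "vr st ''i'' = i" "0 \<le> i" "i < T" and D: "vr st ''D'' = D" "0 \<le> D"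
  shows "wp visit (\<lambda>t st'. visit_inv n k M c0 tl0 hd0 D T (i + 1) st' \<and>
     int t + stage_pot K M st' \<le> stage_pot K M st + (100 + (2 * K + 700) * min D (2 * (T + 2 * k)))) st"
proof -
  let ?rem = "ar st ''rem''" and ?t2 = "vr st ''t2''"
  let ?S = "{0..<?t2} \<union> {i..<T}" and ?S' = "{0..<?t2} \<union> {i + 1..<T}"
  define v where "v = ?rem i"
  define R where "R = ?rem ` {0..<?t2}"
  have net: "net_ok n k M c0 tl0 hd0 st" and gone: "\<And>z. 0 \<le> z \<Longrightarrow> z < n \<Longrightarrow> ar st ''el'' z \<noteq> 0 \<Longrightarrow> ar st ''deg'' z = 0"
    and t2: "0 \<le> ?t2" "?t2 \<le> i" and inj: "inj_on ?rem ?S" and img: "?rem ` ?S = remaining n st"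
    and live: "nlive M (vr st ''cnt'') (ar st ''g'') \<le> M" and ex: "D * ?t2 \<le> exposed M (vr st ''cnt'') R st + M"
    using inv unfolding visit_inv_def R_def by blast+
  have iS: "i \<in> ?S" "?S = insert i ?S'" "i \<notin> ?S'" using i t2 by auto
  have "v \<in> remaining n st" using iS(1) img unfolding v_def by blast
  then have v: "0 \<le> v" "v < n" "ar st ''el'' v = 0" by (auto simp: remaining_def)
  have vR: "v \<notin> R"
  proof
    assume "v \<in> R"
    then obtain j where "j \<in> {0..<?t2}" "?rem j = ?rem i" by (auto simp: R_def v_def)
    then show False using inj_onD[OF inj, of j i] iS t2 by auto
  qed
  have img': "?rem ` ?S' = remaining n st - {v}" and inj': "inj_on ?rem ?S'"
  proof -
    have s: "?S' - {i} = ?S'" using iS(3) by blast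
    have "inj_on ?rem ?S' \<and> v \<notin> ?rem ` ?S'" using inj unfolding iS(2) inj_on_insert s v_def .
    moreover have "insert v (?rem ` ?S') = remaining n st" using img unfolding iS(2) image_insert v_def .
    ultimately show "?rem ` ?S' = remaining n st - {v}" "inj_on ?rem ?S'" by blast+
  qed
  have "card (remaining n st) = card ?S" using card_image[OF inj] img by simp
  also have "card ?S = nat ?t2 + nat (T - i)" using t2 i by (subst card_Un_disjoint) auto
  finally have cardT: "int (card (remaining n st)) \<le> T" using t2 i by simp
  let ?st1 = "st\<lparr>var := (var st)((''v'', []) := v)\<rparr>"
  have k: "0 \<le> k" "0 \<le> T" using net i by (auto simp: net_ok_def shape_ok_def)
  show ?thesis
  proof (cases "D < ar st ''deg'' v")
    case True
    let ?rem' = "?rem(?t2 := v)"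
    have im: "?rem' ` {0..<?t2 + 1} = insert v R"
    proof -
      have e: "{0..<?t2 + 1} = insert ?t2 {0..<?t2}" using t2 by auto
      have "?rem' ` {0..<?t2} = R" unfolding R_def by (intro image_cong) auto
      then show ?thesis unfolding e image_insert fun_upd_same by (rule arg_cong)
    qed
    have im2: "?rem' ` {i + 1..<T} = ?rem ` {i + 1..<T}" using t2 by (intro image_cong) auto
    have "?rem' ` ({0..<?t2 + 1} \<union> {i + 1..<T}) = insert v (?rem ` ?S')"
      by (simp only: image_Un im im2 R_def Un_insert_left)
    also have "\<dots> = remaining n st" unfolding img' using \<open>v \<in> remaining n st\<close> by blast
    finally have 1: "?rem' ` ({0..<?t2 + 1} \<union> {i + 1..<T}) = remaining n st" .
    have 2: "inj_on ?rem' ({0..<?t2 + 1} \<union> {i + 1..<T})"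
    proof -
      have e: "{0..<?t2 + 1} \<union> {i + 1..<T} = insert ?t2 ?S'" using t2 by auto
      have "inj_on ?rem' ?S'" using inj' t2 by (subst inj_on_cong[of _ _ ?rem]) auto
      moreover have "?rem' ` (?S' - {?t2}) = ?rem ` ?S'" using t2 by (intro image_cong) auto
      ultimately show ?thesis unfolding e inj_on_insert using img' by simp
    qed
    have 3: "exposed M (vr st ''cnt'') (insert v R) st = exposed M (vr st ''cnt'') R st + ar st ''deg'' v"
      using vR by (simp add: exposed_def R_def)
    let ?st2 = "?st1\<lparr>arr := (arr st)((''rem'', []) := ?rem'), var := (var st)((''v'', []) := v, (''t2'', []) := ?t2 + 1)\<rparr>"
    have e: "ar ?st2 ''rem'' = ?rem'" "vr ?st2 ''t2'' = ?t2 + 1" "vr ?st2 ''cnt'' = vr st ''cnt''" "ar ?st2 ''el'' = ar st ''el''"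
      "ar ?st2 ''deg'' = ar st ''deg''" "ar ?st2 ''g'' = ar st ''g''" "remaining n ?st2 = remaining n st"
      "exposed M (vr st ''cnt'') (insert v R) ?st2 = exposed M (vr st ''cnt'') (insert v R) st"
      by (simp_all add: remaining_def exposed_def)
    have "net_ok n k M c0 tl0 hd0 ?st2" using net by (simp add: net_ok_def)
    moreover have "D * (?t2 + 1) \<le> exposed M (vr st ''cnt'') (insert v R) st + M"
      using 3 ex True by (simp add: algebra_simps)
    moreover have "\<forall>z. 0 \<le> z \<and> z < n \<and> ar st ''el'' z \<noteq> 0 \<longrightarrow> ar st ''deg'' z = 0" using gone by blast
    moreover have "0 \<le> ?t2 + 1" "?t2 + 1 \<le> i + 1" using t2 by simp_all
    ultimately have "visit_inv n k M c0 tl0 hd0 D T (i + 1) ?st2"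
      unfolding visit_inv_def e im using 1 2 live by (intro conjI)
    moreover have "0 \<le> (2 * K + 700) * min D (2 * (T + 2 * k))" using K D k by simp
    ultimately show ?thesis
      using True i D by (simp add: visit_def v_def stage_pot_def unscanned_def)
  next
    case False
    have "net_ok n k M c0 tl0 hd0 ?st1" using net by (simp add: net_ok_def)
    then have "wp eliminate (\<lambda>t st'. net_ok n k M c0 tl0 hd0 st' \<and> elim_progress M v ?st1 st' \<and> ar st' ''deg'' v = 0 \<and>
     ar st' ''el'' = (ar ?st1 ''el'')(v := 1) \<and>
     int t + K * (vr st' ''L'' + vr st' ''cnt'') + 60 * unscanned M st' \<le>
       K * (vr ?st1 ''L'' + vr ?st1 ''cnt'') + 60 * unscanned M ?st1 + (2 * K + 700) * ar ?st1 ''deg'' v + 50) ?st1"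
      using v by (intro wp_eliminate[OF _ fl _ _ _ _ K]) auto
    then have "wp eliminate (\<lambda>t st'. visit_inv n k M c0 tl0 hd0 D T (i + 1) st' \<and>
     int t + stage_pot K M st' \<le> stage_pot K M st + (50 + (2 * K + 700) * min D (2 * (T + 2 * k)))) ?st1"
    proof (rule wp_conseq_agree, elim conjE)
      fix t :: nat and st'
      assume ag: "agree eliminate ?st1 st'" and net': "net_ok n k M c0 tl0 hd0 st'" and pr: "elim_progress M v ?st1 st'"
        and d: "ar st' ''deg'' v = 0" and el: "ar st' ''el'' = (ar ?st1 ''el'')(v := 1)"
        and t: "int t + K * (vr st' ''L'' + vr st' ''cnt'') + 60 * unscanned M st' \<le>
          K * (vr ?st1 ''L'' + vr ?st1 ''cnt'') + 60 * unscanned M ?st1 + (2 * K + 700) * ar ?st1 ''deg'' v + 50"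
      have fr: "vr st' ''t2'' = ?t2" "ar st' ''rem'' = ?rem"
        using ag[THEN agree_var] ag[THEN agree_arr]
        by (simp_all add: eliminate_def advance_def shortcut_def pick_def lower_def link_def find_arc_def add_cap_def log_op_def)
      have "remaining n st' = remaining n st - {v}" using el by (auto simp: remaining_def)
      moreover have "ar st' ''deg'' z = 0" if "0 \<le> z" "z < n" "ar st' ''el'' z \<noteq> 0" for z
      proof (cases "z = v")
        case False
        then have "ar st ''el'' z \<noteq> 0" using that el by simp
        then show ?thesis using gone that False pr unfolding elim_progress_def by simp
      qed (use d in simp)
      moreover have "exposed M (vr st ''cnt'') R st \<le> exposed M (vr st' ''cnt'') R st'"
        using pr vR unfolding elim_progress_def exposed_def by (simp add: R_def)
      moreover have "nlive M (vr st' ''cnt'') (ar st' ''g'') \<le> M" using pr live unfolding elim_progress_def by simp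
      ultimately have "visit_inv n k M c0 tl0 hd0 D T (i + 1) st'"
        unfolding visit_inv_def fr R_def[symmetric] using net' t2 inj' img' ex by auto
      moreover have "(2 * K + 700) * ar st ''deg'' v \<le> (2 * K + 700) * min D (2 * (T + 2 * k))"
        using deg_le[OF net gone, of v] cardT False K by (intro mult_left_mono) auto
      ultimately show "visit_inv n k M c0 tl0 hd0 D T (i + 1) st' \<and>
        int t + stage_pot K M st' \<le> stage_pot K M st + (50 + (2 * K + 700) * min D (2 * (T + 2 * k)))"
        using t by (simp add: stage_pot_def unscanned_def)
    qed
    then show ?thesis using False i D by (auto simp: visit_def v_def elim!: wp_conseq)
  qed
qed

definition stage_inv where
  "stage_inv n k M c0 tl0 hd0 st \<longleftrightarrow> net_ok n k M c0 tl0 hd0 st \<and>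
     (\<forall>z. 0 \<le> z \<and> z < n \<and> ar st ''el'' z \<noteq> 0 \<longrightarrow> ar st ''deg'' z = 0) \<and>
     0 \<le> vr st ''t'' \<and> inj_on (ar st ''rem'') {0..<vr st ''t''} \<and>
     ar st ''rem'' ` {0..<vr st ''t''} = remaining n st \<and> nlive M (vr st ''cnt'') (ar st ''g'') \<le> M"

text \<open>By double counting, the degree sum of the \<open>t2\<close> postponed vertices is at
  most twice the number of live arcs, so \<open>exposed\<close> is at most that number and hence at
  most \<open>M\<close>. This gives \<open>D * t2 <= 2 * M\<close>, the bound on the size of the
  next stage.\<close>

lemma wp_stage:
  assumes inv: "stage_inv n k M c0 tl0 hd0 st" and fl: "flow_ok n M c0 tl0 hd0" and K: "0 \<le> K"
    and T: "vr st ''t'' = T" and D: "vr st ''D'' = D" "0 \<le> D"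
  shows "wp stage (\<lambda>t st'. stage_inv n k M c0 tl0 hd0 st' \<and> vr st' ''D'' = 2 * D \<and>
     vr st' ''t'' \<le> T \<and> D * vr st' ''t'' \<le> 2 * M \<and>
     int t + stage_pot K M st' \<le> stage_pot K M st + T * (110 + (2 * K + 700) * min D (2 * (T + 2 * k))) + 30) st"
proof -
  let ?st = "st\<lparr>var := (var st)((''i'', []) := 0, (''t2'', []) := 0)\<rparr>"
  let ?W = "100 + (2 * K + 700) * min D (2 * (T + 2 * k))"
  let ?I = "visit_inv n k M c0 tl0 hd0 D T"
  note defs = visit_def eliminate_def advance_def shortcut_def pick_def lower_def link_def find_arc_def add_cap_def log_op_def
  have v0: "vr ?st ''i'' = 0" "vr ?st ''t'' = T" using T by simp_all
  have upd: "?I j (s\<lparr>var := (var s)((''i'', []) := e)\<rparr>) = ?I j s"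
    "stage_pot K M (s\<lparr>var := (var s)((''i'', []) := e)\<rparr>) = stage_pot K M s" for j s e
    by (simp_all add: visit_inv_def net_ok_def remaining_def exposed_def stage_pot_def unscanned_def)
  have "wp (for_loop ''i'' ''t'' visit) (\<lambda>t st'. ?I (vr ?st ''t'') st' \<and> vr st' ''i'' = vr ?st ''t'' \<and>
      int t + stage_pot K M st' \<le> stage_pot K M ?st + (?W + 10) * (vr ?st ''t'' - vr ?st ''i'') + 10) ?st"
  proof (rule wp_for_loop_pot)
    have "nlive M (vr st ''cnt'') (ar st ''g'') \<le> M" using inv by (simp add: stage_inv_def)
    then show "?I (vr ?st ''i'') ?st" using inv T
      by (simp add: stage_inv_def visit_inv_def net_ok_def remaining_def exposed_def)
    show "vr ?st ''i'' \<le> vr ?st ''t''" using inv T by (simp add: stage_inv_def)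
  next
    fix e s
    assume I: "?I e s" and ag: "agree (for_loop ''i'' ''t'' visit) ?st s" and e: "vr s ''i'' = e" "vr ?st ''i'' \<le> e" "e < vr ?st ''t''"
    have "vr s ''D'' = D" using ag[THEN agree_var, of "(''D'', [])"] D by (simp add: defs)
    then have "wp visit (\<lambda>t s'. ?I (e + 1) s' \<and> int t + stage_pot K M s' \<le> stage_pot K M s + ?W) s"
      using e T D by (intro wp_visit[OF I fl K]) auto
    then show "wp visit (\<lambda>t s'. ?I (e + 1) (s'\<lparr>var := (var s')((''i'', []) := e + 1)\<rparr>) \<and>
        int t + stage_pot K M (s'\<lparr>var := (var s')((''i'', []) := e + 1)\<rparr>) \<le> stage_pot K M s + ?W) s"
      unfolding upd .
  qed (simp_all add: defs)
  then have "wp (for_loop ''i'' ''t'' visit;; ''t'' ::= Vr ''t2'';; ''D'' ::= Plus (Vr ''D'') (Vr ''D''))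
   (\<lambda>t st'. stage_inv n k M c0 tl0 hd0 st' \<and> vr st' ''D'' = 2 * D \<and>
     vr st' ''t'' \<le> T \<and> D * vr st' ''t'' \<le> 2 * M \<and>
     int t + stage_pot K M st' \<le> stage_pot K M st + T * (110 + (2 * K + 700) * min D (2 * (T + 2 * k))) + 20) ?st"
  proof (rule wp_SeqI)
    fix t s
    assume *: "?I (vr ?st ''t'') s \<and> vr s ''i'' = vr ?st ''t'' \<and>
      int t + stage_pot K M s \<le> stage_pot K M ?st + (?W + 10) * (vr ?st ''t'' - vr ?st ''i'') + 10"
      and ag: "agree (for_loop ''i'' ''t'' visit) ?st s"
    have Ds: "vr s ''D'' = D" using ag[THEN agree_var, of "(''D'', [])"] D by (simp add: defs)
    have I: "?I T s" using * v0 by simp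
    have deg: "ar s ''deg'' = ndeg M (vr s ''cnt'') (ar s ''tail'') (ar s ''head'') (ar s ''g'')"
      using I by (simp add: visit_inv_def net_ok_def caps_ok_def)
    have "D * vr s ''t2'' \<le> 2 * M"
    proof -
      let ?R = "ar s ''rem'' ` {0..<vr s ''t2''}"
      have "D * vr s ''t2'' \<le> exposed M (vr s ''cnt'') ?R s + M" "nlive M (vr s ''cnt'') (ar s ''g'') \<le> M"
        using I unfolding visit_inv_def by blast+
      moreover have "(\<Sum>z\<in>?R. ar s ''deg'' z) \<le> 2 * nlive M (vr s ''cnt'') (ar s ''g'')"
        unfolding deg by (rule sum_ndeg_le) simp
      ultimately show ?thesis unfolding exposed_def by linarith
    qed
    moreover have "stage_pot K M ?st = stage_pot K M st" by (simp add: stage_pot_def unscanned_def)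
    ultimately show "wp (''t'' ::= Vr ''t2'';; ''D'' ::= Plus (Vr ''D'') (Vr ''D''))
     (\<lambda>u st'. stage_inv n k M c0 tl0 hd0 st' \<and> vr st' ''D'' = 2 * D \<and>
     vr st' ''t'' \<le> T \<and> D * vr st' ''t'' \<le> 2 * M \<and>
     int (t + u) + stage_pot K M st' \<le> stage_pot K M st + T * (110 + (2 * K + 700) * min D (2 * (T + 2 * k))) + 20) s"
      using * I Ds v0
      by (simp add: stage_inv_def visit_inv_def net_ok_def remaining_def stage_pot_def unscanned_def algebra_simps)
  qed
  then show ?thesis unfolding stage_def by (auto elim!: wp_conseq)
qed

text \<open>With \<open>T\<close> vertices and threshold \<open>D = 2 ^ j\<close> a stage costs
  about \<open>T * min D T\<close>. As \<open>T <= n\<close> and, after the first stage,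
  \<open>T * D <= 4 * M\<close>, this is at most \<open>n * 2 ^ j\<close>, at most
  \<open>4 * M\<close>, and at most the square of \<open>4 * M / D\<close>. The extra
  \<open>n\<close> covers the first stage, where no earlier stage has bounded
  \<open>T * D\<close>.\<close>

definition stage_bound :: "real \<Rightarrow> real \<Rightarrow> nat \<Rightarrow> real" where
  "stage_bound n M j = n * of_bool (j = 0) + min (n * 2 ^ j) (min (4 * M) (16 * M\<^sup>2 / 4 ^ j))"

text \<open>The subtracted tail is what lets the induction close.\<close>

lemma sum_quarter: "(\<Sum>j\<in>{b..<b + i}. (1 / 4 :: real) ^ j) \<le> 2 * (1 / 4) ^ b - 2 * (1 / 4) ^ (b + i)"
proof (induction i)
  case (Suc i)
  have "(\<Sum>j\<in>{b..<b + Suc i}. (1 / 4 :: real) ^ j) = (\<Sum>j\<in>{b..<b + i}. (1 / 4) ^ j) + (1 / 4) ^ (b + i)"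
    "(1 / 4 :: real) ^ (b + Suc i) = (1 / 4) ^ (b + i) / 4" by simp_all
  moreover have "(1 / 4 :: real) ^ (b + i) \<ge> 0" by simp
  ultimately show ?case using Suc by linarith
qed simp

text \<open>
  The three regimes of \<open>stage_bound\<close>: geometric growth while \<open>n 2\<^sup>j < M\<close>, geometric decay once
  \<open>M \<le> 4\<^sup>j\<close>, and about \<open>log (n\<^sup>2 / M) / 2\<close> stages of cost \<open>4 M\<close> in between.
\<close>

lemma sum_stage_bound:
  fixes n M :: real
  assumes n: "1 \<le> n" and M: "1 \<le> M"
  shows "(\<Sum>j\<le>J. stage_bound n M j) \<le> n + 42 * M * log 2 (2 + n\<^sup>2 / M)"
proof -
  \<comment> \<open>Growth is the useful bound below \<open>a\<close>, decay from \<open>b\<close>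
    on. If \<open>b < a\<close>, the middle range is empty and the outer ranges overlap, so the sum
    over the cover is only bounded from above.\<close>
  define a where "a = (LEAST j. M \<le> n * 2 ^ j)"
  define b where "b = (LEAST j. M \<le> 4 ^ j)"
  have ex: "\<exists>j. M \<le> 4 ^ j" "\<exists>j. M \<le> n * 2 ^ j"
  proof -
    obtain j where j: "M < 2 ^ j" using real_arch_pow[of 2 M] by auto
    moreover have "(2 :: real) ^ j \<le> 4 ^ j" by (rule power_mono) auto
    moreover have "(2 :: real) ^ j \<le> n * 2 ^ j" using n by simp
    ultimately show "\<exists>j. M \<le> 4 ^ j" "\<exists>j. M \<le> n * 2 ^ j" by (meson less_le_trans less_imp_le)+
  qed
  have a: "M \<le> n * 2 ^ a" and b: "M \<le> 4 ^ b"
    unfolding a_def b_def using ex by (auto intro: LeastI_ex)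
  have a': "n * 2 ^ j < M" if "j < a" for j using not_less_Least[of j] that unfolding a_def by force
  have b': "4 ^ j < M" if "j < b" for j using not_less_Least[of j] that unfolding b_def by force
  let ?l = "log 2 (2 + n\<^sup>2 / M)"
  have nM: "0 \<le> n\<^sup>2 / M" using M by simp
  have l: "1 \<le> ?l" using nM by (simp add: le_log_iff)
  let ?f = "\<lambda>j. min (n * 2 ^ j) (min (4 * M) (16 * M\<^sup>2 / 4 ^ j))"
  have "(\<Sum>j\<le>J. ?f j) \<le> (\<Sum>j\<in>{..<a} \<union> {a..<b} \<union> {b..<b + Suc J}. ?f j)"
    using n M by (intro sum_mono2) auto
  also have "\<dots> \<le> (\<Sum>j\<in>{..<a} \<union> {a..<b}. ?f j) + (\<Sum>j\<in>{b..<b + Suc J}. ?f j)"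
    using n M by (subst sum.union_inter[symmetric]) (auto intro!: sum_nonneg)
  also have "(\<Sum>j\<in>{..<a} \<union> {a..<b}. ?f j) = (\<Sum>j\<in>{..<a}. ?f j) + (\<Sum>j\<in>{a..<b}. ?f j)"
    by (rule sum.union_disjoint) auto
  also have "(\<Sum>j\<in>{..<a}. ?f j) \<le> 2 * M"
  proof -
    have "(\<Sum>j\<in>{..<a}. ?f j) \<le> (\<Sum>j\<in>{..<a}. n * 2 ^ j)" by (rule sum_mono) auto
    also have "\<dots> = n * (2 ^ a - 1)"
    proof -
      have "(\<Sum>j<a. 2 ^ j) = (2 ^ a - 1 :: real)" by (induction a) auto
      then show ?thesis unfolding sum_distrib_left[symmetric] by simp
    qed
    also have "\<dots> \<le> 2 * M"
    proof (cases a)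
      case (Suc i)
      then show ?thesis using a'[of i] n by (simp add: algebra_simps)
    qed (use M in simp)
    finally show ?thesis .
  qed
  also have "(\<Sum>j\<in>{a..<b}. ?f j) \<le> 8 * M * ?l"
  proof (cases "a < b")
    case True
    have "(\<Sum>j\<in>{a..<b}. ?f j) \<le> (\<Sum>j\<in>{a..<b}. 4 * M)" by (rule sum_mono) auto
    also have "\<dots> = 4 * M * real (b - a)" by simp
    also have "real (b - a) \<le> 2 * ?l"
    proof -
      \<comment> \<open>Stage \<open>a + d\<close> is still before \<open>b\<close>, so
        \<open>4 ^ (a + d) < M\<close>, whereas \<open>M <= n * 2 ^ a\<close>. Multiplying the first
        by \<open>M\<close> and squaring the second gives \<open>4 ^ d * M <= n ^ 2\<close>.\<close>
      obtain d where d: "b = Suc (a + d)" using less_imp_Suc_add[OF True] by auto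
      have "4 ^ a * 4 ^ d * M \<le> M * M" using b'[of "a + d"] M by (simp add: d power_add)
      also have "M * M \<le> (n * 2 ^ a) * (n * 2 ^ a)" using a M n by (intro mult_mono) auto
      also have "\<dots> = 4 ^ a * n\<^sup>2" by (simp add: power2_eq_square power_mult_distrib[symmetric] algebra_simps)
      finally have "4 ^ d * M \<le> n\<^sup>2" by (simp add: mult.assoc)
      then have "(4 :: real) ^ d \<le> 2 + n\<^sup>2 / M" using M by (simp add: field_simps)
      moreover have "(4 :: real) ^ d = 2 powr (2 * real d)"
      proof -
        have "(4 :: real) ^ d = 2 ^ (2 * d)" by (simp add: power_mult)
        also have "\<dots> = 2 powr real (2 * d)" by (rule powr_realpow[symmetric]) simp
        finally show ?thesis by simp
      qed
      ultimately have "2 * real d \<le> ?l" using nM by (subst le_log_iff) auto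
      then show ?thesis using l d by simp
    qed
    finally show ?thesis using M by (simp add: mult_left_mono)
  qed (use M l in simp)
  also have "(\<Sum>j\<in>{b..<b + Suc J}. ?f j) \<le> 32 * M"
  proof -
    have "(\<Sum>j\<in>{b..<b + Suc J}. ?f j) \<le> (\<Sum>j\<in>{b..<b + Suc J}. 16 * M\<^sup>2 * (1 / 4) ^ j)"
      by (rule sum_mono) (simp add: power_divide)
    also have "\<dots> = 16 * M\<^sup>2 * (\<Sum>j\<in>{b..<b + Suc J}. (1 / 4) ^ j)" by (simp only: sum_distrib_left)
    also have "\<dots> \<le> 16 * M\<^sup>2 * (2 * (1 / 4) ^ b)"
      using sum_quarter[of b "Suc J"] by (intro mult_left_mono) (auto intro: order_trans)
    also have "\<dots> = 32 * (M * (M / 4 ^ b))" by (simp add: power2_eq_square power_divide)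
    also have "\<dots> \<le> 32 * (M * 1)" using b M by (intro mult_left_mono) (auto simp: field_simps)
    finally show ?thesis by simp
  qed
  \<comment> \<open>The constant 42 is 2 for the growth, 8 for the middle and 32 for the decay, the
    logarithm being at least 1.\<close>
  finally have "(\<Sum>j\<le>J. ?f j) \<le> 2 * M + 8 * M * ?l + 32 * M" by simp
  also have "\<dots> \<le> 42 * M * ?l" using l M mult_left_mono[of 1 ?l "34 * M"] by simp
  finally have "(\<Sum>j\<le>J. ?f j) \<le> 42 * M * ?l" .
  moreover have "(\<Sum>j\<le>J. n * of_bool (j = 0)) = n"
    by (subst sum.mono_neutral_right[of _ "{0}"]) auto
  ultimately show ?thesis unfolding stage_bound_def sum.distrib by simp
qed

text \<open>Potential of the outer loop: the bounds of all stages whose threshold is not below the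
  current one. The cutoff \<open>J\<close> keeps the sum finite.\<close>

definition later_stages :: "real \<Rightarrow> real \<Rightarrow> nat \<Rightarrow> int \<Rightarrow> real" where
  "later_stages n M J D = (\<Sum>j\<in>{j. j \<le> J \<and> D \<le> 2 ^ j}. stage_bound n M j)"

lemma later_stages_Suc:
  assumes "j \<le> J"
  shows "later_stages n M J (2 ^ j) = stage_bound n M j + later_stages n M J (2 * 2 ^ j)"
proof -
  have "{i. i \<le> J \<and> (2 :: int) ^ j \<le> 2 ^ i} = insert j {i. i \<le> J \<and> (2 :: int) ^ Suc j \<le> 2 ^ i}"
    using assms by (auto simp: power_increasing_iff simp del: power_Suc)
  moreover have "j \<notin> {i. i \<le> J \<and> (2 :: int) ^ Suc j \<le> 2 ^ i}" by (auto simp: power_increasing_iff simp del: power_Suc)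
  ultimately show ?thesis by (simp add: later_stages_def)
qed

lemma stage_bound_nonneg: "0 \<le> n \<Longrightarrow> 0 \<le> M \<Longrightarrow> 0 \<le> stage_bound n M j"
  by (simp add: stage_bound_def)

text \<open>The added vertices are absorbed by \<open>2 * (T + 2 * k) <= (2 + 4 * k) * T\<close> for
  \<open>T >= 1\<close>, so that only \<open>T * min D T\<close> remains. The summand 150 collects
  110 per visited vertex and 40 per stage.\<close>

lemma stage_cost_le:
  fixes n M T k K D :: int
  assumes T: "1 \<le> T" "T \<le> n" and D: "D = 2 ^ j" "j = 0 \<or> T * D \<le> 4 * M" and "0 \<le> k" "0 \<le> K" "0 \<le> M"
  shows "real_of_int (T * (110 + (2 * K + 700) * min D (2 * (T + 2 * k))) + 40) \<le>
    real_of_int (150 + (2 * K + 700) * (2 + 4 * k)) * stage_bound (of_int n) (of_int M) j"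
proof -
  let ?m = "min D T"
  have m: "1 \<le> ?m" using T D by simp
  have "2 * (T + 2 * k) \<le> (2 + 4 * k) * T" using T \<open>0 \<le> k\<close> mult_left_mono[of 1 T "4 * k"] by (simp add: algebra_simps)
  moreover have "D \<le> (2 + 4 * k) * D" using D \<open>0 \<le> k\<close> by (simp add: distrib_right)
  ultimately have "min D (2 * (T + 2 * k)) \<le> (2 + 4 * k) * ?m" by (auto simp: min_def)
  then have "(2 * K + 700) * min D (2 * (T + 2 * k)) \<le> (2 * K + 700) * ((2 + 4 * k) * ?m)"
    using \<open>0 \<le> K\<close> by (intro mult_left_mono) auto
  then have "110 + (2 * K + 700) * min D (2 * (T + 2 * k)) \<le> (110 + (2 * K + 700) * (2 + 4 * k)) * ?m"
  proof -
    have "110 + a \<le> (110 + b) * m" if "a \<le> b * m" "1 \<le> m" for a b m :: int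
      using that by (simp add: distrib_right)
    from this[OF _ m] show ?thesis using \<open>(2 * K + 700) * min D (2 * (T + 2 * k)) \<le> _\<close> by (simp only: mult.assoc)
  qed
  then have "T * (110 + (2 * K + 700) * min D (2 * (T + 2 * k))) \<le> T * ((110 + (2 * K + 700) * (2 + 4 * k)) * ?m)"
    using T by (intro mult_left_mono) auto
  moreover have "40 \<le> 40 * (T * ?m)" using T m mult_mono[of 1 T 1 ?m] by simp
  ultimately have "T * (110 + (2 * K + 700) * min D (2 * (T + 2 * k))) + 40 \<le> (150 + (2 * K + 700) * (2 + 4 * k)) * (T * ?m)"
    by (simp add: algebra_simps)
  then have "real_of_int (T * (110 + (2 * K + 700) * min D (2 * (T + 2 * k))) + 40) \<le>
    real_of_int (150 + (2 * K + 700) * (2 + 4 * k)) * of_int (T * ?m)" by (metis of_int_le_iff of_int_mult)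
  also have "\<dots> \<le> real_of_int (150 + (2 * K + 700) * (2 + 4 * k)) * stage_bound (of_int n) (of_int M) j"
  proof (rule mult_left_mono)
    show "real_of_int (T * ?m) \<le> stage_bound (of_int n) (of_int M) j"
    proof (cases "j = 0")
      case True
      have "T * ?m \<le> n" using T D True by simp
      then have "real_of_int (T * ?m) \<le> of_int n" by (rule of_int_le_iff[THEN iffD2])
      moreover have "0 \<le> min (real_of_int n * 2 ^ j) (min (4 * of_int M) (16 * (of_int M)\<^sup>2 / 4 ^ j))"
        using T \<open>0 \<le> M\<close> by simp
      ultimately show ?thesis using True unfolding stage_bound_def by (simp only: of_bool_eq mult_1_right simp_thms)
    next
      case False
      then have TD: "T * D \<le> 4 * M" using D by simp
      have le: "T * ?m \<le> T * D" "T * ?m \<le> T * T" using T by (auto intro: mult_left_mono)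
      have "T * D \<le> n * 2 ^ j" unfolding D using T by simp
      with le(1) have "T * ?m \<le> n * 2 ^ j" by (rule order_trans)
      then have "real_of_int (T * ?m) \<le> of_int (n * 2 ^ j)" by (rule of_int_le_iff[THEN iffD2])
      then have 1: "real_of_int (T * ?m) \<le> of_int n * 2 ^ j" by (simp only: of_int_mult of_int_power of_int_numeral)
      have "T * ?m \<le> 4 * M" using le(1) TD by (rule order_trans)
      then have "real_of_int (T * ?m) \<le> of_int (4 * M)" by (rule of_int_le_iff[THEN iffD2])
      then have 2: "real_of_int (T * ?m) \<le> 4 * of_int M" by (simp only: of_int_mult of_int_numeral)
      have "(T * D) * (T * D) \<le> (4 * M) * (4 * M)" using T D \<open>0 \<le> M\<close> by (intro mult_mono[OF TD TD]) simp_all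
      then have "T * T * 4 ^ j \<le> 16 * M\<^sup>2"
        unfolding D by (simp add: power2_eq_square algebra_simps flip: power_mult_distrib)
      then have "T * ?m * 4 ^ j \<le> 16 * M\<^sup>2" using le(2) by (smt (verit) mult_right_mono zero_le_power)
      then have "real_of_int (T * ?m * 4 ^ j) \<le> of_int (16 * M\<^sup>2)" by (rule of_int_le_iff[THEN iffD2])
      then have 3: "real_of_int (T * ?m) \<le> 16 * (of_int M)\<^sup>2 / 4 ^ j" by (simp add: field_simps)
      show ?thesis using 1 2 3 False unfolding stage_bound_def by (simp del: of_int_mult)
    qed
  qed (use \<open>0 \<le> k\<close> \<open>0 \<le> K\<close> in simp)
  finally show ?thesis .
qed

lemma wp_elim_all:
  fixes n k M K :: int
  defines "W \<equiv> real_of_int (150 + (2 * K + 700) * (2 + 4 * k))"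
  assumes inv: "stage_inv n k M c0 tl0 hd0 st0" and fl: "flow_ok n M c0 tl0 hd0" and K: "0 \<le> K"
    and n: "1 \<le> n" and M: "1 \<le> M" and k: "0 \<le> k" and t: "vr st0 ''t'' \<le> n"
  shows "wp elim_all (\<lambda>t st'. stage_inv n k M c0 tl0 hd0 st' \<and> vr st' ''t'' = 0 \<and>
     real t + real_of_int (stage_pot K M st') \<le> real_of_int (stage_pot K M st0) +
       W * (of_int n + 42 * of_int M * log 2 (2 + (of_int n)\<^sup>2 / of_int M)) + 20) st0"
proof -
  \<comment> \<open>A stage \<open>j > 0\<close> that still has a vertex satisfies
    \<open>2 ^ j <= 4 * M\<close>, hence \<open>j <= 4 * M\<close>.\<close>
  define J where "J = nat (4 * M)"
  let ?st = "st0\<lparr>var := (var st0)((''D'', []) := 1)\<rparr>"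
  let ?b = "Less (Const 0) (Vr ''t'')"
  let ?I = "\<lambda>st. stage_inv n k M c0 tl0 hd0 st \<and> vr st ''t'' \<le> n \<and>
     (\<exists>j. vr st ''D'' = 2 ^ j \<and> (j = 0 \<or> vr st ''t'' * vr st ''D'' \<le> 4 * M))"
  let ?L = "later_stages (of_int n) (of_int M) J"
  let ?\<phi> = "\<lambda>st. real_of_int (stage_pot K M st) + W * ?L (vr st ''D'')"
  have W: "0 \<le> W" using K k by (simp add: W_def)
  have "wp (While ?b stage) (\<lambda>t st'. ?I st' \<and> \<not> bval ?b st' \<and> real t + ?\<phi> st' \<le> ?\<phi> ?st + real (1 + bcost ?b)) ?st"
  proof (rule wp_While[where \<mu> = "\<lambda>st. card {j. j \<le> J \<and> vr st ''D'' \<le> 2 ^ j}"])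
    show "?I ?st" using inv t by (simp add: stage_inv_def net_ok_def remaining_def) (metis power_0)
  next
    fix st
    assume I: "?I st" and b: "bval ?b st"
    let ?T = "vr st ''t''" and ?D = "vr st ''D''"
    obtain j where j: "?D = 2 ^ j" "j = 0 \<or> ?T * ?D \<le> 4 * M" using I by blast
    have T: "1 \<le> ?T" "?T \<le> n" using I b by auto
    have jJ: "j \<le> J"
    proof (cases "j = 0")
      case False
      then have "(2 :: int) ^ j \<le> 4 * M" using j T by (smt (verit) mult_le_cancel_right1 zero_less_power)
      moreover have "int j < 2 ^ j" using less_exp[of j] by (metis of_nat_less_iff of_nat_numeral of_nat_power)
      ultimately show ?thesis unfolding J_def by linarith
    qed simp
    have "{i. i \<le> J \<and> 2 * ?D \<le> 2 ^ i} \<subset> {i. i \<le> J \<and> ?D \<le> 2 ^ i}"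
    proof (rule psubsetI)
      show "{i. i \<le> J \<and> 2 * ?D \<le> 2 ^ i} \<subseteq> {i. i \<le> J \<and> ?D \<le> 2 ^ i}"
      proof (rule Collect_mono, rule impI)
        have "0 \<le> ?D" using j(1) by simp
        then show "i \<le> J \<and> ?D \<le> 2 ^ i" if "i \<le> J \<and> 2 * ?D \<le> 2 ^ i" for i using that by linarith
      qed
      have "j \<in> {i. i \<le> J \<and> ?D \<le> 2 ^ i} - {i. i \<le> J \<and> 2 * ?D \<le> 2 ^ i}" using j jJ by simp
      then show "{i. i \<le> J \<and> 2 * ?D \<le> 2 ^ i} \<noteq> {i. i \<le> J \<and> ?D \<le> 2 ^ i}" by blast
    qed
    then have mu: "card {i. i \<le> J \<and> 2 * ?D \<le> 2 ^ i} < card {i. i \<le> J \<and> ?D \<le> 2 ^ i}"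
      by (intro psubset_card_mono) auto
    have M0: "0 \<le> M" using M by simp
    note cost = stage_cost_le[OF T j k K M0, folded W_def]
    have D0: "0 \<le> ?D" using j by simp
    show "wp stage (\<lambda>t st'. ?I st' \<and> card {j. j \<le> J \<and> vr st' ''D'' \<le> 2 ^ j} < card {j. j \<le> J \<and> vr st ''D'' \<le> 2 ^ j} \<and>
       real t + real (1 + bcost ?b) + ?\<phi> st' \<le> ?\<phi> st) st"
    proof (rule wp_conseq[OF wp_stage[OF I[THEN conjunct1] fl K refl refl D0]], elim conjE)
      fix t :: nat and st'
      assume s: "stage_inv n k M c0 tl0 hd0 st'" "vr st' ''D'' = 2 * ?D" "vr st' ''t'' \<le> ?T" "?D * vr st' ''t'' \<le> 2 * M"
        and c: "int t + stage_pot K M st' \<le> stage_pot K M st + ?T * (110 + (2 * K + 700) * min ?D (2 * (?T + 2 * k))) + 30"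
      have "real_of_int (int t + stage_pot K M st') \<le> of_int (stage_pot K M st + ?T * (110 + (2 * K + 700) * min ?D (2 * (?T + 2 * k))) + 30)"
        using c by (rule of_int_le_iff[THEN iffD2])
      moreover have "?L ?D = stage_bound (of_int n) (of_int M) j + ?L (2 * ?D)"
        unfolding j(1) by (rule later_stages_Suc[OF jJ])
      ultimately have "real t + real (1 + bcost ?b) + ?\<phi> st' \<le> ?\<phi> st"
        using cost s(2) by (simp add: distrib_left)
      moreover have "vr st' ''D'' = 2 ^ Suc j" "vr st' ''t'' * vr st' ''D'' \<le> 4 * M" using s j by (simp_all add: mult.commute)
      ultimately show "?I st' \<and> card {j. j \<le> J \<and> vr st' ''D'' \<le> 2 ^ j} < card {j. j \<le> J \<and> vr st ''D'' \<le> 2 ^ j} \<and>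
       real t + real (1 + bcost ?b) + ?\<phi> st' \<le> ?\<phi> st"
        using s mu T by (metis order_trans)
    qed
  qed
  then have "wp (While ?b stage) (\<lambda>t st'. stage_inv n k M c0 tl0 hd0 st' \<and> vr st' ''t'' = 0 \<and>
     real t + real_of_int (stage_pot K M st') \<le> real_of_int (stage_pot K M st0) +
       W * (of_int n + 42 * of_int M * log 2 (2 + (of_int n)\<^sup>2 / of_int M)) + 10) ?st"
  proof (rule wp_conseq, elim conjE)
    fix t :: nat and st'
    assume s: "stage_inv n k M c0 tl0 hd0 st'" "\<not> bval ?b st'" and c: "real t + ?\<phi> st' \<le> ?\<phi> ?st + real (1 + bcost ?b)"
    have "?L 1 = (\<Sum>j\<le>J. stage_bound (of_int n) (of_int M) j)"
      unfolding later_stages_def by (rule sum.cong) auto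
    also have "\<dots> \<le> of_int n + 42 * of_int M * log 2 (2 + (of_int n)\<^sup>2 / of_int M)"
      using n M by (intro sum_stage_bound) auto
    finally have "W * ?L 1 \<le> W * (of_int n + 42 * of_int M * log 2 (2 + (of_int n)\<^sup>2 / of_int M))"
      using W by (rule mult_left_mono)
    moreover have "0 \<le> W * ?L (vr st' ''D'')"
      using W n M unfolding later_stages_def by (intro mult_nonneg_nonneg sum_nonneg stage_bound_nonneg) auto
    moreover have "vr st' ''t'' = 0" using s by (auto simp: stage_inv_def)
    moreover have "stage_pot K M ?st = stage_pot K M st0" by (simp add: stage_pot_def unscanned_def)
    ultimately show "stage_inv n k M c0 tl0 hd0 st' \<and> vr st' ''t'' = 0 \<and>
     real t + real_of_int (stage_pot K M st') \<le> real_of_int (stage_pot K M st0) +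
       W * (of_int n + 42 * of_int M * log 2 (2 + (of_int n)\<^sup>2 / of_int M)) + 10"
      using s c by simp
  qed
  then show ?thesis unfolding elim_all_def by (auto elim!: wp_conseq)
qed

section \<open>Splitting the flow by undoing the moves\<close>

text \<open>A list, because the loop over ordered pairs is written out in the program text, with one
  array for each pair.\<close>

definition pairs :: "nat \<Rightarrow> (nat \<times> nat) list" where
  "pairs k = List.product [1..<k + 1] [1..<k + 1]"

lemma set_pairs: "set (pairs k) = {1..k} \<times> {1..k}"
  by (auto simp: pairs_def)

lemma distinct_pairs: "distinct (pairs k)"
  by (auto simp: pairs_def distinct_product)

lemma length_pairs: "length (pairs k) = k * k"
  by (simp add: pairs_def)

definition part :: "store \<Rightarrow> nat \<times> nat \<Rightarrow> int \<Rightarrow> int" where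
  "part st c = arr st (''F'', [fst c, snd c])"

abbreviation part_id :: "nat \<times> nat \<Rightarrow> ident" where
  "part_id c \<equiv> (''F'', [fst c, snd c])"

text \<open>Greedy withdrawal of the remaining \<open>x\<close> units from node \<open>r\<close>. A
  unit taken off \<open>r\<close> had run through both \<open>p\<close> and \<open>q\<close>, so
  each of them receives it.\<close>

definition take_part :: "nat \<times> nat \<Rightarrow> com" where
  "take_part c =
     (''y'' ::= Elem (part_id c) (Vr ''r'');; If (Less (Vr ''x'') (Vr ''y'')) (''y'' ::= Vr ''x'') Skip;;
      Update (part_id c) (Vr ''r'') (Minus (Elem (part_id c) (Vr ''r'')) (Vr ''y''));;
      Update (part_id c) (Vr ''p'') (Plus (Elem (part_id c) (Vr ''p'')) (Vr ''y''));;
      Update (part_id c) (Vr ''q'') (Plus (Elem (part_id c) (Vr ''q'')) (Vr ''y''));;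
      ''x'' ::= Minus (Vr ''x'') (Vr ''y''))"

definition undo_op :: "nat \<Rightarrow> com" where
  "undo_op k =
     (''p'' ::= Ar ''lp'' (Vr ''L'');; ''q'' ::= Ar ''lq'' (Vr ''L'');; ''r'' ::= Ar ''lr'' (Vr ''L'');;
      ''x'' ::= Ar ''lx'' (Vr ''L'');; ''L'' ::= Minus (Vr ''L'') (Const 1);;
      seqs (map take_part (pairs k)))"

definition undo_all :: "nat \<Rightarrow> com" where
  "undo_all k = While (Less (Const 0) (Vr ''L'')) (undo_op k)"

lemma written_seqs:
  "written_vars (seqs (map f xs)) = (\<Union>x\<in>set xs. written_vars (f x))"
  "written_arrs (seqs (map f xs)) = (\<Union>x\<in>set xs. written_arrs (f x))"
  by (induction xs) auto

lemma wp_take_part: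
  "wp (take_part c) (\<lambda>t st'. t \<le> 60 \<and>
     (\<exists>y. y = min (vr st ''x'') (part st c (vr st ''r'')) \<and> vr st' ''x'' = vr st ''x'' - y \<and>
       vr st' ''p'' = vr st ''p'' \<and> vr st' ''q'' = vr st ''q'' \<and> vr st' ''r'' = vr st ''r'' \<and>
       (vr st ''p'' \<noteq> vr st ''r'' \<and> vr st ''q'' \<noteq> vr st ''r'' \<and> vr st ''p'' \<noteq> vr st ''q'' \<longrightarrow>
         (\<forall>z. part st' c z = part st c z +
            y * (of_bool (vr st ''p'' = z) + of_bool (vr st ''q'' = z) - of_bool (vr st ''r'' = z)))) \<and>
       (\<forall>d. d \<noteq> c \<longrightarrow> part st' d = part st d))) st"
proof (cases "vr st ''x'' < part st c (vr st ''r'')")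
  case True
  then show ?thesis
    by (auto simp: take_part_def part_def prod_eq_iff)
next
  case False
  then show ?thesis
    by (auto simp: take_part_def part_def prod_eq_iff)
qed

lemma wp_take_parts:
  fixes st1 :: store
  defines "p \<equiv> vr st1 ''p''" and "q \<equiv> vr st1 ''q''" and "r \<equiv> vr st1 ''r''" and "x1 \<equiv> vr st1 ''x''"
  assumes ne: "p \<noteq> r" "q \<noteq> r" "p \<noteq> q"
    and nn: "\<And>c z. c \<in> set (pairs k) \<Longrightarrow> 0 \<le> part st1 c z"
    and x: "0 \<le> x1" "x1 \<le> (\<Sum>c\<in>set (pairs k). part st1 c r)"
  shows "wp (seqs (map take_part (pairs k))) (\<lambda>t st'. (\<exists>y. (\<forall>c\<in>set (pairs k). 0 \<le> y c \<and> y c \<le> part st1 c r \<and>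
      (\<forall>z. part st' c z = part st1 c z + y c * (of_bool (p = z) + of_bool (q = z) - of_bool (r = z)))) \<and>
      (\<Sum>c\<in>set (pairs k). y c) = x1) \<and> int t \<le> 60 * int (length (pairs k)) + 1) st1"
proof -
  let ?cs = "pairs k"
  \<comment> \<open>The final disjunction is the greedy invariant: either all \<open>x1\<close>
    units have been placed, or every part seen so far was drained at \<open>r\<close>. In the second
    case the upper bound on \<open>x1\<close> forces the remainder to be 0 at the end.\<close>
  let ?I = "\<lambda>i st. vr st ''p'' = p \<and> vr st ''q'' = q \<and> vr st ''r'' = r \<and>
    (\<exists>y. (\<forall>c\<in>set (take i ?cs). 0 \<le> y c \<and> y c \<le> part st1 c r \<and>
      (\<forall>z. part st c z = part st1 c z + y c * (of_bool (p = z) + of_bool (q = z) - of_bool (r = z)))) \<and>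
     (\<forall>c\<in>set (drop i ?cs). part st c = part st1 c) \<and>
     vr st ''x'' = x1 - (\<Sum>c\<in>set (take i ?cs). y c) \<and> 0 \<le> vr st ''x'' \<and>
     (vr st ''x'' = 0 \<or> (\<forall>c\<in>set (take i ?cs). y c = part st1 c r)))"
  have "wp (seqs (map take_part ?cs)) (\<lambda>t st'. ?I (length ?cs) st' \<and> int t \<le> 60 * int (length ?cs) + 1) st1"
  proof (rule wp_seqs)
    show "?I 0 st1" using x by (auto simp: p_def q_def r_def x1_def)
  next
    fix i st
    assume i: "i < length ?cs" and I: "?I i st"
    let ?c = "?cs ! i"
    obtain y where v: "vr st ''p'' = p" "vr st ''q'' = q" "vr st ''r'' = r"
      and y: "\<And>c. c \<in> set (take i ?cs) \<Longrightarrow> 0 \<le> y c \<and> y c \<le> part st1 c r \<and>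
        (\<forall>z. part st c z = part st1 c z + y c * (of_bool (p = z) + of_bool (q = z) - of_bool (r = z)))"
      and rest: "\<And>c. c \<in> set (drop i ?cs) \<Longrightarrow> part st c = part st1 c"
      and xs: "vr st ''x'' = x1 - (\<Sum>c\<in>set (take i ?cs). y c)" "0 \<le> vr st ''x''"
        "vr st ''x'' = 0 \<or> (\<forall>c\<in>set (take i ?cs). y c = part st1 c r)"
      using I by blast
    have tk: "set (take (Suc i) ?cs) = insert ?c (set (take i ?cs))" using i by (simp add: take_Suc_conv_app_nth)
    have dr: "drop i ?cs = ?c # drop (Suc i) ?cs" using i by (simp add: Cons_nth_drop_Suc)
    have "distinct (take i ?cs @ ?c # drop (Suc i) ?cs)" using distinct_pairs[of k] append_take_drop_id[of i ?cs] unfolding dr by simp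
    then have new: "?c \<notin> set (take i ?cs)" "?c \<notin> set (drop (Suc i) ?cs)"
      "set (take i ?cs) \<inter> set (drop (Suc i) ?cs) = {}" by auto
    have cin: "?c \<in> set ?cs" using i by simp
    have pc: "part st ?c = part st1 ?c" using rest dr by simp
    show "wp (take_part ?c) (\<lambda>t st'. ?I (Suc i) st' \<and> int t \<le> 60) st"
    proof (rule wp_conseq[OF wp_take_part], elim conjE exE)
      fix t :: nat and st' yc
      assume t: "t \<le> 60" and yc: "yc = min (vr st ''x'') (part st ?c (vr st ''r''))"
        and x': "vr st' ''x'' = vr st ''x'' - yc"
        and v': "vr st' ''p'' = vr st ''p''" "vr st' ''q'' = vr st ''q''" "vr st' ''r'' = vr st ''r''"
        and pt: "vr st ''p'' \<noteq> vr st ''r'' \<and> vr st ''q'' \<noteq> vr st ''r'' \<and> vr st ''p'' \<noteq> vr st ''q'' \<longrightarrow>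
          (\<forall>z. part st' ?c z = part st ?c z +
            yc * (of_bool (vr st ''p'' = z) + of_bool (vr st ''q'' = z) - of_bool (vr st ''r'' = z)))"
        and oth: "\<forall>d. d \<noteq> ?c \<longrightarrow> part st' d = part st d"
      let ?y = "y(?c := yc)"
      have yc': "yc = min (vr st ''x'') (part st1 ?c r)" using yc pc v by simp
      have pt': "part st' ?c z = part st1 ?c z + yc * (of_bool (p = z) + of_bool (q = z) - of_bool (r = z))" for z
        using pt ne pc v by simp
      have "0 \<le> yc \<and> yc \<le> part st1 ?c r" using yc' xs(2) nn[OF cin, of r] by simp
      then have 1: "\<forall>c\<in>set (take (Suc i) ?cs). 0 \<le> ?y c \<and> ?y c \<le> part st1 c r \<and>
        (\<forall>z. part st' c z = part st1 c z + ?y c * (of_bool (p = z) + of_bool (q = z) - of_bool (r = z)))"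
        unfolding tk using y oth pt' by auto
      have 2: "\<forall>c\<in>set (drop (Suc i) ?cs). part st' c = part st1 c"
      proof
        fix c assume c: "c \<in> set (drop (Suc i) ?cs)"
        then have "c \<noteq> ?c" using new(2) by blast
        then have "part st' c = part st c" using oth by blast
        then show "part st' c = part st1 c" using rest[of c] c dr by simp
      qed
      have "(\<Sum>c\<in>set (take (Suc i) ?cs). ?y c) = yc + (\<Sum>c\<in>set (take i ?cs). y c)"
        unfolding tk using new by (simp add: sum.insert) (rule sum.cong, auto)
      then have 3: "vr st' ''x'' = x1 - (\<Sum>c\<in>set (take (Suc i) ?cs). ?y c)" using x' xs(1) by simp
      have 4: "0 \<le> vr st' ''x''" using x' yc' by simp
      have 5: "vr st' ''x'' = 0 \<or> (\<forall>c\<in>set (take (Suc i) ?cs). ?y c = part st1 c r)"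
        unfolding tk using xs(2,3) x' yc' nn[OF cin, of r] by (auto simp: min_def split: if_splits)
      show "?I (Suc i) st' \<and> int t \<le> 60"
        using 1 2 3 4 5 v v' t by (intro conjI exI[of _ ?y]) simp_all
    qed
  qed
  then show ?thesis
  proof (rule wp_conseq, elim conjE exE)
    fix t st' y
    assume y: "\<forall>c\<in>set (take (length ?cs) ?cs). 0 \<le> y c \<and> y c \<le> part st1 c r \<and>
        (\<forall>z. part st' c z = part st1 c z + y c * (of_bool (p = z) + of_bool (q = z) - of_bool (r = z)))"
      and x': "vr st' ''x'' = x1 - (\<Sum>c\<in>set (take (length ?cs) ?cs). y c)" "0 \<le> vr st' ''x''"
        "vr st' ''x'' = 0 \<or> (\<forall>c\<in>set (take (length ?cs) ?cs). y c = part st1 c r)"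
      and t: "int t \<le> 60 * int (length ?cs) + 1"
    have "(\<Sum>c\<in>set ?cs. y c) = x1"
    proof (cases "vr st' ''x'' = 0")
      case False
      then have "(\<Sum>c\<in>set ?cs. y c) = (\<Sum>c\<in>set ?cs. part st1 c r)" using x'(3) by (intro sum.cong) auto
      then show ?thesis using x x' by simp
    qed (use x' in simp)
    then show "(\<exists>y. (\<forall>c\<in>set ?cs. 0 \<le> y c \<and> y c \<le> part st1 c r \<and>
      (\<forall>z. part st' c z = part st1 c z + y c * (of_bool (p = z) + of_bool (q = z) - of_bool (r = z)))) \<and>
      (\<Sum>c\<in>set ?cs. y c) = x1) \<and> int t \<le> 60 * int (length ?cs) + 1"
      using y t by (intro conjI exI[of _ y]) auto
  qed
qed

text \<open>\<open>cap\<close> is the capacity function at the current point of the log and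
  \<open>\<beta> c\<close> the divergence of part \<open>c\<close>. Undoing a move changes the
  former and preserves the latter.\<close>

definition split_ok where
  "split_ok k cap cnt src dst \<beta> st \<longleftrightarrow>
     (\<forall>p\<in>{0..cnt}. (\<Sum>c\<in>set (pairs k). part st c p) = cap p) \<and>
     (\<forall>c\<in>set (pairs k). (\<forall>z. 0 \<le> part st c z) \<and>
        (\<forall>v. (\<Sum>p\<in>{0..cnt}. part st c p * bd src dst p v) = \<beta> c v))"

lemma capat_pred:
  assumes "0 < j"
  shows "capat c0 lp lq lr lx j z = capat c0 lp lq lr lx (j - 1) z +
    lx j * (of_bool (lr j = z) - of_bool (lp j = z) - of_bool (lq j = z))"
  unfolding capat_def using sum_upto_Suc[of 0 "j - 1"] assms by simp

lemma wp_undo_op: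
  fixes st :: store
  defines "cnt \<equiv> vr st ''cnt''" and "src \<equiv> ar st ''tail''" and "dst \<equiv> ar st ''head''" and "L \<equiv> vr st ''L''"
    and "lp \<equiv> ar st ''lp''" and "lq \<equiv> ar st ''lq''" and "lr \<equiv> ar st ''lr''" and "lx \<equiv> ar st ''lx''"
  assumes sp: "split_ok k (capat c0 lp lq lr lx L) cnt src dst \<beta> st" and lg: "log_ok c0 cnt src dst cap L0 lp lq lr lx"
    and L: "0 < L" "L \<le> L0"
  shows "wp (undo_op k) (\<lambda>t st'. split_ok k (capat c0 lp lq lr lx (L - 1)) cnt src dst \<beta> st' \<and> vr st' ''L'' = L - 1 \<and>
     int t \<le> 60 * int (length (pairs k)) + 31) st"
proof -
  let ?p = "lp L" and ?q = "lq L" and ?r = "lr L" and ?x = "lx L"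
  let ?st = "st\<lparr>var := (var st)((''p'', []) := ?p, (''q'', []) := ?q, (''r'', []) := ?r, (''x'', []) := ?x, (''L'', []) := L - 1)\<rparr>"
  let ?cap = "capat c0 lp lq lr lx L" and ?cap' = "capat c0 lp lq lr lx (L - 1)"
  have l: "?p \<in> {0..cnt}" "?q \<in> {0..cnt}" "?r \<in> {0..cnt}" "?p \<noteq> ?r" "?q \<noteq> ?r" "?p \<noteq> ?q" "0 \<le> ?x"
    "\<And>v. bd src dst ?p v + bd src dst ?q v = bd src dst ?r v"
    using lg L unfolding log_ok_def by blast+
  have cap: "?cap z = ?cap' z + ?x * (of_bool (?r = z) - of_bool (?p = z) - of_bool (?q = z))" for z
    by (rule capat_pred[OF L(1)])
  \<comment> \<open>The moved units were added to a nonnegative capacity, so at least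
    \<open>lx L\<close> units are present on \<open>r\<close> to be withdrawn.\<close>
  have "0 \<le> ?cap' ?r" using lg L unfolding log_ok_def by simp
  then have xr: "?x \<le> ?cap ?r" using cap[of ?r] l by simp
  have part_st: "part ?st = part st" by (rule ext) (simp add: part_def)
  have sum_r: "(\<Sum>c\<in>set (pairs k). part st c ?r) = ?cap ?r" using sp l(3) unfolding split_ok_def by blast
  have "wp (seqs (map take_part (pairs k))) (\<lambda>t st'. (\<exists>y. (\<forall>c\<in>set (pairs k). 0 \<le> y c \<and> y c \<le> part ?st c ?r \<and>
      (\<forall>z. part st' c z = part ?st c z + y c * (of_bool (?p = z) + of_bool (?q = z) - of_bool (?r = z)))) \<and>
      (\<Sum>c\<in>set (pairs k). y c) = ?x) \<and> int t \<le> 60 * int (length (pairs k)) + 1) ?st"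
    using wp_take_parts[of ?st k] l xr sum_r sp unfolding split_ok_def part_st by simp
  then have "wp (seqs (map take_part (pairs k))) (\<lambda>t st'. split_ok k ?cap' cnt src dst \<beta> st' \<and> vr st' ''L'' = L - 1 \<and>
     int t \<le> 60 * int (length (pairs k)) + 1) ?st"
  proof (rule wp_conseq_agree, elim conjE exE)
    fix t st' y
    assume ag: "agree (seqs (map take_part (pairs k))) ?st st'"
      and y: "\<forall>c\<in>set (pairs k). 0 \<le> y c \<and> y c \<le> part ?st c ?r \<and>
        (\<forall>z. part st' c z = part ?st c z + y c * (of_bool (?p = z) + of_bool (?q = z) - of_bool (?r = z)))"
      and sy: "(\<Sum>c\<in>set (pairs k). y c) = ?x" and t: "int t \<le> 60 * int (length (pairs k)) + 1"
    have pt: "part st' c z = part st c z + y c * (of_bool (?p = z) + of_bool (?q = z) - of_bool (?r = z))"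
      and yc: "0 \<le> y c" "y c \<le> part st c ?r" if "c \<in> set (pairs k)" for c z
      using y that unfolding part_st by blast+
    have "(\<Sum>c\<in>set (pairs k). part st' c z) = ?cap' z" if z: "z \<in> {0..cnt}" for z
    proof -
      have "(\<Sum>c\<in>set (pairs k). part st' c z) =
        (\<Sum>c\<in>set (pairs k). part st c z) + (\<Sum>c\<in>set (pairs k). y c) * (of_bool (?p = z) + of_bool (?q = z) - of_bool (?r = z))"
        unfolding sum_distrib_right sum.distrib[symmetric] by (rule sum.cong) (simp_all add: pt)
      also have "\<dots> = ?cap' z" using sp z sy cap[of z] unfolding split_ok_def by (simp add: algebra_simps)
      finally show ?thesis .
    qed
    moreover have "0 \<le> part st' c z" if c: "c \<in> set (pairs k)" for c z
    proof -
      have "0 \<le> part st c z" using sp c unfolding split_ok_def by blast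
      then show ?thesis using pt[OF c, of z] yc[OF c] l(4,5) by (cases "z = ?r") auto
    qed
    moreover have "(\<Sum>p\<in>{0..cnt}. part st' c p * bd src dst p v) = \<beta> c v" if c: "c \<in> set (pairs k)" for c v
    proof -
      have "(\<Sum>p\<in>{0..cnt}. part st' c p * bd src dst p v) =
        (\<Sum>p\<in>{0..cnt}. part st c p * bd src dst p v) + y c * ((\<Sum>p\<in>{0..cnt}. of_bool (?p = p) * bd src dst p v) +
          (\<Sum>p\<in>{0..cnt}. of_bool (?q = p) * bd src dst p v) - (\<Sum>p\<in>{0..cnt}. of_bool (?r = p) * bd src dst p v))"
        unfolding sum.distrib[symmetric] sum_subtractf[symmetric] sum_distrib_left
        by (rule sum.cong) (simp_all add: pt[OF c] algebra_simps)
      also have "\<dots> = (\<Sum>p\<in>{0..cnt}. part st c p * bd src dst p v) + y c * (bd src dst ?p v + bd src dst ?q v - bd src dst ?r v)"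
        using l(1-3) by (simp only: sum_of_bool_bd finite_atLeastAtMost_int)
      also have "\<dots> = \<beta> c v" using sp c l(8)[of v] unfolding split_ok_def by simp
      finally show ?thesis .
    qed
    moreover have "vr st' ''L'' = L - 1"
      using ag[THEN agree_var, of "(''L'', [])"] by (auto simp: written_seqs take_part_def)
    ultimately show "split_ok k ?cap' cnt src dst \<beta> st' \<and> vr st' ''L'' = L - 1 \<and>
     int t \<le> 60 * int (length (pairs k)) + 1" using t unfolding split_ok_def by blast
  qed
  then show ?thesis
    unfolding undo_op_def using L by (auto simp: L_def lp_def lq_def lr_def lx_def elim!: wp_conseq)
qed

lemma wp_undo_all:
  fixes st0 :: store
  defines "cnt \<equiv> vr st0 ''cnt''" and "src \<equiv> ar st0 ''tail''" and "dst \<equiv> ar st0 ''head''" and "L \<equiv> vr st0 ''L''"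
  assumes sp: "split_ok k (ar st0 ''g'') cnt src dst \<beta> st0" and lg: "log_st c0 st0"
  shows "wp (undo_all k) (\<lambda>t st'. split_ok k c0 cnt src dst \<beta> st' \<and>
     int t \<le> (60 * int (k * k) + 40) * L + 10) st0"
proof -
  let ?C = "60 * int (k * k) + 40" and ?cap = "capat c0 (ar st0 ''lp'') (ar st0 ''lq'') (ar st0 ''lr'') (ar st0 ''lx'')"
  let ?I = "\<lambda>st. split_ok k (?cap (vr st ''L'')) cnt src dst \<beta> st \<and> 0 \<le> vr st ''L'' \<and> vr st ''L'' \<le> L"
  let ?b = "Less (Const 0) (Vr ''L'')"
  have L0: "0 \<le> L" using lg by (simp add: log_ok_def L_def)
  have "wp (While ?b (undo_op k)) (\<lambda>t st'. ?I st' \<and> \<not> bval ?b st' \<and> int t + ?C * vr st' ''L'' \<le> ?C * vr st0 ''L'' + int (1 + bcost ?b)) st0"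
  proof (rule wp_While_int[where \<mu> = "\<lambda>st. nat (vr st ''L'')"])
    show "?I st0" using sp lg L0 by (simp add: L_def log_ok_def)
  next
    fix st
    assume I: "?I st" and ag: "agree (undo_op k) st0 st" and b: "bval ?b st"
    have v: "vr st ''cnt'' = cnt"
      using ag[THEN agree_var, of "(''cnt'', [])"] by (auto simp: undo_op_def written_seqs take_part_def cnt_def)
    have a: "ar st ''tail'' = src" "ar st ''head'' = dst" "ar st ''lp'' = ar st0 ''lp''" "ar st ''lq'' = ar st0 ''lq''"
      "ar st ''lr'' = ar st0 ''lr''" "ar st ''lx'' = ar st0 ''lx''"
      using ag[THEN agree_arr] by (auto simp: undo_op_def written_seqs take_part_def src_def dst_def)
    have "wp (undo_op k) (\<lambda>t st'. split_ok k (?cap (vr st ''L'' - 1)) cnt src dst \<beta> st' \<and> vr st' ''L'' = vr st ''L'' - 1 \<and>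
       int t \<le> 60 * int (length (pairs k)) + 31) st"
      using wp_undo_op[of k c0 st \<beta> "ar st0 ''g''" L, unfolded v a] I b lg
      unfolding cnt_def src_def dst_def L_def by simp
    then show "wp (undo_op k) (\<lambda>t st'. ?I st' \<and> nat (vr st' ''L'') < nat (vr st ''L'') \<and>
      int t + int (1 + bcost ?b) + ?C * vr st' ''L'' \<le> ?C * vr st ''L'') st"
    proof (rule wp_conseq, elim conjE)
      fix t :: nat and st'
      assume s: "split_ok k (?cap (vr st ''L'' - 1)) cnt src dst \<beta> st'" and v': "vr st' ''L'' = vr st ''L'' - 1"
        and t: "int t \<le> 60 * int (length (pairs k)) + 31"
      have "?I st'" unfolding v' using s I b by simp
      moreover have "int t + int (1 + bcost ?b) + ?C * vr st' ''L'' \<le> ?C * vr st ''L''"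
        unfolding v' using t by (simp add: length_pairs algebra_simps)
      ultimately show "?I st' \<and> nat (vr st' ''L'') < nat (vr st ''L'') \<and>
        int t + int (1 + bcost ?b) + ?C * vr st' ''L'' \<le> ?C * vr st ''L''" using v' b by simp
    qed
  qed
  then show ?thesis
    unfolding undo_all_def
  proof (rule wp_conseq, elim conjE)
    fix t :: nat and st'
    assume I: "split_ok k (?cap (vr st' ''L'')) cnt src dst \<beta> st'" "0 \<le> vr st' ''L''" "\<not> bval ?b st'"
      and t: "int t + ?C * vr st' ''L'' \<le> ?C * vr st0 ''L'' + int (1 + bcost ?b)"
    then have "vr st' ''L'' = 0" by simp
    moreover have "?cap 0 = c0" by (rule ext) (simp add: capat_def)
    ultimately show "split_ok k c0 cnt src dst \<beta> st' \<and> int t \<le> ?C * L + 10" using I t by (simp add: L_def)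
  qed
qed

section \<open>Labelling the remaining arcs by terminal pairs\<close>

definition assign_part :: "nat \<Rightarrow> nat \<times> nat \<Rightarrow> com" where
  "assign_part k c =
     If (And (Equal (Ar ''tail'' (Vr ''p'')) (Plus (Vr ''n'') (Const (int (fst c) - 1))))
             (Equal (Ar ''head'' (Vr ''p'')) (Plus (Vr ''n'') (Const (int k + int (snd c) - 1)))))
       (Update (part_id c) (Vr ''p'') (Ar ''g'' (Vr ''p''))) Skip"

text \<open>The flow parked on \<open>M\<close> comes from closed walks and has no divergence, so it
  may be given to any pair; \<open>(1, 1)\<close> is one as soon as \<open>k >= 1\<close>.\<close>

definition assign_all :: "nat \<Rightarrow> com" where
  "assign_all k =
     (Update (part_id (1, 1)) (Vr ''M'') (Ar ''g'' (Vr ''M''));;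
      ''p'' ::= Plus (Vr ''M'') (Const 1);; ''y'' ::= Plus (Vr ''cnt'') (Const 1);;
      for_loop ''p'' ''y'' (seqs (map (assign_part k) (pairs k))))"

definition joins :: "int \<Rightarrow> int \<Rightarrow> (int \<Rightarrow> int) \<Rightarrow> (int \<Rightarrow> int) \<Rightarrow> nat \<times> nat \<Rightarrow> int \<Rightarrow> bool" where
  "joins n k src dst c p \<longleftrightarrow> src p = n + int (fst c) - 1 \<and> dst p = n + k + int (snd c) - 1"

lemma wp_assign_parts:
  fixes st1 :: store
  defines "p \<equiv> vr st1 ''p''"
  shows "wp (seqs (map (assign_part k) (pairs k))) (\<lambda>t st'. (\<forall>c\<in>set (pairs k). part st' c =
      (if joins (vr st1 ''n'') k (ar st1 ''tail'') (ar st1 ''head'') c p then (part st1 c)(p := ar st1 ''g'' p) else part st1 c)) \<and>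
      int t \<le> 20 * int (length (pairs k)) + 1) st1"
proof -
  let ?cs = "pairs k"
  let ?new = "\<lambda>c. if joins (vr st1 ''n'') k (ar st1 ''tail'') (ar st1 ''head'') c p then (part st1 c)(p := ar st1 ''g'' p) else part st1 c"
  let ?I = "\<lambda>i st. (\<forall>c\<in>set (take i ?cs). part st c = ?new c) \<and> (\<forall>c\<in>set (drop i ?cs). part st c = part st1 c)"
  have "wp (seqs (map (assign_part k) ?cs)) (\<lambda>t st'. ?I (length ?cs) st' \<and> int t \<le> 20 * int (length ?cs) + 1) st1"
  proof (rule wp_seqs)
    fix i st
    assume i: "i < length ?cs" and I: "?I i st" and ag: "agree (seqs (map (assign_part k) ?cs)) st1 st"
    let ?c = "?cs ! i"
    have fr: "vr st ''p'' = p" "vr st ''n'' = vr st1 ''n''" "ar st ''tail'' = ar st1 ''tail''" "ar st ''head'' = ar st1 ''head''"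
      "ar st ''g'' = ar st1 ''g''"
      using ag[THEN agree_var] ag[THEN agree_arr] by (auto simp: written_seqs assign_part_def p_def)
    have tk: "set (take (Suc i) ?cs) = insert ?c (set (take i ?cs))" using i by (simp add: take_Suc_conv_app_nth)
    have dr: "drop i ?cs = ?c # drop (Suc i) ?cs" using i by (simp add: Cons_nth_drop_Suc)
    have "distinct (take i ?cs @ ?c # drop (Suc i) ?cs)" using distinct_pairs[of k] append_take_drop_id[of i ?cs] unfolding dr by simp
    then have new: "?c \<notin> set (take i ?cs)" "?c \<notin> set (drop (Suc i) ?cs)" by auto
    have pc: "part st ?c = part st1 ?c" using I dr by simp
    have "wp (assign_part k ?c) (\<lambda>t st'. part st' ?c = ?new ?c \<and> (\<forall>d. d \<noteq> ?c \<longrightarrow> part st' d = part st d) \<and> t \<le> 20) st"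
      using pc[unfolded part_def] by (simp add: assign_part_def part_def joins_def fr add_diff_eq prod_eq_iff algebra_simps)
    then show "wp (assign_part k ?c) (\<lambda>t st'. ?I (Suc i) st' \<and> int t \<le> 20) st"
    proof (rule wp_conseq, elim conjE)
      fix t :: nat and st'
      assume 1: "part st' ?c = ?new ?c" "\<forall>d. d \<noteq> ?c \<longrightarrow> part st' d = part st d" "t \<le> 20"
      have "part st' c = ?new c" if c: "c \<in> set (take (Suc i) ?cs)" for c
      proof (cases "c = ?c")
        case True
        then show ?thesis using 1(1) by simp
      next
        case False
        then have "part st' c = part st c" "c \<in> set (take i ?cs)" using 1(2) c tk by blast+
        then show ?thesis using I by simp
      qed
      moreover have "part st' c = part st1 c" if c: "c \<in> set (drop (Suc i) ?cs)" for c
      proof -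
        have "c \<noteq> ?c" using c new by blast
        then have "part st' c = part st c" using 1(2) by blast
        then show ?thesis using I c dr by simp
      qed
      ultimately show "?I (Suc i) st' \<and> int t \<le> 20" using 1(3) by simp
    qed
  qed simp
  then show ?thesis by (rule wp_conseq) auto
qed

lemma wp_assign_all:
  fixes st0 :: store and k :: nat
  assumes k: "1 \<le> k" and z: "\<And>c. c \<in> set (pairs k) \<Longrightarrow> part st0 c = (\<lambda>_. 0)"
    and M: "vr st0 ''M'' = M" "M \<le> vr st0 ''cnt''"
  shows "wp (assign_all k) (\<lambda>t st'. (\<forall>c\<in>set (pairs k). \<forall>z. part st' c z =
      (if z = M then (if c = (1, 1) then ar st0 ''g'' M else 0)
       else if M < z \<and> z \<le> vr st0 ''cnt'' \<and> joins (vr st0 ''n'') k (ar st0 ''tail'') (ar st0 ''head'') c z then ar st0 ''g'' z else 0)) \<and>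
      int t \<le> (20 * int (k * k) + 20) * (vr st0 ''cnt'' - M) + 40) st0"
proof -
  let ?st = "st0\<lparr>arr := (arr st0)(part_id (1, 1) := (arr st0 (part_id (1, 1)))(M := ar st0 ''g'' M)),
     var := (var st0)((''p'', []) := M + 1, (''y'', []) := vr st0 ''cnt'' + 1)\<rparr>"
  let ?body = "seqs (map (assign_part k) (pairs k))"
  let ?I = "\<lambda>e st. \<forall>c\<in>set (pairs k). \<forall>z. part st c z =
      (if z = M then (if c = (1, 1) then ar st0 ''g'' M else 0)
       else if M < z \<and> z < e \<and> joins (vr st0 ''n'') k (ar st0 ''tail'') (ar st0 ''head'') c z then ar st0 ''g'' z else 0)"
  have "wp (for_loop ''p'' ''y'' ?body) (\<lambda>t st'. ?I (vr ?st ''y'') st' \<and> vr st' ''p'' = vr ?st ''y'' \<and>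
      int t \<le> ((20 * int (k * k) + 1) + 10) * (vr ?st ''y'' - vr ?st ''p'') + 10) ?st"
  proof (rule wp_for_loop)
    show "?I (vr ?st ''p'') ?st"
    proof (intro ballI allI)
      fix c z assume c: "c \<in> set (pairs k)"
      have "part ?st c = (if c = (1, 1) then (part st0 c)(M := ar st0 ''g'' M) else part st0 c)"
        by (auto simp: part_def prod_eq_iff)
      then show "part ?st c z = (if z = M then (if c = (1, 1) then ar st0 ''g'' M else 0)
       else if M < z \<and> z < vr ?st ''p'' \<and> joins (vr st0 ''n'') k (ar st0 ''tail'') (ar st0 ''head'') c z then ar st0 ''g'' z else 0)"
        using z[OF c] by (cases "c = (1, 1)") auto
    qed
    show "vr ?st ''p'' \<le> vr ?st ''y''" using M by simp
  next
    fix e st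
    assume I: "?I e st" and ag: "agree (for_loop ''p'' ''y'' ?body) ?st st" and e: "vr st ''p'' = e" "vr ?st ''p'' \<le> e" "e < vr ?st ''y''"
    have fr: "vr st ''n'' = vr st0 ''n''" "ar st ''tail'' = ar st0 ''tail''" "ar st ''head'' = ar st0 ''head''"
      "ar st ''g'' = ar st0 ''g''"
      using ag[THEN agree_var] ag[THEN agree_arr] by (auto simp: written_seqs assign_part_def)
    have part_upd: "part (s\<lparr>var := x\<rparr>) = part s" for s x by (rule ext) (simp add: part_def)
    show "wp ?body (\<lambda>t st'. ?I (e + 1) (st'\<lparr>var := (var st')((''p'', []) := e + 1)\<rparr>) \<and> int t \<le> 20 * int (k * k) + 1) st"
      unfolding part_upd
    proof (rule wp_conseq[OF wp_assign_parts], elim conjE, unfold fr e(1) length_pairs, intro conjI ballI allI)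
      fix t st' c z
      assume "\<forall>c\<in>set (pairs k). part st' c = (if joins (vr st0 ''n'') k (ar st0 ''tail'') (ar st0 ''head'') c e
         then (part st c)(e := ar st0 ''g'' e) else part st c)" and c: "c \<in> set (pairs k)"
      then have p: "part st' c = (if joins (vr st0 ''n'') k (ar st0 ''tail'') (ar st0 ''head'') c e
         then (part st c)(e := ar st0 ''g'' e) else part st c)" by blast
      have q: "part st c z = (if z = M then (if c = (1, 1) then ar st0 ''g'' M else 0)
       else if M < z \<and> z < e \<and> joins (vr st0 ''n'') k (ar st0 ''tail'') (ar st0 ''head'') c z then ar st0 ''g'' z else 0)"
        using I c by blast
      have eM: "M < e" using e by simp
      show "part st' c z = (if z = M then (if c = (1, 1) then ar st0 ''g'' M else 0)
       else if M < z \<and> z < e + 1 \<and> joins (vr st0 ''n'') k (ar st0 ''tail'') (ar st0 ''head'') c z then ar st0 ''g'' z else 0)"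
        unfolding p using q eM by (cases "z = e") auto
    qed
  qed (auto simp: written_seqs assign_part_def)
  then show ?thesis
    unfolding assign_all_def using M by (auto simp: algebra_simps elim!: wp_conseq)
qed

section \<open>Combining opposite ordered pairs into the output\<close>

definition output_pairs :: "nat \<Rightarrow> (nat \<times> nat) list" where
  "output_pairs k = filter (\<lambda>c. fst c \<le> snd c) (pairs k)"

definition output_part :: "nat \<times> nat \<Rightarrow> com" where
  "output_part c = Update (''flow'', [fst c, snd c]) (Vr ''e'')
     (if fst c = snd c then Elem (part_id c) (Vr ''e'')
      else Plus (Elem (part_id c) (Vr ''e'')) (Elem (part_id (snd c, fst c)) (Ar ''sigmaE'' (Vr ''e''))))"

definition output_all :: "nat \<Rightarrow> com" where
  "output_all k = (''e'' ::= Const 0;; for_loop ''e'' ''m'' (seqs (map output_part (output_pairs k))))"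

lemma wp_output_all:
  fixes st0 :: store
  assumes m: "0 \<le> vr st0 ''m''"
  shows "wp (output_all k) (\<lambda>t st'. (\<forall>c\<in>set (output_pairs k). \<forall>e. 0 \<le> e \<and> e < vr st0 ''m'' \<longrightarrow>
      arr st' (''flow'', [fst c, snd c]) e =
        (if fst c = snd c then part st0 c e else part st0 c e + part st0 (snd c, fst c) (ar st0 ''sigmaE'' e))) \<and>
      int t \<le> (20 * int (k * k) + 20) * vr st0 ''m'' + 20) st0"
proof -
  let ?cs = "output_pairs k"
  let ?body = "seqs (map output_part ?cs)"
  let ?st = "st0\<lparr>var := (var st0)((''e'', []) := 0)\<rparr>"
  let ?out = "\<lambda>st c. arr st (''flow'', [fst c, snd c])"
  let ?val = "\<lambda>c e. if fst c = snd c then part st0 c e else part st0 c e + part st0 (snd c, fst c) (ar st0 ''sigmaE'' e)"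
  let ?I = "\<lambda>e st. \<forall>c\<in>set ?cs. \<forall>j. 0 \<le> j \<and> j < e \<longrightarrow> ?out st c j = ?val c j"
  have len: "length ?cs \<le> k * k" unfolding output_pairs_def length_pairs[symmetric] by (rule length_filter_le)
  have dist: "distinct ?cs" unfolding output_pairs_def using distinct_pairs by simp
  have "wp (for_loop ''e'' ''m'' ?body) (\<lambda>t st'. ?I (vr ?st ''m'') st' \<and> vr st' ''e'' = vr ?st ''m'' \<and>
      int t \<le> ((20 * int (length ?cs) + 1) + 10) * (vr ?st ''m'' - vr ?st ''e'') + 10) ?st"
  proof (rule wp_for_loop)
    fix e st
    assume I: "?I e st" and ag: "agree (for_loop ''e'' ''m'' ?body) ?st st" and e: "vr st ''e'' = e" "vr ?st ''e'' \<le> e" "e < vr ?st ''m''"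
    let ?J = "\<lambda>i s. ?I e s \<and> (\<forall>c\<in>set (take i ?cs). ?out s c e = ?val c e)"
    have "wp ?body (\<lambda>t s. ?J (length ?cs) s \<and> int t \<le> 20 * int (length ?cs) + 1) st"
    proof (rule wp_seqs)
      fix i s
      assume i: "i < length ?cs" and J: "?J i s" and ag': "agree ?body st s"
      let ?c = "?cs ! i"
      have fr: "part s d = part st0 d" "ar s ''sigmaE'' = ar st0 ''sigmaE''" "vr s ''e'' = e" for d
        using ag[THEN agree_arr] ag'[THEN agree_arr] ag'[THEN agree_var] e by (auto simp: written_seqs output_part_def part_def)
      have tk: "set (take (Suc i) ?cs) = insert ?c (set (take i ?cs))" using i by (simp add: take_Suc_conv_app_nth)
      have "wp (output_part ?c) (\<lambda>t s'. ?out s' ?c = (?out s ?c)(e := ?val ?c e) \<and> (\<forall>d. d \<noteq> ?c \<longrightarrow> ?out s' d = ?out s d) \<and> t \<le> 20) s"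
        using fr(1)[unfolded part_def, of ?c] fr(1)[unfolded part_def, of "(snd ?c, fst ?c)"]
        by (cases "fst ?c = snd ?c") (simp_all add: output_part_def fr part_def prod_eq_iff)
      then show "wp (output_part ?c) (\<lambda>t s'. ?J (Suc i) s' \<and> int t \<le> 20) s"
      proof (rule wp_conseq, elim conjE)
        fix t :: nat and s'
        assume o: "?out s' ?c = (?out s ?c)(e := ?val ?c e)" "\<forall>d. d \<noteq> ?c \<longrightarrow> ?out s' d = ?out s d" and t: "t \<le> 20"
        have s': "?out s' c j = (if c = ?c \<and> j = e then ?val ?c e else ?out s c j)" for c j
          using o by (cases "c = ?c") auto
        have "?I e s'"
        proof (intro ballI allI impI)
          fix c j assume "c \<in> set ?cs" "0 \<le> j \<and> j < e"
          then show "?out s' c j = ?val c j" using J s'[of c j] by simp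
        qed
        moreover have "?out s' c e = ?val c e" if "c \<in> set (take (Suc i) ?cs)" for c
          using that J s'[of c e] unfolding tk by (cases "c = ?c") simp_all
        ultimately show "?J (Suc i) s' \<and> int t \<le> 20" using t by simp
      qed
    qed (use I in simp)
    then show "wp ?body (\<lambda>t st'. ?I (e + 1) (st'\<lparr>var := (var st')((''e'', []) := e + 1)\<rparr>) \<and> int t \<le> 20 * int (length ?cs) + 1) st"
    proof (rule wp_conseq, intro conjI ballI allI impI)
      fix t s c j
      assume *: "?J (length ?cs) s \<and> int t \<le> 20 * int (length ?cs) + 1" and c: "c \<in> set ?cs" and j: "0 \<le> j \<and> j < e + 1"
      show "?out (s\<lparr>var := (var s)((''e'', []) := e + 1)\<rparr>) c j = ?val c j"
        using * c j by (cases "j = e") auto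
    qed simp
  qed (use m in \<open>auto simp: written_seqs output_part_def\<close>)
  then show ?thesis
    unfolding output_all_def wp_Seq wp_Assign aval.simps
  proof (rule wp_conseq, elim conjE)
    fix t st'
    assume "?I (vr ?st ''m'') st'" and t: "int t \<le> ((20 * int (length ?cs) + 1) + 10) * (vr ?st ''m'' - vr ?st ''e'') + 10"
    moreover have "(11 + 20 * int (length ?cs)) * vr st0 ''m'' \<le> (20 * int (k * k) + 20) * vr st0 ''m''"
      using len m by (intro mult_right_mono) (auto simp: of_nat_mult[symmetric] simp del: of_nat_mult)
    ultimately show "(\<forall>c\<in>set ?cs. \<forall>e. 0 \<le> e \<and> e < vr st0 ''m'' \<longrightarrow> ?out st' c e = ?val c e) \<and>
      int (1 + acost (Const 0) + t) \<le> (20 * int (k * k) + 20) * vr st0 ''m'' + 20" by simp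
  qed
qed

section \<open>Building the network\<close>

definition divergences :: com where
  "divergences =
     (''e'' ::= Const 0;; ''tot'' ::= Const 0;;
      for_loop ''e'' ''m''
       (''x'' ::= Ar ''h'' (Vr ''e'');; ''g''\<lbrakk>Vr ''e''\<rbrakk> ::= Vr ''x'';;
        ''dv''\<lbrakk>Ar ''tail'' (Vr ''e'')\<rbrakk> ::= Plus (Ar ''dv'' (Ar ''tail'' (Vr ''e''))) (Vr ''x'');;
        ''dv''\<lbrakk>Ar ''head'' (Vr ''e'')\<rbrakk> ::= Minus (Ar ''dv'' (Ar ''head'' (Vr ''e''))) (Vr ''x'');;
        ''tot'' ::= Plus (Vr ''tot'') (Vr ''x'')))"

lemma sum_atLeastLessThan_Suc:
  fixes F :: "int \<Rightarrow> int"
  assumes "a \<le> e"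
  shows "(\<Sum>p\<in>{a..<e + 1}. F p) = (\<Sum>p\<in>{a..<e}. F p) + F e"
proof -
  have "{a..<e + 1} = insert e {a..<e}" using assms by auto
  then show ?thesis by simp
qed

lemma wp_divergences:
  fixes st0 :: store
  assumes z: "ar st0 ''g'' = (\<lambda>_. 0)" "ar st0 ''dv'' = (\<lambda>_. 0)" and m: "0 \<le> vr st0 ''m''"
  shows "wp divergences (\<lambda>t st'. (\<forall>p. ar st' ''g'' p = (if 0 \<le> p \<and> p < vr st0 ''m'' then ar st0 ''h'' p else 0)) \<and>
     (\<forall>v. ar st' ''dv'' v = (\<Sum>e\<in>{0..<vr st0 ''m''}. ar st0 ''h'' e * bd (ar st0 ''tail'') (ar st0 ''head'') e v)) \<and>
     vr st' ''tot'' = (\<Sum>e\<in>{0..<vr st0 ''m''}. ar st0 ''h'' e) \<and> int t \<le> 50 * vr st0 ''m'' + 20) st0"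
proof -
  let ?st = "st0\<lparr>var := (var st0)((''e'', []) := 0, (''tot'', []) := 0)\<rparr>"
  let ?c = "''x'' ::= Ar ''h'' (Vr ''e'');; ''g''\<lbrakk>Vr ''e''\<rbrakk> ::= Vr ''x'';;
        ''dv''\<lbrakk>Ar ''tail'' (Vr ''e'')\<rbrakk> ::= Plus (Ar ''dv'' (Ar ''tail'' (Vr ''e''))) (Vr ''x'');;
        ''dv''\<lbrakk>Ar ''head'' (Vr ''e'')\<rbrakk> ::= Minus (Ar ''dv'' (Ar ''head'' (Vr ''e''))) (Vr ''x'');;
        ''tot'' ::= Plus (Vr ''tot'') (Vr ''x'')"
  let ?I = "\<lambda>e st. (\<forall>p. ar st ''g'' p = (if 0 \<le> p \<and> p < e then ar st0 ''h'' p else 0)) \<and>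
     (\<forall>v. ar st ''dv'' v = (\<Sum>e\<in>{0..<e}. ar st0 ''h'' e * bd (ar st0 ''tail'') (ar st0 ''head'') e v)) \<and>
     vr st ''tot'' = (\<Sum>e\<in>{0..<e}. ar st0 ''h'' e)"
  have "wp (for_loop ''e'' ''m'' ?c) (\<lambda>t st'. ?I (vr ?st ''m'') st' \<and> vr st' ''e'' = vr ?st ''m'' \<and>
      int t \<le> (40 + 10) * (vr ?st ''m'' - vr ?st ''e'') + 10) ?st"
  proof (rule wp_for_loop)
    fix e st
    assume I: "?I e st" and ag: "agree (for_loop ''e'' ''m'' ?c) ?st st" and e: "vr st ''e'' = e" "vr ?st ''e'' \<le> e" "e < vr ?st ''m''"
    have fr: "ar st ''h'' = ar st0 ''h''" "ar st ''tail'' = ar st0 ''tail''" "ar st ''head'' = ar st0 ''head''"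
      using ag[THEN agree_arr] by auto
    have e0: "0 \<le> e" using e by simp
    have "ar st0 ''h'' e * bd (ar st0 ''tail'') (ar st0 ''head'') e v =
      ar st0 ''h'' e * of_bool (ar st0 ''tail'' e = v) - ar st0 ''h'' e * of_bool (ar st0 ''head'' e = v)" for v
      by (simp add: bd_def algebra_simps)
    then show "wp ?c (\<lambda>t st'. ?I (e + 1) (st'\<lparr>var := (var st')((''e'', []) := e + 1)\<rparr>) \<and> int t \<le> 40) st"
      using I e e0 by (auto simp: fr sum_atLeastLessThan_Suc)
  qed (use m z in auto)
  then show ?thesis unfolding divergences_def by (auto elim!: wp_conseq)
qed

text \<open>The loop index is 0-based while \<open>s\<close> is 1-based. Each super arc carries the
  divergence at its terminal, up to sign, so that conservation holds there. \<open>M\<close> is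
  stocked with the total of all raw values, which \<open>insert_arc\<close> draws on.\<close>

definition add_terminals :: "nat \<Rightarrow> com" where
  "add_terminals k =
     (''kk'' ::= Const (int k);; ''i'' ::= Const 0;;
      for_loop ''i'' ''kk''
       (''a'' ::= Ar ''s'' (Plus (Vr ''i'') (Const 1));; ''b'' ::= Ar ''sigmaV'' (Vr ''a'');;
        ''u'' ::= Plus (Vr ''m'') (Vr ''i'');; ''w'' ::= Plus (Vr ''u'') (Const (int k));;
        ''tail''\<lbrakk>Vr ''u''\<rbrakk> ::= Plus (Vr ''n'') (Vr ''i'');; ''head''\<lbrakk>Vr ''u''\<rbrakk> ::= Vr ''a'';;
        ''g''\<lbrakk>Vr ''u''\<rbrakk> ::= Ar ''dv'' (Vr ''a'');;
        ''tail''\<lbrakk>Vr ''w''\<rbrakk> ::= Vr ''b'';; ''head''\<lbrakk>Vr ''w''\<rbrakk> ::= Plus (Plus (Vr ''n'') (Const (int k))) (Vr ''i'');;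
        ''g''\<lbrakk>Vr ''w''\<rbrakk> ::= Minus (Const 0) (Ar ''dv'' (Vr ''b''));;
        ''tot'' ::= Plus (Vr ''tot'') (Minus (Ar ''dv'' (Vr ''a'')) (Ar ''dv'' (Vr ''b''))));;
      ''M'' ::= Plus (Vr ''m'') (Const (2 * int k));; ''N'' ::= Plus (Vr ''n'') (Const (2 * int k));;
      ''g''\<lbrakk>Vr ''M''\<rbrakk> ::= Vr ''tot'';; ''cnt'' ::= Vr ''M'')"

text \<open>\<open>k\<close> fixes the layout and \<open>j\<close> counts the loop iterations
  already done; the finished network has \<open>j = k\<close>.\<close>

definition with_terminals :: "int \<Rightarrow> int \<Rightarrow> int \<Rightarrow> (int \<Rightarrow> int) \<Rightarrow> (int \<Rightarrow> int) \<Rightarrow> (int \<Rightarrow> int) \<Rightarrow> int \<Rightarrow> int" where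
  "with_terminals m k j f s t p =
     (if m \<le> p \<and> p < m + j then s (p - m) else if m + k \<le> p \<and> p < m + k + j then t (p - m - k) else f p)"

lemma wp_add_terminals:
  fixes st0 :: store and k :: nat
  defines "m \<equiv> vr st0 ''m''" and "n \<equiv> vr st0 ''n''" and "K \<equiv> int k" and "dv \<equiv> ar st0 ''dv''"
    and "sa \<equiv> \<lambda>i. ar st0 ''s'' (i + 1)" and "sb \<equiv> \<lambda>i. ar st0 ''sigmaV'' (ar st0 ''s'' (i + 1))"
  shows "wp (add_terminals k) (\<lambda>t st'. ar st' ''tail'' = with_terminals m K K (ar st0 ''tail'') (\<lambda>i. n + i) sb \<and>
     ar st' ''head'' = with_terminals m K K (ar st0 ''head'') sa (\<lambda>i. n + K + i) \<and>
     ar st' ''g'' = (with_terminals m K K (ar st0 ''g'') (\<lambda>i. dv (sa i)) (\<lambda>i. - dv (sb i)))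
        (m + 2 * K := vr st0 ''tot'' + (\<Sum>i\<in>{0..<K}. dv (sa i) - dv (sb i))) \<and>
     vr st' ''M'' = m + 2 * K \<and> vr st' ''N'' = n + 2 * K \<and> vr st' ''cnt'' = m + 2 * K \<and> int t \<le> 80 * K + 50) st0"
proof -
  let ?st = "st0\<lparr>var := (var st0)((''kk'', []) := K, (''i'', []) := 0)\<rparr>"
  let ?c = "''a'' ::= Ar ''s'' (Plus (Vr ''i'') (Const 1));; ''b'' ::= Ar ''sigmaV'' (Vr ''a'');;
        ''u'' ::= Plus (Vr ''m'') (Vr ''i'');; ''w'' ::= Plus (Vr ''u'') (Const (int k));;
        ''tail''\<lbrakk>Vr ''u''\<rbrakk> ::= Plus (Vr ''n'') (Vr ''i'');; ''head''\<lbrakk>Vr ''u''\<rbrakk> ::= Vr ''a'';;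
        ''g''\<lbrakk>Vr ''u''\<rbrakk> ::= Ar ''dv'' (Vr ''a'');;
        ''tail''\<lbrakk>Vr ''w''\<rbrakk> ::= Vr ''b'';; ''head''\<lbrakk>Vr ''w''\<rbrakk> ::= Plus (Plus (Vr ''n'') (Const (int k))) (Vr ''i'');;
        ''g''\<lbrakk>Vr ''w''\<rbrakk> ::= Minus (Const 0) (Ar ''dv'' (Vr ''b''));;
        ''tot'' ::= Plus (Vr ''tot'') (Minus (Ar ''dv'' (Vr ''a'')) (Ar ''dv'' (Vr ''b'')))"
  let ?I = "\<lambda>j st. ar st ''tail'' = with_terminals m K j (ar st0 ''tail'') (\<lambda>i. n + i) sb \<and>
     ar st ''head'' = with_terminals m K j (ar st0 ''head'') sa (\<lambda>i. n + K + i) \<and>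
     ar st ''g'' = with_terminals m K j (ar st0 ''g'') (\<lambda>i. dv (sa i)) (\<lambda>i. - dv (sb i)) \<and>
     vr st ''tot'' = vr st0 ''tot'' + (\<Sum>i\<in>{0..<j}. dv (sa i) - dv (sb i))"
  have ext0: "with_terminals m h 0 f s t = f" for h f s t by (rule ext) (simp add: with_terminals_def)
  have step: "(with_terminals m K j f s t)(m + j := s j, m + j + K := t j) = with_terminals m K (j + 1) f s t" if "0 \<le> j" "j < K" for j f s t
    by (rule ext) (use that in \<open>auto simp: with_terminals_def\<close>)
  have "wp (for_loop ''i'' ''kk'' ?c) (\<lambda>t st'. ?I (vr ?st ''kk'') st' \<and> vr st' ''i'' = vr ?st ''kk'' \<and>
      int t \<le> (70 + 10) * (vr ?st ''kk'' - vr ?st ''i'') + 10) ?st"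
  proof (rule wp_for_loop)
    fix j st
    assume I: "?I j st" and ag: "agree (for_loop ''i'' ''kk'' ?c) ?st st" and j: "vr st ''i'' = j" "vr ?st ''i'' \<le> j" "j < vr ?st ''kk''"
    have fr: "ar st ''s'' = ar st0 ''s''" "ar st ''sigmaV'' = ar st0 ''sigmaV''" "ar st ''dv'' = dv"
      "vr st ''m'' = m" "vr st ''n'' = n"
      using ag[THEN agree_arr] ag[THEN agree_var] by (auto simp: m_def n_def dv_def)
    have jj: "0 \<le> j" "j < K" using j by simp_all
    note st1 = step[OF jj, of "ar st0 ''tail''" "\<lambda>i. n + i" sb] step[OF jj, of "ar st0 ''head''" sa "\<lambda>i. n + K + i"]
      step[OF jj, of "ar st0 ''g''" "\<lambda>i. dv (sa i)" "\<lambda>i. - dv (sb i)"]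
    show "wp ?c (\<lambda>t st'. ?I (j + 1) (st'\<lparr>var := (var st')((''i'', []) := j + 1)\<rparr>) \<and> int t \<le> 70) st"
      using I jj st1 sum_atLeastLessThan_Suc[OF jj(1), of "\<lambda>i. dv (sa i) - dv (sb i)"]
      by (simp add: fr j(1) K_def[symmetric] sa_def sb_def)
  qed (auto simp: ext0 K_def)
  then have "wp (for_loop ''i'' ''kk'' ?c) (\<lambda>t st'. ?I K st' \<and> vr st' ''m'' = m \<and> vr st' ''n'' = n \<and> int t \<le> 80 * K + 10) ?st"
  proof (rule wp_conseq_agree)
    fix t st'
    assume *: "?I (vr ?st ''kk'') st' \<and> vr st' ''i'' = vr ?st ''kk'' \<and>
      int t \<le> (70 + 10) * (vr ?st ''kk'' - vr ?st ''i'') + 10" and ag: "agree (for_loop ''i'' ''kk'' ?c) ?st st'"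
    show "?I K st' \<and> vr st' ''m'' = m \<and> vr st' ''n'' = n \<and> int t \<le> 80 * K + 10"
      using * ag[THEN agree_var] by (simp add: m_def n_def)
  qed
  then show ?thesis
    unfolding add_terminals_def by (auto simp: K_def elim!: wp_conseq)
qed

text \<open>Multiples of \<open>N\<close> by repeated addition; the entry for 0 is there from the
  start.\<close>

definition rows :: com where
  "rows = (''i'' ::= Const 0;;
     for_loop ''i'' ''N'' (''row''\<lbrakk>Plus (Vr ''i'') (Const 1)\<rbrakk> ::= Plus (Ar ''row'' (Vr ''i'')) (Vr ''N'')))"

lemma wp_rows:
  assumes z: "ar st0 ''row'' = (\<lambda>_. 0)" and N: "0 \<le> vr st0 ''N''"
  shows "wp rows (\<lambda>t st'. (\<forall>u. 0 \<le> u \<and> u < vr st0 ''N'' \<longrightarrow> ar st' ''row'' u = u * vr st0 ''N'') \<and>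
     int t \<le> 30 * vr st0 ''N'' + 20) st0"
proof -
  let ?st = "st0\<lparr>var := (var st0)((''i'', []) := 0)\<rparr>"
  let ?c = "''row''\<lbrakk>Plus (Vr ''i'') (Const 1)\<rbrakk> ::= Plus (Ar ''row'' (Vr ''i'')) (Vr ''N'')"
  let ?I = "\<lambda>j st. \<forall>u. 0 \<le> u \<and> u \<le> j \<longrightarrow> ar st ''row'' u = u * vr st0 ''N''"
  have "wp (for_loop ''i'' ''N'' ?c) (\<lambda>t st'. ?I (vr ?st ''N'') st' \<and> vr st' ''i'' = vr ?st ''N'' \<and>
      int t \<le> (20 + 10) * (vr ?st ''N'' - vr ?st ''i'') + 10) ?st"
  proof (rule wp_for_loop)
    fix j st
    assume I: "?I j st" and ag: "agree (for_loop ''i'' ''N'' ?c) ?st st" and j: "vr st ''i'' = j" "vr ?st ''i'' \<le> j" "j < vr ?st ''N''"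
    have "vr st ''N'' = vr st0 ''N''" using ag[THEN agree_var] by auto
    then show "wp ?c (\<lambda>t st'. ?I (j + 1) (st'\<lparr>var := (var st')((''i'', []) := j + 1)\<rparr>) \<and> int t \<le> 20) st"
      using I j by (auto simp: distrib_right)
  qed (use N z in auto)
  then show ?thesis unfolding rows_def by (auto elim!: wp_conseq)
qed

text \<open>Insertion is logged as a move along the raw arc \<open>e\<close> and the loop
  \<open>M\<close> onto a network arc with the ends of \<open>e\<close>. The log then has a single
  kind of entry, parallel arcs are merged on the way, and undoing returns the flow to the raw arcs.
  The stock on \<open>M\<close> is used up exactly when all arcs are inserted.\<close>

definition insert_arc :: com where
  "insert_arc =
     (''p'' ::= Vr ''e'';; ''q'' ::= Vr ''M'';; ''x'' ::= Ar ''g'' (Vr ''e'');;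
      ''u'' ::= Ar ''tail'' (Vr ''e'');; ''w'' ::= Ar ''head'' (Vr ''e'');;
      ''g''\<lbrakk>Vr ''e''\<rbrakk> ::= Const 0;; ''g''\<lbrakk>Vr ''M''\<rbrakk> ::= Minus (Ar ''g'' (Vr ''M'')) (Vr ''x'');;
      (find_arc;; add_cap);; log_op)"

definition insert_all :: com where
  "insert_all = (''e'' ::= Const 0;; for_loop ''e'' ''M'' insert_arc)"

definition list_vertices :: com where
  "list_vertices = (''i'' ::= Const 0;; for_loop ''i'' ''n'' (''rem''\<lbrakk>Vr ''i''\<rbrakk> ::= Vr ''i'');; ''t'' ::= Vr ''n'')"

lemma wp_list_vertices:
  assumes n: "0 \<le> vr st0 ''n''"
  shows "wp list_vertices (\<lambda>t st'. (\<forall>u. 0 \<le> u \<and> u < vr st0 ''n'' \<longrightarrow> ar st' ''rem'' u = u) \<and> vr st' ''t'' = vr st0 ''n'' \<and>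
     int t \<le> 30 * vr st0 ''n'' + 20) st0"
proof -
  let ?st = "st0\<lparr>var := (var st0)((''i'', []) := 0)\<rparr>"
  let ?c = "''rem''\<lbrakk>Vr ''i''\<rbrakk> ::= Vr ''i''"
  let ?I = "\<lambda>j st. \<forall>u. 0 \<le> u \<and> u < j \<longrightarrow> ar st ''rem'' u = u"
  have "wp (for_loop ''i'' ''n'' ?c) (\<lambda>t st'. ?I (vr ?st ''n'') st' \<and> vr st' ''i'' = vr ?st ''n'' \<and>
      int t \<le> (20 + 10) * (vr ?st ''n'' - vr ?st ''i'') + 10) ?st"
    by (rule wp_for_loop) (use n in auto)
  then have "wp (for_loop ''i'' ''n'' ?c) (\<lambda>t st'. ?I (vr st0 ''n'') st' \<and> vr st' ''n'' = vr st0 ''n'' \<and>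
      int t \<le> 30 * vr st0 ''n'' + 10) ?st"
    by (rule wp_conseq_agree) (use agree_var in auto)
  then show ?thesis unfolding list_vertices_def by (auto elim!: wp_conseq)
qed

lemma wp_insert_arc:
  assumes sh: "shape_st n k M st" and cp: "caps_st M st" and lg: "log_st c0 st" and M: "vr st ''M'' = M"
    and e: "vr st ''e'' = e" "0 \<le> e" "e < M" and ge: "ar st ''g'' e \<le> ar st ''g'' M"
    and uw: "0 \<le> ar st ''tail'' e" "ar st ''tail'' e < n + k" "0 \<le> ar st ''head'' e" "ar st ''head'' e < n + 2 * k"
      "ar st ''head'' e < n \<or> n + k \<le> ar st ''head'' e" "ar st ''tail'' e \<noteq> ar st ''head'' e"
    and trash: "ar st ''tail'' M = ar st ''head'' M"
  shows "wp insert_arc (\<lambda>t st'. shape_st n k M st' \<and> caps_st M st' \<and> log_st c0 st' \<and>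
     vr st' ''cnt'' \<le> vr st ''cnt'' + 1 \<and> vr st' ''L'' = vr st ''L'' + 1 \<and>
     (\<forall>p\<le>M. ar st' ''tail'' p = ar st ''tail'' p \<and> ar st' ''head'' p = ar st ''head'' p) \<and>
     (\<forall>z<M. ar st' ''g'' z = (if z = e then 0 else ar st ''g'' z)) \<and> ar st' ''g'' M = ar st ''g'' M - ar st ''g'' e \<and>
     nlive M (vr st' ''cnt'') (ar st' ''g'') \<le> nlive M (vr st ''cnt'') (ar st ''g'') + 1 \<and> t \<le> 200) st"
proof -
  let ?g = "ar st ''g''" and ?cnt = "vr st ''cnt''"
  let ?u = "ar st ''tail'' e" and ?w = "ar st ''head'' e" and ?x = "?g e"
  let ?g1 = "?g(e := 0, M := ?g M - ?x)"
  let ?st = "st\<lparr>var := (var st)((''p'', []) := e, (''q'', []) := M, (''x'', []) := ?x, (''u'', []) := ?u, (''w'', []) := ?w),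
    arr := (arr st)((''g'', []) := ?g1)\<rparr>"
  have M0: "0 \<le> M" "M \<le> ?cnt" using sh by (auto simp: shape_ok_def)
  have x: "0 \<le> ?x" using cp by (simp add: caps_ok_def)
  have "caps_ok M ?cnt (ar st ''tail'') (ar st ''head'') (ar st ''deg'') ?g1"
    using e ge M0 by (intro caps_set_raw[OF caps_set_raw[OF cp]]) auto
  then have cp1: "caps_st M ?st" by simp
  have sh1: "shape_st n k M ?st" using sh by simp
  have live1: "nlive M ?cnt ?g1 = nlive M ?cnt ?g" using e by (simp only: nlive_set_raw order_refl less_imp_le)
  have "wp (find_arc;; add_cap) (\<lambda>t st'. (\<exists>c. link_post n k M ?st c st') \<and> t \<le> 110) ?st"
    using uw x by (intro wp_new_link[OF sh1 cp1]) auto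
  then have "wp ((find_arc;; add_cap);; log_op) (\<lambda>t st'. shape_st n k M st' \<and> caps_st M st' \<and> log_st c0 st' \<and>
     vr st' ''cnt'' \<le> ?cnt + 1 \<and> vr st' ''L'' = vr st ''L'' + 1 \<and>
     (\<forall>p\<le>M. ar st' ''tail'' p = ar st ''tail'' p \<and> ar st' ''head'' p = ar st ''head'' p) \<and>
     (\<forall>z<M. ar st' ''g'' z = (if z = e then 0 else ?g z)) \<and> ar st' ''g'' M = ?g M - ?x \<and>
     nlive M (vr st' ''cnt'') (ar st' ''g'') \<le> nlive M ?cnt ?g + 1 \<and> t \<le> 140) ?st"
  proof (rule wp_SeqI, elim conjE exE)
    fix t :: nat and st1 c
    assume ag: "agree (find_arc;; add_cap) ?st st1" and l: "link_post n k M ?st c st1" and t: "t \<le> 110"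
    let ?r = "vr st1 ''r''"
    have fr: "vr st1 ''p'' = e" "vr st1 ''q'' = M" "vr st1 ''x'' = ?x" "vr st1 ''L'' = vr st ''L''"
      using ag[THEN agree_var] by (simp_all add: find_arc_def add_cap_def)
    have fa: "ar st1 ''lp'' = ar st ''lp''" "ar st1 ''lq'' = ar st ''lq''" "ar st1 ''lr'' = ar st ''lr''" "ar st1 ''lx'' = ar st ''lx''"
      using ag[THEN agree_arr] by (simp_all add: find_arc_def add_cap_def)
    have stu: "vr ?st ''u'' = ?u" "vr ?st ''w'' = ?w" "vr ?st ''x'' = ?x" "vr ?st ''cnt'' = ?cnt"
      "ar ?st ''tail'' = ar st ''tail''" "ar ?st ''head'' = ar st ''head''" "ar ?st ''g'' = ?g1"
      by simp_all
    note l' = l[unfolded link_post_def stu]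
    have sh2: "shape_st n k M st1" and cp2: "caps_st M st1" and r: "M < ?r" "?r \<le> vr st1 ''cnt''"
      "ar st1 ''tail'' ?r = ?u" "ar st1 ''head'' ?r = ?w" and cnt: "?cnt \<le> vr st1 ''cnt''" "vr st1 ''cnt'' \<le> ?cnt + 1"
      and c: "c \<in> {0, 1}"
      using l' uw(6) by blast+
    have agr: "ar st1 ''tail'' z = ar st ''tail'' z \<and> ar st1 ''head'' z = ar st ''head'' z" if "z \<le> ?cnt" for z
      using l' that by blast
    have g1: "ar st1 ''g'' = ?g1(?r := ?g1 ?r + ?x)" and live: "nlive M (vr st1 ''cnt'') (ar st1 ''g'') = nlive M ?cnt ?g1 + c"
      using l' by blast+
    have g1': "ar st1 ''g'' z = ?g z + ?x * (of_bool (?r = z) - of_bool (e = z) - of_bool (M = z))" for z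
      unfolding g1 using e r by auto
    have nn: "0 \<le> ar st1 ''g'' z" for z using cp2 by (simp add: caps_ok_def)
    have bd: "bd (ar st1 ''tail'') (ar st1 ''head'') e v + bd (ar st1 ''tail'') (ar st1 ''head'') M v =
        bd (ar st1 ''tail'') (ar st1 ''head'') ?r v" for v
      using agr[of e] agr[of M] e M0 trash r by (simp add: bd_def)
    have "log_ok c0 (vr st1 ''cnt'') (ar st1 ''tail'') (ar st1 ''head'') (ar st1 ''g'') (vr st ''L'' + 1)
       ((ar st ''lp'')(vr st ''L'' + 1 := e)) ((ar st ''lq'')(vr st ''L'' + 1 := M))
       ((ar st ''lr'')(vr st ''L'' + 1 := ?r)) ((ar st ''lx'')(vr st ''L'' + 1 := ?x))"
      using e M0 r x cnt by (intro log_append[OF lg cnt(1) agr _ _ _ _ _ _ _ bd g1' nn]) auto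
    moreover have "ar st1 ''tail'' p = ar st ''tail'' p \<and> ar st1 ''head'' p = ar st ''head'' p" if "p \<le> M" for p
      using agr[of p] that M0 by simp
    moreover have "ar st1 ''g'' z = (if z = e then 0 else ?g z)" if "z < M" for z
      using g1'[of z] that r by auto
    moreover have "ar st1 ''g'' M = ?g M - ?x" using g1'[of M] e r by simp
    moreover have "nlive M (vr st1 ''cnt'') (ar st1 ''g'') \<le> nlive M ?cnt ?g + 1" using live live1 c by auto
    ultimately show "wp log_op (\<lambda>u st'. shape_st n k M st' \<and> caps_st M st' \<and> log_st c0 st' \<and>
     vr st' ''cnt'' \<le> ?cnt + 1 \<and> vr st' ''L'' = vr st ''L'' + 1 \<and>
     (\<forall>p\<le>M. ar st' ''tail'' p = ar st ''tail'' p \<and> ar st' ''head'' p = ar st ''head'' p) \<and>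
     (\<forall>z<M. ar st' ''g'' z = (if z = e then 0 else ?g z)) \<and> ar st' ''g'' M = ?g M - ?x \<and>
     nlive M (vr st' ''cnt'') (ar st' ''g'') \<le> nlive M ?cnt ?g + 1 \<and> t + u \<le> 140) st1"
      using sh2 cp2 cnt t by (simp add: log_op_def fr fa)
  qed
  then show ?thesis
    unfolding insert_arc_def using M e by (auto simp: fun_upd_twist elim!: wp_conseq)
qed

lemma wp_insert_all:
  fixes st0 :: store
  defines "c0 \<equiv> ar st0 ''g''" and "tl0 \<equiv> ar st0 ''tail''" and "hd0 \<equiv> ar st0 ''head''"
  assumes sh: "shape_st n k M st0" and cp: "caps_st M st0" and M: "vr st0 ''M'' = M" "vr st0 ''cnt'' = M" and L: "vr st0 ''L'' = 0"
    and tot: "c0 M = (\<Sum>p\<in>{0..<M}. c0 p)" and neg: "\<And>p. p < 0 \<Longrightarrow> c0 p = 0"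
    and ends: "\<And>e. 0 \<le> e \<Longrightarrow> e < M \<Longrightarrow> 0 \<le> tl0 e \<and> tl0 e < n + k \<and> 0 \<le> hd0 e \<and> hd0 e < n + 2 * k \<and>
      (hd0 e < n \<or> n + k \<le> hd0 e) \<and> tl0 e \<noteq> hd0 e" and trash: "tl0 M = hd0 M"
  shows "wp insert_all (\<lambda>t st'. net_ok n k M c0 tl0 hd0 st' \<and> vr st' ''cnt'' \<le> 2 * M \<and> vr st' ''L'' = M \<and>
     nlive M (vr st' ''cnt'') (ar st' ''g'') \<le> M \<and> int t \<le> 210 * M + 20) st0"
proof -
  let ?st = "st0\<lparr>var := (var st0)((''e'', []) := 0)\<rparr>"
  let ?I = "\<lambda>e st. shape_st n k M st \<and> caps_st M st \<and> log_st c0 st \<and>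
     vr st ''cnt'' \<le> M + e \<and> vr st ''L'' = e \<and>
     (\<forall>p\<le>M. ar st ''tail'' p = tl0 p \<and> ar st ''head'' p = hd0 p) \<and>
     (\<forall>z<M. ar st ''g'' z = (if z < e then 0 else c0 z)) \<and> ar st ''g'' M = (\<Sum>p\<in>{e..<M}. c0 p) \<and>
     nlive M (vr st ''cnt'') (ar st ''g'') \<le> e"
  have M0: "0 \<le> M" using sh by (simp add: shape_ok_def)
  have nn: "0 \<le> c0 p" for p using cp by (simp add: caps_ok_def c0_def)
  have "wp (for_loop ''e'' ''M'' insert_arc) (\<lambda>t st'. ?I (vr ?st ''M'') st' \<and> vr st' ''e'' = vr ?st ''M'' \<and>
      int t \<le> (200 + 10) * (vr ?st ''M'' - vr ?st ''e'') + 10) ?st"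
  proof (rule wp_for_loop)
    have "capat c0 lp lq lr lx 0 = c0" for lp lq lr lx by (rule ext) (simp add: capat_def)
    then have "log_st c0 ?st" using L nn by (auto simp: log_ok_def c0_def)
    then show "?I (vr ?st ''e'') ?st"
      using sh cp M L tot neg by (auto simp: c0_def tl0_def hd0_def nlive_def)
    show "vr ?st ''e'' \<le> vr ?st ''M''" using M M0 by simp
  next
    fix e st
    assume I: "?I e st" and ag: "agree (for_loop ''e'' ''M'' insert_arc) ?st st" and e: "vr st ''e'' = e" "vr ?st ''e'' \<le> e" "e < vr ?st ''M''"
    have upd: "?I j (s\<lparr>var := (var s)((''e'', []) := v)\<rparr>) = ?I j s" for j s v by simp
    have eM: "0 \<le> e" "e < M" using e M by simp_all
    have fr: "vr st ''M'' = M" using ag[THEN agree_var] M by (simp add: insert_arc_def find_arc_def add_cap_def log_op_def)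
    have se: "(\<Sum>p\<in>{e..<M}. c0 p) = c0 e + (\<Sum>p\<in>{e + 1..<M}. c0 p)"
    proof -
      have "{e..<M} = insert e {e + 1..<M}" using eM by auto
      then show ?thesis by simp
    qed
    have ge: "ar st ''g'' e = c0 e" "ar st ''g'' M = (\<Sum>p\<in>{e..<M}. c0 p)" using I eM by auto
    have le: "ar st ''g'' e \<le> ar st ''g'' M"
      unfolding ge se using nn by (simp add: sum_nonneg)
    have tr: "ar st ''tail'' M = ar st ''head'' M" using I trash by simp
    have th: "ar st ''tail'' e = tl0 e" "ar st ''head'' e = hd0 e" using I eM by auto
    have "wp insert_arc (\<lambda>t st'. ?I (e + 1) st' \<and> int t \<le> 200) st"
    proof (rule wp_conseq[OF wp_insert_arc[of n k M st c0 e]])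
      fix t :: nat and st'
      assume *: "shape_st n k M st' \<and> caps_st M st' \<and> log_st c0 st' \<and>
       vr st' ''cnt'' \<le> vr st ''cnt'' + 1 \<and> vr st' ''L'' = vr st ''L'' + 1 \<and>
       (\<forall>p\<le>M. ar st' ''tail'' p = ar st ''tail'' p \<and> ar st' ''head'' p = ar st ''head'' p) \<and>
       (\<forall>z<M. ar st' ''g'' z = (if z = e then 0 else ar st ''g'' z)) \<and> ar st' ''g'' M = ar st ''g'' M - ar st ''g'' e \<and>
       nlive M (vr st' ''cnt'') (ar st' ''g'') \<le> nlive M (vr st ''cnt'') (ar st ''g'') + 1 \<and> t \<le> 200"
      have "\<forall>z<M. ar st' ''g'' z = (if z < e + 1 then 0 else c0 z)" using * I by auto
      moreover have "ar st' ''g'' M = (\<Sum>p\<in>{e + 1..<M}. c0 p)" using * ge se by simp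
      ultimately show "?I (e + 1) st' \<and> int t \<le> 200" using * I by auto
    qed (use I fr e eM le tr th ends[OF eM] in auto)
    then show "wp insert_arc (\<lambda>t st'. ?I (e + 1) (st'\<lparr>var := (var st')((''e'', []) := e + 1)\<rparr>) \<and> int t \<le> 200) st"
      unfolding upd .
  qed (simp_all add: insert_arc_def find_arc_def add_cap_def log_op_def)
  then have "wp (for_loop ''e'' ''M'' insert_arc) (\<lambda>t st'. ?I M st' \<and> vr st' ''M'' = M \<and> int t \<le> 210 * M + 10) ?st"
    by (rule wp_conseq_agree) (use M in \<open>auto dest!: agree_var[of _ _ _ "(''M'', [])"] simp: insert_arc_def find_arc_def add_cap_def log_op_def\<close>)
  then show ?thesis unfolding insert_all_def by (auto simp: net_ok_def elim!: wp_conseq)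
qed

section \<open>The complete algorithm\<close>

definition terminal_flow where
  "terminal_flow n m k src dst h sa sb \<longleftrightarrow> (0 :: int) \<le> m \<and> (1 :: int) \<le> n \<and> (0 :: int) \<le> k \<and>
     (\<forall>e. 0 \<le> e \<and> e < m \<longrightarrow> 0 \<le> src e \<and> src e < n \<and> 0 \<le> dst e \<and> dst e < n \<and> src e \<noteq> dst e \<and> (0 :: int) \<le> h e) \<and>
     (\<forall>i. 0 \<le> i \<and> i < k \<longrightarrow> 0 \<le> sa i \<and> sa i < n \<and> 0 \<le> sb i \<and> sb i < n) \<and>
     inj_on sa {0..<k} \<and> inj_on sb {0..<k} \<and> (\<forall>i j. 0 \<le> i \<and> i < k \<and> 0 \<le> j \<and> j < k \<longrightarrow> sa i \<noteq> sb j) \<and>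
     (\<forall>v. 0 \<le> v \<and> v < n \<and> v \<notin> sa ` {0..<k} \<and> v \<notin> sb ` {0..<k} \<longrightarrow> (\<Sum>e\<in>{0..<m}. h e * bd src dst e v) = 0) \<and>
     (\<forall>i. 0 \<le> i \<and> i < k \<longrightarrow> 0 \<le> (\<Sum>e\<in>{0..<m}. h e * bd src dst e (sa i)) \<and> (\<Sum>e\<in>{0..<m}. h e * bd src dst e (sb i)) \<le> 0)"

lemma sum_shift_int:
  fixes F :: "int \<Rightarrow> int"
  shows "(\<Sum>p\<in>{m..<m + k}. F p) = (\<Sum>i\<in>{0..<k}. F (m + i))"
  by (rule sum.reindex_bij_witness[of _ "\<lambda>i. m + i" "\<lambda>p. p - m"]) auto

lemma sum_ext:
  fixes X :: "int \<Rightarrow> int"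
  assumes "0 \<le> m" "0 \<le> k"
  shows "(\<Sum>p\<in>{0..<m + 2 * k}. X p * bd (with_terminals m k k src (\<lambda>i. n + i) sb) (with_terminals m k k dst sa (\<lambda>i. n + k + i)) p v) =
    (\<Sum>e\<in>{0..<m}. X e * bd src dst e v) + (\<Sum>i\<in>{0..<k}. X (m + i) * (of_bool (n + i = v) - of_bool (sa i = v))) +
    (\<Sum>i\<in>{0..<k}. X (m + k + i) * (of_bool (sb i = v) - of_bool (n + k + i = v)))"
proof -
  let ?F = "\<lambda>p. X p * bd (with_terminals m k k src (\<lambda>i. n + i) sb) (with_terminals m k k dst sa (\<lambda>i. n + k + i)) p v"
  have "{0..<m + 2 * k} = ({0..<m} \<union> {m..<m + k}) \<union> {m + k..<m + k + k}" using assms by auto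
  then have "sum ?F {0..<m + 2 * k} = sum ?F ({0..<m} \<union> {m..<m + k}) + sum ?F {m + k..<m + k + k}"
    by (simp only:) (rule sum.union_disjoint; auto)
  also have "sum ?F ({0..<m} \<union> {m..<m + k}) = sum ?F {0..<m} + sum ?F {m..<m + k}"
    by (rule sum.union_disjoint) auto
  also have "sum ?F {0..<m} = (\<Sum>e\<in>{0..<m}. X e * bd src dst e v)"
    by (rule sum.cong) (auto simp: bd_def with_terminals_def)
  also have "sum ?F {m..<m + k} = (\<Sum>i\<in>{0..<k}. X (m + i) * (of_bool (n + i = v) - of_bool (sa i = v)))"
    unfolding sum_shift_int by (rule sum.cong) (auto simp: bd_def with_terminals_def)
  also have "sum ?F {m + k..<m + k + k} = (\<Sum>i\<in>{0..<k}. X (m + k + i) * (of_bool (sb i = v) - of_bool (n + k + i = v)))"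
    unfolding sum_shift_int by (rule sum.cong) (auto simp: bd_def with_terminals_def)
  finally show ?thesis .
qed

lemma sum_delta_inj:
  fixes X :: "int \<Rightarrow> int"
  assumes "finite A" "inj_on s A" "i \<in> A"
  shows "(\<Sum>j\<in>A. X j * of_bool (s j = s i)) = X i"
proof -
  have "(\<Sum>j\<in>A. X j * of_bool (s j = s i)) = (\<Sum>j\<in>A. of_bool (i = j) * X j)"
    using assms by (intro sum.cong) (auto dest: inj_onD)
  then show ?thesis using sum_of_bool_bd[OF assms(1,3)] by simp
qed

text \<open>At a terminal the capacity of its super arc cancels the divergence of \<open>h\<close>;
  at other vertices that divergence is 0 already. Injectivity and disjointness of \<open>sa\<close>
  and \<open>sb\<close> give every terminal exactly one super arc.\<close>

lemma terminal_flow_ok: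
  fixes tot :: int
  assumes tf: "terminal_flow n m k src dst h sa sb"
  defines "dv \<equiv> \<lambda>v. \<Sum>e\<in>{0..<m}. h e * bd src dst e v"
  defines "c0 \<equiv> (with_terminals m k k (\<lambda>p. if 0 \<le> p \<and> p < m then h p else 0) (\<lambda>i. dv (sa i)) (\<lambda>i. - dv (sb i)))(m + 2 * k := tot)"
    and "tl0 \<equiv> with_terminals m k k src (\<lambda>i. n + i) sb" and "hd0 \<equiv> with_terminals m k k dst sa (\<lambda>i. n + k + i)"
  assumes out: "src (m + 2 * k) = dst (m + 2 * k)"
  shows "flow_ok n (m + 2 * k) c0 tl0 hd0"
    and "\<And>p. p \<noteq> m + 2 * k \<Longrightarrow> 0 \<le> c0 p"
    and "(\<Sum>p\<in>{0..<m + 2 * k}. c0 p) = (\<Sum>e\<in>{0..<m}. h e) + (\<Sum>i\<in>{0..<k}. dv (sa i) - dv (sb i))"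
    and "\<And>e. 0 \<le> e \<Longrightarrow> e < m + 2 * k \<Longrightarrow> 0 \<le> tl0 e \<and> tl0 e < n + k \<and> 0 \<le> hd0 e \<and> hd0 e < n + 2 * k \<and>
      (hd0 e < n \<or> n + k \<le> hd0 e) \<and> tl0 e \<noteq> hd0 e"
proof -
  let ?M = "m + 2 * k"
  have k: "0 \<le> m" "0 \<le> k" "1 \<le> n" using tf by (auto simp: terminal_flow_def)
  have c0: "c0 e = h e" if "0 \<le> e" "e < m" for e using that k by (simp add: c0_def with_terminals_def)
  have c1: "c0 (m + i) = dv (sa i)" if "0 \<le> i" "i < k" for i using that k by (simp add: c0_def with_terminals_def)
  have c2: "c0 (m + k + i) = - dv (sb i)" if "0 \<le> i" "i < k" for i using that k by (simp add: c0_def with_terminals_def)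
  show "0 \<le> c0 p" if "p \<noteq> ?M" for p
  proof -
    have "0 \<le> dv (sa i)" "dv (sb i) \<le> 0" if "0 \<le> i" "i < k" for i using tf that unfolding terminal_flow_def dv_def by blast+
    from this[of "p - m"] this[of "p - m - k"] show ?thesis
      using that tf by (auto simp: c0_def with_terminals_def terminal_flow_def)
  qed
  have "{0..<?M} = ({0..<m} \<union> {m..<m + k}) \<union> {m + k..<m + k + k}" using k by auto
  then have "sum c0 {0..<?M} = sum c0 ({0..<m} \<union> {m..<m + k}) + sum c0 {m + k..<m + k + k}"
    by (simp only:) (rule sum.union_disjoint; auto)
  also have "sum c0 ({0..<m} \<union> {m..<m + k}) = sum c0 {0..<m} + sum c0 {m..<m + k}"
    by (rule sum.union_disjoint) auto
  also have "sum c0 {0..<m} = (\<Sum>e\<in>{0..<m}. h e)" by (rule sum.cong) (auto simp: c0)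
  also have "sum c0 {m..<m + k} = (\<Sum>i\<in>{0..<k}. dv (sa i))" unfolding sum_shift_int by (rule sum.cong) (auto simp: c1)
  also have "sum c0 {m + k..<m + k + k} = (\<Sum>i\<in>{0..<k}. - dv (sb i))" unfolding sum_shift_int by (rule sum.cong) (auto simp: c2)
  finally show "(\<Sum>p\<in>{0..<?M}. c0 p) = (\<Sum>e\<in>{0..<m}. h e) + (\<Sum>i\<in>{0..<k}. dv (sa i) - dv (sb i))"
    by (simp add: sum_subtractf sum_negf)
  show "0 \<le> tl0 e \<and> tl0 e < n + k \<and> 0 \<le> hd0 e \<and> hd0 e < n + 2 * k \<and> (hd0 e < n \<or> n + k \<le> hd0 e) \<and> tl0 e \<noteq> hd0 e"
    if e: "0 \<le> e" "e < ?M" for e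
  proof -
    consider "e < m" | "m \<le> e" "e < m + k" | "m + k \<le> e" by linarith
    then show ?thesis
    proof cases
      case 1
      then have "0 \<le> src e \<and> src e < n \<and> 0 \<le> dst e \<and> dst e < n \<and> src e \<noteq> dst e" using tf e unfolding terminal_flow_def by blast
      then show ?thesis using 1 k by (simp add: tl0_def hd0_def with_terminals_def)
    next
      case 2
      then have "0 \<le> sa (e - m) \<and> sa (e - m) < n" using tf unfolding terminal_flow_def by simp
      then show ?thesis using 2 k by (simp add: tl0_def hd0_def with_terminals_def)
    next
      case 3
      then have "0 \<le> sb (e - m - k) \<and> sb (e - m - k) < n" using tf e unfolding terminal_flow_def by simp
      then show ?thesis using 3 k e by (simp add: tl0_def hd0_def with_terminals_def)
    qed
  qed
  show "flow_ok n ?M c0 tl0 hd0"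
    unfolding flow_ok_def
  proof (intro conjI allI impI)
    show "tl0 ?M = hd0 ?M" using out k by (simp add: tl0_def hd0_def with_terminals_def)
    show "c0 p = 0" if "?M < p" for p using that k by (simp add: c0_def with_terminals_def)
    fix v assume v: "0 \<le> v \<and> v < n"
    have fin: "finite {0..<k}" by simp
    have inj: "inj_on sa {0..<k}" "inj_on sb {0..<k}" and dis: "\<And>i j. i \<in> {0..<k} \<Longrightarrow> j \<in> {0..<k} \<Longrightarrow> sa i \<noteq> sb j"
      using tf by (auto simp: terminal_flow_def)
    have "{0..?M} = insert ?M {0..<?M}" using k by auto
    then have "(\<Sum>p\<in>{0..?M}. c0 p * bd tl0 hd0 p v) = (\<Sum>p\<in>{0..<?M}. c0 p * bd tl0 hd0 p v)"
      using \<open>tl0 ?M = hd0 ?M\<close> by (simp add: bd_def)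
    also have "\<dots> = (\<Sum>e\<in>{0..<m}. c0 e * bd src dst e v) + (\<Sum>i\<in>{0..<k}. c0 (m + i) * (of_bool (n + i = v) - of_bool (sa i = v))) +
      (\<Sum>i\<in>{0..<k}. c0 (m + k + i) * (of_bool (sb i = v) - of_bool (n + k + i = v)))"
      unfolding tl0_def hd0_def by (rule sum_ext) (use k in auto)
    also have "(\<Sum>e\<in>{0..<m}. c0 e * bd src dst e v) = dv v" unfolding dv_def by (rule sum.cong) (auto simp: c0)
    also have "(\<Sum>i\<in>{0..<k}. c0 (m + i) * (of_bool (n + i = v) - of_bool (sa i = v))) = (\<Sum>i\<in>{0..<k}. - (dv (sa i) * of_bool (sa i = v)))"
      by (rule sum.cong) (use v in \<open>auto simp: c1\<close>)
    also have "(\<Sum>i\<in>{0..<k}. c0 (m + k + i) * (of_bool (sb i = v) - of_bool (n + k + i = v))) = (\<Sum>i\<in>{0..<k}. - (dv (sb i) * of_bool (sb i = v)))"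
      by (rule sum.cong) (use v k in \<open>auto simp: c2\<close>)
    also have "dv v + (\<Sum>i\<in>{0..<k}. - (dv (sa i) * of_bool (sa i = v))) + (\<Sum>i\<in>{0..<k}. - (dv (sb i) * of_bool (sb i = v))) = 0"
    proof -
      have zero: "(\<Sum>i\<in>{0..<k}. dv (s i) * of_bool (s i = v)) = 0" if "v \<notin> s ` {0..<k}" for s
        using that by (intro sum.neutral) auto
      consider i where "i \<in> {0..<k}" "v = sa i" | i where "i \<in> {0..<k}" "v = sb i" | "v \<notin> sa ` {0..<k}" "v \<notin> sb ` {0..<k}" by blast
      then show ?thesis
      proof cases
        case 1
        then have "v \<notin> sb ` {0..<k}" using dis by auto
        then show ?thesis using zero[of sb] sum_delta_inj[OF fin inj(1) 1(1), of "\<lambda>i. dv (sa i)"]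
          unfolding sum_negf 1(2) by linarith
      next
        case 2
        have "v \<notin> sa ` {0..<k}"
        proof
          assume "v \<in> sa ` {0..<k}"
          then obtain j where j: "j \<in> {0..<k}" "v = sa j" by blast
          show False using dis[OF j(1) 2(1)] j(2) 2(2) by simp
        qed
        then show ?thesis using zero[of sa] sum_delta_inj[OF fin inj(2) 2(1), of "\<lambda>i. dv (sb i)"]
          unfolding sum_negf 2(2) by linarith
      next
        case 3
        then have "dv v = 0" using tf v unfolding terminal_flow_def dv_def by blast
        then show ?thesis using zero[OF 3(1)] zero[OF 3(2)] unfolding sum_negf by linarith
      qed
    qed
    finally show "(\<Sum>p\<in>{0..?M}. c0 p * bd tl0 hd0 p v) = 0" .
  qed
qed

definition build :: "nat \<Rightarrow> com" where
  "build k = (divergences;; add_terminals k;; rows;; insert_all;; list_vertices)"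

definition fresh :: "store \<Rightarrow> bool" where
  "fresh st \<longleftrightarrow> vr st ''L'' = 0 \<and>
     (\<forall>x\<in>{''g'', ''dv'', ''row'', ''mat'', ''onx'', ''ohd'', ''inx'', ''ihd'', ''deg'', ''el''}. ar st x = (\<lambda>_. 0)) \<and>
     (\<forall>c. part st c = (\<lambda>_. 0))"

lemma wp_build:
  fixes st0 :: store and k :: nat
  defines "n \<equiv> vr st0 ''n''" and "m \<equiv> vr st0 ''m''" and "src \<equiv> ar st0 ''tail''" and "dst \<equiv> ar st0 ''head''" and "h \<equiv> ar st0 ''h''"
    and "sa \<equiv> \<lambda>i. ar st0 ''s'' (i + 1)" and "sb \<equiv> \<lambda>i. ar st0 ''sigmaV'' (ar st0 ''s'' (i + 1))" and "M \<equiv> vr st0 ''m'' + 2 * int k"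
  defines "tl0 \<equiv> with_terminals m (int k) (int k) src (\<lambda>i. n + i) sb" and "hd0 \<equiv> with_terminals m (int k) (int k) dst sa (\<lambda>i. n + int k + i)"
  assumes fresh: "fresh st0" and tf: "terminal_flow n m (int k) src dst h sa sb"
    and out: "src M = dst M"
  shows "wp (build k) (\<lambda>t st'. (\<exists>c0. (\<forall>e. 0 \<le> e \<and> e < m \<longrightarrow> c0 e = h e) \<and> flow_ok n M c0 tl0 hd0 \<and>
     stage_inv n (int k) M c0 tl0 hd0 st') \<and> vr st' ''n'' = n \<and> vr st' ''m'' = m \<and> vr st' ''t'' = n \<and> vr st' ''cnt'' \<le> 2 * M \<and> vr st' ''L'' = M \<and>
     (\<forall>c. part st' c = (\<lambda>_. 0)) \<and> int t \<le> 400 * (M + n) + 200) st0"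
proof -
  define dv where "dv v = (\<Sum>e\<in>{0..<m}. h e * bd src dst e v)" for v
  define tot where "tot = (\<Sum>e\<in>{0..<m}. h e) + (\<Sum>i\<in>{0..<int k}. dv (sa i) - dv (sb i))"
  define c0 where "c0 = (with_terminals m (int k) (int k) (\<lambda>p. if 0 \<le> p \<and> p < m then h p else 0) (\<lambda>i. dv (sa i)) (\<lambda>i. - dv (sb i)))(M := tot)"
  have k: "0 \<le> m" "1 \<le> n" "0 \<le> M" "m \<le> M" using tf by (auto simp: terminal_flow_def M_def m_def)
  have Mk: "M = m + 2 * int k" by (simp add: M_def m_def)
  note ok = terminal_flow_ok(1-3)[OF tf out[unfolded Mk], where tot = tot, folded dv_def Mk tl0_def hd0_def, folded c0_def]
    terminal_flow_ok(4)[OF tf out[unfolded Mk], folded Mk tl0_def hd0_def]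
  have c0M: "c0 M = (\<Sum>p\<in>{0..<M}. c0 p)" unfolding ok(3) by (simp add: c0_def tot_def)
  have c0nn: "0 \<le> c0 p" for p
  proof (cases "p = M")
    case True
    have "0 \<le> (\<Sum>p\<in>{0..<M}. c0 p)" using ok(2) by (intro sum_nonneg) auto
    then show ?thesis using True c0M by simp
  qed (use ok(2) in blast)
  have c0out: "c0 p = 0" if "p < 0 \<or> M < p" for p using that k by (auto simp: c0_def with_terminals_def Mk)
  have z: "ar st0 ''g'' = (\<lambda>_. 0)" "ar st0 ''dv'' = (\<lambda>_. 0)" "ar st0 ''row'' = (\<lambda>_. 0)" "ar st0 ''mat'' = (\<lambda>_. 0)" "ar st0 ''onx'' = (\<lambda>_. 0)" "ar st0 ''ohd'' = (\<lambda>_. 0)" "ar st0 ''inx'' = (\<lambda>_. 0)" "ar st0 ''ihd'' = (\<lambda>_. 0)" "ar st0 ''deg'' = (\<lambda>_. 0)" "ar st0 ''el'' = (\<lambda>_. 0)"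
    using fresh unfolding fresh_def by simp_all
  show ?thesis
    unfolding build_def
  proof (rule wp_SeqI[OF wp_divergences], goal_cases)
    case (4 t1 st1)
    note ag1 = 4(2)[THEN agree_arr] 4(2)[THEN agree_var]
    have f1: "vr st1 ''n'' = n" "vr st1 ''m'' = m" "vr st1 ''L'' = 0" "ar st1 ''tail'' = src" "ar st1 ''head'' = dst" "ar st1 ''s'' = ar st0 ''s''"
      "ar st1 ''sigmaV'' = ar st0 ''sigmaV''" "part st1 = part st0"
      using fresh ag1 by (simp_all add: divergences_def n_def m_def src_def dst_def fresh_def part_def fun_eq_iff)
    have z1: "ar st1 ''row'' = (\<lambda>_. 0)" "ar st1 ''mat'' = (\<lambda>_. 0)" "ar st1 ''onx'' = (\<lambda>_. 0)" "ar st1 ''ohd'' = (\<lambda>_. 0)" "ar st1 ''inx'' = (\<lambda>_. 0)" "ar st1 ''ihd'' = (\<lambda>_. 0)" "ar st1 ''deg'' = (\<lambda>_. 0)" "ar st1 ''el'' = (\<lambda>_. 0)"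
      using ag1(1) z by (simp_all add: divergences_def)
    have d1: "ar st1 ''dv'' = dv" "ar st1 ''g'' = (\<lambda>p. if 0 \<le> p \<and> p < m then h p else 0)" "vr st1 ''tot'' = (\<Sum>e\<in>{0..<m}. h e)"
      "int t1 \<le> 50 * m + 20"
      using 4(1) by (auto simp: dv_def h_def src_def dst_def m_def)
    show ?case
    proof (rule wp_SeqI[OF wp_add_terminals], goal_cases)
      case (1 t2 st2)
      note ag2 = 1(2)[THEN agree_arr] 1(2)[THEN agree_var]
      have f2: "vr st2 ''n'' = n" "vr st2 ''m'' = m" "vr st2 ''L'' = 0" "part st2 = part st0"
        using ag2 f1 by (simp_all add: add_terminals_def part_def fun_eq_iff)
      have z2: "ar st2 ''row'' = (\<lambda>_. 0)" "ar st2 ''mat'' = (\<lambda>_. 0)" "ar st2 ''onx'' = (\<lambda>_. 0)" "ar st2 ''ohd'' = (\<lambda>_. 0)" "ar st2 ''inx'' = (\<lambda>_. 0)" "ar st2 ''ihd'' = (\<lambda>_. 0)" "ar st2 ''deg'' = (\<lambda>_. 0)" "ar st2 ''el'' = (\<lambda>_. 0)"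
        using ag2(1) z1 by (simp_all add: add_terminals_def)
      have d2: "ar st2 ''tail'' = tl0" "ar st2 ''head'' = hd0" "ar st2 ''g'' = c0" "vr st2 ''M'' = M" "vr st2 ''N'' = n + 2 * int k"
        "vr st2 ''cnt'' = M" "int t2 \<le> 80 * int k + 50"
        using 1(1) unfolding f1 d1 by (auto simp: tl0_def hd0_def c0_def tot_def sa_def sb_def Mk)
      show ?case
      proof (rule wp_SeqI[OF wp_rows], goal_cases)
        case (3 t3 st3)
        note ag3 = 3(2)[THEN agree_arr] 3(2)[THEN agree_var]
        have f3: "vr st3 ''n'' = n" "vr st3 ''m'' = m" "vr st3 ''L'' = 0" "part st3 = part st0" "ar st3 ''tail'' = tl0" "ar st3 ''head'' = hd0"
          "ar st3 ''g'' = c0" "vr st3 ''M'' = M" "vr st3 ''cnt'' = M"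
          using ag3 f2 d2 by (simp_all add: rows_def part_def fun_eq_iff)
        have z3: "ar st3 ''mat'' = (\<lambda>_. 0)" "ar st3 ''onx'' = (\<lambda>_. 0)" "ar st3 ''ohd'' = (\<lambda>_. 0)" "ar st3 ''inx'' = (\<lambda>_. 0)" "ar st3 ''ihd'' = (\<lambda>_. 0)" "ar st3 ''deg'' = (\<lambda>_. 0)" "ar st3 ''el'' = (\<lambda>_. 0)"
          using ag3(1) z2 by (simp_all add: rows_def)
        have d3: "\<forall>u. 0 \<le> u \<and> u < n + 2 * int k \<longrightarrow> ar st3 ''row'' u = u * (n + 2 * int k)" "int t3 \<le> 30 * (n + 2 * int k) + 20"
          using 3(1) unfolding d2 by auto
        have sh: "shape_st n (int k) M st3"
          using k d3 z3 by (auto simp: shape_ok_def chain_def mat_ok_def f3)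
        have cp: "caps_st M st3"
          using c0nn c0out z3 by (auto simp: caps_ok_def f3 ndeg_def)
        have "wp insert_all (\<lambda>t st'. net_ok n (int k) M c0 tl0 hd0 st' \<and> vr st' ''cnt'' \<le> 2 * M \<and> vr st' ''L'' = M \<and>
           nlive M (vr st' ''cnt'') (ar st' ''g'') \<le> M \<and> int t \<le> 210 * M + 20) st3"
          using wp_insert_all[OF sh cp f3(8,9,3)] c0M c0out ok(4) ok(1) unfolding f3 flow_ok_def by blast
        then show ?case
        proof (rule wp_SeqI, goal_cases)
          case (1 t4 st4)
          note ag4 = 1(2)[THEN agree_arr] 1(2)[THEN agree_var]
          have f4: "vr st4 ''n'' = n" "vr st4 ''m'' = m" "part st4 = part st0" "ar st4 ''el'' = (\<lambda>_. 0)"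
            using ag4 f3 z3 by (simp_all add: insert_all_def insert_arc_def find_arc_def add_cap_def log_op_def part_def fun_eq_iff)
          show ?case
          proof (rule wp_conseq_agree[OF wp_list_vertices], goal_cases)
            case (2 t5 st5)
            note ag5 = 2(2)[THEN agree_arr] 2(2)[THEN agree_var]
            have f5: "vr st5 ''n'' = vr st4 ''n''" "vr st5 ''m'' = vr st4 ''m''" "vr st5 ''M'' = vr st4 ''M''"
              "vr st5 ''cnt'' = vr st4 ''cnt''" "vr st5 ''L'' = vr st4 ''L''"
              using ag5(2) by (simp_all add: list_vertices_def)
            have a5: "ar st5 ''rem'' u = u" if "0 \<le> u" "u < n" for u using 2(1) that unfolding f4 by blast
            have a5': "arr st5 A = arr st4 A" if "A \<noteq> (''rem'', [])" for A using ag5(1)[of A] that by (simp add: list_vertices_def)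
            have t5: "vr st5 ''t'' = n" "int t5 \<le> 30 * n + 20" using 2(1) unfolding f4 by auto
            have "net_ok n (int k) M c0 tl0 hd0 st4" using 1(1) by blast
            then have "net_ok n (int k) M c0 tl0 hd0 st5"
              by (simp add: net_ok_def a5' f5)
            moreover have "remaining n st5 = {0..<n}" using f4 by (auto simp: remaining_def a5')
            moreover have "inj_on (ar st5 ''rem'') {0..<n}" "ar st5 ''rem'' ` {0..<n} = {0..<n}"
              using a5 by (auto simp: inj_on_def image_def)
            ultimately have "stage_inv n (int k) M c0 tl0 hd0 st5"
              using 1(1) k f4 unfolding stage_inv_def t5 by (simp add: a5' f5)
            moreover have "\<forall>e. 0 \<le> e \<and> e < m \<longrightarrow> c0 e = h e" using k by (simp add: c0_def with_terminals_def Mk)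
            moreover have "vr st5 ''n'' = n" "vr st5 ''m'' = m" "vr st5 ''cnt'' \<le> 2 * M" "vr st5 ''L'' = M" using 1(1) f4 by (simp_all add: f5)
            moreover have "part st5 c = (\<lambda>_. 0)" for c using f4(3) fresh by (simp add: part_def a5' fun_eq_iff fresh_def)
            moreover have "int (t1 + (t2 + (t3 + (t4 + t5)))) \<le> 400 * (M + n) + 200"
              using d1(4) d2(7) d3(2) 1(1) t5(2) k Mk by simp
            ultimately show ?case using ok(1) t5(1) by blast
          qed (use f4 k in simp)
        qed
      qed (use z2 d2 k in auto)
    qed
  qed (use z k in \<open>auto simp: m_def\<close>)
qed

definition solve :: "nat \<Rightarrow> com" where
  "solve k = (elim_all;; assign_all k;; undo_all k)"

text \<open>Both ends of a live arc have positive degree, so neither is ordinary, and the shape of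
  the network leaves only arcs from a source to a sink.\<close>

lemma final_ends:
  assumes net: "net_ok n k M c0 tl0 hd0 st" and gone: "\<And>z. 0 \<le> z \<Longrightarrow> z < n \<Longrightarrow> ar st ''deg'' z = 0"
    and p: "M < p" "p \<le> vr st ''cnt''" "0 < ar st ''g'' p"
  shows "n \<le> ar st ''tail'' p \<and> ar st ''tail'' p < n + k \<and> n + k \<le> ar st ''head'' p \<and> ar st ''head'' p < n + 2 * k"
proof -
  let ?tl = "ar st ''tail''" and ?hd = "ar st ''head''"
  have e: "0 \<le> ?tl p" "0 \<le> ?hd p" "?hd p < n + 2 * k" "?tl p < n + k" "?hd p < n \<or> n + k \<le> ?hd p"
    using net p unfolding net_ok_def shape_ok_def mat_ok_def by blast+
  have "0 < ar st ''deg'' z" if "z = ?tl p \<or> z = ?hd p" for z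
  proof -
    have "ar st ''deg'' = ndeg M (vr st ''cnt'') ?tl ?hd (ar st ''g'')" using net by (simp add: net_ok_def caps_ok_def)
    then show ?thesis using ndeg_pos[of M p _ _ ?tl z ?hd] p that by auto
  qed
  then have "\<not> ?tl p < n" "\<not> ?hd p < n" using gone e by force+
  then show ?thesis using e by auto
qed

lemma sum_pairs_joins:
  assumes "n \<le> src p" "src p < n + int k" "n + int k \<le> dst p" "dst p < n + 2 * int k"
  shows "(\<Sum>c\<in>set (pairs k). if joins n (int k) src dst c p then (x :: int) else 0) = x"
proof -
  let ?c = "(nat (src p - n + 1), nat (dst p - n - int k + 1))"
  have c: "?c \<in> set (pairs k)" using assms by (auto simp: set_pairs)
  have "joins n (int k) src dst c p \<longleftrightarrow> c = ?c" for c
    unfolding joins_def prod_eq_iff using assms by auto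
  then have "(\<Sum>c\<in>set (pairs k). if joins n (int k) src dst c p then x else 0) = (\<Sum>c\<in>set (pairs k). if c = ?c then x else 0)"
    by simp
  also have "\<dots> = x" using c by simp
  finally show ?thesis .
qed

text \<open>\<open>K\<close> is the sum of the cost factor of \<open>assign_all\<close> per network
  arc and that of \<open>undo_all\<close> per log entry. Carried in \<open>stage_pot\<close>, it
  prepays both phases, whose lengths are fixed only by the elimination.\<close>

lemma wp_solve:
  fixes st0 :: store and k :: nat and n M :: int
  defines "K \<equiv> 80 * int (k * k) + 60"
  assumes k: "1 \<le> k" and inv: "stage_inv n (int k) M c0 tl0 hd0 st0" and fl: "flow_ok n M c0 tl0 hd0"
    and v0: "vr st0 ''n'' = n" "vr st0 ''t'' = n" "vr st0 ''cnt'' \<le> 2 * M" "vr st0 ''L'' = M" "\<And>c. part st0 c = (\<lambda>_. 0)"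
    and n: "1 \<le> n" and M: "1 \<le> M"
  shows "wp (solve k) (\<lambda>t st'. (\<forall>p. 0 \<le> p \<and> p < M \<longrightarrow> (\<Sum>c\<in>set (pairs k). part st' c p) = c0 p) \<and>
     (\<forall>c\<in>set (pairs k). (\<forall>p. 0 \<le> part st' c p) \<and> (\<exists>V\<ge>0. \<forall>v. (\<Sum>p\<in>{0..<M}. part st' c p * bd tl0 hd0 p v) =
         V * (of_bool (n + int (fst c) - 1 = v) - of_bool (n + int k + int (snd c) - 1 = v)))) \<and>
     real t \<le> real_of_int ((3 * K + 120) * M + 100) + real_of_int (150 + (2 * K + 700) * (2 + 4 * int k)) *
        (of_int n + 42 * of_int M * log 2 (2 + (of_int n)\<^sup>2 / of_int M))) st0"
proof -
  let ?W = "real_of_int (150 + (2 * K + 700) * (2 + 4 * int k)) * (of_int n + 42 * of_int M * log 2 (2 + (of_int n)\<^sup>2 / of_int M))"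
  have K: "0 \<le> K" by (simp add: K_def)
  \<comment> \<open>\<open>L = M\<close> and \<open>cnt <= 2 * M\<close> give the factor 3, and each
    of the at most \<open>M\<close> network arcs holds two list positions with credit 60.\<close>
  have pot0: "stage_pot K M st0 \<le> (3 * K + 120) * M"
  proof -
    have net: "net_ok n (int k) M c0 tl0 hd0 st0" using inv by (simp add: stage_inv_def)
    have "unscanned M st0 \<le> (\<Sum>z\<in>{M<..vr st0 ''cnt''}. 2)" unfolding unscanned_def by (rule sum_mono) auto
    also have "\<dots> \<le> 2 * M" using v0(3) M by simp
    finally have "unscanned M st0 \<le> 2 * M" .
    moreover have "K * (vr st0 ''L'' + vr st0 ''cnt'') \<le> K * (3 * M)" using v0 K by (intro mult_left_mono) auto
    ultimately show ?thesis unfolding stage_pot_def by (simp add: algebra_simps)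
  qed
  show ?thesis
    unfolding solve_def
  proof (rule wp_SeqI[OF wp_elim_all[OF inv fl K n M]], goal_cases)
    case (3 t1 st1)
    note inv1 = 3(1)[THEN conjunct1]
    have t1: "real t1 + real_of_int (stage_pot K M st1) \<le> real_of_int ((3 * K + 120) * M) + ?W + 20"
      using 3(1) pot0 by (meson add_right_mono of_int_le_iff order_trans)
    have net: "net_ok n (int k) M c0 tl0 hd0 st1" and "remaining n st1 = {}"
      and gone: "\<And>z. 0 \<le> z \<Longrightarrow> z < n \<Longrightarrow> ar st1 ''el'' z \<noteq> 0 \<Longrightarrow> ar st1 ''deg'' z = 0"
      using 3(1) unfolding stage_inv_def by auto
    then have gone: "ar st1 ''deg'' z = 0" if "0 \<le> z" "z < n" for z using that by (auto simp: remaining_def)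
    let ?tl = "ar st1 ''tail''" and ?hd = "ar st1 ''head''" and ?g = "ar st1 ''g''" and ?cnt = "vr st1 ''cnt''"
    note defs = elim_all_def stage_def visit_def eliminate_def advance_def shortcut_def pick_def lower_def link_def find_arc_def add_cap_def log_op_def
    have f1: "vr st1 ''n'' = n" "part st1 = part st0"
      using 3(2)[THEN agree_var] 3(2)[THEN agree_arr] v0 by (simp_all add: defs part_def fun_eq_iff)
    have M1: "vr st1 ''M'' = M" "0 \<le> M" "M \<le> ?cnt" and lg: "log_st c0 st1" and g0: "\<And>z. z < M \<Longrightarrow> ?g z = 0"
      and nn: "\<And>z. 0 \<le> ?g z" and th: "\<And>p. p \<le> M \<Longrightarrow> ?tl p = tl0 p \<and> ?hd p = hd0 p"
      using net by (auto simp: net_ok_def shape_ok_def caps_ok_def)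
    have trash: "tl0 M = hd0 M" and c0z: "\<And>p. M < p \<Longrightarrow> c0 p = 0" using fl by (auto simp: flow_ok_def)
    show ?case
    proof (rule wp_SeqI[OF wp_assign_all[OF k _ M1(1,3)]], goal_cases)
      case (2 t2 st2)
      have pt: "part st2 c z = (if z = M then (if c = (1, 1) then ?g M else 0)
         else if M < z \<and> z \<le> ?cnt \<and> joins n (int k) ?tl ?hd c z then ?g z else 0)" if "c \<in> set (pairs k)" for c z
        using 2(1) that unfolding f1 by blast
      have t2: "int t2 \<le> (20 * int (k * k) + 20) * (?cnt - M) + 40" using 2(1) by blast
      have f2: "vr st2 ''cnt'' = ?cnt" "vr st2 ''L'' = vr st1 ''L''" "ar st2 ''tail'' = ?tl" "ar st2 ''head'' = ?hd" "ar st2 ''g'' = ?g"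
        "ar st2 ''lp'' = ar st1 ''lp''" "ar st2 ''lq'' = ar st1 ''lq''" "ar st2 ''lr'' = ar st1 ''lr''" "ar st2 ''lx'' = ar st1 ''lx''"
        using 2(2)[THEN agree_var] 2(2)[THEN agree_arr] by (auto simp: assign_all_def assign_part_def written_seqs)
      \<comment> \<open>The value of part \<open>c\<close> is read off after the elimination, when
        all of its network arcs lead from one super source to one super sink.\<close>
      define V where "V c = (\<Sum>p\<in>{M<..?cnt}. part st2 c p)" for c
      define \<beta> where "\<beta> c v = V c * (of_bool (n + int (fst c) - 1 = v) - of_bool (n + int k + int (snd c) - 1 = v))" for c v
      have ptnn: "0 \<le> part st2 c z" if "c \<in> set (pairs k)" for c z using pt[OF that] nn by simp
      have tot: "(\<Sum>c\<in>set (pairs k). part st2 c p) = ?g p" if p: "0 \<le> p" "p \<le> ?cnt" for p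
      proof -
        consider "p < M" | "p = M" | "M < p" by linarith
        then show ?thesis
        proof cases
          case 1
          then show ?thesis using pt g0 by simp
        next
          case 2
          have "(1, 1) \<in> set (pairs k)" using k by (simp add: set_pairs)
          moreover have "(\<Sum>c\<in>set (pairs k). part st2 c p) = (\<Sum>c\<in>set (pairs k). if c = (1, 1) then ?g M else 0)"
            using pt 2 by (intro sum.cong) auto
          ultimately show ?thesis using 2 by simp
        next
          case 3
          have "(\<Sum>c\<in>set (pairs k). part st2 c p) = (\<Sum>c\<in>set (pairs k). if joins n (int k) ?tl ?hd c p then ?g p else 0)"
            using pt 3 p by (intro sum.cong) auto
          also have "\<dots> = ?g p"
          proof (cases "?g p = 0")
            case False
            then have "0 < ?g p" using nn[of p] by simp
            then show ?thesis using final_ends[OF net gone 3 p(2)] by (intro sum_pairs_joins) auto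
          next
            case True
            then show ?thesis by (intro trans[OF sum.neutral]) auto
          qed
          finally show ?thesis .
        qed
      qed
      have bdsum: "(\<Sum>p\<in>{0..?cnt}. part st2 c p * bd ?tl ?hd p v) = \<beta> c v" if c: "c \<in> set (pairs k)" for c v
      proof -
        have "(\<Sum>p\<in>{0..?cnt}. part st2 c p * bd ?tl ?hd p v) = (\<Sum>p\<in>{M<..?cnt}. part st2 c p * bd ?tl ?hd p v)"
        proof (rule sum.mono_neutral_right)
          show "\<forall>p\<in>{0..?cnt} - {M<..?cnt}. part st2 c p * bd ?tl ?hd p v = 0"
            using pt[OF c] th[of M] trash by (auto simp: bd_def)
        qed (use M1 in auto)
        also have "\<dots> = (\<Sum>p\<in>{M<..?cnt}. part st2 c p * (of_bool (n + int (fst c) - 1 = v) - of_bool (n + int k + int (snd c) - 1 = v)))"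
          by (rule sum.cong) (auto simp: pt[OF c] joins_def bd_def)
        finally show ?thesis unfolding \<beta>_def V_def sum_distrib_right .
      qed
      have sp: "split_ok k (ar st2 ''g'') (vr st2 ''cnt'') (ar st2 ''tail'') (ar st2 ''head'') \<beta> st2"
        unfolding split_ok_def f2 using tot ptnn bdsum by auto
      have lg2: "log_st c0 st2" using lg by (simp add: f2)
      show ?case
      proof (rule wp_conseq[OF wp_undo_all[OF sp lg2]], unfold f2, elim conjE, intro conjI allI ballI impI)
        fix t3 :: nat and st3
        assume sp3: "split_ok k c0 ?cnt ?tl ?hd \<beta> st3" and t3: "int t3 \<le> (60 * int (k * k) + 40) * vr st1 ''L'' + 10"
        have tot3: "(\<Sum>c\<in>set (pairs k). part st3 c p) = c0 p" if "0 \<le> p" "p \<le> ?cnt" for p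
          using sp3 that unfolding split_ok_def by simp
        have nn3: "0 \<le> part st3 c p" if "c \<in> set (pairs k)" for c p using sp3 that unfolding split_ok_def by blast
        show "(\<Sum>c\<in>set (pairs k). part st3 c p) = c0 p" if "0 \<le> p \<and> p < M" for p using tot3[of p] that M1 by simp
        show "0 \<le> part st3 c p" if "c \<in> set (pairs k)" for c p using nn3 that .
        show "\<exists>V\<ge>0. \<forall>v. (\<Sum>p\<in>{0..<M}. part st3 c p * bd tl0 hd0 p v) =
           V * (of_bool (n + int (fst c) - 1 = v) - of_bool (n + int k + int (snd c) - 1 = v))" if c: "c \<in> set (pairs k)" for c
        proof (intro exI[of _ "V c"] conjI allI)
          show "0 \<le> V c" unfolding V_def using ptnn[OF c] by (intro sum_nonneg) auto
          fix v
          \<comment> \<open>Before any move the network arcs are empty, and nonnegative parts of 0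
            vanish. The divergence of a part is then carried by the raw arcs alone.\<close>
          have "part st3 c p = 0" if "M < p" "p \<le> ?cnt" for p
          proof -
            have "(\<Sum>c\<in>set (pairs k). part st3 c p) = 0" using tot3[of p] c0z[of p] that M1 by simp
            then show ?thesis using nn3 c by (simp add: sum_nonneg_eq_0_iff)
          qed
          then have "(\<Sum>p\<in>{0..<M}. part st3 c p * bd ?tl ?hd p v) = (\<Sum>p\<in>{0..?cnt}. part st3 c p * bd ?tl ?hd p v)"
          proof (intro sum.mono_neutral_left ballI)
            fix p assume z: "\<And>p. M < p \<Longrightarrow> p \<le> ?cnt \<Longrightarrow> part st3 c p = 0" and p: "p \<in> {0..?cnt} - {0..<M}"
            then show "part st3 c p * bd ?tl ?hd p v = 0"
              using th[of M] trash by (cases "p = M") (auto simp: bd_def)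
          qed (use M1 in auto)
          also have "\<dots> = \<beta> c v" using sp3 c unfolding split_ok_def by blast
          also have "(\<Sum>p\<in>{0..<M}. part st3 c p * bd ?tl ?hd p v) = (\<Sum>p\<in>{0..<M}. part st3 c p * bd tl0 hd0 p v)"
            by (rule sum.cong) (auto simp: bd_def th)
          finally show "(\<Sum>p\<in>{0..<M}. part st3 c p * bd tl0 hd0 p v) =
            V c * (of_bool (n + int (fst c) - 1 = v) - of_bool (n + int k + int (snd c) - 1 = v))" unfolding \<beta>_def .
        qed
        have "0 \<le> vr st1 ''L''" using lg by (simp add: log_ok_def)
        have "unscanned M st1 \<ge> 0" unfolding unscanned_def by (rule sum_nonneg) auto
        moreover have "int t2 + int t3 \<le> K * (vr st1 ''L'' + ?cnt) + 50"
        proof -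
          have "(20 * int (k * k) + 20) * (?cnt - M) \<le> K * ?cnt"
            unfolding K_def using M1 by (intro mult_mono) auto
          moreover have "(60 * int (k * k) + 40) * vr st1 ''L'' \<le> K * vr st1 ''L''"
            unfolding K_def using \<open>0 \<le> vr st1 ''L''\<close> by (intro mult_right_mono) auto
          ultimately show ?thesis using t2 t3 by (simp add: distrib_left)
        qed
        ultimately have "int t2 + int t3 \<le> stage_pot K M st1 + 50" unfolding stage_pot_def by simp
        then have "real t2 + real t3 \<le> real_of_int (stage_pot K M st1) + 50" by linarith
        then show "real (t1 + (t2 + t3)) \<le> real_of_int ((3 * K + 120) * M + 100) + ?W" using t1 by simp
      qed
    qed (use f1 v0 in simp)
  qed (use v0 in auto)
qed

definition round_flow :: com where
  "round_flow = (splice_all;; round_all)"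

lemma wp_round_flow:
  fixes st0 :: store and n :: int
  defines "m \<equiv> vr st0 ''m''" and "f \<equiv> ar st0 ''f''" and "sv \<equiv> ar st0 ''sigmaV''" and "se \<equiv> ar st0 ''sigmaE''"
    and "src \<equiv> ar st0 ''tail''" and "dst \<equiv> ar st0 ''head''"
  assumes z: "ar st0 ''wait'' = (\<lambda>_. 0)" "ar st0 ''sg'' = (\<lambda>_. 0)" "ar st0 ''x'' = (\<lambda>_. 0)" and m: "0 \<le> m"
    and sv: "\<And>v. 0 \<le> v \<Longrightarrow> v < n \<Longrightarrow> 0 \<le> sv v \<and> sv v < n \<and> sv (sv v) = v \<and> sv v \<noteq> v"
    and se: "\<And>e. 0 \<le> e \<Longrightarrow> e < m \<Longrightarrow> 0 \<le> se e \<and> se e < m \<and> se (se e) = e \<and> se e \<noteq> e \<and>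
       0 \<le> src e \<and> src e < n \<and> 0 \<le> dst e \<and> dst e < n \<and> src (se e) = sv (dst e) \<and> dst (se e) = sv (src e)"
    and f: "\<And>e. 0 \<le> e \<Longrightarrow> e < m \<Longrightarrow> 0 \<le> f e \<and> f (se e) = f e"
  shows "wp round_flow (\<lambda>t st'. (\<forall>e. 0 \<le> e \<and> e < m \<longrightarrow> 0 \<le> ar st' ''h'' e \<and> ar st' ''h'' e + ar st' ''h'' (se e) = f e) \<and>
     (\<forall>v. 0 \<le> v \<and> v < n \<longrightarrow>
       \<bar>2 * (\<Sum>e\<in>{0..<m}. ar st' ''h'' e * bd src dst e v) - (\<Sum>e\<in>{0..<m}. f e * bd src dst e v)\<bar> \<le> 1) \<and>
     int t \<le> 300 * m + 30) st0"
  unfolding round_flow_def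
proof (rule wp_SeqI[OF wp_splice_all[OF z(1,2) m[unfolded m_def]]], goal_cases)
  case (1 t1 st1)
  note sp = 1(1)[folded f_def sv_def se_def src_def dst_def m_def]
  have fr: "ar st1 ''f'' = f" "ar st1 ''sigmaE'' = se" "vr st1 ''m'' = m" "ar st1 ''x'' = (\<lambda>_. 0)"
    using 1(2)[THEN agree_arr] 1(2)[THEN agree_var] z(3)
    by (simp_all add: splice_all_def splice_edge_def load_ends_def attach_a_def attach_b_def register_def f_def se_def m_def)
  have spl: "spliced (\<lambda>i. rep sv (src i)) (\<lambda>i. rep sv (dst i)) (odd_reps se f m) (ar st1 ''wait'') (ar st1 ''ta'') (ar st1 ''tb'')
    (ar st1 ''par'') (ar st1 ''sg'')" using sp by blast
  then have links: "links_ok (odd_reps se f m) (ar st1 ''wait'') (ar st1 ''ta'') (ar st1 ''tb'') (ar st1 ''par'') (ar st1 ''sg'')"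
    by (simp add: spliced_def)
  show ?case
  proof (rule wp_conseq[OF wp_round_all[OF fr(4), unfolded fr, OF links]], goal_cases)
    case (3 t2 st2)
    then obtain x where x: "follows (odd_reps se f m) (ar st1 ''par'') (ar st1 ''sg'') x" "\<forall>i\<in>odd_reps se f m. x i \<in> {-1, 1}"
      "\<forall>i. i \<notin> odd_reps se f m \<longrightarrow> x i = 0"
      "\<forall>j. 0 \<le> j \<and> j < m \<and> j < se j \<longrightarrow> ar st2 ''h'' j = (f j + x j) div 2 \<and> ar st2 ''h'' (se j) = f j - (f j + x j) div 2"
      by blast
    have bal: "\<bar>\<Sum>i\<in>odd_reps se f m. x i * bd (\<lambda>i. rep sv (src i)) (\<lambda>i. rep sv (dst i)) i v\<bar> \<le> 1" for v
      by (rule spliced_balance[OF spl x(1,2)])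
    note R = round_balance[where n = n and m = m and tl = src and hd = dst and sv = sv and se = se and f = f and x = x and g = "ar st2 ''h''",
        OF sv se f x(2,3) bal x(4)]
    show ?case using R sp 3 by auto
  qed (use se m in auto)
qed

definition decompose :: "nat \<Rightarrow> com" where
  "decompose k = (round_flow;; build k;; solve k;; output_all k)"

section \<open>Transfer to the original graph\<close>

lemma divergence_sum:
  fixes G :: "(nat, nat) pre_digraph"
  assumes "finite (arcs G)" and arcs: "arcs G = {..<m}"
    and src: "\<And>e. e < m \<Longrightarrow> src (int e) = int (tail G e)" and dst: "\<And>e. e < m \<Longrightarrow> dst (int e) = int (head G e)"
  shows "divergence G (\<lambda>e. H (int e)) v = (\<Sum>e\<in>{0..<int m}. H e * bd src dst e (int v) :: int)"
proof -
  have "(\<Sum>e\<in>{0..<int m}. H e * bd src dst e (int v)) = (\<Sum>e\<in>{..<m}. H (int e) * bd src dst (int e) (int v))"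
    by (rule sum.reindex_bij_witness[of _ int nat]) auto
  also have "\<dots> = (\<Sum>e\<in>{..<m}. (if tail G e = v then H (int e) else 0) - (if head G e = v then H (int e) else 0))"
    by (rule sum.cong) (auto simp: bd_def src dst)
  also have "\<dots> = (\<Sum>e\<in>out_arcs G v. H (int e)) - (\<Sum>e\<in>in_arcs G v. H (int e))"
    unfolding sum_subtractf out_arcs_def in_arcs_def arcs
  proof -
    have "(\<Sum>e\<in>{..<m}. if t e = v then H (int e) else 0) = (\<Sum>e\<in>{e. e \<in> {..<m} \<and> t e = v}. H (int e))" for t
      by (rule sum.inter_filter[symmetric]) simp
    then show "(\<Sum>e\<in>{..<m}. if tail G e = v then H (int e) else 0) - (\<Sum>e\<in>{..<m}. if head G e = v then H (int e) else 0) =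
      (\<Sum>e\<in>{e. e \<in> {..<m} \<and> tail G e = v}. H (int e)) - (\<Sum>e\<in>{e. e \<in> {..<m} \<and> head G e = v}. H (int e))" by simp
  qed
  finally show ?thesis by (simp add: divergence_def)
qed

text \<open>An off-diagonal output collects both orders of its pair, so the sum over
  \<open>i <= j\<close> meets every ordered pair exactly once.\<close>

lemma sum_upper_triangle:
  fixes P :: "nat \<times> nat \<Rightarrow> int"
  shows "(\<Sum>i\<in>{1..k}. \<Sum>j\<in>{i..k}. if i = j then P (i, i) else P (i, j) + P (j, i)) = (\<Sum>c\<in>set (pairs k). P c)"
proof -
  let ?A = "{1..k} :: nat set"
  have "(\<Sum>i\<in>?A. \<Sum>j\<in>{i..k}. if i = j then P (i, i) else P (i, j) + P (j, i)) =
    (\<Sum>i\<in>?A. \<Sum>j\<in>?A. (if i \<le> j then P (i, j) else 0) + (if i < j then P (j, i) else 0))"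
  proof (rule sum.cong[OF refl])
    fix i assume i: "i \<in> ?A"
    show "(\<Sum>j\<in>{i..k}. if i = j then P (i, i) else P (i, j) + P (j, i)) =
      (\<Sum>j\<in>?A. (if i \<le> j then P (i, j) else 0) + (if i < j then P (j, i) else 0))"
      by (rule sum.mono_neutral_cong_left) (use i in auto)
  qed
  also have "\<dots> = (\<Sum>i\<in>?A. \<Sum>j\<in>?A. if i \<le> j then P (i, j) else 0) + (\<Sum>i\<in>?A. \<Sum>j\<in>?A. if i < j then P (j, i) else 0)"
    by (simp only: sum.distrib)
  also have "(\<Sum>i\<in>?A. \<Sum>j\<in>?A. if i < j then P (j, i) else 0) = (\<Sum>j\<in>?A. \<Sum>i\<in>?A. if i < j then P (j, i) else 0)"
    by (rule sum.swap)
  also have "(\<Sum>i\<in>?A. \<Sum>j\<in>?A. if i \<le> j then P (i, j) else 0) + (\<Sum>j\<in>?A. \<Sum>i\<in>?A. if i < j then P (j, i) else 0) =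
    (\<Sum>i\<in>?A. \<Sum>j\<in>?A. P (i, j))"
    unfolding sum.distrib[symmetric] by (intro sum.cong) auto
  also have "\<dots> = (\<Sum>c\<in>set (pairs k). P c)"
    unfolding set_pairs by (subst sum.cartesian_product) simp
  finally show ?thesis .
qed

text \<open>At the super source \<open>n + a\<close> the only arc present is \<open>m + a\<close>,
  so the hypothesis there determines its flow; likewise at the super sinks. Hence the part uses just
  the super arcs of \<open>i\<close> and \<open>j\<close>, both with flow \<open>V\<close>, and
  dropping them leaves a flow of value \<open>V\<close> between these terminals.\<close>

lemma parts_flow:
  fixes X :: "int \<Rightarrow> int"
  assumes mk: "0 \<le> m" "0 \<le> k" and e: "\<And>e. 0 \<le> e \<Longrightarrow> e < m \<Longrightarrow> src e < n \<and> dst e < n"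
    and s: "\<And>i. 0 \<le> i \<Longrightarrow> i < k \<Longrightarrow> sa i < n \<and> sb i < n"
    and ij: "0 \<le> i" "i < k" "0 \<le> j" "j < k"
    and X: "\<And>v. (\<Sum>p\<in>{0..<m + 2 * k}. X p * bd (with_terminals m k k src (\<lambda>i. n + i) sb) (with_terminals m k k dst sa (\<lambda>i. n + k + i)) p v) =
      V * (of_bool (n + i = v) - of_bool (n + k + j = v))"
    and v: "v < n"
  shows "(\<Sum>e\<in>{0..<m}. X e * bd src dst e v) = V * (of_bool (sa i = v) - of_bool (sb j = v))"
proof -
  let ?E = "\<lambda>v. \<Sum>e\<in>{0..<m}. X e * bd src dst e v"
  have S: "?E v + (\<Sum>i\<in>{0..<k}. X (m + i) * (of_bool (n + i = v) - of_bool (sa i = v))) +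
    (\<Sum>i\<in>{0..<k}. X (m + k + i) * (of_bool (sb i = v) - of_bool (n + k + i = v))) =
    V * (of_bool (n + i = v) - of_bool (n + k + j = v))" for v
    using X[of v] sum_ext[OF mk, of X src n sb dst sa v] by simp
  have E0: "?E v = 0" if "n \<le> v" for v
    by (rule sum.neutral) (use e that in \<open>fastforce simp: bd_def\<close>)
  have fin: "finite {0..<k}" by simp
  have Xa: "X (m + a) = V * of_bool (i = a)" if a: "a \<in> {0..<k}" for a
  proof -
    have "(\<Sum>i\<in>{0..<k}. X (m + i) * (of_bool (n + i = n + a) - of_bool (sa i = n + a))) =
      (\<Sum>i\<in>{0..<k}. of_bool (a = i) * X (m + i))"
      by (rule sum.cong) (use s a in \<open>force+\<close>)
    moreover have "(\<Sum>i\<in>{0..<k}. X (m + k + i) * (of_bool (sb i = n + a) - of_bool (n + k + i = n + a))) = 0"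
      by (rule sum.neutral) (use s a in force)
    ultimately show ?thesis
      using S[of "n + a"] E0[of "n + a"] a ij sum_of_bool_bd[OF fin a, of "\<lambda>i. X (m + i)"] by simp
  qed
  have Xb: "X (m + k + b) = V * of_bool (j = b)" if b: "b \<in> {0..<k}" for b
  proof -
    have "(\<Sum>i\<in>{0..<k}. X (m + k + i) * (of_bool (sb i = n + k + b) - of_bool (n + k + i = n + k + b))) =
      (\<Sum>i\<in>{0..<k}. - (of_bool (b = i) * X (m + k + i)))"
      by (rule sum.cong) (use s b mk in \<open>force+\<close>)
    moreover have "(\<Sum>i\<in>{0..<k}. X (m + i) * (of_bool (n + i = n + k + b) - of_bool (sa i = n + k + b))) = 0"
      by (rule sum.neutral) (use s b in force)
    ultimately show ?thesis
      using S[of "n + k + b"] E0[of "n + k + b"] b ij mk sum_of_bool_bd[OF fin b, of "\<lambda>i. X (m + k + i)"]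
      by (simp add: sum_negf)
  qed
  have "(\<Sum>a\<in>{0..<k}. X (m + a) * (of_bool (n + a = v) - of_bool (sa a = v))) = (\<Sum>a\<in>{0..<k}. of_bool (i = a) * (- V * of_bool (sa a = v)))"
    by (rule sum.cong) (use v Xa in \<open>auto\<close>)
  moreover have "(\<Sum>a\<in>{0..<k}. X (m + k + a) * (of_bool (sb a = v) - of_bool (n + k + a = v))) = (\<Sum>a\<in>{0..<k}. of_bool (j = a) * (V * of_bool (sb a = v)))"
    by (rule sum.cong) (use v mk Xb in \<open>auto\<close>)
  moreover have "i \<in> {0..<k}" "j \<in> {0..<k}" using ij by auto
  ultimately show ?thesis
    using S[of v] v ij mk sum_of_bool_bd[OF fin, of i "\<lambda>a. - V * of_bool (sa a = v)"] sum_of_bool_bd[OF fin, of j "\<lambda>a. V * of_bool (sb a = v)"]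
    by (simp add: algebra_simps del: sum_mult_of_bool_eq sum_of_bool_mult_eq)
qed

definition time_bound :: "nat \<Rightarrow> real \<Rightarrow> real \<Rightarrow> real" where
  "time_bound k n m = (let K = 80 * real (k * k) + 60; M = m + 2 * real k in
     (300 + 20 * real (k * k) + 20) * m + 400 * (M + n) + (3 * K + 120) * M + 350 +
     (150 + (2 * K + 700) * (2 + 4 * real k)) * (n + 42 * M * log 2 (2 + n\<^sup>2 / M)))"

text \<open>The logarithm is at least 1 and \<open>m >= 1\<close>, so constant and linear terms fit
  under \<open>m\<close> times the logarithm. Replacing \<open>M\<close> by \<open>m\<close> inside
  the logarithm only increases it, and outside it costs the factor \<open>1 + 2 * k\<close>.\<close>

lemma time_bound_le:
  assumes n: "1 \<le> n" "n \<le> c * m" and m: "1 \<le> m"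
  shows "time_bound k n m \<le> (let K = 80 * real (k * k) + 60; W = 150 + (2 * K + 700) * (2 + 4 * real k) in
     320 + 20 * real (k * k) + 400 * (1 + 2 * real k + c) + (3 * K + 120) * (1 + 2 * real k) + 350 +
     W * (c + 42 * (1 + 2 * real k))) * m * log 2 (2 + n\<^sup>2 / m)"
proof -
  define K where "K = 80 * real (k * k) + 60"
  define W where "W = 150 + (2 * K + 700) * (2 + 4 * real k)"
  define M where "M = m + 2 * real k"
  let ?l = "log 2 (2 + n\<^sup>2 / m)"
  have K: "0 \<le> K" "0 \<le> W" by (simp_all add: K_def W_def)
  have M: "m \<le> M" "M \<le> (1 + 2 * real k) * m" using m mult_left_mono[of 1 m "2 * real k"] by (simp_all add: M_def distrib_right)
  have c: "0 \<le> c" using n m by (smt (verit) mult_nonneg_nonneg zero_le_mult_iff)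
  have "0 \<le> n\<^sup>2 / m" using m by simp
  then have l: "1 \<le> ?l" by (simp add: le_log_iff)
  have "n\<^sup>2 / M \<le> n\<^sup>2 / m" using M m by (intro divide_left_mono) auto
  moreover have nM: "0 \<le> n\<^sup>2 / M" using M m by simp
  ultimately have lM: "log 2 (2 + n\<^sup>2 / M) \<le> ?l" by (subst log_le_cancel_iff) auto
  from nM have "1 \<le> log 2 (2 + n\<^sup>2 / M)" by (simp add: le_log_iff)
  then have lM0: "0 \<le> log 2 (2 + n\<^sup>2 / M)" by linarith
  have up: "x \<le> a * (m * ?l)" if "x \<le> a * m" "0 \<le> a" for x a
  proof -
    have "m \<le> m * ?l" using l m mult_left_mono[of 1 ?l m] by simp
    then have "a * m \<le> a * (m * ?l)" using that(2) by (rule mult_left_mono)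
    then show ?thesis using that(1) by linarith
  qed
  have k0: "0 \<le> real k" "0 \<le> real (k * k)" by simp_all
  have 1: "(300 + 20 * real (k * k) + 20) * m \<le> (320 + 20 * real (k * k)) * (m * ?l)" by (rule up) auto
  have 2: "400 * (M + n) \<le> 400 * (1 + 2 * real k + c) * (m * ?l)"
    by (rule up) (use M(2) n c in \<open>auto simp: distrib_right\<close>)
  have 3: "(3 * K + 120) * M \<le> (3 * K + 120) * (1 + 2 * real k) * (m * ?l)"
  proof (rule up)
    show "(3 * K + 120) * M \<le> (3 * K + 120) * (1 + 2 * real k) * m"
      unfolding mult.assoc using M(2) K by (intro mult_left_mono) auto
  qed (use K in auto)
  have 4: "350 \<le> 350 * (m * ?l)" by (rule up) (use m in auto)
  have 5: "n \<le> c * (m * ?l)" by (rule up) (use n c in auto)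
  have 6: "42 * M * log 2 (2 + n\<^sup>2 / M) \<le> 42 * ((1 + 2 * real k) * m) * ?l"
    using M lM lM0 m by (intro mult_mono) auto
  have "W * (n + 42 * M * log 2 (2 + n\<^sup>2 / M)) \<le> W * ((c + 42 * (1 + 2 * real k)) * (m * ?l))"
  proof (rule mult_left_mono[OF _ K(2)])
    have "42 * ((1 + 2 * real k) * m) * ?l = 42 * (1 + 2 * real k) * (m * ?l)" by (simp only: mult.assoc)
    then show "n + 42 * M * log 2 (2 + n\<^sup>2 / M) \<le> (c + 42 * (1 + 2 * real k)) * (m * ?l)"
      unfolding distrib_right[of c] using 5 6 by linarith
  qed
  then have 7: "W * (n + 42 * M * log 2 (2 + n\<^sup>2 / M)) \<le> W * (c + 42 * (1 + 2 * real k)) * (m * ?l)" by (simp only: mult.assoc)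
  have "time_bound k n m = (300 + 20 * real (k * k) + 20) * m + 400 * (M + n) + (3 * K + 120) * M + 350 +
     W * (n + 42 * M * log 2 (2 + n\<^sup>2 / M))" by (simp only: time_bound_def Let_def K_def W_def M_def)
  also have "\<dots> \<le> (320 + 20 * real (k * k)) * (m * ?l) + 400 * (1 + 2 * real k + c) * (m * ?l) +
      (3 * K + 120) * (1 + 2 * real k) * (m * ?l) + 350 * (m * ?l) + W * (c + 42 * (1 + 2 * real k)) * (m * ?l)"
    using 1 2 3 4 7 by linarith
  also have "\<dots> = (320 + 20 * real (k * k) + 400 * (1 + 2 * real k + c) + (3 * K + 120) * (1 + 2 * real k) + 350 +
     W * (c + 42 * (1 + 2 * real k))) * m * ?l" by (simp only: distrib_right mult.assoc)
  finally show ?thesis by (simp only: Let_def K_def W_def)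
qed

lemma sum_reindex_se:
  fixes F :: "int \<Rightarrow> int"
  assumes "\<And>e. 0 \<le> e \<Longrightarrow> e < m \<Longrightarrow> 0 \<le> se e \<and> se e < m \<and> se (se e) = e"
  shows "(\<Sum>e\<in>{0..<m}. F (se e)) = (\<Sum>e\<in>{0..<m}. F e)"
  by (rule sum.reindex_bij_witness[of _ se se]) (use assms in auto)

lemma decompose_correct:
  fixes G :: "(nat, nat) pre_digraph"
  assumes k: "1 \<le> k" and num: "numbered G" and inst: "flow_instance k G sv se s f"
  shows "wp (decompose k) (\<lambda>t st. flow_decomposition k G sv se s f (output_flow st) \<and>
      real t \<le> time_bound k (real (card (verts G))) (real (card (arcs G)))) (input_store k G sv se s f)"
proof -
  interpret skew_symmetric_graph G sv se using inst by (simp add: flow_instance_def)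
  define m where "m = card (arcs G)"
  define n where "n = card (verts G)"
  have A: "arcs G = {..<m}" and V: "verts G = {..<n}" using num by (auto simp: numbered_def m_def n_def)
  let ?k = "int k" and ?m = "int m" and ?n = "int n"
  define st0 where "st0 = input_store k G sv se s f"
  define src where "src = ar st0 ''tail''"
  define dst where "dst = ar st0 ''head''"
  define svi where "svi = ar st0 ''sigmaV''"
  define sei where "sei = ar st0 ''sigmaE''"
  define fi where "fi = ar st0 ''f''"
  define sa where "sa i = ar st0 ''s'' (i + 1)" for i
  define sb where "sb i = svi (sa i)" for i
  have v0: "vr st0 ''m'' = ?m" "vr st0 ''n'' = ?n" "vr st0 ''L'' = 0" by (simp_all add: st0_def input_store_def m_def n_def)
  have z0: "ar st0 x = (\<lambda>_. 0)" if "x \<notin> {''tail'', ''head'', ''sigmaV'', ''sigmaE'', ''s'', ''f''}" for x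
    using that by (simp add: st0_def input_store_def)
  have srcE: "src e = (if 0 \<le> e \<and> e < ?m then int (tail G (nat e)) else 0)" and dstE: "dst e = (if 0 \<le> e \<and> e < ?m then int (head G (nat e)) else 0)"
    and seE: "sei e = (if 0 \<le> e \<and> e < ?m then int (se (nat e)) else 0)" and fE: "fi e = (if 0 \<le> e \<and> e < ?m then f (nat e) else 0)"
    and svE: "svi e = (if 0 \<le> e \<and> e < ?n then int (sv (nat e)) else 0)" for e
    by (auto simp: src_def dst_def sei_def fi_def svi_def st0_def input_store_def array_on_def A V)
  have saE: "sa i = int (s (nat i + 1))" if "0 \<le> i" "i < ?k" for i
    using that by (auto simp: sa_def st0_def input_store_def array_on_def nat_add_distrib)
  have sN: "s i < n" if "i \<in> {1..k}" for i
  proof -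
    have "s ` {1..k} \<subseteq> verts G" using inst unfolding flow_instance_def by blast
    then show ?thesis using that V by blast
  qed
  have n1: "1 \<le> n" using sN[of 1] k by simp
  have th: "tail G e < n" "head G e < n" "tail G e \<noteq> head G e" if "e < m" for e
    using that A V wellformed[of e] no_loops[of e] by auto
  have svn: "sv v < n" "sv (sv v) = v" "sv v \<noteq> v" if "v < n" for v
    using that V sv_in_verts[of v] sv_involution[of v] sv_no_fixpoint[of v] by auto
  have sem: "se e < m" "se (se e) = e" "se e \<noteq> e" "tail G (se e) = sv (head G e)" "head G (se e) = sv (tail G e)" if "e < m" for e
    using that A se_in_arcs[of e] se_involution[of e] se_no_fixpoint[of e] tail_se[of e] head_se[of e] by auto
  have SV: "0 \<le> svi v \<and> svi v < ?n \<and> svi (svi v) = v \<and> svi v \<noteq> v" if "0 \<le> v" "v < ?n" for v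
  proof -
    have "nat v < n" using that by auto
    note this svn[OF this]
    moreover have "svi v = int (sv (nat v))" using that by (simp add: svE)
    ultimately show ?thesis using that by (auto simp: svE)
  qed
  have SE: "0 \<le> sei e \<and> sei e < ?m \<and> sei (sei e) = e \<and> sei e \<noteq> e \<and>
       0 \<le> src e \<and> src e < ?n \<and> 0 \<le> dst e \<and> dst e < ?n \<and> src (sei e) = svi (dst e) \<and> dst (sei e) = svi (src e)" if "0 \<le> e" "e < ?m" for e
  proof -
    have e: "nat e < m" using that by auto
    have "sei e = int (se (nat e))" using that by (simp add: seE)
    moreover have "int (se (nat e)) \<noteq> e" using sem(3)[OF e] by (metis nat_int)
    ultimately show ?thesis using e sem[OF e] th[OF e] that by (auto simp: srcE dstE seE svE)
  qed
  have NL: "src e \<noteq> dst e" if "0 \<le> e" "e < ?m" for e using that th[of "nat e"] by (auto simp: srcE dstE)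
  have fl: "integer_symmetric_flow G sv se (s ` {1..k}) f" using inst by (simp add: flow_instance_def)
  have FE: "0 \<le> fi e \<and> fi (sei e) = fi e" if "0 \<le> e" "e < ?m" for e
  proof -
    have e: "nat e < m" using that by auto
    have "0 \<le> f (nat e)" "f (nat e) = f (se (nat e))"
      using fl e A unfolding integer_symmetric_flow_def symmetric_fun_def by auto
    then show ?thesis using that sem(1)[OF e] by (simp add: fE seE)
  qed
  \<comment> \<open>The symmetry reverses arcs, so tail and head exchange their roles.\<close>
  have bdse: "bd src dst (sei e) (svi v) = - bd src dst e v" if "0 \<le> e" "e < ?m" "0 \<le> v" "v < ?n" for e v
  proof -
    have "svi a = svi v \<longleftrightarrow> a = v" if "0 \<le> a" "a < ?n" for a using SV[OF that] SV[OF \<open>0 \<le> v\<close> \<open>v < ?n\<close>] by metis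
    then show ?thesis using SE[OF that(1,2)] by (simp add: bd_def)
  qed
  \<comment> \<open>Composition with the symmetry turns a flow from s_j to s'_i into one from s_i to
    s'_j; the same identity gives the divergence of \<open>f\<close> on S' from that on S.\<close>
  have flip: "(\<Sum>e\<in>{0..<?m}. H (sei e) * bd src dst e v) = - (\<Sum>e\<in>{0..<?m}. H e * bd src dst e (svi v))"
    if v: "0 \<le> v" "v < ?n" for H v
  proof -
    have "(\<Sum>e\<in>{0..<?m}. H e * bd src dst e (svi v)) = (\<Sum>e\<in>{0..<?m}. H (sei e) * bd src dst (sei e) (svi v))"
      by (rule sum_reindex_se[symmetric]) (use SE in blast)
    also have "\<dots> = (\<Sum>e\<in>{0..<?m}. - (H (sei e) * bd src dst e v))"
      by (rule sum.cong) (use bdse v in auto)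
    finally show ?thesis by (simp add: sum_negf)
  qed
  have divG: "divergence G h v = (\<Sum>e\<in>{0..<?m}. H e * bd src dst e (int v))" if "\<And>e. e < m \<Longrightarrow> h e = H (int e)" for h H v
  proof -
    have "divergence G h v = divergence G (\<lambda>e. H (int e)) v"
      using that A by (simp add: divergence_def out_arcs_def in_arcs_def)
    then show ?thesis using divergence_sum[of G m src dst H v] A by (simp add: srcE dstE)
  qed
  have divf: "divergence G f v = (\<Sum>e\<in>{0..<?m}. fi e * bd src dst e (int v))" for v by (rule divG) (simp add: fE)
  have sab: "0 \<le> sa i \<and> sa i < ?n \<and> 0 \<le> sb i \<and> sb i < ?n" if "0 \<le> i" "i < ?k" for i
    using saE[OF that] sN[of "nat i + 1"] that SV[of "sa i"] by (auto simp: sb_def)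
  have injs: "inj_on s {1..k}" and disj: "s ` {1..k} \<inter> sv ` s ` {1..k} = {}" using inst by (auto simp: flow_instance_def)
  have inja: "inj_on sa {0..<?k}"
  proof (rule inj_onI)
    fix i j assume "i \<in> {0..<?k}" "j \<in> {0..<?k}" "sa i = sa j"
    then have "nat i + 1 = nat j + 1" using inj_onD[OF injs, of "nat i + 1" "nat j + 1"] saE[of i] saE[of j] by auto
    then show "i = j" using \<open>i \<in> _\<close> \<open>j \<in> _\<close> by auto
  qed
  have injb: "inj_on sb {0..<?k}"
  proof (rule inj_onI)
    fix i j assume ij: "i \<in> {0..<?k}" "j \<in> {0..<?k}" "sb i = sb j"
    have "svi (sb l) = sa l" if "l \<in> {0..<?k}" for l using SV[of "sa l"] sab[of l] that by (simp add: sb_def)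
    from this[OF ij(1)] this[OF ij(2)] have "sa i = sa j" unfolding ij(3) by simp
    then show "i = j" using inj_onD[OF inja] ij by auto
  qed
  have sbE: "sb i = int (sv (s (nat i + 1)))" if "0 \<le> i" "i < ?k" for i
    using saE[OF that] sN[of "nat i + 1"] that by (simp add: sb_def svE)
  have dis: "sa i \<noteq> sb j" if "0 \<le> i" "i < ?k" "0 \<le> j" "j < ?k" for i j
  proof
    assume "sa i = sb j"
    then have "s (nat i + 1) = sv (s (nat j + 1))" using saE sbE that by simp
    moreover have "nat i + 1 \<in> {1..k}" "nat j + 1 \<in> {1..k}" using that by auto
    ultimately show False using disj by blast
  qed
  \<comment> \<open>Twice the divergence of \<open>h\<close> is within 1 of that of
    \<open>f\<close>. By integrality it is 0 where the latter is 0, nonnegative where the latter is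
    nonnegative, and nonpositive where the latter is nonpositive.\<close>
  have tf: "terminal_flow ?n ?m ?k src dst h sa sb"
    if h: "\<And>e. 0 \<le> e \<Longrightarrow> e < ?m \<Longrightarrow> 0 \<le> h e"
      and bal: "\<And>v. 0 \<le> v \<Longrightarrow> v < ?n \<Longrightarrow>
        \<bar>2 * (\<Sum>e\<in>{0..<?m}. h e * bd src dst e v) - (\<Sum>e\<in>{0..<?m}. fi e * bd src dst e v)\<bar> \<le> 1" for h
  proof -
    let ?d = "\<lambda>v. \<Sum>e\<in>{0..<?m}. h e * bd src dst e v" and ?df = "\<lambda>v. \<Sum>e\<in>{0..<?m}. fi e * bd src dst e v"
    have zero: "?d v = 0" if v: "0 \<le> v" "v < ?n" "v \<notin> sa ` {0..<?k}" "v \<notin> sb ` {0..<?k}" for v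
    proof -
      have "nat v \<noteq> s i" "nat v \<noteq> sv (s i)" if i: "i \<in> {1..k}" for i
      proof -
        have j: "int (i - 1) \<in> {0..<?k}" "0 \<le> int (i - 1)" "int (i - 1) < ?k" "nat (int (i - 1)) + 1 = i" using i by auto
        then have "v \<noteq> sa (int (i - 1))" "v \<noteq> sb (int (i - 1))" using v(3,4) by blast+
        then have "v \<noteq> int (s i)" "v \<noteq> int (sv (s i))" using saE[OF j(2,3)] sbE[OF j(2,3)] unfolding j(4) by metis+
        then show "nat v \<noteq> s i" "nat v \<noteq> sv (s i)" using v(1) by (auto simp only: nat_eq_iff if_True)
      qed
      moreover have "nat v \<in> verts G" using v(1,2) V by auto
      ultimately have "nat v \<in> verts G - (s ` {1..k} \<union> sv ` s ` {1..k})" by blast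
      then have "divergence G f (nat v) = 0" using fl unfolding integer_symmetric_flow_def by blast
      then have "?df v = 0" using divf[of "nat v"] v(1) by simp
      then show ?thesis using bal[OF v(1,2)] by linarith
    qed
    have ge: "0 \<le> ?d (sa i) \<and> ?d (sb i) \<le> 0" if i: "0 \<le> i" "i < ?k" for i
    proof -
      have "nat i + 1 \<in> {1..k}" using i by auto
      then have "0 \<le> divergence G f (s (nat i + 1))" using fl unfolding integer_symmetric_flow_def by blast
      then have 1: "0 \<le> ?df (sa i)" using divf[of "s (nat i + 1)"] saE[OF i] by simp
      have s: "0 \<le> sa i" "sa i < ?n" "0 \<le> sb i" "sb i < ?n" using sab[OF i] by auto
      have "svi (sb i) = sa i" using SV[OF s(1,2)] by (simp add: sb_def)
      moreover have "?df (sb i) = (\<Sum>e\<in>{0..<?m}. fi (sei e) * bd src dst e (sb i))" by (rule sum.cong) (use FE in auto)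
      \<comment> \<open>The definition of a symmetric flow prescribes the sign on S; the symmetry of
        \<open>f\<close> yields the opposite sign on S'.\<close>
      ultimately have 2: "?df (sb i) = - ?df (sa i)" using flip[OF s(3,4), of fi] by simp
      show ?thesis using bal[OF s(1,2)] bal[OF s(3,4)] 1 2 by linarith
    qed
    show ?thesis
      unfolding terminal_flow_def using n1 SE NL h sab inja injb dis zero ge by auto
  qed
  show ?thesis
    unfolding st0_def[symmetric] decompose_def
  proof (rule wp_SeqI[OF wp_round_flow[of st0 ?n]], unfold v0 src_def[symmetric] dst_def[symmetric] svi_def[symmetric] sei_def[symmetric] fi_def[symmetric], goal_cases)
    case (8 t1 st1)
    note r1 = 8(1)
    note ag1 = 8(2)[THEN agree_arr] 8(2)[THEN agree_var]
    note defs1 = round_flow_def splice_all_def splice_edge_def load_ends_def attach_a_def attach_b_def register_def round_all_def round_edge_def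
    define h where "h = ar st1 ''h''"
    have f1: "vr st1 ''m'' = ?m" "vr st1 ''n'' = ?n" "ar st1 ''tail'' = src" "ar st1 ''head'' = dst" "ar st1 ''sigmaV'' = svi"
      "ar st1 ''sigmaE'' = sei" "ar st1 ''s'' = ar st0 ''s''"
      using ag1 v0 by (simp_all add: defs1 src_def dst_def svi_def sei_def)
    have fresh: "fresh st1"
      using ag1 v0 z0 by (simp add: fresh_def defs1 part_def fun_eq_iff) (simp add: st0_def input_store_def)
    have hh: "0 \<le> h e" "h e + h (sei e) = fi e" if "0 \<le> e" "e < ?m" for e using r1 that by (simp_all add: h_def)
    have tfh: "terminal_flow ?n ?m ?k src dst h sa sb" using r1 hh(1) by (intro tf) (auto simp: h_def)
    let ?M = "?m + 2 * ?k"
    let ?tl0 = "with_terminals ?m ?k ?k src (\<lambda>i. ?n + i) sb" and ?hd0 = "with_terminals ?m ?k ?k dst sa (\<lambda>i. ?n + ?k + i)"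
    \<comment> \<open>The cell of the collecting node lies beyond the given arcs, so both of its
      ends read the default 0: it is a loop at vertex 0.\<close>
    have out: "src ?M = dst ?M" by (simp add: srcE dstE)
    have "wp (build k) (\<lambda>t st'. (\<exists>c0. (\<forall>e. 0 \<le> e \<and> e < ?m \<longrightarrow> c0 e = h e) \<and> flow_ok ?n ?M c0 ?tl0 ?hd0 \<and>
       stage_inv ?n ?k ?M c0 ?tl0 ?hd0 st') \<and> vr st' ''n'' = ?n \<and> vr st' ''m'' = ?m \<and> vr st' ''t'' = ?n \<and> vr st' ''cnt'' \<le> 2 * ?M \<and> vr st' ''L'' = ?M \<and>
       (\<forall>c. part st' c = (\<lambda>_. 0)) \<and> int t \<le> 400 * (?M + ?n) + 200) st1"
      using wp_build[OF fresh, of k] tfh out unfolding f1 h_def sa_def sb_def by blast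
    then show ?case
    proof (rule wp_SeqI, elim conjE exE)
      fix t2 :: nat and st2 :: store and c0
      assume ag2: "agree (build k) st1 st2" and c0: "\<forall>e. 0 \<le> e \<and> e < ?m \<longrightarrow> c0 e = h e" and fo: "flow_ok ?n ?M c0 ?tl0 ?hd0"
        and si: "stage_inv ?n ?k ?M c0 ?tl0 ?hd0 st2" and v2: "vr st2 ''n'' = ?n" "vr st2 ''m'' = ?m" "vr st2 ''t'' = ?n"
          "vr st2 ''cnt'' \<le> 2 * ?M" "vr st2 ''L'' = ?M" and p2: "\<forall>c. part st2 c = (\<lambda>_. 0)" and t2: "int t2 \<le> 400 * (?M + ?n) + 200"
      have se2: "ar st2 ''sigmaE'' = sei"
        using agree_arr[OF ag2, of "(''sigmaE'', [])"] f1
        by (simp add: build_def divergences_def add_terminals_def rows_def insert_all_def insert_arc_def find_arc_def add_cap_def log_op_def list_vertices_def)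
      have n1': "1 \<le> ?n" "1 \<le> ?M" using n1 k by auto
      note slv = wp_solve[OF k si fo v2(1,3,4,5) _ n1']
      show "wp (solve k;; output_all k) (\<lambda>t st. flow_decomposition k G sv se s f (output_flow st) \<and>
        real (t1 + (t2 + t)) \<le> time_bound k (real (card (verts G))) (real (card (arcs G)))) st2"
      proof (rule wp_SeqI[OF slv], use p2 in blast, elim conjE)
        fix t3 :: nat and st3 :: store
        assume ag3: "agree (solve k) st2 st3"
          and tot: "\<forall>p. 0 \<le> p \<and> p < ?M \<longrightarrow> (\<Sum>c\<in>set (pairs k). part st3 c p) = c0 p"
          and pV: "\<forall>c\<in>set (pairs k). (\<forall>p. 0 \<le> part st3 c p) \<and> (\<exists>V\<ge>0. \<forall>v. (\<Sum>p\<in>{0..<?M}. part st3 c p * bd ?tl0 ?hd0 p v) =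
             V * (of_bool (?n + int (fst c) - 1 = v) - of_bool (?n + ?k + int (snd c) - 1 = v)))"
          and t3: "real t3 \<le> real_of_int ((3 * (80 * int (k * k) + 60) + 120) * ?M + 100) +
             real_of_int (150 + (2 * (80 * int (k * k) + 60) + 700) * (2 + 4 * ?k)) *
               (of_int ?n + 42 * of_int ?M * log 2 (2 + (of_int ?n)\<^sup>2 / of_int ?M))"
        note defs3 = solve_def elim_all_def stage_def visit_def eliminate_def advance_def shortcut_def pick_def lower_def link_def
          find_arc_def add_cap_def log_op_def assign_all_def assign_part_def undo_all_def undo_op_def take_part_def
        have f3: "vr st3 ''m'' = ?m" "ar st3 ''sigmaE'' = sei"
          using agree_var[OF ag3, of "(''m'', [])"] agree_arr[OF ag3, of "(''sigmaE'', [])"] v2 se2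
          by (auto simp: defs3 written_seqs)
        define P where "P c = part st3 c" for c
        have Pnn: "0 \<le> P c p" if "c \<in> set (pairs k)" for c p using pV that by (simp add: P_def)
        have Ptot: "(\<Sum>c\<in>set (pairs k). P c e) = h e" if "0 \<le> e" "e < ?m" for e
          using tot[rule_format, of e] c0 that by (simp add: P_def)
        have PV: "\<exists>V\<ge>0. \<forall>v<?n. (\<Sum>e\<in>{0..<?m}. P c e * bd src dst e v) =
            V * (of_bool (sa (int (fst c) - 1) = v) - of_bool (sb (int (snd c) - 1) = v))" if c: "c \<in> set (pairs k)" for c
        proof -
          obtain U where U: "U \<ge> 0" "\<And>v. (\<Sum>p\<in>{0..<?M}. P c p * bd ?tl0 ?hd0 p v) =
             U * (of_bool (?n + (int (fst c) - 1) = v) - of_bool (?n + ?k + (int (snd c) - 1) = v))"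
            using pV c by (auto simp: P_def add_diff_eq)
          have "0 \<le> int (fst c) - 1" "int (fst c) - 1 < ?k" "0 \<le> int (snd c) - 1" "int (snd c) - 1 < ?k"
            using c by (auto simp: set_pairs)
          from parts_flow[OF _ _ _ _ this U(2)] show ?thesis using U(1) SE sab by auto
        qed
        have o: "wp (output_all k) (\<lambda>t st'. (\<forall>c\<in>set (output_pairs k). \<forall>e. 0 \<le> e \<and> e < ?m \<longrightarrow>
            arr st' (''flow'', [fst c, snd c]) e = (if fst c = snd c then P c e else P c e + P (snd c, fst c) (sei e))) \<and>
            int t \<le> (20 * int (k * k) + 20) * ?m + 20) st3"
          using wp_output_all[of st3 k] unfolding f3 P_def by simp
        show "wp (output_all k) (\<lambda>t st. flow_decomposition k G sv se s f (output_flow st) \<and>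
          real (t1 + (t2 + (t3 + t))) \<le> time_bound k (real (card (verts G))) (real (card (arcs G)))) st3"
        proof (rule wp_conseq[OF o], elim conjE)
          fix t4 :: nat and st4 :: store
          assume out: "\<forall>c\<in>set (output_pairs k). \<forall>e. 0 \<le> e \<and> e < ?m \<longrightarrow>
            arr st4 (''flow'', [fst c, snd c]) e = (if fst c = snd c then P c e else P c e + P (snd c, fst c) (sei e))"
            and t4: "int t4 \<le> (20 * int (k * k) + 20) * ?m + 20"
          define Q where "Q i j e = (if i = j then P (i, j) e else P (i, j) e + P (j, i) (sei e))" for i j e
          have F: "output_flow st4 i j e = Q i j (int e)" if "i \<in> {1..k}" "j \<in> {i..k}" "e < m" for i j e
            using out[rule_format, of "(i, j)" "int e"] that by (auto simp: output_flow_def Q_def output_pairs_def set_pairs)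
          have flow: "integer_flow G (s i) (sv (s j)) (output_flow st4 i j)" if ij: "i \<in> {1..k}" "j \<in> {i..k}" for i j
          proof -
            have c: "(i, j) \<in> set (pairs k)" "(j, i) \<in> set (pairs k)" using ij by (auto simp: set_pairs)
            have ji: "0 \<le> int i - 1" "int i - 1 < ?k" "nat (int i - 1) + 1 = i" "0 \<le> int j - 1" "int j - 1 < ?k" "nat (int j - 1) + 1 = j"
              using ij by auto
            have si: "sa (int i - 1) = int (s i)" "sb (int j - 1) = int (sv (s j))" "sa (int j - 1) = int (s j)" "sb (int i - 1) = int (sv (s i))"
              using saE[OF ji(1,2)] sbE[OF ji(4,5)] saE[OF ji(4,5)] sbE[OF ji(1,2)] unfolding ji(3,6) .
            obtain U where U: "U \<ge> 0" "\<And>v. v < ?n \<Longrightarrow> (\<Sum>e\<in>{0..<?m}. P (i, j) e * bd src dst e v) =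
                U * (of_bool (int (s i) = v) - of_bool (int (sv (s j)) = v))"
              using PV[OF c(1)] si by auto
            obtain U' where U': "U' \<ge> 0" "\<And>v. v < ?n \<Longrightarrow> (\<Sum>e\<in>{0..<?m}. P (j, i) e * bd src dst e v) =
                U' * (of_bool (int (s j) = v) - of_bool (int (sv (s i)) = v))"
              using PV[OF c(2)] si by auto
            have div: "\<exists>W\<ge>0. \<forall>v<n. divergence G (output_flow st4 i j) v = W * (of_bool (s i = v) - of_bool (sv (s j) = v))"
            proof (cases "i = j")
              case True
              have "divergence G (output_flow st4 i j) v = U * (of_bool (s i = v) - of_bool (sv (s j) = v))" if "v < n" for v
                using divG[of "output_flow st4 i j" "Q i j" v] F[OF ij] U(2)[of "int v"] that True by (simp add: Q_def)
              then show ?thesis using U(1) by blast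
            next
              case False
              have "divergence G (output_flow st4 i j) v = (U + U') * (of_bool (s i = v) - of_bool (sv (s j) = v))" if v: "v < n" for v
              proof -
                have vi: "0 \<le> int v" "int v < ?n" using v by auto
                have sn: "s i < n" "s j < n" using sN ij by auto
                have svv: "svi (int v) < ?n" using SV[OF vi] by blast
                have e1: "int (s j) = svi (int v) \<longleftrightarrow> sv (s j) = v" "int (sv (s i)) = svi (int v) \<longleftrightarrow> s i = v"
                proof -
                  have "svi (int v) = int (sv v)" using v by (simp add: svE)
                  moreover have "s j = sv v \<longleftrightarrow> sv (s j) = v" using svn(2)[OF v] svn(2)[OF sn(2)] by metis
                  moreover have "sv (s i) = sv v \<longleftrightarrow> s i = v" using svn(2)[OF v] svn(2)[OF sn(1)] by metis
                  ultimately show "int (s j) = svi (int v) \<longleftrightarrow> sv (s j) = v" "int (sv (s i)) = svi (int v) \<longleftrightarrow> s i = v"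
                    by (simp_all only: of_nat_eq_iff)
                qed
                have "divergence G (output_flow st4 i j) v = (\<Sum>e\<in>{0..<?m}. Q i j e * bd src dst e (int v))"
                  by (rule divG) (rule F[OF ij])
                also have "\<dots> = (\<Sum>e\<in>{0..<?m}. P (i, j) e * bd src dst e (int v)) + (\<Sum>e\<in>{0..<?m}. P (j, i) (sei e) * bd src dst e (int v))"
                  using False by (simp add: Q_def distrib_right sum.distrib)
                also have "(\<Sum>e\<in>{0..<?m}. P (j, i) (sei e) * bd src dst e (int v)) = - (U' * (of_bool (sv (s j) = v) - of_bool (s i = v)))"
                  unfolding flip[OF vi] U'(2)[OF svv] e1 ..
                also have "(\<Sum>e\<in>{0..<?m}. P (i, j) e * bd src dst e (int v)) = U * (of_bool (s i = v) - of_bool (sv (s j) = v))"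
                  using U(2)[OF vi(2)] by simp
                finally show ?thesis by (simp add: algebra_simps)
              qed
              then show ?thesis using U(1) U'(1) by (intro exI[of _ "U + U'"]) auto
            qed
            then obtain W where W: "W \<ge> 0" "\<And>v. v < n \<Longrightarrow> divergence G (output_flow st4 i j) v = W * (of_bool (s i = v) - of_bool (sv (s j) = v))" by blast
            have "s i \<noteq> sv (s j)" using disj ij by fastforce
            moreover have "s i < n" "sv (s j) < n" using sN[of i] sN[of j] svn(1)[of "s j"] ij by auto
            moreover have "0 \<le> output_flow st4 i j e" if "e \<in> arcs G" for e
              using F[OF ij, of e] that A Pnn[OF c(1)] Pnn[OF c(2)] by (cases "i = j") (simp_all add: Q_def)
            ultimately show ?thesis unfolding integer_flow_def using W V by simp
          qed
          have dec: "f e = (\<Sum>i\<in>{1..k}. \<Sum>j\<in>{i..k}. output_flow st4 i j e + symmetric_fun se (output_flow st4 i j) e)" if e: "e \<in> arcs G" for e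
          proof -
            have em: "e < m" "se e < m" using e A sem(1) by auto
            have ei: "0 \<le> int e" "int e < ?m" using em by auto
            have sei: "sei (int e) = int (se e)" "sei (int (se e)) = int e" using em sem(2)[OF em(1)] by (simp_all add: seE)
            let ?R = "\<lambda>c. P c (int e) + P c (int (se e))"
            have "(\<Sum>i\<in>{1..k}. \<Sum>j\<in>{i..k}. output_flow st4 i j e + symmetric_fun se (output_flow st4 i j) e) =
              (\<Sum>i\<in>{1..k}. \<Sum>j\<in>{i..k}. if i = j then ?R (i, i) else ?R (i, j) + ?R (j, i))"
              by (intro sum.cong refl) (auto simp: symmetric_fun_def F em Q_def sei)
            also have "\<dots> = (\<Sum>c\<in>set (pairs k). ?R c)" by (rule sum_upper_triangle)
            also have "\<dots> = h (int e) + h (sei (int e))"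
              using Ptot[of "int e"] Ptot[of "int (se e)"] em sei by (simp add: sum.distrib)
            also have "\<dots> = f e" using hh(2)[OF ei] em by (simp add: fE)
            finally show ?thesis by simp
          qed
          have "flow_decomposition k G sv se s f (output_flow st4)"
            unfolding flow_decomposition_def using flow dec by blast
          moreover have "real (t1 + (t2 + (t3 + t4))) \<le> time_bound k (real n) (real m)"
          proof -
            have "int t1 \<le> 300 * ?m + 30" using r1 by blast
            then have "real t1 \<le> 300 * real m + 30" by linarith
            moreover have "real_of_int (int t2) \<le> real_of_int (400 * (?M + ?n) + 200)" using t2 by (rule of_int_le_iff[THEN iffD2])
            then have "real t2 \<le> 400 * (real m + 2 * real k + real n) + 200" by simp
            moreover have "real_of_int (int t4) \<le> real_of_int ((20 * int (k * k) + 20) * ?m + 20)" using t4 by (rule of_int_le_iff[THEN iffD2])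
            then have "real t4 \<le> (20 * real (k * k) + 20) * real m + 20" by simp
            ultimately show ?thesis using t3 unfolding time_bound_def Let_def by (simp add: algebra_simps)
          qed
          ultimately show "flow_decomposition k G sv se s f (output_flow st4) \<and>
            real (t1 + (t2 + (t3 + t4))) \<le> time_bound k (real (card (verts G))) (real (card (arcs G)))"
            unfolding m_def n_def by blast
        qed
      qed
    qed
  qed (use z0 SV SE FE in auto)
qed

theorem theorem6p1:
  fixes k :: nat
  assumes "k \<ge> 1"
  shows "\<exists>prog :: com. \<forall>c :: real. \<exists>C :: real.
    \<forall>(G :: (nat, nat) pre_digraph) (sv :: nat \<Rightarrow> nat) (se :: nat \<Rightarrow> nat)
      (s :: nat \<Rightarrow> nat) (f :: nat \<Rightarrow> int).
      numbered G \<and> flow_instance k G sv se s f \<and>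
      real (card (verts G)) \<le> c * real (card (arcs G)) \<longrightarrow>
      (\<exists>t st. exec prog (input_store k G sv se s f) t st \<and>
         real t \<le> C * real (card (arcs G)) *
           log 2 (2 + (real (card (verts G)))\<^sup>2 / real (card (arcs G))) \<and>
         flow_decomposition k G sv se s f (output_flow st))"
proof (intro exI[of _ "decompose k"] allI)
  fix c :: real
  \<comment> \<open>The program is independent of \<open>c\<close>; the constant is not, because
    costs linear in the number of vertices are charged to the arcs.\<close>
  define C where "C = (let K = 80 * real (k * k) + 60; W = 150 + (2 * K + 700) * (2 + 4 * real k) in
     320 + 20 * real (k * k) + 400 * (1 + 2 * real k + c) + (3 * K + 120) * (1 + 2 * real k) + 350 +
     W * (c + 42 * (1 + 2 * real k)))"
  show "\<exists>C :: real. \<forall>(G :: (nat, nat) pre_digraph) sv se s f.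
      numbered G \<and> flow_instance k G sv se s f \<and>
      real (card (verts G)) \<le> c * real (card (arcs G)) \<longrightarrow>
      (\<exists>t st. exec (decompose k) (input_store k G sv se s f) t st \<and>
         real t \<le> C * real (card (arcs G)) *
           log 2 (2 + (real (card (verts G)))\<^sup>2 / real (card (arcs G))) \<and>
         flow_decomposition k G sv se s f (output_flow st))"
  proof (intro exI[of _ C] allI impI, elim conjE)
    fix G :: "(nat, nat) pre_digraph" and sv se s :: "nat \<Rightarrow> nat" and f :: "nat \<Rightarrow> int"
    assume num: "numbered G" and inst: "flow_instance k G sv se s f"
      and nm: "real (card (verts G)) \<le> c * real (card (arcs G))"
    obtain t st where t: "exec (decompose k) (input_store k G sv se s f) t st" "flow_decomposition k G sv se s f (output_flow st)"
      "real t \<le> time_bound k (real (card (verts G))) (real (card (arcs G)))"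
      using decompose_correct[OF assms num inst] unfolding wp_def by blast
    \<comment> \<open>\<open>k >= 1\<close> supplies a vertex, and the bound of the vertex number by
      \<open>c\<close> times the arc number then supplies an arc. So \<open>n >= 1\<close> and
      \<open>m >= 1\<close>, as \<open>time_bound_le\<close> requires.\<close>
    have "s 1 \<in> verts G" using inst assms unfolding flow_instance_def by (meson atLeastAtMost_iff image_subset_iff order_refl)
    moreover have "finite (verts G)" using num unfolding numbered_def by (metis finite_lessThan)
    ultimately have n: "1 \<le> real (card (verts G))" by (metis One_nat_def Suc_leI card_gt_0_iff empty_iff of_nat_1 of_nat_le_iff)
    then have "0 < c * real (card (arcs G))" using nm by linarith
    then have m: "1 \<le> real (card (arcs G))" by (cases "card (arcs G) = 0") auto
    have "time_bound k (real (card (verts G))) (real (card (arcs G))) \<le>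
      C * real (card (arcs G)) * log 2 (2 + (real (card (verts G)))\<^sup>2 / real (card (arcs G)))"
      using time_bound_le[OF n nm m, of k] unfolding C_def .
    then show "\<exists>t st. exec (decompose k) (input_store k G sv se s f) t st \<and>
         real t \<le> C * real (card (arcs G)) * log 2 (2 + (real (card (verts G)))\<^sup>2 / real (card (arcs G))) \<and>
         flow_decomposition k G sv se s f (output_flow st)" using t by (meson order_trans)
  qed
qed

end
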